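(* Let $s>0$. Suppose that $(u,h)$ is a weak solution (in the sense defined in the context) of the linearized free surface problem on $\Sigma=\mathbb{T}^{N-1}$ with initial data $(u_0,h_0)$, and that $\mu(\xi)=g+\sigma(2\pi|\xi|)^{2r}$ with $g,\sigma>0$ and $0\le r<\frac12$. Then there exists a constant $K>0$ such that if $u_0\in H^s_x(L^2_y)$ and $h_0\in H^{s+r}(\Sigma)$, then for all $t\ge0$ $$\mathcal{E}(t)\le K\left(\|u_0\|_{H^s_x(L^2_y)}^2+\|h_0\|_{H^{s+r}}^2\right)(1+t)^{-\frac{s}{\frac12-r}} .$$
   Context: Fix an integer $N\ge 2$ and $\ell>0$. Let $\Sigma=\mathbb{T}^{N-1}=\mathbb{R}^{N-1}/\mathbb{Z}^{N-1}$, with dual group $\hat\Sigma=\mathbb{Z}^{N-1}$. Set $\Omega=\Sigma\times(0,\ell)$, with points $(x,y)$, $x\in\Sigma$, $y\in(0,\ell)$. The Fourier transform is always in the horizontal variable $x$ only: $\hat f(\xi)=\mathcal{F}f(\xi)=\int_\Sigma f(x)e^{-2\pi i\xi\cdot x}\,dx$, $\xi\in\hat\Sigma$. Norms: $\|f\|_{H^s(\Sigma)}^2=\sum_{\xi\in\hat\Sigma}(1+|\xi|^2)^s|\hat f(\xi)|^2$ and $\|f\|_{H^s_x(L^2_y)}^2=\int_0^\ell\sum_{\xi\in\hat\Sigma}(1+|\xi|^2)^s|\hat f(\xi,y)|^2\,dy$. Boundary operator: $\mu:\hat\Sigma\to\mathbb{R}$ satisfies, for some $\theta>0$, $\theta\le\mu(\xi)\le\frac1\theta(1+|\xi|)^3$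 for all $\xi\in\hat\Sigma$ (standing assumption), and $M$ is defined by $\mathcal{F}M(h)(\xi)=\mu(\xi)\mathcal{F}h(\xi)$. Let $(\mathbb{D}u)_{ij}=\partial_iu_j+\partial_ju_i$, let $(\cdot,\cdot)$ be the $L^2(\Omega)$ inner product, and let ${}_0H^1_{\mathrm{sol}}=\{u\in H^1(\Omega;\mathbb{R}^N): u=0\text{ on }\{y=0\},\ \operatorname{div}u=0\}$ with inner product $(\nabla u,\nabla v)$; it is embedded in its dual $({}_0H^1_{\mathrm{sol}})^*$ via the $L^2$ inner product, and $[\cdot,\cdot]$ denotes the duality pairing (dual element first). Weak solution: $(u,h)$ is a weak solution with initial data $(u_0,h_0)$ if $u\in L^2_{\mathrm{loc}}([0,\infty);{}_0H^1_{\mathrm{sol}})$, $\partial_tu\in L^2_{\mathrm{loc}}([0,\infty);({}_0H^1_{\mathrm{sol}})^* )$, $h\in L^2_{\mathrm{loc}}([0,\infty);L^2(\Sigma))$, $M(h)\in L^2_{\mathrm{loc}}([0,\infty);L^2(\Sigma))$, $\partial_th\in L^2_{\mathrm{loc}}([0,\infty);H^{1/2}(\Sigma))$, and (i) $[\partial_tu,v]+\frac12(\mathbb{D}u,\mathbb{D}v)+\int_{\{y=\ell\}}M(h)v_N=0$ for all $v\in L^2([0,T];{}_0H^1_{\mathrm{sol}})$ (all $T>0$), for a.e. $t$; (ii) $\operatorname{div}u=0$; (iii) $\partial_th=u_N$ on $\{y=\ell\}$; (iv) $u=u_0$ and $h=h_0$ at $t=0$; (v) $\int_{\mathbb{T}^{N-1}}h(x,t)\,dx=0$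 for all $t\ge0$. Full energy: $$\mathcal{E}(t)=\frac12\int_\Omega|u|^2+\frac12\int_\Sigma M(h)h .$$ *)

theory Defs
  imports "HOL-Analysis.Analysis"
begin

text \<open>
  The horizontal dimension is \<open>N - 1 = CARD('n)\<close>, so \<open>N \<ge> 2\<close> is automatic. A point of
  \<open>\<Omega> = \<Sigma> \<times> (0, l)\<close> is a pair \<open>(x, y)\<close>, and velocities live in the same space
  \<open>real ^ 'n \<times> real\<close>; coordinates are taken with respect to \<open>Basis\<close>, the last one being \<open>snd\<close>.

  A (class of a) measurable function on the torus \<open>\<Sigma>\<close> is represented by a Borel function on
  \<open>real ^ 'n\<close> of which only the values on the fundamental cell matter. The topology of the torus
  enters through the smooth functions, which are required to be 1-periodic in \<open>x\<close>.
\<close>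

type_synonym 'n pt = "(real ^ 'n) \<times> real"
type_synonym 'n field = "'n pt \<Rightarrow> 'n pt"

definition cell :: "(real ^ 'n::finite) set" where
  "cell = {x. \<forall>i. 0 \<le> x $ i \<and> x $ i < 1}"

definition Sig :: "(real ^ 'n::finite) measure" where
  "Sig = restrict_space lborel cell"

definition Om :: "real \<Rightarrow> ('n::finite) pt measure" where
  "Om l = restrict_space lborel (cell \<times> {0<..<l})"


section \<open>Square-integrable functions and Fourier coefficients\<close>

definition L2 :: "'a measure \<Rightarrow> ('a \<Rightarrow> 'b::euclidean_space) set" where
  "L2 M = {f \<in> borel_measurable M. integrable M (\<lambda>z. (norm (f z))\<^sup>2)}"

definition L2_inner :: "'a measure \<Rightarrow> ('a \<Rightarrow> 'b::euclidean_space) \<Rightarrow> ('a \<Rightarrow> 'b) \<Rightarrow> real" where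
  "L2_inner M f g = (LINT z|M. f z \<bullet> g z)"

definition L2_norm :: "'a measure \<Rightarrow> ('a \<Rightarrow> 'b::euclidean_space) \<Rightarrow> real" where
  "L2_norm M f = sqrt (L2_inner M f f)"

definition freq :: "int ^ 'n::finite \<Rightarrow> real ^ 'n" where
  "freq \<xi> = (\<chi> i. real_of_int (\<xi> $ i))"

definition fourier :: "(real ^ 'n::finite \<Rightarrow> real) \<Rightarrow> int ^ 'n \<Rightarrow> complex" where
  "fourier f \<xi> = (LINT x|Sig. of_real (f x) * exp (- 2 * of_real pi * \<i> * of_real (freq \<xi> \<bullet> x)))"

definition Hs_sq :: "real \<Rightarrow> (real ^ 'n::finite \<Rightarrow> real) \<Rightarrow> ennreal" where
  "Hs_sq s f = (\<integral>\<^sup>+ \<xi>. ennreal ((1 + (norm (freq \<xi>))\<^sup>2) powr s * (cmod (fourier f \<xi>))\<^sup>2)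
                  \<partial>count_space UNIV)"

text \<open>Only exponents \<open>s \<ge> 0\<close> are used, so \<open>H\<^sup>s\<close> is a subspace of \<open>L\<^sup>2\<close>.\<close>

definition Hs :: "real \<Rightarrow> (real ^ 'n::finite \<Rightarrow> real) set" where
  "Hs s = {f \<in> L2 Sig. Hs_sq s f < \<infinity>}"

definition Hs_norm :: "real \<Rightarrow> (real ^ 'n::finite \<Rightarrow> real) \<Rightarrow> real" where
  "Hs_norm s f = sqrt (enn2real (Hs_sq s f))"

definition Hs_L2_sq :: "real \<Rightarrow> real \<Rightarrow> ('n::finite) field \<Rightarrow> ennreal" where
  "Hs_L2_sq l s u =
     (\<integral>\<^sup>+ y\<in>{0<..<l}. (\<integral>\<^sup>+ \<xi>. ennreal ((1 + (norm (freq \<xi>))\<^sup>2) powr s *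
          (\<Sum>b\<in>Basis. (cmod (fourier (\<lambda>x. u (x, y) \<bullet> b) \<xi>))\<^sup>2)) \<partial>count_space UNIV) \<partial>lborel)"

definition Hs_L2 :: "real \<Rightarrow> real \<Rightarrow> ('n::finite) field set" where
  "Hs_L2 l s = {u \<in> L2 (Om l). Hs_L2_sq l s u < \<infinity>}"


section \<open>Sobolev functions on the slab, and traces\<close>

definition dir_deriv :: "'a \<Rightarrow> ('a::euclidean_space \<Rightarrow> real) \<Rightarrow> 'a \<Rightarrow> real" where
  "dir_deriv b f z = frechet_derivative f (at z) b"

fun Ck :: "nat \<Rightarrow> ('a::euclidean_space \<Rightarrow> real) \<Rightarrow> bool" where
  "Ck 0 f \<longleftrightarrow> continuous_on UNIV f"
| "Ck (Suc k) f \<longleftrightarrow> f differentiable_on UNIV \<and> (\<forall>b\<in>Basis. Ck k (dir_deriv b f))"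

definition smooth :: "('a::euclidean_space \<Rightarrow> real) \<Rightarrow> bool" where
  "smooth f \<longleftrightarrow> (\<forall>k. Ck k f)"

text \<open>Restrictions of these functions form \<open>C\<^sup>\<infinity>\<close> of the closed slab \<open>\<Sigma> \<times> [0, l]\<close>.\<close>

definition smooth_per :: "(('n::finite) pt \<Rightarrow> real) set" where
  "smooth_per = {\<phi>. smooth \<phi> \<and> (\<forall>x y i. \<phi> (x + axis i 1, y) = \<phi> (x, y))}"

text \<open>The torus being compact, compact support in \<open>\<Sigma> \<times> (0, l)\<close> is a condition on \<open>y\<close> only.\<close>

definition test_fun :: "real \<Rightarrow> (('n::finite) pt \<Rightarrow> real) set" where
  "test_fun l = {\<phi> \<in> smooth_per. \<exists>\<delta>>0. \<forall>x y. \<phi> (x, y) \<noteq> 0 \<longrightarrow> \<delta> \<le> y \<and> y \<le> l - \<delta>}"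

definition is_weak_partial ::
  "real \<Rightarrow> ('n::finite) pt \<Rightarrow> ('n pt \<Rightarrow> real) \<Rightarrow> ('n pt \<Rightarrow> real) \<Rightarrow> bool" where
  "is_weak_partial l b f g \<longleftrightarrow> g \<in> L2 (Om l) \<and>
     (\<forall>\<phi>\<in>test_fun l. (LINT z|Om l. f z * dir_deriv b \<phi> z) = - (LINT z|Om l. g z * \<phi> z))"

definition weak_partial :: "real \<Rightarrow> ('n::finite) pt \<Rightarrow> ('n pt \<Rightarrow> real) \<Rightarrow> 'n pt \<Rightarrow> real" where
  "weak_partial l b f = (SOME g. is_weak_partial l b f g)"

definition H1 :: "real \<Rightarrow> (('n::finite) pt \<Rightarrow> real) set" where
  "H1 l = {f \<in> L2 (Om l). \<forall>b\<in>Basis. \<exists>g. is_weak_partial l b f g}"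

definition H1_norm :: "real \<Rightarrow> (('n::finite) pt \<Rightarrow> real) \<Rightarrow> real" where
  "H1_norm l f = sqrt ((L2_norm (Om l) f)\<^sup>2 + (\<Sum>b\<in>Basis. (L2_norm (Om l) (weak_partial l b f))\<^sup>2))"

text \<open>
  The trace on \<open>{y = c}\<close>, \<open>c \<in> {0, l}\<close>, is the continuous extension to \<open>H\<^sup>1\<close> of the restriction
  of functions that are smooth up to the boundary.
\<close>

definition has_trace ::
  "real \<Rightarrow> real \<Rightarrow> (('n::finite) pt \<Rightarrow> real) \<Rightarrow> (real ^ 'n \<Rightarrow> real) \<Rightarrow> bool" where
  "has_trace l c f g \<longleftrightarrow> f \<in> H1 l \<and> g \<in> L2 Sig \<and>
     (\<exists>\<phi>. (\<forall>k. \<phi> k \<in> smooth_per) \<and>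
          (\<lambda>k. H1_norm l (\<phi> k - f)) \<longlonglongrightarrow> 0 \<and>
          (\<lambda>k. L2_norm Sig (\<lambda>x. \<phi> k (x, c) - g x)) \<longlonglongrightarrow> 0)"

definition bdry_trace :: "real \<Rightarrow> real \<Rightarrow> (('n::finite) pt \<Rightarrow> real) \<Rightarrow> real ^ 'n \<Rightarrow> real" where
  "bdry_trace l c f = (SOME g. has_trace l c f g)"

definition H1_field :: "real \<Rightarrow> ('n::finite) field set" where
  "H1_field l = {u \<in> L2 (Om l). \<forall>c\<in>Basis. (\<lambda>z. u z \<bullet> c) \<in> H1 l}"

text \<open>\<open>pd l u b c\<close> is the derivative in direction \<open>b\<close> of the \<open>c\<close>-component of \<open>u\<close>.\<close>

definition pd :: "real \<Rightarrow> ('n::finite) field \<Rightarrow> 'n pt \<Rightarrow> 'n pt \<Rightarrow> 'n pt \<Rightarrow> real" where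
  "pd l u b c = weak_partial l b (\<lambda>z. u z \<bullet> c)"

definition divergence :: "real \<Rightarrow> ('n::finite) field \<Rightarrow> 'n pt \<Rightarrow> real" where
  "divergence l u z = (\<Sum>b\<in>Basis. pd l u b b z)"

definition sym_grad :: "real \<Rightarrow> ('n::finite) field \<Rightarrow> 'n pt \<Rightarrow> 'n pt \<Rightarrow> 'n pt \<Rightarrow> real" where
  "sym_grad l u b c z = pd l u b c z + pd l u c b z"

definition sym_grad_inner :: "real \<Rightarrow> ('n::finite) field \<Rightarrow> 'n field \<Rightarrow> real" where
  "sym_grad_inner l u v =
     (\<Sum>b\<in>Basis. \<Sum>c\<in>Basis. L2_inner (Om l) (sym_grad l u b c) (sym_grad l v b c))"

definition V :: "real \<Rightarrow> ('n::finite) field set" where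
  "V l = {u \<in> H1_field l. (\<forall>c\<in>Basis. has_trace l 0 (\<lambda>z. u z \<bullet> c) (\<lambda>x. 0)) \<and>
                          (AE z in Om l. divergence l u z = 0)}"

definition V_inner :: "real \<Rightarrow> ('n::finite) field \<Rightarrow> 'n field \<Rightarrow> real" where
  "V_inner l u v = (\<Sum>b\<in>Basis. \<Sum>c\<in>Basis. L2_inner (Om l) (pd l u b c) (pd l v b c))"

definition V_norm :: "real \<Rightarrow> ('n::finite) field \<Rightarrow> real" where
  "V_norm l u = sqrt (V_inner l u u)"

definition V_dual :: "real \<Rightarrow> (('n::finite) field \<Rightarrow> real) set" where
  "V_dual l = {F. (\<forall>u\<in>V l. \<forall>v\<in>V l. \<forall>a b. F (\<lambda>z. a *\<^sub>R u z + b *\<^sub>R v z) = a * F u + b * F v) \<and>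
                  (\<exists>C. \<forall>v\<in>V l. \<bar>F v\<bar> \<le> C * V_norm l v)}"

definition V_dual_norm :: "real \<Rightarrow> (('n::finite) field \<Rightarrow> real) \<Rightarrow> real" where
  "V_dual_norm l F = (SUP v\<in>{v \<in> V l. V_norm l v \<le> 1}. \<bar>F v\<bar>)"


section \<open>Functions of time with values in a function space\<close>

text \<open>
  \<open>X\<close> is the set of representatives of the elements of a normed space and \<open>nrm\<close> its norm.
  Measurability is strong (Bochner) measurability: almost everywhere limit of simple functions.
\<close>

definition strongly_measurable ::
  "real set \<Rightarrow> 'x::minus set \<Rightarrow> ('x \<Rightarrow> real) \<Rightarrow> (real \<Rightarrow> 'x) \<Rightarrow> bool" where
  "strongly_measurable I X nrm f \<longleftrightarrow>
     (\<exists>s. (\<forall>k. simple_function (lebesgue_on I) (s k) \<and> s k ` I \<subseteq> X) \<and>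
          (AE t in lebesgue_on I. (\<lambda>k. nrm (s k t - f t)) \<longlonglongrightarrow> 0))"

definition L2_time ::
  "real set \<Rightarrow> 'x::minus set \<Rightarrow> ('x \<Rightarrow> real) \<Rightarrow> (real \<Rightarrow> 'x) set" where
  "L2_time I X nrm = {f. (AE t in lebesgue_on I. f t \<in> X) \<and> strongly_measurable I X nrm f \<and>
                         (\<integral>\<^sup>+ t. ennreal ((nrm (f t))\<^sup>2) \<partial>lebesgue_on I) < \<infinity>}"

definition L2_loc :: "'x::minus set \<Rightarrow> ('x \<Rightarrow> real) \<Rightarrow> (real \<Rightarrow> 'x) set" where
  "L2_loc X nrm = {f. \<forall>T>0. f \<in> L2_time {0..T} X nrm}"

definition cont_time ::
  "'x::minus set \<Rightarrow> ('x \<Rightarrow> real) \<Rightarrow> (real \<Rightarrow> 'x) set" where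
  "cont_time X nrm = {f. \<forall>t\<ge>0. f t \<in> X \<and> ((\<lambda>\<tau>. nrm (f \<tau> - f t)) \<longlongrightarrow> 0) (at t within {0..})}"

definition time_test :: "(real \<Rightarrow> real) set" where
  "time_test = {\<psi>. smooth \<psi> \<and> (\<exists>a>0. \<exists>b. \<forall>t. \<psi> t \<noteq> 0 \<longrightarrow> a \<le> t \<and> t \<le> b)}"

text \<open>
  \<open>w\<close> is the distributional derivative of \<open>u\<close> with respect to time, as an identity between
  elements of the dual of \<open>V\<close>, in which \<open>u t\<close> is embedded by the inner product of \<open>L\<^sup>2\<close>.
\<close>

definition V_time_deriv ::
  "real \<Rightarrow> (real \<Rightarrow> ('n::finite) field) \<Rightarrow> (real \<Rightarrow> 'n field \<Rightarrow> real) \<Rightarrow> bool" where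
  "V_time_deriv l u w \<longleftrightarrow>
     (\<forall>\<psi>\<in>time_test. \<forall>v\<in>V l.
        (LINT t|lebesgue_on {0..}. \<psi> t * w t v) =
        - (LINT t|lebesgue_on {0..}. deriv \<psi> t * L2_inner (Om l) (u t) v))"

definition Sig_time_deriv ::
  "(real \<Rightarrow> real ^ 'n::finite \<Rightarrow> real) \<Rightarrow> (real \<Rightarrow> real ^ 'n \<Rightarrow> real) \<Rightarrow> bool" where
  "Sig_time_deriv h k \<longleftrightarrow>
     (\<forall>\<psi>\<in>time_test. \<forall>\<phi>\<in>L2 Sig.
        (LINT t|lebesgue_on {0..}. \<psi> t * L2_inner Sig (k t) \<phi>) =
        - (LINT t|lebesgue_on {0..}. deriv \<psi> t * L2_inner Sig (h t) \<phi>))"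


section \<open>The boundary operator, weak solutions and the energy\<close>

definition is_M ::
  "(int ^ 'n::finite \<Rightarrow> real) \<Rightarrow> (real ^ 'n \<Rightarrow> real) \<Rightarrow> (real ^ 'n \<Rightarrow> real) \<Rightarrow> bool" where
  "is_M \<mu> h m \<longleftrightarrow> m \<in> L2 Sig \<and> (\<forall>\<xi>. fourier m \<xi> = of_real (\<mu> \<xi>) * fourier h \<xi>)"

definition dom_M :: "(int ^ 'n::finite \<Rightarrow> real) \<Rightarrow> (real ^ 'n \<Rightarrow> real) set" where
  "dom_M \<mu> = {h \<in> L2 Sig. \<exists>m. is_M \<mu> h m}"

definition M_op :: "(int ^ 'n::finite \<Rightarrow> real) \<Rightarrow> (real ^ 'n \<Rightarrow> real) \<Rightarrow> real ^ 'n \<Rightarrow> real" where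
  "M_op \<mu> h = (SOME m. is_M \<mu> h m)"

definition admissible_symbol :: "(int ^ 'n::finite \<Rightarrow> real) \<Rightarrow> bool" where
  "admissible_symbol \<mu> \<longleftrightarrow>
     (\<exists>\<theta>>0. \<forall>\<xi>. \<theta> \<le> \<mu> \<xi> \<and> \<mu> \<xi> \<le> 1 / \<theta> * (1 + norm (freq \<xi>)) ^ 3)"

text \<open>
  The functions \<open>u\<close> and \<open>h\<close> are the representatives that are continuous in time with values in
  \<open>L\<^sup>2\<close>. These exist by the regularity of \<open>u\<close>, \<open>h\<close> and of their time derivatives, and it is
  through them that the initial conditions and statements for all \<open>t \<ge> 0\<close> make sense.
\<close>

definition weak_solution ::
  "real \<Rightarrow> (int ^ 'n::finite \<Rightarrow> real) \<Rightarrow> (real \<Rightarrow> 'n field) \<Rightarrow> (real \<Rightarrow> real ^ 'n \<Rightarrow> real) \<Rightarrow>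
     'n field \<Rightarrow> (real ^ 'n \<Rightarrow> real) \<Rightarrow> bool" where
  "weak_solution l \<mu> u h u\<^sub>0 h\<^sub>0 \<longleftrightarrow>
     u \<in> L2_loc (V l) (V_norm l) \<and>
     u \<in> cont_time (L2 (Om l)) (L2_norm (Om l)) \<and>
     h \<in> L2_loc (L2 Sig) (L2_norm Sig) \<and>
     h \<in> cont_time (L2 Sig) (L2_norm Sig) \<and>
     (AE t in lebesgue_on {0..}. h t \<in> dom_M \<mu>) \<and>
     (\<lambda>t. M_op \<mu> (h t)) \<in> L2_loc (L2 Sig) (L2_norm Sig) \<and>
     (\<exists>u' h'.
        u' \<in> L2_loc (V_dual l) (V_dual_norm l) \<and> V_time_deriv l u u' \<and>
        h' \<in> L2_loc (Hs (1/2)) (Hs_norm (1/2)) \<and> Sig_time_deriv h h' \<and>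
        (\<forall>T>0. \<forall>v \<in> L2_time {0..T} (V l) (V_norm l). AE t in lebesgue_on {0..T}.
           u' t (v t) + 1/2 * sym_grad_inner l (u t) (v t)
             + (LINT x|Sig. M_op \<mu> (h t) x * bdry_trace l l (\<lambda>z. snd (v t z)) x) = 0) \<and>
        (AE t in lebesgue_on {0..}. has_trace l l (\<lambda>z. snd (u t z)) (h' t))) \<and>
     (AE t in lebesgue_on {0..}. AE z in Om l. divergence l (u t) z = 0) \<and>
     u\<^sub>0 \<in> L2 (Om l) \<and> (AE z in Om l. u 0 z = u\<^sub>0 z) \<and>
     h\<^sub>0 \<in> L2 Sig \<and> (AE x in Sig. h 0 x = h\<^sub>0 x) \<and>
     (\<forall>t\<ge>0. (LINT x|Sig. h t x) = 0)"

text \<open>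
  For a weak solution \<open>M (h t)\<close> is square-integrable for almost every \<open>t\<close> only. At the remaining
  times the integral of \<open>M h * h\<close> is the pairing of the distribution \<open>M h\<close> with \<open>h\<close>, which is the
  sum over all frequencies of \<open>fourier (M h) * cnj (fourier h)\<close>. The value is allowed to be \<open>\<infinity>\<close>,
  so that an upper bound for it includes its finiteness.
\<close>

definition M_form :: "(int ^ 'n::finite \<Rightarrow> real) \<Rightarrow> (real ^ 'n \<Rightarrow> real) \<Rightarrow> ennreal" where
  "M_form \<mu> h =
     (if h \<in> dom_M \<mu> then ennreal (LINT x|Sig. M_op \<mu> h x * h x)
      else (\<integral>\<^sup>+ \<xi>. ennreal (\<mu> \<xi> * (cmod (fourier h \<xi>))\<^sup>2) \<partial>count_space UNIV))"

definition energy ::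
  "real \<Rightarrow> (int ^ 'n::finite \<Rightarrow> real) \<Rightarrow> 'n field \<Rightarrow> (real ^ 'n \<Rightarrow> real) \<Rightarrow> ennreal" where
  "energy l \<mu> u h =
     ennreal (1/2) * ennreal (LINT z|Om l. (norm (u z))\<^sup>2) + ennreal (1/2) * M_form \<mu> h"

text \<open>The case distinction is needed because \<open>0 powr 0 = 0\<close>, whereas \<open>0\<^sup>0 = 1\<close> is meant.\<close>

definition power_symbol :: "real \<Rightarrow> real \<Rightarrow> real \<Rightarrow> int ^ 'n::finite \<Rightarrow> real" where
  "power_symbol g \<sigma> r \<xi> =
     g + \<sigma> * (if r = 0 then 1 else (2 * pi * norm (freq \<xi>)) powr (2 * r))"

lemma admissible_power_symbol:
  fixes g \<sigma> r :: real
  assumes "g > 0" "\<sigma> > 0" "0 \<le> r" "r < 1/2"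
  shows "admissible_symbol (power_symbol g \<sigma> r :: int ^ 'n::finite \<Rightarrow> real)"
proof -
  define C where "C = g + \<sigma> * (2 * pi)"
  define \<theta> where "\<theta> = min g (1 / C)"
  have C: "C > 0" using assms by (simp add: C_def add_pos_pos)
  have \<theta>: "\<theta> > 0" using assms C by (simp add: \<theta>_def)
  have "\<theta> \<le> 1 / C" by (simp add: \<theta>_def)
  then have C_le: "C \<le> 1 / \<theta>" using C \<theta> by (simp add: field_simps)
  have "\<theta> \<le> power_symbol g \<sigma> r \<xi> \<and> power_symbol g \<sigma> r \<xi> \<le> 1 / \<theta> * (1 + norm (freq \<xi>)) ^ 3"
    for \<xi> :: "int ^ 'n"
  proof
    have "\<theta> \<le> g" by (simp add: \<theta>_def)
    also have "g \<le> power_symbol g \<sigma> r \<xi>" using assms by (simp add: power_symbol_def)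
    finally show "\<theta> \<le> power_symbol g \<sigma> r \<xi>" .
    define x where "x = norm (freq \<xi>)"
    define B where "B = 2 * pi * (1 + x)"
    have x: "x \<ge> 0" by (simp add: x_def)
    have pi1: "2 * pi \<ge> 1" using pi_gt3 by simp
    have B1: "B \<ge> 1"
      using mult_mono[OF pi1, of 1 "1 + x"] x by (simp add: B_def)
    have "(if r = 0 then 1 else (2 * pi * x) powr (2 * r)) \<le> B"
    proof (cases "r = 0")
      case False
      have "(2 * pi * x) powr (2 * r) \<le> B powr (2 * r)"
        using x assms by (intro powr_mono2) (auto simp: B_def)
      also have "\<dots> \<le> B powr 1" using B1 assms by (intro powr_mono) auto
      finally show ?thesis using False B1 by simp
    qed (use B1 in simp)
    then have "power_symbol g \<sigma> r \<xi> \<le> g + \<sigma> * B"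
      using assms unfolding power_symbol_def x_def[symmetric] by (intro add_left_mono mult_left_mono) auto
    also have "\<dots> \<le> C * (1 + x)"
      using assms x by (simp add: C_def B_def algebra_simps)
    also have "\<dots> \<le> C * (1 + x) ^ 3"
      using C x power_increasing[of 1 3 "1 + x"] by simp
    also have "\<dots> \<le> 1 / \<theta> * (1 + x) ^ 3" using C_le x by (intro mult_right_mono) auto
    finally show "power_symbol g \<sigma> r \<xi> \<le> 1 / \<theta> * (1 + norm (freq \<xi>)) ^ 3" by (simp add: x_def)
  qed
  then show ?thesis using \<theta> unfolding admissible_symbol_def by blast
qed

end

theory Submission
  imports Defs
begin

text \<open>
  Tested with its projection onto one horizontal frequency \<open>\<xi>\<close>, a weak solution is an evolution of the
  Fourier coefficients of \<open>u\<close> and \<open>h\<close> at \<open>\<xi>\<close>. The dissipation controls \<open>u\<close> but not \<open>h\<close>; adding to the energy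
  \<open>\<epsilon> \<sim> \<mu> / |\<xi>|\<close> times the inner product of \<open>u\<close> with a solenoidal lift of \<open>h\<close> gives an equivalent
  functional that decays at the rate \<open>c * \<mu> / |\<xi>|\<close>. Because \<open>\<partial>\<^sub>t u\<close> is only in the dual space, the bilinear form
  of this functional is averaged over a square \<open>[t, t + \<delta>]\<^sup>2\<close> of times before it is differentiated. Finally
  \<open>\<mu> / |\<xi>| \<ge> c * X powr (r - 1/2)\<close> with \<open>X = 1 + |\<xi>|\<^sup>2\<close>, so the exponential is at most a multiple of
  \<open>X powr s * (1 + t) powr (- s / (1/2 - r))\<close>, and Parseval's identity sums this up.
\<close>

section \<open>Square-integrable functions\<close>

text \<open>The size of the lift forces \<open>\<epsilon>\<close>: its dissipation is of order
  |\<xi>| |h|^2, so its cross term with \<open>u\<close> is absorbed only if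
  \<open>\<epsilon>\<close> |\<xi>| is at most a small multiple of \<mu>. As r < 1/2, \<mu> /
  |\<xi>| tends to 0 at high frequency; there is no uniform rate, and regularity of the data pays
  for the slow modes. At \<xi> = 0 there is no lift, since a solenoidal field has zero total flux
  through the top; there the zero mean of \<open>h\<close> removes the surface term. The equation
  can be differentiated in time only against a fixed test field. Taking \<open>u y\<close> as this
  field turns the functional into a kernel \<open>g x y\<close> of two times whose derivative in
  \<open>x\<close> is known for almost every \<open>y\<close>. The decay inequality says that a
  quadratic form in (\<open>u\<close>, \<open>h\<close>) is nonnegative; it therefore makes a kernel
  in (\<open>x\<close>, \<open>y\<close>) positive semidefinite, and the iterated integral of such a
  kernel is nonnegative. This integrated inequality is the differential inequality for the average
  of \<open>g\<close> over a square, and shrinking the square returns the diagonal because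
  \<open>u\<close> and \<open>h\<close> are continuous in time with values in L2.\<close>

lemma L2I:
  assumes "f \<in> borel_measurable M" "integrable M (\<lambda>z. (norm (f z))^2)"
  shows "f \<in> L2 M"
  using assms by (simp add: L2_def)

lemma L2_measurable: "f \<in> L2 M \<Longrightarrow> f \<in> borel_measurable M"
  by (simp add: L2_def)

lemma L2_integrable_norm_sq: "f \<in> L2 M \<Longrightarrow> integrable M (\<lambda>z. (norm (f z))^2)"
  by (simp add: L2_def)

lemma L2_bound:
  fixes f :: "'a \<Rightarrow> 'b::euclidean_space" and g :: "'a \<Rightarrow> 'c::euclidean_space"
  assumes "f \<in> L2 M" "g \<in> borel_measurable M" "AE z in M. norm (g z) \<le> norm (f z)"
  shows "g \<in> L2 M"
proof (rule L2I[OF assms(2)])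
  show "integrable M (\<lambda>z. (norm (g z))^2)"
    by (rule Bochner_Integration.integrable_bound[OF L2_integrable_norm_sq[OF assms(1)]])
       (use assms in \<open>auto intro!: power_mono\<close>)
qed

lemma L2_zero: "(\<lambda>z. 0) \<in> L2 M"
  by (simp add: L2_def)

lemma L2_scaleR: "f \<in> L2 M \<Longrightarrow> (\<lambda>z. c *\<^sub>R f z) \<in> L2 M"
  by (auto simp: L2_def power_mult_distrib)

lemma L2_add:
  assumes "f \<in> L2 M" "g \<in> L2 M"
  shows "(\<lambda>z. f z + g z) \<in> L2 M"
proof (rule L2I)
  have [measurable]: "f \<in> borel_measurable M" "g \<in> borel_measurable M"
    using assms by (auto dest: L2_measurable)
  show "(\<lambda>z. f z + g z) \<in> borel_measurable M" by simp
  have b: "(norm (x + y))^2 \<le> 2 * (norm x)^2 + 2 * (norm y)^2" for x y :: 'b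
  proof -
    have "(norm (x + y))^2 \<le> (norm x + norm y)^2" by (intro power_mono norm_triangle_ineq) auto
    also have "\<dots> \<le> 2 * (norm x)^2 + 2 * (norm y)^2"
      using sum_squares_bound[of "norm x" "norm y"] by (simp add: power2_sum)
    finally show ?thesis .
  qed
  show "integrable M (\<lambda>z. (norm (f z + g z))^2)"
  proof (rule Bochner_Integration.integrable_bound)
    show "integrable M (\<lambda>z. 2 * (norm (f z))^2 + 2 * (norm (g z))^2)"
      using assms by (auto intro!: L2_integrable_norm_sq)
    show "AE z in M. norm ((norm (f z + g z))^2) \<le> norm (2 * (norm (f z))^2 + 2 * (norm (g z))^2)"
      using b by auto
  qed simp
qed

lemma L2_minus: "f \<in> L2 M \<Longrightarrow> (\<lambda>z. - f z) \<in> L2 M"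
  by (auto simp: L2_def)

lemma L2_diff:
  assumes "f \<in> L2 M" "g \<in> L2 M"
  shows "(\<lambda>z. f z - g z) \<in> L2 M"
  using L2_add[OF assms(1) L2_minus[OF assms(2)]] by simp

lemma L2_sum:
  assumes "\<And>i. i \<in> A \<Longrightarrow> f i \<in> L2 M"
  shows "(\<lambda>z. \<Sum>i\<in>A. f i z) \<in> L2 M"
  using assms by (induction A rule: infinite_finite_induct) (auto intro: L2_zero L2_add)

lemma L2_bounded:
  fixes f :: "'a \<Rightarrow> 'b::euclidean_space"
  assumes "finite_measure M" "f \<in> borel_measurable M" "AE z in M. norm (f z) \<le> B"
  shows "f \<in> L2 M"
proof (rule L2I[OF assms(2)])
  interpret finite_measure M by fact
  show "integrable M (\<lambda>z. (norm (f z))^2)"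
  proof (rule integrable_const_bound[of _ "B\<^sup>2"])
    show "AE z in M. norm ((norm (f z))^2) \<le> B\<^sup>2"
      using assms(3) by eventually_elim (auto intro!: power_mono)
  qed (use assms in auto)
qed

lemma L2_inner_integrable:
  fixes f g :: "'a \<Rightarrow> 'b::euclidean_space"
  assumes "f \<in> L2 M" "g \<in> L2 M"
  shows "integrable M (\<lambda>z. f z \<bullet> g z)"
proof (rule Bochner_Integration.integrable_bound)
  show "integrable M (\<lambda>z. (norm (f z))^2 + (norm (g z))^2)"
    using assms by (auto intro!: L2_integrable_norm_sq)
  show "(\<lambda>z. f z \<bullet> g z) \<in> borel_measurable M"
    using assms[THEN L2_measurable] by simp
  have "\<bar>x \<bullet> y\<bar> \<le> (norm x)^2 + (norm y)^2" for x y :: 'b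
  proof -
    have "\<bar>x \<bullet> y\<bar> \<le> norm x * norm y" by (rule Cauchy_Schwarz_ineq2)
    also have "\<dots> \<le> (norm x)^2 + (norm y)^2"
      using sum_squares_bound[of "norm x" "norm y"]
        mult_nonneg_nonneg[OF norm_ge_zero[of x] norm_ge_zero[of y]] by linarith
    finally show ?thesis .
  qed
  then show "AE z in M. norm (f z \<bullet> g z) \<le> norm ((norm (f z))^2 + (norm (g z))^2)" by auto
qed

lemma L2_integrable:
  fixes f :: "'a \<Rightarrow> 'b::euclidean_space"
  assumes "finite_measure M" "f \<in> L2 M"
  shows "integrable M f"
proof (rule Bochner_Integration.integrable_bound)
  interpret finite_measure M by fact
  show "integrable M (\<lambda>z. 1 + (norm (f z))^2)"
    using assms by (auto intro!: L2_integrable_norm_sq)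
  have "norm x \<le> 1 + (norm x)^2" for x :: 'b
    using sum_squares_bound[of "norm x" 1] by (simp add: power2_eq_square) (smt (verit) norm_ge_zero)
  then show "AE z in M. norm (f z) \<le> norm (1 + (norm (f z))^2)" by auto
qed (use assms in \<open>auto dest: L2_measurable\<close>)

lemma L2_inner_commute: "L2_inner M f g = L2_inner M g f"
  by (simp add: L2_inner_def inner_commute)

lemma L2_inner_add_left:
  assumes "f \<in> L2 M" "g \<in> L2 M" "k \<in> L2 M"
  shows "L2_inner M (\<lambda>z. f z + g z) k = L2_inner M f k + L2_inner M g k"
  using assms by (simp add: L2_inner_def inner_add_left L2_inner_integrable)

lemma L2_inner_diff_left:
  assumes "f \<in> L2 M" "g \<in> L2 M" "k \<in> L2 M"
  shows "L2_inner M (\<lambda>z. f z - g z) k = L2_inner M f k - L2_inner M g k"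
  using assms by (simp add: L2_inner_def inner_diff_left L2_inner_integrable)

lemma L2_inner_add_right:
  assumes "f \<in> L2 M" "g \<in> L2 M" "k \<in> L2 M"
  shows "L2_inner M k (\<lambda>z. f z + g z) = L2_inner M k f + L2_inner M k g"
  using assms by (simp add: L2_inner_def inner_add_right L2_inner_integrable)

lemma L2_inner_diff_right:
  assumes "f \<in> L2 M" "g \<in> L2 M" "k \<in> L2 M"
  shows "L2_inner M k (\<lambda>z. f z - g z) = L2_inner M k f - L2_inner M k g"
  using assms by (simp add: L2_inner_def inner_diff_right L2_inner_integrable)

lemma L2_inner_scaleR_left: "L2_inner M (\<lambda>z. c *\<^sub>R f z) k = c * L2_inner M f k"
  by (simp add: L2_inner_def)

lemma L2_inner_scaleR_right: "L2_inner M k (\<lambda>z. c *\<^sub>R f z) = c * L2_inner M k f"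
  by (simp add: L2_inner_def)

lemma L2_inner_cong_AE:
  fixes f g f' g' :: "'a \<Rightarrow> 'b::euclidean_space"
  assumes "f \<in> borel_measurable M" "f' \<in> borel_measurable M" "g \<in> borel_measurable M" "g' \<in> borel_measurable M"
    "AE z in M. f z = f' z" "AE z in M. g z = g' z"
  shows "L2_inner M f g = L2_inner M f' g'"
  unfolding L2_inner_def
proof (rule integral_cong_AE)
  show "AE z in M. f z \<bullet> g z = f' z \<bullet> g' z" using assms(5,6) by eventually_elim simp
qed (use assms in auto)

lemma L2_inner_nonneg: "0 \<le> L2_inner M f f"
  by (simp add: L2_inner_def)

lemma L2_norm_nonneg: "0 \<le> L2_norm M f"
  by (simp add: L2_norm_def L2_inner_nonneg)

lemma L2_norm_sq: "(L2_norm M f)^2 = L2_inner M f f"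
  by (simp add: L2_norm_def L2_inner_nonneg)

lemma L2_norm_sq_integral: "(L2_norm M f)^2 = (LINT z|M. (norm (f z))^2)"
  by (simp add: L2_norm_sq) (simp add: L2_inner_def power2_norm_eq_inner)

lemma L2_norm_scaleR: "L2_norm M (\<lambda>z. c *\<^sub>R f z) = \<bar>c\<bar> * L2_norm M f"
  by (simp add: L2_norm_def L2_inner_scaleR_left L2_inner_scaleR_right real_sqrt_mult flip: mult.assoc)

lemma L2_norm_minus: "L2_norm M (\<lambda>z. - f z) = L2_norm M f"
  by (simp add: L2_norm_def L2_inner_def)

lemma L2_norm_zero [simp]: "L2_norm M (\<lambda>z. 0) = 0"
  by (simp add: L2_norm_def L2_inner_def)

lemma L2_norm_cong_AE:
  fixes f f' :: "'a \<Rightarrow> 'b::euclidean_space"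
  assumes "f \<in> borel_measurable M" "f' \<in> borel_measurable M" "AE z in M. f z = f' z"
  shows "L2_norm M f = L2_norm M f'"
  unfolding L2_norm_def using assms by (metis L2_inner_cong_AE)

lemma L2_norm_eq_0_iff:
  fixes f :: "'a \<Rightarrow> 'b::euclidean_space"
  assumes "f \<in> L2 M"
  shows "L2_norm M f = 0 \<longleftrightarrow> (AE z in M. f z = 0)"
proof -
  have "L2_norm M f = 0 \<longleftrightarrow> (LINT z|M. (norm (f z))^2) = 0"
    unfolding L2_norm_sq_integral[symmetric] by simp
  also have "\<dots> \<longleftrightarrow> (AE z in M. f z = 0)"
    using L2_integrable_norm_sq[OF assms] by (subst integral_nonneg_eq_0_iff_AE) auto
  finally show ?thesis .
qed

lemma L2_inner_square_add:
  assumes "f \<in> L2 M" "g \<in> L2 M"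
  shows "L2_inner M (\<lambda>z. f z + g z) (\<lambda>z. f z + g z) = L2_inner M f f + 2 * L2_inner M f g + L2_inner M g g"
  using assms L2_add[OF assms]
  by (simp add: L2_inner_add_left L2_inner_add_right L2_inner_commute[of M g f])

text \<open>The discriminant of a nonnegative quadratic polynomial. It is stated for bare numbers so
  that \<open>L2_inner\<close> and the degenerate forms \<open>qf\<close> and \<open>df\<close> can
  share it.\<close>

lemma psd_Cauchy_Schwarz:
  fixes a b c :: real
  assumes "\<And>t. 0 \<le> a + 2 * t * b + t^2 * c" "0 \<le> a" "0 \<le> c"
  shows "\<bar>b\<bar> \<le> sqrt a * sqrt c"
proof -
  have "b\<^sup>2 \<le> a * c"
  proof (cases "c = 0")
    case True
    have "b = 0"
    proof (rule ccontr)
      assume "b \<noteq> 0"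
      \<comment> \<open>For \<open>c = 0\<close> the polynomial is affine in \<open>t\<close>; at
        this \<open>t\<close> its value would be -1.\<close>
      have "0 \<le> a + 2 * (- (a + 1) / (2 * b)) * b" using assms(1)[of "- (a + 1) / (2 * b)"] True by simp
      also have "2 * (- (a + 1) / (2 * b)) * b = - (a + 1)" using \<open>b \<noteq> 0\<close> by simp
      finally show False by simp
    qed
    then show ?thesis using True by simp
  next
    case False
    then have c: "c > 0" using assms by simp
    have "0 \<le> a + 2 * (- b / c) * b + (- b / c)\<^sup>2 * c" by (rule assms(1))
    also have "\<dots> = a - b\<^sup>2 / c" using c by (simp add: power2_eq_square field_simps)
    finally show ?thesis using c by (simp add: field_simps)
  qed
  then have "sqrt (b^2) \<le> sqrt (a * c)" by (rule real_sqrt_le_mono)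
  then show ?thesis by (simp only: real_sqrt_mult real_sqrt_abs)
qed

lemma L2_Cauchy_Schwarz:
  assumes "f \<in> L2 M" "g \<in> L2 M"
  shows "\<bar>L2_inner M f g\<bar> \<le> L2_norm M f * L2_norm M g"
  unfolding L2_norm_def
proof (rule psd_Cauchy_Schwarz[OF _ L2_inner_nonneg L2_inner_nonneg])
  fix t :: real
  have "0 \<le> L2_inner M (\<lambda>z. f z + t *\<^sub>R g z) (\<lambda>z. f z + t *\<^sub>R g z)" by (rule L2_inner_nonneg)
  also have "\<dots> = L2_inner M f f + 2 * t * L2_inner M f g + t^2 * L2_inner M g g"
    using assms by (subst L2_inner_square_add)
      (auto simp: L2_scaleR L2_inner_scaleR_left L2_inner_scaleR_right power2_eq_square)
  finally show "0 \<le> L2_inner M f f + 2 * t * L2_inner M f g + t^2 * L2_inner M g g" .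
qed

lemma L2_norm_triangle:
  assumes "f \<in> L2 M" "g \<in> L2 M"
  shows "L2_norm M (\<lambda>z. f z + g z) \<le> L2_norm M f + L2_norm M g"
proof (rule power2_le_imp_le)
  have "(L2_norm M (\<lambda>z. f z + g z))^2 = (L2_norm M f)^2 + 2 * L2_inner M f g + (L2_norm M g)^2"
    by (simp add: L2_norm_sq L2_inner_square_add[OF assms])
  also have "\<dots> \<le> (L2_norm M f)^2 + 2 * (L2_norm M f * L2_norm M g) + (L2_norm M g)^2"
    using L2_Cauchy_Schwarz[OF assms] by auto
  finally show "(L2_norm M (\<lambda>z. f z + g z))^2 \<le> (L2_norm M f + L2_norm M g)^2"
    by (simp add: power2_sum)
qed (simp add: L2_norm_nonneg)

lemma L2_norm_diff_commute: "L2_norm M (\<lambda>z. f z - g z) = L2_norm M (\<lambda>z. g z - f z)"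
  using L2_norm_minus[of M "\<lambda>z. f z - g z"] by simp

lemma L2_norm_triangle_diff:
  assumes "f \<in> L2 M" "g \<in> L2 M" "k \<in> L2 M"
  shows "L2_norm M (\<lambda>z. f z - k z) \<le> L2_norm M (\<lambda>z. f z - g z) + L2_norm M (\<lambda>z. g z - k z)"
  using L2_norm_triangle[OF L2_diff[OF assms(1,2)] L2_diff[OF assms(2,3)]] by simp

lemma L2_norm_mono_AE:
  fixes f :: "'a \<Rightarrow> 'b::euclidean_space" and g :: "'a \<Rightarrow> 'c::euclidean_space"
  assumes "f \<in> L2 M" "AE z in M. norm (g z) \<le> norm (f z)" "g \<in> borel_measurable M"
  shows "L2_norm M g \<le> L2_norm M f"
proof (rule power2_le_imp_le)
  show "(L2_norm M g)^2 \<le> (L2_norm M f)^2"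
    unfolding L2_norm_sq_integral
  proof (rule integral_mono_AE)
    show "integrable M (\<lambda>z. (norm (g z))^2)"
      using L2_bound[OF assms(1,3,2)] by (rule L2_integrable_norm_sq)
    show "AE z in M. (norm (g z))^2 \<le> (norm (f z))^2"
      using assms(2) by eventually_elim (auto intro!: power_mono)
  qed (rule L2_integrable_norm_sq[OF assms(1)])
qed (rule L2_norm_nonneg)

lemma L2_inner_tendsto:
  assumes "\<And>k. f k \<in> L2 M" "f' \<in> L2 M" "\<And>k. g k \<in> L2 M" "g' \<in> L2 M"
    and "((\<lambda>k. L2_norm M (\<lambda>z. f k z - f' z)) \<longlongrightarrow> 0) F" "((\<lambda>k. L2_norm M (\<lambda>z. g k z - g' z)) \<longlongrightarrow> 0) F"
  shows "((\<lambda>k. L2_inner M (f k) (g k)) \<longlongrightarrow> L2_inner M f' g') F"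
proof -
  have eq: "L2_inner M (f k) (g k) - L2_inner M f' g' =
     L2_inner M (\<lambda>z. f k z - f' z) (\<lambda>z. g k z - g' z) + L2_inner M (\<lambda>z. f k z - f' z) g'
       + L2_inner M f' (\<lambda>z. g k z - g' z)" for k
    using assms(1-4) by (simp add: L2_inner_diff_left L2_inner_diff_right L2_diff)
  have "((\<lambda>k. L2_inner M (f k) (g k) - L2_inner M f' g') \<longlongrightarrow> 0) F"
  proof (rule tendsto_0_le[where K = 1])
    show "((\<lambda>k. L2_norm M (\<lambda>z. f k z - f' z) * L2_norm M (\<lambda>z. g k z - g' z)
        + L2_norm M (\<lambda>z. f k z - f' z) * L2_norm M g' + L2_norm M f' * L2_norm M (\<lambda>z. g k z - g' z)) \<longlongrightarrow> 0) F"
      using assms(5,6) by (auto intro!: tendsto_eq_intros)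
    show "\<forall>\<^sub>F k in F. norm (L2_inner M (f k) (g k) - L2_inner M f' g') \<le>
       norm (L2_norm M (\<lambda>z. f k z - f' z) * L2_norm M (\<lambda>z. g k z - g' z)
        + L2_norm M (\<lambda>z. f k z - f' z) * L2_norm M g' + L2_norm M f' * L2_norm M (\<lambda>z. g k z - g' z)) * 1"
    proof (rule always_eventually, rule allI)
      fix k
      have "\<bar>L2_inner M (\<lambda>z. f k z - f' z) (\<lambda>z. g k z - g' z)\<bar> \<le> L2_norm M (\<lambda>z. f k z - f' z) * L2_norm M (\<lambda>z. g k z - g' z)"
        "\<bar>L2_inner M (\<lambda>z. f k z - f' z) g'\<bar> \<le> L2_norm M (\<lambda>z. f k z - f' z) * L2_norm M g'"
        "\<bar>L2_inner M f' (\<lambda>z. g k z - g' z)\<bar> \<le> L2_norm M f' * L2_norm M (\<lambda>z. g k z - g' z)"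
        using assms(1-4) by (auto intro!: L2_Cauchy_Schwarz L2_diff)
      then show "norm (L2_inner M (f k) (g k) - L2_inner M f' g') \<le>
       norm (L2_norm M (\<lambda>z. f k z - f' z) * L2_norm M (\<lambda>z. g k z - g' z)
        + L2_norm M (\<lambda>z. f k z - f' z) * L2_norm M g' + L2_norm M f' * L2_norm M (\<lambda>z. g k z - g' z)) * 1"
        unfolding eq by simp
    qed
  qed
  then show ?thesis by (simp add: LIM_zero_iff)
qed

lemma L2_norm_tendsto:
  assumes "\<And>k. f k \<in> L2 M" "f' \<in> L2 M" "((\<lambda>k. L2_norm M (\<lambda>z. f k z - f' z)) \<longlongrightarrow> 0) F"
  shows "((\<lambda>k. L2_norm M (f k)) \<longlongrightarrow> L2_norm M f') F"
  unfolding L2_norm_def by (intro tendsto_intros L2_inner_tendsto assms)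

lemma L2_limit_unique:
  assumes "\<And>k. f k \<in> L2 M" "g \<in> L2 M" "g' \<in> L2 M"
    and "(\<lambda>k::nat. L2_norm M (\<lambda>z. f k z - g z)) \<longlonglongrightarrow> 0" "(\<lambda>k. L2_norm M (\<lambda>z. f k z - g' z)) \<longlonglongrightarrow> 0"
  shows "AE z in M. g z = g' z"
proof -
  have "L2_norm M (\<lambda>z. g z - g' z) \<le> L2_norm M (\<lambda>z. f k z - g z) + L2_norm M (\<lambda>z. f k z - g' z)" for k
    using L2_norm_triangle_diff[OF assms(2) assms(1) assms(3), of k] by (simp add: L2_norm_diff_commute[of M g])
  moreover have "(\<lambda>k. L2_norm M (\<lambda>z. f k z - g z) + L2_norm M (\<lambda>z. f k z - g' z)) \<longlonglongrightarrow> 0"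
    using tendsto_add[OF assms(4,5)] by simp
  ultimately have "L2_norm M (\<lambda>z. g z - g' z) \<le> 0"
    by (metis (no_types, lifting) LIMSEQ_le_const)
  then have "L2_norm M (\<lambda>z. g z - g' z) = 0" using L2_norm_nonneg[of M "\<lambda>z. g z - g' z"] by simp
  then show ?thesis using L2_norm_eq_0_iff[OF L2_diff[OF assms(2,3)]] by simp
qed

text \<open>Cauchy-Schwarz against the constant 1.\<close>

lemma norm_integral_le_L2_norm:
  fixes f :: "'a \<Rightarrow> 'b::euclidean_space"
  assumes "finite_measure M" "f \<in> L2 M"
  shows "norm (LINT z|M. f z) \<le> sqrt (measure M (space M)) * L2_norm M f"
proof -
  interpret finite_measure M by fact
  have nL: "(\<lambda>z. norm (f z)) \<in> L2 M"
    using assms(2) by (rule L2_bound) (use L2_measurable[OF assms(2)] in auto)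
  have cL: "(\<lambda>z. 1::real) \<in> L2 M" by (simp add: L2_def)
  have "norm (LINT z|M. f z) \<le> (LINT z|M. norm (f z))" by (rule integral_norm_bound)
  also have "\<dots> = L2_inner M (\<lambda>z. 1::real) (\<lambda>z. norm (f z))" by (simp add: L2_inner_def)
  also have "\<dots> \<le> L2_norm M (\<lambda>z. 1::real) * L2_norm M (\<lambda>z. norm (f z))"
    using L2_Cauchy_Schwarz[OF cL nL] by simp
  also have "L2_norm M (\<lambda>z. norm (f z)) = L2_norm M f"
    by (simp add: L2_norm_def L2_inner_def power2_norm_eq_inner[symmetric] power2_eq_square)
  also have "L2_norm M (\<lambda>z. 1::real) = sqrt (measure M (space M))"
    by (simp add: L2_norm_def L2_inner_def)
  finally show ?thesis .
qed

lemma L2_component: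
  fixes f :: "'a \<Rightarrow> 'b::euclidean_space"
  assumes "f \<in> L2 M" "norm c \<le> 1"
  shows "(\<lambda>z. f z \<bullet> c) \<in> L2 M"
proof (rule L2_bound[OF assms(1)])
  show "(\<lambda>z. f z \<bullet> c) \<in> borel_measurable M" using L2_measurable[OF assms(1)] by simp
  have "norm (f z \<bullet> c) \<le> norm (f z)" for z
    using Cauchy_Schwarz_ineq2[of "f z" c] assms(2) mult_left_mono[OF assms(2), of "norm (f z)"] by simp
  then show "AE z in M. norm (f z \<bullet> c) \<le> norm (f z)" by simp
qed

section \<open>The cell and the slab as measure spaces\<close>

abbreviation ones :: "real ^ 'n::finite" where
  "ones \<equiv> (\<chi> i. 1)"

abbreviation Iy :: "real \<Rightarrow> real measure" where
  "Iy l \<equiv> restrict_space lborel {0<..<l}"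

lemma cell_alt: "cell = (\<Inter>i. {x :: real ^ 'n::finite. 0 \<le> x $ i} \<inter> {x. x $ i < 1})"
  by (auto simp: cell_def)

lemma cell_borel [measurable]: "(cell :: (real ^ 'n::finite) set) \<in> sets borel"
  unfolding cell_alt by (intro sets.countable_INT'' borel_closed borel_open sets.Int)
    (auto intro!: closed_Collect_le open_Collect_less continuous_intros)

lemma box_subset_cell: "box 0 ones \<subseteq> (cell :: (real ^ 'n::finite) set)"
  by (auto simp: cell_def mem_box_cart less_imp_le)

lemma cell_subset_cbox: "(cell :: (real ^ 'n::finite) set) \<subseteq> cbox 0 ones"
  by (auto simp: cell_def mem_box_cart less_imp_le)

lemma inner_ones_Basis: "b \<in> Basis \<Longrightarrow> (ones :: real ^ 'n::finite) \<bullet> b = 1"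
  by (auto simp: Basis_vec_def inner_axis)

lemma emeasure_cell: "emeasure lborel (cell :: (real ^ 'n::finite) set) = 1"
proof (rule antisym)
  have "emeasure lborel (cell :: (real ^ 'n) set) \<le> emeasure lborel (cbox 0 (ones :: real ^ 'n))"
    by (rule emeasure_mono[OF cell_subset_cbox]) simp
  also have "\<dots> = 1" by (simp add: emeasure_lborel_cbox_eq inner_ones_Basis)
  finally show "emeasure lborel (cell :: (real ^ 'n) set) \<le> 1" .
  have "1 = emeasure lborel (box 0 (ones :: real ^ 'n))"
    by (simp add: emeasure_lborel_box_eq inner_ones_Basis)
  also have "\<dots> \<le> emeasure lborel (cell :: (real ^ 'n) set)"
    by (rule emeasure_mono[OF box_subset_cell]) simp
  finally show "1 \<le> emeasure lborel (cell :: (real ^ 'n) set)" .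
qed

lemma space_Sig [simp]: "space Sig = cell"
  by (simp add: Sig_def space_restrict_space)

lemma prob_space_Sig: "emeasure Sig (cell :: (real ^ 'n::finite) set) = 1"
  by (simp add: Sig_def emeasure_restrict_space emeasure_cell)

lemma finite_measure_Sig: "finite_measure (Sig :: (real ^ 'n::finite) measure)"
  by (rule finite_measureI) (simp add: prob_space_Sig)

lemma measure_Sig [simp]: "measure Sig (cell :: (real ^ 'n::finite) set) = 1"
  by (simp add: measure_def prob_space_Sig)

text \<open>The faces of the cell are a null set. A point of the open box is separated by
  \<open>circ\<close> from every other point of the closed cube (\<open>circ_inj\<close>), and
  \<open>open_indicator_tpc\<close> relies on this.\<close>

lemma AE_Sig_box: "AE x in Sig. x \<in> box 0 (ones :: real ^ 'n::finite)"
proof (rule AE_I[where N = "cell - box 0 ones"])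
  show "emeasure Sig (cell - box 0 (ones :: real ^ 'n)) = 0"
  proof -
    have "emeasure lborel (cell - box 0 (ones :: real ^ 'n)) = 1 - 1"
      by (subst emeasure_Diff) (auto simp: box_subset_cell emeasure_cell emeasure_lborel_box_eq inner_ones_Basis)
    then show ?thesis by (simp add: Sig_def emeasure_restrict_space)
  qed
qed (auto simp: Sig_def sets_restrict_space_iff)

lemma borel_measurable_Sig: "f \<in> borel_measurable borel \<Longrightarrow> f \<in> borel_measurable Sig"
  unfolding Sig_def by (rule measurable_restrict_space1) simp

lemma space_Iy [simp]: "space (Iy l) = {0<..<l}"
  by (simp add: space_restrict_space)

lemma finite_measure_Iy: "finite_measure (Iy l)"
  by (rule finite_measureI) (cases "0 \<le> l", auto simp: emeasure_restrict_space space_restrict_space)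

lemma emeasure_Iy: "emeasure (Iy l) (space (Iy l)) = ennreal l"
  by (cases "0 \<le> l") (auto simp: emeasure_restrict_space ennreal_neg)

lemma borel_measurable_Iy: "f \<in> borel_measurable borel \<Longrightarrow> f \<in> borel_measurable (Iy l)"
  by (rule measurable_restrict_space1) simp

lemma measurable_ident_restrict: "A \<in> sets M \<Longrightarrow> (\<lambda>x. x) \<in> measurable (restrict_space M A) M"
  by (rule measurable_restrict_space1) simp

lemma sigma_finite_Sig: "sigma_finite_measure (Sig :: (real ^ 'n::finite) measure)"
  using finite_measure_Sig by (rule finite_measure.axioms(1))

lemma sigma_finite_Iy: "sigma_finite_measure (Iy l)"
  using finite_measure_Iy by (rule finite_measure.axioms(1))

lemma cell_slab_sets: "(cell :: (real ^ 'n::finite) set) \<times> {0<..<l::real} \<in> sets lborel"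
proof -
  have "(cell :: (real ^ 'n) set) \<times> {0<..<l} \<in> sets (lborel \<Otimes>\<^sub>M lborel)" by (intro pair_measureI) auto
  then show ?thesis by (simp only: lborel_prod)
qed

text \<open>\<open>Om\<close> restricts Lebesgue measure on the product space, whereas slicing and
  Fubini ask for a product measure. The two agree on rectangles by \<open>lborel_prod\<close>, and
  rectangles determine a product of sigma-finite measures.\<close>

lemma Om_eq_pair: "(Om l :: ('n::finite) pt measure) = Sig \<Otimes>\<^sub>M Iy l"
proof (rule pair_measure_eqI[symmetric, OF sigma_finite_Sig sigma_finite_Iy])
  note [measurable] = measurable_ident_restrict
  show "sets (Sig \<Otimes>\<^sub>M Iy l) = sets (Om l :: 'n pt measure)"
  proof
    show "sets (Sig \<Otimes>\<^sub>M Iy l) \<subseteq> sets (Om l :: 'n pt measure)"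
    proof (rule sets_pair_in_sets)
      fix a :: "(real ^ 'n) set" and b :: "real set"
      assume "a \<in> sets Sig" "b \<in> sets (Iy l)"
      then have ab: "a \<in> sets lborel" "b \<in> sets lborel" "a \<subseteq> cell" "b \<subseteq> {0<..<l}"
        by (auto simp: Sig_def sets_restrict_space_iff)
      then have "a \<times> b \<in> sets (lborel \<Otimes>\<^sub>M lborel)" by (intro pair_measureI)
      then have "a \<times> b \<in> sets lborel" by (simp only: lborel_prod)
      with ab show "a \<times> b \<in> sets (Om l)"
        unfolding Om_def by (subst sets_restrict_space_iff) (use cell_slab_sets in auto)
    qed
    show "sets (Om l :: 'n pt measure) \<subseteq> sets (Sig \<Otimes>\<^sub>M Iy l)"
    proof
      fix A assume "A \<in> sets (Om l :: 'n pt measure)"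
      then have A0: "A \<in> sets lborel" "A \<subseteq> cell \<times> {0<..<l}"
        using cell_slab_sets[where 'n='n, of l] by (auto simp: Om_def sets_restrict_space_iff)
      then have A: "A \<in> sets (lborel \<Otimes>\<^sub>M lborel)" "A \<subseteq> cell \<times> {0<..<l}" by (simp_all only: lborel_prod)
      have s: "space (Sig \<Otimes>\<^sub>M Iy l) = (cell :: (real ^ 'n) set) \<times> {0<..<l}"
        by (simp add: space_pair_measure)
      have "(\<lambda>z. (fst z, snd z)) \<in> measurable (Sig \<Otimes>\<^sub>M Iy l) (lborel \<Otimes>\<^sub>M lborel :: 'n pt measure)"
      proof (rule measurable_Pair)
        have i1: "(\<lambda>x. x) \<in> measurable Sig (lborel :: (real ^ 'n) measure)"
          unfolding Sig_def by (rule measurable_ident_restrict) simp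
        have i2: "(\<lambda>x. x) \<in> measurable (Iy l) lborel"
          by (rule measurable_ident_restrict) simp
        show "fst \<in> measurable (Sig \<Otimes>\<^sub>M Iy l) (lborel :: (real ^ 'n) measure)"
          using measurable_compose[OF measurable_fst i1] .
        show "snd \<in> measurable (Sig \<Otimes>\<^sub>M Iy l :: 'n pt measure) lborel"
          using measurable_compose[OF measurable_snd i2] .
      qed
      from measurable_sets[OF this A(1)] show "A \<in> sets (Sig \<Otimes>\<^sub>M Iy l)"
        using A(2) unfolding s by (simp add: vimage_def Int_absorb2 s)
    qed
  qed
next
  fix A :: "(real ^ 'n) set" and B :: "real set"
  assume "A \<in> sets Sig" "B \<in> sets (Iy l)"
  then have ab: "A \<in> sets lborel" "B \<in> sets lborel" "A \<subseteq> cell" "B \<subseteq> {0<..<l}"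
    by (auto simp: Sig_def sets_restrict_space_iff)
  have "emeasure (Om l) (A \<times> B) = emeasure lborel (A \<times> B)"
    unfolding Om_def by (rule emeasure_restrict_space) (use ab cell_slab_sets in auto)
  also have "\<dots> = emeasure (lborel \<Otimes>\<^sub>M lborel) (A \<times> B)" by (simp only: lborel_prod)
  also have "\<dots> = emeasure lborel A * emeasure lborel B"
    by (rule lborel.emeasure_pair_measure_Times) (use ab in auto)
  also have "\<dots> = emeasure Sig A * emeasure (Iy l) B"
    using ab by (simp add: Sig_def emeasure_restrict_space)
  finally show "emeasure Sig A * emeasure (Iy l) B = emeasure (Om l) (A \<times> B)" by simp
qed

interpretation Om: pair_sigma_finite "Sig :: (real ^ 'n::finite) measure" "Iy l" for l
  by (rule pair_sigma_finite.intro[OF sigma_finite_Sig sigma_finite_Iy])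

lemma space_Om [simp]: "space (Om l :: ('n::finite) pt measure) = cell \<times> {0<..<l}"
  by (simp add: Om_eq_pair space_pair_measure)

lemma finite_measure_Om: "finite_measure (Om l :: ('n::finite) pt measure)"
  proof (rule finite_measureI)
  have "emeasure lborel ((cell :: (real ^ 'n) set) \<times> {0<..<l}) = emeasure (lborel \<Otimes>\<^sub>M lborel) ((cell :: (real ^ 'n) set) \<times> {0<..<l})"
    by (simp only: lborel_prod)
  also have "\<dots> = emeasure lborel (cell :: (real ^ 'n) set) * emeasure lborel {0<..<l}"
    by (rule lborel.emeasure_pair_measure_Times) auto
  also have "\<dots> < \<infinity>" by (cases "0 \<le> l") (auto simp: emeasure_cell)
  finally show "emeasure (Om l) (space (Om l :: 'n pt measure)) \<noteq> \<infinity>"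
    using cell_slab_sets[where 'n='n, of l] by (simp add: Om_def emeasure_restrict_space space_restrict_space)
qed

lemma borel_measurable_Om: "f \<in> borel_measurable borel \<Longrightarrow> f \<in> borel_measurable (Om l)"
  unfolding Om_def by (rule measurable_restrict_space1) simp


section \<open>Periodic functions and characters\<close>

lemma integral_lborel_translate:
  fixes f :: "'a::euclidean_space \<Rightarrow> 'b::{banach, second_countable_topology}"
  assumes "f \<in> borel_measurable borel"
  shows "(LINT x|lborel. f (c + x)) = (LINT x|lborel. f x)"
proof -
  have "(LINT x|lborel. f x) = (LINT x|distr lborel borel ((+) c). f x)" by (simp only: lborel_distr_plus)
  also have "\<dots> = (LINT x|lborel. f (c + x))" by (rule integral_distr) (use assms in auto)
  finally show ?thesis by simp
qed

lemma integral_Sig: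
  fixes f :: "real ^ 'n::finite \<Rightarrow> 'b::{banach, second_countable_topology}"
  shows "(LINT x|Sig. f x) = (LINT x|lborel. indicator cell x *\<^sub>R f x)"
  unfolding Sig_def by (subst integral_restrict_space) auto

text \<open>The shifted cell consists of a part inside the cell and a slice that sticks out by at
  most one period. Moving the slice back by \<open>axis i 1\<close> reassembles the cell, and
  periodicity leaves the integrand unchanged.\<close>

lemma integral_periodic_shift:
  fixes f :: "real ^ 'n::finite \<Rightarrow> 'b::{banach, second_countable_topology}"
  assumes m: "f \<in> borel_measurable borel" and per: "\<And>x. f (x + axis i 1) = f x"
    and b: "\<And>x. norm (f x) \<le> B" and s: "0 \<le> s" "s \<le> 1"
  shows "(LINT x|Sig. f (x + s *\<^sub>R axis i 1)) = (LINT x|Sig. f x)"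
proof -
  note [measurable] = m
  define e :: "real ^ 'n" where "e = axis i 1"
  have e: "(x + c *\<^sub>R e) $ j = x $ j + (if j = i then c else 0)" for x c j
    by (simp add: e_def axis_def)
  \<comment> \<open>The shifted cell is the union of \<open>A\<close> and of the translate of
    \<open>A'\<close> by one period.\<close>
  define A where "A = cell \<inter> {x :: real ^ 'n. x $ i \<ge> s}"
  define A' where "A' = cell \<inter> {x :: real ^ 'n. x $ i < s}"
  have [measurable]: "A \<in> sets borel" "A' \<in> sets borel"
    unfolding A_def A'_def by (auto intro!: sets.Int borel_closed borel_open closed_Collect_le open_Collect_less continuous_intros)
  have fin: "emeasure lborel X < \<infinity>" if "X \<in> sets borel" "X \<subseteq> cell" for X :: "(real ^ 'n) set"
    using emeasure_mono[OF that(2), of lborel] that(1) emeasure_cell[where 'n='n]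
    by (simp add: order_le_less_trans)
  have int: "integrable lborel (\<lambda>x. indicator X x *\<^sub>R f x)" if [measurable]: "X \<in> sets borel" and "X \<subseteq> cell" for X
  proof (rule Bochner_Integration.integrable_bound[where f = "\<lambda>x. B * indicator X x"])
    show "integrable lborel (\<lambda>x. B * indicat_real X x)"
      using that fin[OF that] by simp
    show "AE x in lborel. norm (indicat_real X x *\<^sub>R f x) \<le> norm (B * indicat_real X x)"
      using b by (auto simp: indicator_def intro: order_trans[OF _ abs_ge_self])
  qed simp
  have "(LINT x|Sig. f (x + s *\<^sub>R e)) = (LINT x|lborel. indicator cell x *\<^sub>R f (x + s *\<^sub>R e))"
    by (rule integral_Sig)
  also have "\<dots> = (LINT x|lborel. (\<lambda>y. indicator cell (y - s *\<^sub>R e) *\<^sub>R f y) (s *\<^sub>R e + x))"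
    by (simp add: add.commute)
  also have "\<dots> = (LINT x|lborel. indicator cell (x - s *\<^sub>R e) *\<^sub>R f x)"
    by (rule integral_lborel_translate) measurable
  also have "\<dots> = (LINT x|lborel. indicator A x *\<^sub>R f x + indicator A' (x - e) *\<^sub>R f x)"
  proof (rule Bochner_Integration.integral_cong[OF refl])
    fix x :: "real ^ 'n"
    have "indicat_real cell (x - s *\<^sub>R e) = indicator A x + indicator A' (x - e)"
    proof -
      have m1: "x - s *\<^sub>R e \<in> cell \<longleftrightarrow> (\<forall>j. j \<noteq> i \<longrightarrow> 0 \<le> x $ j \<and> x $ j < 1) \<and> s \<le> x $ i \<and> x $ i < 1 + s"
        using e[of x "- s"] by (auto simp: cell_def split: if_splits) (smt (verit))+
      have m2: "x \<in> A \<longleftrightarrow> (\<forall>j. j \<noteq> i \<longrightarrow> 0 \<le> x $ j \<and> x $ j < 1) \<and> s \<le> x $ i \<and> x $ i < 1"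
        using s by (auto simp: A_def cell_def) (metis order_trans)
      have m3: "x - e \<in> A' \<longleftrightarrow> (\<forall>j. j \<noteq> i \<longrightarrow> 0 \<le> x $ j \<and> x $ j < 1) \<and> 1 \<le> x $ i \<and> x $ i < 1 + s"
        using s e[of x "- 1"] by (auto simp: A'_def cell_def split: if_splits) (smt (verit))+
      show ?thesis unfolding indicator_def m1 m2 m3 using s by auto
    qed
    then show "indicat_real cell (x - s *\<^sub>R e) *\<^sub>R f x = indicator A x *\<^sub>R f x + indicator A' (x - e) *\<^sub>R f x"
      by (simp add: scaleR_add_left)
  qed
  also have "\<dots> = (LINT x|lborel. indicator A x *\<^sub>R f x) + (LINT x|lborel. indicator A' (x - e) *\<^sub>R f x)"
  proof (rule Bochner_Integration.integral_add)
    show "integrable lborel (\<lambda>x. indicat_real A x *\<^sub>R f x)" by (rule int) (auto simp: A_def)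
    have "integrable (distr lborel borel ((+) e)) (\<lambda>x. indicat_real A' (x - e) *\<^sub>R f x)"
    proof (subst integrable_distr_eq)
      show "integrable lborel (\<lambda>x. indicat_real A' (e + x - e) *\<^sub>R f (e + x))"
        using int[of A'] per by (simp add: A'_def e_def add.commute)
    qed measurable
    then show "integrable lborel (\<lambda>x. indicat_real A' (x - e) *\<^sub>R f x)" by (simp only: lborel_distr_plus)
  qed
  also have "(LINT x|lborel. indicator A' (x - e) *\<^sub>R f x) = (LINT x|lborel. indicator A' x *\<^sub>R f x)"
  proof -
    have "(LINT x|lborel. indicator A' (x - e) *\<^sub>R f x) = (LINT x|lborel. indicator A' (e + x - e) *\<^sub>R f (e + x))"
      by (rule integral_lborel_translate[symmetric]) measurable
    then show ?thesis using per by (simp add: e_def add.commute)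
  qed
  also have "(LINT x|lborel. indicator A x *\<^sub>R f x) + (LINT x|lborel. indicator A' x *\<^sub>R f x) =
     (LINT x|lborel. indicator A x *\<^sub>R f x + indicator A' x *\<^sub>R f x)"
    by (rule Bochner_Integration.integral_add[symmetric]) (auto intro!: int simp: A_def A'_def)
  also have "\<dots> = (LINT x|lborel. indicator cell x *\<^sub>R f x)"
    by (rule Bochner_Integration.integral_cong) (auto simp: A_def A'_def indicator_def)
  also have "\<dots> = (LINT x|Sig. f x)" by (rule integral_Sig[symmetric])
  finally show ?thesis by (simp add: e_def)
qed

definition tr :: "int ^ 'n::finite \<Rightarrow> real ^ 'n \<Rightarrow> complex" where
  "tr \<xi> x = cis (2 * pi * (freq \<xi> \<bullet> x))"

lemma freq_add: "freq (\<xi> + \<eta>) = freq \<xi> + freq \<eta>"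
  by (simp add: freq_def vec_eq_iff)

lemma freq_minus: "freq (- \<xi>) = - freq \<xi>"
  by (simp add: freq_def vec_eq_iff)

lemma freq_0 [simp]: "freq 0 = 0"
  by (simp add: freq_def vec_eq_iff)

lemma freq_eq_0_iff [simp]: "freq \<xi> = 0 \<longleftrightarrow> \<xi> = 0"
  by (simp add: freq_def vec_eq_iff)

lemma norm_tr [simp]: "norm (tr \<xi> x) = 1"
  by (simp add: tr_def)

lemma tr_0 [simp]: "tr 0 x = 1"
  by (simp add: tr_def)

lemma tr_mult: "tr \<xi> x * tr \<eta> x = tr (\<xi> + \<eta>) x"
  by (simp add: tr_def freq_add cis_mult inner_add_left distrib_left)

lemma cnj_tr: "cnj (tr \<xi> x) = tr (- \<xi>) x"
  by (simp add: tr_def freq_minus cis_cnj)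

lemma tr_continuous: "continuous_on UNIV (tr \<xi>)"
  unfolding tr_def by (intro continuous_intros)

lemma tr_borel [measurable]: "tr \<xi> \<in> borel_measurable borel"
  by (rule borel_measurable_continuous_onI[OF tr_continuous])

lemma tr_shift: "tr \<xi> (x + s *\<^sub>R axis i 1) = tr \<xi> x * cis (2 * pi * s * of_int (\<xi> $ i))"
  by (simp add: tr_def freq_def inner_add_right cis_mult inner_axis distrib_left algebra_simps)

lemma tr_periodic: "tr \<xi> (x + axis i 1) = tr \<xi> x"
proof -
  have "cis (2 * pi * real_of_int (\<xi> $ i)) = 1" by (intro cis_multiple_2pi) auto
  then show ?thesis using tr_shift[of \<xi> x 1 i] by simp
qed

lemma fourier_alt: "fourier f \<xi> = (LINT x|Sig. of_real (f x) * cnj (tr \<xi> x))"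
proof -
  have "exp (- 2 * complex_of_real pi * \<i> * complex_of_real (freq \<xi> \<bullet> x)) = cnj (tr \<xi> x)" for x
    by (simp add: tr_def cis_cnj) (simp add: cis_conv_exp mult_ac)
  then show ?thesis by (simp add: fourier_def)
qed

lemma integrable_tr [simp]: "integrable Sig (tr \<xi>)"
proof -
  interpret finite_measure Sig by (rule finite_measure_Sig)
  show ?thesis by (rule integrable_const_bound[of _ 1]) (auto intro: borel_measurable_Sig)
qed

text \<open>Along an axis on which \<xi> has a nonzero component, translation by half a wavelength
  changes the sign of \<open>tr \<xi>\<close> but not the integral over the torus.\<close>

lemma integral_tr: "(LINT x|Sig. tr \<xi> x) = (if \<xi> = 0 then 1 else 0)"
proof (cases "\<xi> = 0")
  case False
  then obtain i where i: "\<xi> $ i \<noteq> 0" by (metis vec_eq_iff zero_index)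
  \<comment> \<open>Half a wavelength along axis \<open>i\<close>. It is at most 1, as the shift
    lemma requires, because the component is a nonzero integer.\<close>
  define s where "s = 1 / (2 * \<bar>real_of_int (\<xi> $ i)\<bar>)"
  have "\<bar>real_of_int (\<xi> $ i)\<bar> \<ge> 1" using i by linarith
  then have s: "0 \<le> s" "s \<le> 1" by (auto simp: s_def field_simps)
  have ss: "2 * pi * s * real_of_int (\<xi> $ i) = pi * sgn (real_of_int (\<xi> $ i))"
    using i by (simp add: s_def sgn_if abs_if field_simps)
  have c: "cis (2 * pi * s * real_of_int (\<xi> $ i)) = -1"
    unfolding ss using i by (auto simp: sgn_if complex_eq_iff)
  have "(LINT x|Sig. tr \<xi> x) = (LINT x|Sig. tr \<xi> (x + s *\<^sub>R axis i 1))"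
    by (rule integral_periodic_shift[symmetric, where B = 1]) (auto simp: tr_periodic s)
  also have "\<dots> = - (LINT x|Sig. tr \<xi> x)" by (simp add: tr_shift c)
  finally show ?thesis using False by (simp add: eq_neg_iff_add_eq_0)
qed simp

lemma integral_tr_cnj_tr: "(LINT x|Sig. tr \<xi> x * cnj (tr \<eta> x)) = (if \<xi> = \<eta> then 1 else 0)"
  using integral_tr[of "\<xi> - \<eta>"] by (simp add: cnj_tr tr_mult)

lemma L2_tr: "(\<lambda>x. c * tr \<xi> x) \<in> L2 Sig"
  by (rule L2_bounded[OF finite_measure_Sig, where B = "norm c"]) (auto intro: borel_measurable_Sig simp: norm_mult)

text \<open>Trigonometric polynomials. The inductive form makes closure under products a double
  induction; \<open>tp_finite_sum\<close> recovers the explicit sum.\<close>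

inductive_set tp :: "(real ^ 'n::finite \<Rightarrow> complex) set" where
  tp_char: "(\<lambda>x. c * tr \<xi> x) \<in> tp"
| tp_add: "p \<in> tp \<Longrightarrow> q \<in> tp \<Longrightarrow> (\<lambda>x. p x + q x) \<in> tp"

lemma tp_const: "(\<lambda>x. c) \<in> tp"
  using tp_char[of c 0] by simp

lemma tp_mult:
  assumes "p \<in> tp" "q \<in> tp"
  shows "(\<lambda>x. p x * q x) \<in> tp"
  using assms(1)
proof induction
  case (tp_char c \<xi>)
  show ?case using assms(2)
  proof induction
    case (tp_char d \<eta>)
    have "(\<lambda>x. c * tr \<xi> x * (d * tr \<eta> x)) = (\<lambda>x. (c * d) * tr (\<xi> + \<eta>) x)"
      by (simp add: tr_mult[symmetric] mult_ac)
    then show ?case by (simp add: tp.tp_char)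
  next
    case (tp_add p q)
    then show ?case using tp.tp_add[OF tp_add.IH] by (simp add: distrib_left)
  qed
next
  case (tp_add p' q')
  then show ?case using tp.tp_add[OF tp_add.IH] by (simp add: distrib_right)
qed

lemma tp_sum: "(\<And>i. i \<in> A \<Longrightarrow> p i \<in> tp) \<Longrightarrow> (\<lambda>x. \<Sum>i\<in>A. p i x) \<in> tp"
  by (induction A rule: infinite_finite_induct) (auto intro: tp_add tp_const)

lemma tp_finite_sum:
  assumes "p \<in> tp"
  shows "\<exists>F c. finite F \<and> p = (\<lambda>x. \<Sum>\<xi>\<in>F. c \<xi> * tr \<xi> x)"
  using assms
proof induction
  case (tp_char c \<xi>)
  show ?case by (rule exI[of _ "{\<xi>}"], rule exI[of _ "\<lambda>_. c"]) simp
next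
  case (tp_add p q)
  then obtain F c G d where F: "finite F" "p = (\<lambda>x. \<Sum>\<xi>\<in>F. c \<xi> * tr \<xi> x)"
    and G: "finite G" "q = (\<lambda>x. \<Sum>\<xi>\<in>G. d \<xi> * tr \<xi> x)" by blast
  have "p x + q x = (\<Sum>\<xi>\<in>F \<union> G. ((if \<xi> \<in> F then c \<xi> else 0) + (if \<xi> \<in> G then d \<xi> else 0)) * tr \<xi> x)" for x
  proof -
    have "(\<Sum>\<xi>\<in>F. c \<xi> * tr \<xi> x) = (\<Sum>\<xi>\<in>F \<union> G. (if \<xi> \<in> F then c \<xi> else 0) * tr \<xi> x)"
      using F G by (intro sum.mono_neutral_cong_left) auto
    moreover have "(\<Sum>\<xi>\<in>G. d \<xi> * tr \<xi> x) = (\<Sum>\<xi>\<in>F \<union> G. (if \<xi> \<in> G then d \<xi> else 0) * tr \<xi> x)"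
      using F G by (intro sum.mono_neutral_cong_left) auto
    ultimately show ?thesis by (simp add: F G distrib_right sum.distrib)
  qed
  then show ?case using F(1) G(1)
    by (intro exI[of _ "F \<union> G"] exI[of _ "\<lambda>\<xi>. (if \<xi> \<in> F then c \<xi> else 0) + (if \<xi> \<in> G then d \<xi> else 0)"]) auto
qed

lemma tp_L2: "p \<in> tp \<Longrightarrow> p \<in> L2 Sig"
  by (induction rule: tp.induct) (auto intro: L2_tr L2_add)


section \<open>Density of trigonometric polynomials and Parseval's identity\<close>

lemma L2_dominated:
  fixes f :: "nat \<Rightarrow> 'a \<Rightarrow> 'b::euclidean_space" and w :: "'a \<Rightarrow> 'c::euclidean_space"
  assumes w: "w \<in> L2 M" and m: "\<And>k. f k \<in> borel_measurable M" "g \<in> borel_measurable M"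
    and lim: "AE z in M. (\<lambda>k. f k z) \<longlonglongrightarrow> g z" and b: "\<And>k. AE z in M. norm (f k z) \<le> norm (w z)"
  shows "g \<in> L2 M" "(\<lambda>k. L2_norm M (\<lambda>z. f k z - g z)) \<longlonglongrightarrow> 0"
proof -
  have bg: "AE z in M. norm (g z) \<le> norm (w z)"
  proof -
    have "AE z in M. \<forall>k. norm (f k z) \<le> norm (w z)" using b by (simp add: AE_all_countable)
    then show ?thesis using lim
    proof eventually_elim
      case (elim z)
      then show ?case by (intro LIMSEQ_le_const2[OF tendsto_norm]) auto
    qed
  qed
  show "g \<in> L2 M" by (rule L2_bound[OF w m(2) bg])
  have "(\<lambda>k. LINT z|M. (norm (f k z - g z))^2) \<longlonglongrightarrow> (LINT z|M. 0)"
  proof (rule integral_dominated_convergence[where w = "\<lambda>z. 4 * (norm (w z))^2"])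
    show "integrable M (\<lambda>z. 4 * (norm (w z))^2)" using L2_integrable_norm_sq[OF w] by simp
    show "AE z in M. (\<lambda>k. (norm (f k z - g z))^2) \<longlonglongrightarrow> 0"
      using lim
    proof eventually_elim
      case (elim z)
      then have "(\<lambda>k. (norm (f k z - g z))^2) \<longlonglongrightarrow> (norm (g z - g z))\<^sup>2" by (intro tendsto_intros)
      then show ?case by simp
    qed
    show "AE z in M. norm ((norm (f k z - g z))^2) \<le> 4 * (norm (w z))^2" for k
      using b[of k] bg
    proof eventually_elim
      case (elim z)
      have "norm (f k z - g z) \<le> 2 * norm (w z)"
        using norm_triangle_ineq4[of "f k z" "g z"] elim by linarith
      then have "(norm (f k z - g z))^2 \<le> (2 * norm (w z))\<^sup>2" by (intro power_mono) auto
      then show ?case by (simp add: power_mult_distrib)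
    qed
  qed (use m in auto)
  then have "(\<lambda>k. (L2_norm M (\<lambda>z. f k z - g z))^2) \<longlonglongrightarrow> 0" by (simp add: L2_norm_sq_integral)
  then have "(\<lambda>k. sqrt ((L2_norm M (\<lambda>z. f k z - g z))^2)) \<longlonglongrightarrow> sqrt 0" by (intro tendsto_intros)
  then show "(\<lambda>k. L2_norm M (\<lambda>z. f k z - g z)) \<longlonglongrightarrow> 0" by (simp add: L2_norm_nonneg)
qed

text \<open>The real functions in the L2 closure of the trigonometric polynomials.
  \<open>L2_Sig_eq_tpc\<close> shows that these are all of L2.\<close>

definition tpc :: "(real ^ 'n::finite \<Rightarrow> real) set" where
  "tpc = {f \<in> L2 Sig. \<forall>e>0. \<exists>p\<in>tp. L2_norm Sig (\<lambda>x. of_real (f x) - p x) < e}"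

lemma L2_of_real: "f \<in> L2 M \<Longrightarrow> (\<lambda>x. complex_of_real (f x)) \<in> L2 M"
  by (rule L2_bound[where f = f]) (use L2_measurable[of f M] in auto)

lemma L2_norm_of_real: "L2_norm M (\<lambda>x. complex_of_real (f x)) = L2_norm M f"
  by (simp add: L2_norm_def L2_inner_def inner_complex_def)

lemma tpc_closed:
  assumes f: "f \<in> L2 Sig" and g: "\<And>k. g k \<in> tpc" and lim: "(\<lambda>k. L2_norm Sig (\<lambda>x. g k x - f x)) \<longlonglongrightarrow> 0"
  shows "f \<in> tpc"
  unfolding tpc_def
proof (intro CollectI conjI f allI impI)
  fix e :: real assume e: "e > 0"
  obtain k where k: "L2_norm Sig (\<lambda>x. g k x - f x) < e / 2"
    using order_tendstoD(2)[OF lim, of "e / 2"] e by (auto simp: eventually_sequentially)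
  obtain p where p: "p \<in> tp" "L2_norm Sig (\<lambda>x. of_real (g k x) - p x) < e / 2"
    using g[of k] e by (auto simp: tpc_def dest!: spec[of _ "e / 2"])
  have gk: "g k \<in> L2 Sig" using g by (simp add: tpc_def)
  have "L2_norm Sig (\<lambda>x. of_real (f x) - p x) \<le>
    L2_norm Sig (\<lambda>x. complex_of_real (f x) - of_real (g k x)) + L2_norm Sig (\<lambda>x. of_real (g k x) - p x)"
    by (intro L2_norm_triangle_diff L2_of_real f gk tp_L2 p)
  also have "L2_norm Sig (\<lambda>x. complex_of_real (f x) - of_real (g k x)) = L2_norm Sig (\<lambda>x. g k x - f x)"
    using L2_norm_of_real[of Sig "\<lambda>x. f x - g k x"] by (simp add: L2_norm_diff_commute[of _ f])
  finally show "\<exists>p\<in>tp. L2_norm Sig (\<lambda>x. of_real (f x) - p x) < e" using p(1) p(2) k by force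
qed

lemma tpc_add:
  assumes "f \<in> tpc" "g \<in> tpc"
  shows "(\<lambda>x. f x + g x) \<in> tpc"
  unfolding tpc_def
proof (intro CollectI conjI allI impI)
  have fg: "f \<in> L2 Sig" "g \<in> L2 Sig" using assms by (auto simp: tpc_def)
  then show "(\<lambda>x. f x + g x) \<in> L2 Sig" by (rule L2_add)
  fix e :: real assume e: "e > 0"
  obtain p where p: "p \<in> tp" "L2_norm Sig (\<lambda>x. of_real (f x) - p x) < e / 2"
    using assms(1) e by (auto simp: tpc_def dest!: spec[of _ "e / 2"])
  obtain q where q: "q \<in> tp" "L2_norm Sig (\<lambda>x. of_real (g x) - q x) < e / 2"
    using assms(2) e by (auto simp: tpc_def dest!: spec[of _ "e / 2"])
  have "L2_norm Sig (\<lambda>x. (complex_of_real (f x) - p x) + (of_real (g x) - q x)) \<le>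
    L2_norm Sig (\<lambda>x. of_real (f x) - p x) + L2_norm Sig (\<lambda>x. of_real (g x) - q x)"
    by (intro L2_norm_triangle L2_diff L2_of_real fg tp_L2 p q)
  then have "L2_norm Sig (\<lambda>x. of_real (f x + g x) - (p x + q x)) < e"
    using p(2) q(2) by (simp add: algebra_simps)
  then show "\<exists>p\<in>tp. L2_norm Sig (\<lambda>x. of_real (f x + g x) - p x) < e"
    using tp_add[OF p(1) q(1)] by (rule bexI[where x = "\<lambda>x. p x + q x"])
qed

lemma tpc_scale:
  assumes "f \<in> tpc"
  shows "(\<lambda>x. c * f x) \<in> tpc"
proof (cases "c = 0")
  case True
  have "(\<lambda>x :: real ^ 'n. 0 :: real) \<in> tpc"
    unfolding tpc_def
  proof (intro CollectI conjI L2_zero allI impI)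
    show "\<exists>p\<in>tp. L2_norm Sig (\<lambda>x :: real ^ 'n. complex_of_real 0 - p x) < e" if "e > 0" for e :: real
      using that by (intro bexI[OF _ tp_const[of 0]]) simp
  qed
  then show ?thesis using True by simp
next
  case False
  show ?thesis unfolding tpc_def
  proof (intro CollectI conjI allI impI)
    have f: "f \<in> L2 Sig" using assms by (auto simp: tpc_def)
    then show "(\<lambda>x. c * f x) \<in> L2 Sig" using L2_scaleR[OF f, of c] by simp
    fix e :: real assume e: "e > 0"
    obtain p where p: "p \<in> tp" "L2_norm Sig (\<lambda>x. of_real (f x) - p x) < e / \<bar>c\<bar>"
      using assms e False by (auto simp: tpc_def dest!: spec[of _ "e / \<bar>c\<bar>"])
    have "L2_norm Sig (\<lambda>x. c *\<^sub>R (of_real (f x) - p x)) < e"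
      using p(2) False by (subst L2_norm_scaleR) (simp add: field_simps)
    then have "L2_norm Sig (\<lambda>x. of_real (c * f x) - of_real c * p x) < e"
      by (simp add: scaleR_conv_of_real algebra_simps)
    then show "\<exists>p\<in>tp. L2_norm Sig (\<lambda>x. of_real (c * f x) - p x) < e"
      using tp_mult[OF tp_const p(1), of "of_real c"] by (rule bexI[where x = "\<lambda>x. of_real c * p x"])
  qed
qed

lemma one_tpc: "(\<lambda>x. 1) \<in> tpc"
  unfolding tpc_def
proof (intro CollectI conjI allI impI)
  show "(\<lambda>x. 1::real) \<in> L2 Sig"
    by (rule L2_bounded[OF finite_measure_Sig, where B = 1]) simp_all
  show "\<exists>p\<in>tp. L2_norm Sig (\<lambda>x. of_real 1 - p x) < e" if "e > 0" for e
    using that tp_const[of 1] by (intro bexI[of _ "\<lambda>x. 1"]) auto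
qed

text \<open>Embedding of the torus into a product of unit circles. Continuous functions of
  \<open>circ x\<close> are periodic, and polynomials in \<open>circ x\<close> are trigonometric
  polynomials, so Stone-Weierstrass on a compact subset of Euclidean space applies.\<close>

definition circ :: "real ^ 'n::finite \<Rightarrow> complex ^ 'n" where
  "circ x = (\<chi> j. cis (2 * pi * x $ j))"

lemma continuous_on_circ: "continuous_on A circ"
  unfolding circ_def by (intro continuous_intros continuous_on_vec_lambda)

text \<open>A real coordinate of \<open>circ x\<close> is a combination of a character and its
  conjugate, and \<open>tp\<close> is an algebra.\<close>

lemma tp_circ_polynomial:
  fixes g :: "complex ^ 'n::finite \<Rightarrow> real"
  assumes "real_polynomial_function g"
  shows "(\<lambda>x. complex_of_real (g (circ x))) \<in> tp"
  using assms
proof induction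
  case (linear f)
  interpret bounded_linear f by fact
  have comp: "(\<lambda>x. complex_of_real (circ x \<bullet> b)) \<in> tp" if b: "b \<in> Basis" for b :: "complex ^ 'n"
  proof -
    obtain j u where bu: "b = axis j u" using b by (auto simp: Basis_vec_def)
    have fr: "freq (axis j 1 :: int ^ 'n) \<bullet> x = x $ j" for x :: "real ^ 'n"
    proof -
      have "freq (axis j 1) = (axis j 1 :: real ^ 'n)"
        by (simp add: freq_def axis_def vec_eq_iff)
      then show ?thesis by (simp add: inner_axis')
    qed
    have "complex_of_real (circ x \<bullet> b) = (cnj u / 2) * tr (axis j 1) x + (u / 2) * tr (- axis j 1) x" for x
      by (simp add: bu circ_def inner_axis tr_def freq_minus fr complex_eq_iff inner_complex_def field_simps)
    then show ?thesis using tp_add[OF tp_char[of "cnj u / 2" "axis j 1"] tp_char[of "u / 2" "- axis j 1"]] by simp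
  qed
  have "complex_of_real (f (circ x)) = (\<Sum>b\<in>Basis. of_real (f b) * complex_of_real (circ x \<bullet> b))" for x
  proof -
    have "f (circ x) = f (\<Sum>b\<in>Basis. (circ x \<bullet> b) *\<^sub>R b)" by (simp add: euclidean_representation)
    also have "\<dots> = (\<Sum>b\<in>Basis. (circ x \<bullet> b) * f b)" by (simp add: sum scaleR)
    finally show ?thesis by (simp add: mult.commute)
  qed
  then show ?case using comp by (auto intro!: tp_sum tp_mult tp_const)
next
  case (const c)
  show ?case by (rule tp_const)
next
  case (add f g)
  then show ?case using tp_add by fastforce
next
  case (mult f g)
  then show ?case using tp_mult by fastforce
qed

text \<open>Stone-Weierstrass on the compact image of the closed cube; the uniform error bounds the
  L2 error because the cell has measure 1.\<close>

lemma continuous_circ_tpc: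
  fixes \<phi> :: "complex ^ 'n::finite \<Rightarrow> real"
  assumes "continuous_on UNIV \<phi>"
  shows "(\<lambda>x. \<phi> (circ x)) \<in> tpc"
proof -
  let ?K = "circ ` cbox 0 (ones :: real ^ 'n)"
  have K: "compact ?K" by (rule compact_continuous_image[OF continuous_on_circ compact_cbox])
  have m: "(\<lambda>x. \<phi> (circ x)) \<in> borel_measurable borel"
    by (intro borel_measurable_continuous_onI continuous_on_compose2[OF assms continuous_on_circ]) auto
  obtain B where B: "\<And>z. z \<in> ?K \<Longrightarrow> \<bar>\<phi> z\<bar> \<le> B"
    using compact_imp_bounded[OF compact_continuous_image[OF continuous_on_subset[OF assms] K]]
    by (force simp: bounded_iff)
  have inK: "circ x \<in> ?K" if "x \<in> cell" for x using that cell_subset_cbox by blast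
  have L: "(\<lambda>x. \<phi> (circ x)) \<in> L2 Sig"
    by (rule L2_bounded[OF finite_measure_Sig, where B = B]) (use m B inK in \<open>auto intro!: borel_measurable_Sig AE_I2\<close>)
  show ?thesis unfolding tpc_def
  proof (intro CollectI conjI allI impI L)
    fix e :: real assume e: "e > 0"
    obtain g where g: "real_polynomial_function g" "\<And>z. z \<in> ?K \<Longrightarrow> \<bar>\<phi> z - g z\<bar> < e / 2"
      using Stone_Weierstrass_real_polynomial_function[OF K continuous_on_subset[OF assms], of "e / 2"] e by auto
    let ?p = "\<lambda>x. complex_of_real (g (circ x))"
    have p: "?p \<in> tp" by (rule tp_circ_polynomial[OF g(1)])
    have c: "(\<lambda>x :: real ^ 'n. e / 2) \<in> L2 Sig"
      by (rule L2_bounded[OF finite_measure_Sig, where B = "e / 2"]) (use e in auto)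
    have "L2_norm Sig (\<lambda>x. of_real (\<phi> (circ x)) - ?p x) \<le> L2_norm Sig (\<lambda>x :: real ^ 'n. e / 2)"
    proof (rule L2_norm_mono_AE[OF c])
      show "AE x in Sig. norm (of_real (\<phi> (circ x)) - ?p x) \<le> norm (e / 2)"
      proof (rule AE_I2)
        fix x :: "real ^ 'n" assume "x \<in> space Sig"
        then show "norm (of_real (\<phi> (circ x)) - ?p x) \<le> norm (e / 2)"
          using g(2)[OF inK[of x]] e by (simp flip: of_real_diff)
      qed
      show "(\<lambda>x. of_real (\<phi> (circ x)) - ?p x) \<in> borel_measurable Sig"
        by (rule L2_measurable[OF L2_diff[OF L2_of_real[OF L] tp_L2[OF p]]])
    qed
    also have "\<dots> = e / 2" using e by (simp add: L2_norm_def power_divide real_sqrt_divide L2_inner_def flip: power2_eq_square)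
    finally show "\<exists>p\<in>tp. L2_norm Sig (\<lambda>x. of_real (\<phi> (circ x)) - p x) < e"
      using e p by (intro bexI[OF _ p]) auto
  qed
qed

lemma circ_inj:
  assumes "x \<in> box 0 (ones :: real ^ 'n::finite)" "y \<in> cbox 0 ones" "circ x = circ y"
  shows "x = y"
proof -
  have "x $ j = y $ j" for j
  proof -
    have "cis (2 * pi * x $ j) = cis (2 * pi * y $ j)"
      using assms(3) by (metis circ_def vec_lambda_beta)
    then have "cis (2 * pi * (x $ j - y $ j)) = 1"
      by (simp add: right_diff_distrib flip: cis_divide)
    then obtain n :: int where n: "2 * pi * (x $ j - y $ j) = 2 * pi * n"
      using cos_one_2pi_int[of "2 * pi * (x $ j - y $ j)"] by (auto simp: complex_eq_iff)
    then have "x $ j - y $ j = n" by simp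
    moreover have "0 < x $ j" "x $ j < 1" "0 \<le> y $ j" "y $ j \<le> 1"
      using assms by (auto simp: mem_box_cart)
    ultimately have "n = 0" by linarith
    then show ?thesis using n by simp
  qed
  then show ?thesis by (simp add: vec_eq_iff)
qed

text \<open>The indicator is the limit of the truncated multiples \<open>\<phi> k\<close> of the
  distance to a compact set, evaluated at \<open>circ x\<close>. These are continuous on the torus
  although the indicator need not respect the periodic identification of the faces.\<close>

lemma open_indicator_tpc:
  fixes U :: "(real ^ 'n::finite) set"
  assumes "open U"
  shows "indicat_real U \<in> tpc"
proof -
  define V where "V = U \<inter> box 0 ones"
  \<comment> \<open>The faces of the cube are put into the complement as well. For \<open>x\<close>
    in the open box, \<open>circ_inj\<close> then gives \<open>circ x \<notin> K\<close> exactly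
    when \<open>x \<in> U\<close>; and \<open>K\<close> is never empty, since it contains
    \<open>circ 0\<close>.\<close>
  define K where "K = circ ` (cbox 0 ones - V)"
  have V: "open V" using assms by (auto simp: V_def)
  have ne: "K \<noteq> {}"
  proof -
    have "(0 :: real ^ 'n) \<in> cbox 0 ones - V" by (auto simp: V_def mem_box_cart)
    then show ?thesis unfolding K_def by blast
  qed
  have cK: "closed K"
    unfolding K_def by (intro compact_imp_closed compact_continuous_image continuous_on_circ compact_diff compact_cbox V)
  define \<phi> where "\<phi> k z = min 1 (real k * infdist z K)" for k :: nat and z
  have "(\<lambda>k. \<phi> k (circ x)) \<longlonglongrightarrow> indicat_real U x" if x: "x \<in> box 0 ones" for x
  proof (cases "x \<in> U")
    case True
    have "circ x \<notin> K"
    proof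
      assume "circ x \<in> K"
      then obtain y where y: "y \<in> cbox 0 ones" "y \<notin> V" "circ x = circ y" by (auto simp: K_def)
      then have "x = y" using circ_inj[OF x] by blast
      then show False using y True x by (simp add: V_def)
    qed
    then have pos: "infdist (circ x) K > 0"
      using in_closed_iff_infdist_zero[OF cK ne, of "circ x"] infdist_nonneg[of "circ x" K] by linarith
    obtain n where n: "real n * infdist (circ x) K > 1" using reals_Archimedean3[OF pos] by blast
    have "\<phi> k (circ x) = 1" if "k \<ge> n" for k
    proof -
      have "real n * infdist (circ x) K \<le> real k * infdist (circ x) K"
        using that pos by (intro mult_right_mono) auto
      then show ?thesis using n by (simp add: \<phi>_def)
    qed
    then have "\<forall>\<^sub>F k in sequentially. \<phi> k (circ x) = 1" by (auto simp: eventually_sequentially)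
    then show ?thesis using True by (auto intro: tendsto_eventually)
  next
    case False
    then have "circ x \<in> K"
      using x box_subset_cbox[of 0 "ones :: real ^ 'n"] by (auto simp: K_def V_def)
    then have "infdist (circ x) K = 0" by simp
    then show ?thesis using False by (simp add: \<phi>_def)
  qed
  then have lim: "AE x in Sig. (\<lambda>k. \<phi> k (circ x)) \<longlonglongrightarrow> indicat_real U x"
    by (rule eventually_mono[OF AE_Sig_box])
  have \<phi>c: "continuous_on UNIV (\<phi> k)" for k
    unfolding \<phi>_def by (intro continuous_intros)
  have t: "(\<lambda>x. \<phi> k (circ x)) \<in> tpc" for k by (rule continuous_circ_tpc[OF \<phi>c])
  have one: "(\<lambda>x :: real ^ 'n. 1 :: real) \<in> L2 Sig" using one_tpc unfolding tpc_def by blast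
  have mU: "indicat_real U \<in> borel_measurable Sig"
    by (intro borel_measurable_Sig borel_measurable_indicator) (use assms in auto)
  have mk: "(\<lambda>x. \<phi> k (circ x)) \<in> borel_measurable Sig" for k
    using t[of k] by (simp add: tpc_def L2_measurable)
  have b: "AE x in Sig. norm (\<phi> k (circ x)) \<le> norm (1 :: real)" for k
    by (auto simp: \<phi>_def infdist_nonneg)
  note D = L2_dominated[OF one mk mU lim b]
  show ?thesis by (rule tpc_closed[OF D(1) t D(2)])
qed

text \<open>Open sets form a generator stable under intersection. Complements stay in
  \<open>tpc\<close> by linearity, countable disjoint unions by dominated convergence of the partial
  sums.\<close>

lemma borel_indicator_tpc:
  fixes A :: "(real ^ 'n::finite) set"
  assumes "A \<in> sets borel"
  shows "indicat_real A \<in> tpc"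
proof -
  have one: "(\<lambda>x :: real ^ 'n. 1 :: real) \<in> L2 Sig" using one_tpc unfolding tpc_def by blast
  have A: "A \<in> sigma_sets UNIV (Collect open)" using assms by (simp add: borel_def)
  have stable: "Int_stable (Collect open :: (real ^ 'n) set set)" by (auto simp: Int_stable_def)
  have "Collect open \<subseteq> Pow (UNIV :: (real ^ 'n) set)" by simp
  from stable this A show ?thesis
  proof (induction rule: sigma_sets_induct_disjoint)
    case (basic A)
    then show ?case by (intro open_indicator_tpc) auto
  next
    case empty
    show ?case using tpc_scale[OF one_tpc, of 0] by (simp add: indicator_def)
  next
    case (compl A)
    have "indicat_real (UNIV - A) = (\<lambda>x. 1 + (-1) * indicator A x)" by (auto simp: indicator_def)
    then show ?case using tpc_add[OF one_tpc tpc_scale[OF compl(2), of "-1"]] by simp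
  next
    case (union A)
    have A: "A i \<in> sets borel" for i using union(2) by (auto simp: borel_def)
    define f where "f n x = (\<Sum>i<n. indicat_real (A i) x)" for n x
    have f_tpc: "f n \<in> tpc" for n
    proof (induction n)
      case 0
      show ?case using tpc_scale[OF one_tpc, of 0] by (simp add: f_def)
    next
      case (Suc n)
      show ?case using tpc_add[OF Suc union(3)[of n]] by (simp add: f_def)
    qed
    have feq: "f n x = indicat_real (\<Union>i<n. A i) x" for n x
      unfolding f_def using union(1)
      by (subst indicator_UN_disjoint) (auto simp: disjoint_family_on_def)
    have lim: "AE x in Sig. (\<lambda>n. f n x) \<longlonglongrightarrow> indicat_real (\<Union>i. A i) x"
      unfolding feq by (intro AE_I2 LIMSEQ_indicator_UN)
    have mU: "indicat_real (\<Union>i. A i) \<in> borel_measurable Sig"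
      by (intro borel_measurable_Sig borel_measurable_indicator) (use A in auto)
    have mk: "f k \<in> borel_measurable Sig" for k using f_tpc[of k] by (simp add: tpc_def L2_measurable)
    have b: "AE x in Sig. norm (f k x) \<le> norm (1 :: real)" for k by (auto simp: feq indicator_def)
    note D = L2_dominated[OF one mk mU lim b]
    show ?case by (rule tpc_closed[OF D(1) f_tpc D(2)])
  qed
qed

text \<open>Density of the trigonometric polynomials in L2: a simple function is a combination of
  Borel indicators on the cell, and simple functions dominated by \<open>2 * norm (f x)\<close>
  converge to \<open>f\<close>.\<close>

lemma L2_Sig_eq_tpc: "(L2 Sig :: (real ^ 'n::finite \<Rightarrow> real) set) = tpc"
proof
  show "(tpc :: (real ^ 'n \<Rightarrow> real) set) \<subseteq> L2 Sig" by (auto simp: tpc_def)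
  show "(L2 Sig :: (real ^ 'n \<Rightarrow> real) set) \<subseteq> tpc"
  proof
    fix f :: "real ^ 'n \<Rightarrow> real" assume f: "f \<in> L2 Sig"
    have cong: "g \<in> tpc" if "g' \<in> tpc" "\<And>x. x \<in> cell \<Longrightarrow> g x = g' x" for g g' :: "real ^ 'n \<Rightarrow> real"
    proof -
      have m: "g' \<in> borel_measurable Sig" using that(1) by (auto simp: tpc_def L2_measurable)
      have gm: "g \<in> borel_measurable Sig"
        using m by (rule measurable_cong[THEN iffD1, rotated]) (use that(2) in auto)
      have gL: "g \<in> L2 Sig"
        by (rule L2_bound[of g']) (use that gm in \<open>auto simp: tpc_def\<close>)
      have g'L: "g' \<in> L2 Sig" using that(1) by (simp add: tpc_def)
      have "L2_norm Sig (\<lambda>x. g' x - g x) = 0"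
        by (subst L2_norm_eq_0_iff[OF L2_diff[OF g'L gL]]) (use that(2) in auto)
      then show ?thesis using tpc_closed[OF gL, of "\<lambda>_. g'"] that(1) by simp
    qed
    obtain s where s: "\<And>i. simple_function Sig (s i)" "\<And>x. x \<in> space Sig \<Longrightarrow> (\<lambda>i. s i x) \<longlonglongrightarrow> f x"
      "\<And>i x. x \<in> space Sig \<Longrightarrow> norm (s i x) \<le> 2 * norm (f x)"
      using borel_measurable_implies_sequence_metric[OF L2_measurable[OF f], of 0] by (metis norm_conv_dist)
    have t: "s i \<in> tpc" for i
    proof -
      have rep: "s i x = (\<Sum>y\<in>s i ` cell. y * indicat_real (s i -` {y} \<inter> cell) x)" if "x \<in> cell" for x
      proof -
        have "(\<Sum>y\<in>s i ` cell. y * indicat_real (s i -` {y} \<inter> cell) x) = (\<Sum>y\<in>s i ` cell. if y = s i x then y else 0)"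
          using that by (intro sum.cong) (auto simp: indicator_def)
        then show ?thesis using that simple_functionD(1)[OF s(1), of i] by simp
      qed
      have ind: "indicat_real (s i -` {y} \<inter> cell) \<in> tpc" for y
        using simple_functionD(2)[OF s(1), of i "{y}"]
        by (intro borel_indicator_tpc) (auto simp: Sig_def sets_restrict_space_iff)
      have sm: "(\<lambda>x. \<Sum>y\<in>A. y * indicat_real (s i -` {y} \<inter> cell) x) \<in> tpc" if "finite A" for A
        using that
      proof induction
        case empty
        show ?case using tpc_scale[OF one_tpc, of 0] by simp
      next
        case (insert y A)
        then show ?case using tpc_add[OF tpc_scale[OF ind[of y], of y] insert.IH] by (simp add: sum.insert[OF insert.hyps] del: sum_mult_indicator)
      qed
      show ?thesis
        by (rule cong[OF sm[OF simple_functionD(1)[OF s(1), of i]]]) (simp only: space_Sig, rule rep)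
    qed
    have f2: "(\<lambda>x. 2 *\<^sub>R f x) \<in> L2 Sig" using f by (rule L2_scaleR)
    have m: "s i \<in> borel_measurable Sig" for i using t[of i] by (simp add: tpc_def L2_measurable)
    have b: "AE x in Sig. norm (s i x) \<le> norm (2 *\<^sub>R f x)" for i
      using s(3)[of _ i] by (auto intro!: AE_I2 simp: abs_mult)
    have l: "AE x in Sig. (\<lambda>i. s i x) \<longlonglongrightarrow> f x" using s(2) by (auto intro!: AE_I2)
    show "f \<in> tpc"
      using tpc_closed[OF f t L2_dominated(2)[OF f2 m L2_measurable[OF f] l b]] .
  qed
qed

section \<open>Bessel's inequality, Parseval's identity and Fourier multipliers\<close>

abbreviation nn_sum :: "('a \<Rightarrow> ennreal) \<Rightarrow> ennreal" (binder "\<Sum>\<^sup>+" 10) where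
  "nn_sum f \<equiv> nn_integral (count_space UNIV) f"

lemma sum_le_nn_integral_count:
  fixes f :: "'a \<Rightarrow> ennreal"
  assumes "finite F"
  shows "sum f F \<le> (\<Sum>\<^sup>+ x. f x)"
proof -
  have "sum f F = (\<Sum>\<^sup>+ x. f x * indicator F x)"
    by (subst nn_integral_count_space'[OF assms]) auto
  also have "\<dots> \<le> (\<Sum>\<^sup>+ x. f x)"
    by (rule nn_integral_mono) (auto simp: indicator_def)
  finally show ?thesis .
qed

lemma nn_integral_count_le:
  fixes f :: "'a::countable \<Rightarrow> ennreal"
  assumes "\<And>F. finite F \<Longrightarrow> sum f F \<le> C"
  shows "(\<Sum>\<^sup>+ x. f x) \<le> C"
proof -
  define A where "A n = {x :: 'a. to_nat x < n}" for n :: nat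
  have fin: "finite (A n)" for n
    unfolding A_def by (rule finite_imageD[of to_nat]) (auto intro: finite_subset[of _ "{..<n}"] inj_on_subset[OF inj_to_nat])
  have "(\<Sum>\<^sup>+ x. f x) = (\<Sum>\<^sup>+ x. (SUP n. f x * indicator (A n) x))"
  proof (rule nn_integral_cong)
    fix x
    show "f x = (SUP n. f x * indicator (A n) x)"
    proof (rule antisym)
      have "f x = f x * indicator (A (Suc (to_nat x))) x" by (simp add: A_def)
      also have "\<dots> \<le> (SUP n. f x * indicator (A n) x)" by (rule SUP_upper) simp
      finally show "f x \<le> (SUP n. f x * indicator (A n) x)" .
    qed (auto intro!: SUP_least simp: indicator_def)
  qed
  also have "\<dots> = (SUP n. \<integral>\<^sup>+ x. f x * indicator (A n) x \<partial>count_space UNIV)"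
    by (rule nn_integral_monotone_convergence_SUP)
      (auto simp: incseq_def le_fun_def A_def indicator_def)
  also have "\<dots> \<le> C"
  proof (rule SUP_least)
    fix n
    have "(\<Sum>\<^sup>+ x. f x * indicator (A n) x) = (\<Sum>x\<in>A n. f x * indicator (A n) x)"
      by (rule nn_integral_count_space'[OF fin]) auto
    also have "\<dots> = sum f (A n)" by (rule sum.cong) auto
    finally show "(\<Sum>\<^sup>+ x. f x * indicator (A n) x) \<le> C" using assms[OF fin] by simp
  qed
  finally show ?thesis .
qed

lemma tr_Sig [measurable]: "tr \<xi> \<in> borel_measurable Sig"
  by (intro borel_measurable_Sig) simp

lemma fourier_integrable:
  assumes "f \<in> L2 Sig"
  shows "integrable Sig (\<lambda>x. complex_of_real (f x) * cnj (tr \<xi> x))"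
proof (rule Bochner_Integration.integrable_bound)
  show "integrable Sig f" by (rule L2_integrable[OF finite_measure_Sig assms])
  have [measurable]: "f \<in> borel_measurable Sig" using assms by (rule L2_measurable)
  show "(\<lambda>x. complex_of_real (f x) * cnj (tr \<xi> x)) \<in> borel_measurable Sig" unfolding cnj_tr by measurable
qed (auto simp: norm_mult)

lemma fourier_add:
  assumes "f \<in> L2 Sig" "g \<in> L2 Sig"
  shows "fourier (\<lambda>x. f x + g x) \<xi> = fourier f \<xi> + fourier g \<xi>"
  using assms by (simp add: fourier_alt distrib_right fourier_integrable)

lemma fourier_scale: "fourier (\<lambda>x. c * f x) \<xi> = of_real c * fourier f \<xi>"
  by (simp add: fourier_alt mult.assoc)

lemma fourier_diff:
  assumes "f \<in> L2 Sig" "g \<in> L2 Sig"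
  shows "fourier (\<lambda>x. f x - g x) \<xi> = fourier f \<xi> - fourier g \<xi>"
  using assms by (simp add: fourier_alt left_diff_distrib fourier_integrable)

lemma fourier_zero [simp]: "fourier (\<lambda>x. 0) \<xi> = 0"
  by (simp add: fourier_alt)

lemma fourier_cong_AE:
  assumes "f \<in> borel_measurable Sig" "g \<in> borel_measurable Sig" "AE x in Sig. f x = g x"
  shows "fourier f \<xi> = fourier g \<xi>"
  unfolding fourier_alt
proof (rule integral_cong_AE)
  show "(\<lambda>x. complex_of_real (f x) * cnj (tr \<xi> x)) \<in> borel_measurable Sig"
    "(\<lambda>x. complex_of_real (g x) * cnj (tr \<xi> x)) \<in> borel_measurable Sig" using assms(1,2) unfolding cnj_tr by measurable
  show "AE x in Sig. complex_of_real (f x) * cnj (tr \<xi> x) = complex_of_real (g x) * cnj (tr \<xi> x)"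
    using assms(3) by eventually_elim simp
qed

lemma L2_inner_char:
  assumes "f \<in> L2 Sig"
  shows "L2_inner Sig (\<lambda>x. complex_of_real (f x)) (\<lambda>x. c * tr \<xi> x) = fourier f \<xi> \<bullet> c"
proof -
  have "L2_inner Sig (\<lambda>x. complex_of_real (f x)) (\<lambda>x. c * tr \<xi> x) =
      (LINT x|Sig. Re (cnj c * (complex_of_real (f x) * cnj (tr \<xi> x))))"
    unfolding L2_inner_def by (rule Bochner_Integration.integral_cong) (simp_all add: inner_complex_def algebra_simps)
  also have "\<dots> = Re (LINT x|Sig. cnj c * (complex_of_real (f x) * cnj (tr \<xi> x)))"
    by (rule integral_bounded_linear[OF bounded_linear_Re]) (simp add: fourier_integrable[OF assms])
  also have "\<dots> = Re (cnj c * fourier f \<xi>)" by (simp add: fourier_alt)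
  finally show ?thesis by (simp add: inner_complex_def algebra_simps)
qed

lemma L2_inner_char_char:
  "L2_inner Sig (\<lambda>x. c * tr \<xi> x) (\<lambda>x. d * tr \<eta> x) = (if \<xi> = \<eta> then c \<bullet> d else 0)"
proof -
  have "L2_inner Sig (\<lambda>x. c * tr \<xi> x) (\<lambda>x. d * tr \<eta> x) = (LINT x|Sig. Re ((c * cnj d) * (tr \<xi> x * cnj (tr \<eta> x))))"
    unfolding L2_inner_def by (rule Bochner_Integration.integral_cong) (simp_all add: inner_complex_def algebra_simps)
  also have "\<dots> = Re (LINT x|Sig. (c * cnj d) * (tr \<xi> x * cnj (tr \<eta> x)))"
    by (rule integral_bounded_linear[OF bounded_linear_Re]) (simp add: cnj_tr tr_mult)
  also have "\<dots> = Re ((c * cnj d) * (if \<xi> = \<eta> then 1 else 0))" by (simp add: integral_tr_cnj_tr)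
  finally show ?thesis by (simp add: inner_complex_def)
qed

lemma L2_inner_sum_left:
  assumes "\<And>i. i \<in> A \<Longrightarrow> f i \<in> L2 M" "g \<in> L2 M"
  shows "L2_inner M (\<lambda>z. \<Sum>i\<in>A. f i z) g = (\<Sum>i\<in>A. L2_inner M (f i) g)"
  using assms(1)
proof (induction A rule: infinite_finite_induct)
  case (insert x F)
  then show ?case using L2_inner_add_left[of "f x" M "\<lambda>z. \<Sum>i\<in>F. f i z" g] assms(2)
    by (simp add: L2_sum)
qed (simp_all add: L2_inner_def)

lemma L2_inner_sum_right:
  assumes "\<And>i. i \<in> A \<Longrightarrow> f i \<in> L2 M" "g \<in> L2 M"
  shows "L2_inner M g (\<lambda>z. \<Sum>i\<in>A. f i z) = (\<Sum>i\<in>A. L2_inner M g (f i))"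
  using L2_inner_sum_left[OF assms] by (simp add: L2_inner_commute)

text \<open>One identity gives both Bessel's inequality, with \<open>c = fourier f\<close>, and the
  best approximation property, since the Fourier coefficients make the last sum vanish.\<close>

lemma L2_distance_trig:
  assumes f: "f \<in> L2 Sig" and F: "finite F"
  shows "(L2_norm Sig (\<lambda>x. complex_of_real (f x) - (\<Sum>\<xi>\<in>F. c \<xi> * tr \<xi> x)))^2 =
    (L2_norm Sig f)\<^sup>2 - (\<Sum>\<xi>\<in>F. (cmod (fourier f \<xi>))^2) + (\<Sum>\<xi>\<in>F. (cmod (fourier f \<xi> - c \<xi>))^2)"
proof -
  let ?f = "\<lambda>x. complex_of_real (f x)" and ?p = "\<lambda>x. \<Sum>\<xi>\<in>F. c \<xi> * tr \<xi> x"
  have fL: "?f \<in> L2 Sig" by (rule L2_of_real[OF f])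
  have pL: "?p \<in> L2 Sig" by (intro L2_sum L2_tr)
  have "L2_inner Sig ?f ?p = (\<Sum>\<xi>\<in>F. fourier f \<xi> \<bullet> c \<xi>)"
    by (subst L2_inner_sum_right) (auto simp: L2_tr fL L2_inner_char[OF f])
  moreover have "L2_inner Sig ?p ?p = (\<Sum>\<xi>\<in>F. c \<xi> \<bullet> c \<xi>)"
  proof -
    have "L2_inner Sig ?p ?p = (\<Sum>\<xi>\<in>F. \<Sum>\<eta>\<in>F. L2_inner Sig (\<lambda>x. c \<xi> * tr \<xi> x) (\<lambda>x. c \<eta> * tr \<eta> x))"
      using pL by (simp add: L2_inner_sum_left L2_inner_sum_right L2_tr)
    also have "\<dots> = (\<Sum>\<xi>\<in>F. \<Sum>\<eta>\<in>F. if \<xi> = \<eta> then c \<xi> \<bullet> c \<eta> else 0)" by (simp only: L2_inner_char_char)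
    finally show ?thesis using F by simp
  qed
  moreover have "(L2_norm Sig (\<lambda>x. ?f x - ?p x))^2 = L2_inner Sig ?f ?f - 2 * L2_inner Sig ?f ?p + L2_inner Sig ?p ?p"
    using fL pL by (simp add: L2_norm_sq L2_inner_diff_left L2_inner_diff_right L2_diff L2_inner_commute[of Sig ?p ?f])
  moreover have "L2_inner Sig ?f ?f = (L2_norm Sig f)^2"
    by (simp add: L2_norm_of_real flip: L2_norm_sq)
  moreover have "(cmod (fourier f \<xi> - c \<xi>))^2 = (cmod (fourier f \<xi>))^2 - 2 * (fourier f \<xi> \<bullet> c \<xi>) + c \<xi> \<bullet> c \<xi>" for \<xi>
    by (simp add: power2_norm_eq_inner inner_diff_left inner_diff_right inner_commute[of "c \<xi>" "fourier f \<xi>"])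
  ultimately show ?thesis by (simp add: sum.distrib sum_subtractf sum_distrib_left)
qed

lemma bessel:
  assumes "f \<in> L2 Sig" "finite F"
  shows "(\<Sum>\<xi>\<in>F. (cmod (fourier f \<xi>))^2) \<le> (L2_norm Sig f)^2"
  using L2_distance_trig[OF assms, of "fourier f"]
    zero_le_power2[of "L2_norm Sig (\<lambda>x. complex_of_real (f x) - (\<Sum>\<xi>\<in>F. fourier f \<xi> * tr \<xi> x))"]
  by (simp del: zero_le_power2)

lemma cmod_fourier_le: "f \<in> L2 Sig \<Longrightarrow> cmod (fourier f \<xi>) \<le> L2_norm Sig f"
  using bessel[of f "{\<xi>}"] by (auto intro: power2_le_imp_le simp: L2_norm_nonneg)

lemma fourier_partial_sums_dense:
  assumes f: "f \<in> L2 Sig" and e: "e > 0"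
  shows "\<exists>F. finite F \<and> L2_norm Sig (\<lambda>x. complex_of_real (f x) - (\<Sum>\<xi>\<in>F. fourier f \<xi> * tr \<xi> x)) < e"
proof -
  obtain p where p: "p \<in> tp" "L2_norm Sig (\<lambda>x. of_real (f x) - p x) < e"
    using f e unfolding L2_Sig_eq_tpc by (auto simp: tpc_def)
  obtain F c where F: "finite F" "p = (\<lambda>x. \<Sum>\<xi>\<in>F. c \<xi> * tr \<xi> x)"
    using tp_finite_sum[OF p(1)] by blast
  have "(L2_norm Sig (\<lambda>x. complex_of_real (f x) - (\<Sum>\<xi>\<in>F. fourier f \<xi> * tr \<xi> x)))^2 \<le> (L2_norm Sig (\<lambda>x. of_real (f x) - p x))^2"
    using L2_distance_trig[OF f F(1), of "fourier f"] L2_distance_trig[OF f F(1), of c]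
    by (simp add: F(2) sum_nonneg)
  then have "L2_norm Sig (\<lambda>x. complex_of_real (f x) - (\<Sum>\<xi>\<in>F. fourier f \<xi> * tr \<xi> x)) \<le> L2_norm Sig (\<lambda>x. of_real (f x) - p x)"
    by (rule power2_le_imp_le) (rule L2_norm_nonneg)
  then show ?thesis using F(1) p(2) by (intro exI[of _ F]) auto
qed

theorem parseval:
  assumes f: "f \<in> L2 Sig"
  shows "(\<Sum>\<^sup>+ \<xi>. ennreal ((cmod (fourier f \<xi>))^2)) = ennreal ((L2_norm Sig f)^2)"
proof (rule antisym)
  show "(\<Sum>\<^sup>+ \<xi>. ennreal ((cmod (fourier f \<xi>))^2)) \<le> ennreal ((L2_norm Sig f)^2)"
  proof (rule nn_integral_count_le)
    fix F :: "(int ^ 'a) set" assume F: "finite F"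
    have "(\<Sum>\<xi>\<in>F. ennreal ((cmod (fourier f \<xi>))^2)) = ennreal (\<Sum>\<xi>\<in>F. (cmod (fourier f \<xi>))^2)"
      by (rule sum_ennreal) simp
    then show "(\<Sum>\<xi>\<in>F. ennreal ((cmod (fourier f \<xi>))^2)) \<le> ennreal ((L2_norm Sig f)^2)"
      using bessel[OF f F] by (simp add: ennreal_leI)
  qed
  show "ennreal ((L2_norm Sig f)^2) \<le> (\<Sum>\<^sup>+ \<xi>. ennreal ((cmod (fourier f \<xi>))^2))"
  proof (rule ennreal_le_epsilon)
    fix e :: real assume e: "0 < e"
    obtain F where F: "finite F" "L2_norm Sig (\<lambda>x. complex_of_real (f x) - (\<Sum>\<xi>\<in>F. fourier f \<xi> * tr \<xi> x)) < sqrt e"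
      using fourier_partial_sums_dense[OF f, of "sqrt e"] e by auto
    have "(L2_norm Sig (\<lambda>x. complex_of_real (f x) - (\<Sum>\<xi>\<in>F. fourier f \<xi> * tr \<xi> x)))^2 \<le> (sqrt e)^2"
      using F(2) by (intro power_mono) (auto simp: L2_norm_nonneg)
    then have "(L2_norm Sig f)^2 \<le> (\<Sum>\<xi>\<in>F. (cmod (fourier f \<xi>))^2) + e"
      using L2_distance_trig[OF f F(1), of "fourier f"] e by simp
    then have "ennreal ((L2_norm Sig f)^2) \<le> ennreal ((\<Sum>\<xi>\<in>F. (cmod (fourier f \<xi>))^2) + e)" by (rule ennreal_leI)
    also have "\<dots> = (\<Sum>\<xi>\<in>F. ennreal ((cmod (fourier f \<xi>))^2)) + ennreal e"
      using e by (simp add: ennreal_plus sum_nonneg sum_ennreal)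
    also have "\<dots> \<le> (\<Sum>\<^sup>+ \<xi>. ennreal ((cmod (fourier f \<xi>))^2)) + ennreal e"
      by (intro add_right_mono sum_le_nn_integral_count F)
    finally show "ennreal ((L2_norm Sig f)^2) \<le> (\<Sum>\<^sup>+ \<xi>. ennreal ((cmod (fourier f \<xi>))^2)) + ennreal e" .
  qed
qed

lemma fourier_eq_0_imp_AE_0:
  assumes "f \<in> L2 Sig" "\<And>\<xi>. fourier f \<xi> = 0"
  shows "AE x in Sig. f x = 0"
  using parseval[OF assms(1)] by (simp add: assms(2) ennreal_eq_0_iff L2_norm_eq_0_iff[OF assms(1)])

lemma fourier_eq_imp_AE_eq:
  assumes "f \<in> L2 Sig" "g \<in> L2 Sig" "\<And>\<xi>. fourier f \<xi> = fourier g \<xi>"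
  shows "AE x in Sig. f x = g x"
  using fourier_eq_0_imp_AE_0[OF L2_diff[OF assms(1,2)]] assms by (simp add: fourier_diff)

text \<open>Replacing \<open>h\<close> by a partial Fourier sum turns the pairing into a finite part
  of the right-hand side, and Cauchy-Schwarz bounds the error by the norm of \<open>m\<close>. The
  purpose is to bound the surface energy by a sum over frequencies.\<close>

lemma L2_inner_le_multiplier:
  assumes m: "m \<in> L2 Sig" and h: "h \<in> L2 Sig" and mh: "\<And>\<xi>. fourier m \<xi> = of_real (\<mu> \<xi>) * fourier h \<xi>"
    and \<mu>: "\<And>\<xi>. 0 \<le> \<mu> \<xi>"
  shows "ennreal (L2_inner Sig m h) \<le> (\<Sum>\<^sup>+ \<xi>. ennreal (\<mu> \<xi> * (cmod (fourier h \<xi>))^2))"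
proof (rule ennreal_le_epsilon)
  fix e :: real assume e: "0 < e"
  \<comment> \<open>The error is at most the norm of \<open>m\<close> times \<open>d\<close>; the
    added 1 keeps the quotient meaningful when \<open>m\<close> vanishes.\<close>
  define d where "d = e / (L2_norm Sig m + 1)"
  have d: "d > 0" using e L2_norm_nonneg[of Sig m] by (simp add: d_def)
  obtain F where F: "finite F" "L2_norm Sig (\<lambda>x. complex_of_real (h x) - (\<Sum>\<xi>\<in>F. fourier h \<xi> * tr \<xi> x)) < d"
    using fourier_partial_sums_dense[OF h d] by auto
  let ?p = "\<lambda>x. \<Sum>\<xi>\<in>F. fourier h \<xi> * tr \<xi> x"
  have pL: "?p \<in> L2 Sig" by (intro L2_sum L2_tr)
  have "L2_inner Sig m h = L2_inner Sig (\<lambda>x. complex_of_real (m x)) (\<lambda>x. complex_of_real (h x))"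
    by (simp add: L2_inner_def inner_complex_def)
  also have "\<dots> = L2_inner Sig (\<lambda>x. complex_of_real (m x)) ?p + L2_inner Sig (\<lambda>x. complex_of_real (m x)) (\<lambda>x. complex_of_real (h x) - ?p x)"
    using L2_of_real[OF m] L2_of_real[OF h] pL by (simp add: L2_inner_diff_right)
  also have "L2_inner Sig (\<lambda>x. complex_of_real (m x)) ?p = (\<Sum>\<xi>\<in>F. fourier m \<xi> \<bullet> fourier h \<xi>)"
    by (subst L2_inner_sum_right) (auto simp: L2_tr L2_of_real m L2_inner_char[OF m])
  also have "\<dots> = (\<Sum>\<xi>\<in>F. \<mu> \<xi> * (cmod (fourier h \<xi>))^2)"
    by (simp add: mh power2_norm_eq_inner flip: scaleR_conv_of_real)
  also have "L2_inner Sig (\<lambda>x. complex_of_real (m x)) (\<lambda>x. complex_of_real (h x) - ?p x) \<le>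
     L2_norm Sig (\<lambda>x. complex_of_real (m x)) * L2_norm Sig (\<lambda>x. complex_of_real (h x) - ?p x)"
    using L2_Cauchy_Schwarz[OF L2_of_real[OF m] L2_diff[OF L2_of_real[OF h] pL]] by simp
  also have "\<dots> \<le> L2_norm Sig m * d"
    using F(2) by (auto simp: L2_norm_of_real L2_norm_nonneg intro!: mult_left_mono)
  also have "\<dots> \<le> e" using L2_norm_nonneg[of Sig m] e by (simp add: d_def field_simps)
  finally have "ennreal (L2_inner Sig m h) \<le> ennreal ((\<Sum>\<xi>\<in>F. \<mu> \<xi> * (cmod (fourier h \<xi>))^2) + e)"
    by (intro ennreal_leI) simp
  also have "\<dots> = (\<Sum>\<xi>\<in>F. ennreal (\<mu> \<xi> * (cmod (fourier h \<xi>))^2)) + ennreal e"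
    using e \<mu> by (simp add: ennreal_plus sum_nonneg sum_ennreal)
  also have "\<dots> \<le> (\<Sum>\<^sup>+ \<xi>. ennreal (\<mu> \<xi> * (cmod (fourier h \<xi>))^2)) + ennreal e"
    by (intro add_right_mono sum_le_nn_integral_count F)
  finally show "ennreal (L2_inner Sig m h) \<le> (\<Sum>\<^sup>+ \<xi>. ennreal (\<mu> \<xi> * (cmod (fourier h \<xi>))^2)) + ennreal e" .
qed


section \<open>Horizontal Fourier coefficients on the slab\<close>

definition fc :: "int ^ 'n::finite \<Rightarrow> ('n pt \<Rightarrow> real) \<Rightarrow> real \<Rightarrow> complex" where
  "fc \<xi> f y = fourier (\<lambda>x. f (x, y)) \<xi>"

abbreviation fcn :: "real \<Rightarrow> int ^ 'n::finite \<Rightarrow> ('n pt \<Rightarrow> real) \<Rightarrow> real" where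
  "fcn l \<xi> f \<equiv> L2_norm (Iy l) (fc \<xi> f)"

lemma measurable_slice:
  assumes "f \<in> borel_measurable (Om l)" "y \<in> {0<..<l}"
  shows "(\<lambda>x. f (x, y)) \<in> borel_measurable Sig"
  using assms unfolding Om_eq_pair by (auto intro: measurable_Pair2)

lemma AE_slice_L2:
  fixes f :: "'n::finite pt \<Rightarrow> 'b::euclidean_space"
  assumes "f \<in> L2 (Om l)"
  shows "AE y in Iy l. (\<lambda>x. f (x, y)) \<in> L2 Sig"
proof -
  have i: "integrable (Sig \<Otimes>\<^sub>M Iy l) (\<lambda>z. (norm (f z))^2)"
    using L2_integrable_norm_sq[OF assms] by (simp add: Om_eq_pair)
  have "AE y in Iy l. integrable Sig (\<lambda>x. (norm (f (x, y)))^2)"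
    using Om.AE_integrable_snd[where f = "\<lambda>x y. (norm (f (x, y)))^2"] i by (simp add: case_prod_unfold)
  then show ?thesis
    by (rule AE_mp) (rule AE_I2, auto intro!: L2I measurable_slice[OF L2_measurable[OF assms]])
qed

text \<open>Slicing by \<open>AE_pair\<close> fixes the horizontal variable first. Exchanging the
  two quantifiers asks for a measurable set, so \<open>P\<close> is replaced by the complement of a
  measurable null set containing its exceptions.\<close>

lemma AE_slice:
  assumes "AE z in Om l. P z"
  shows "AE y in Iy l. AE x in Sig. P (x, y)"
proof -
  have "AE z in Sig \<Otimes>\<^sub>M Iy l. P z" using assms unfolding Om_eq_pair .
  then obtain N where N: "N \<in> null_sets (Sig \<Otimes>\<^sub>M Iy l)" "{z \<in> space (Sig \<Otimes>\<^sub>M Iy l). \<not> P z} \<subseteq> N"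
    by (auto simp: eventually_ae_filter)
  have "AE z in Sig \<Otimes>\<^sub>M Iy l. z \<notin> N" using N(1) by (rule AE_not_in)
  from Om.AE_pair[OF this] have "AE x in Sig. AE y in Iy l. (x, y) \<notin> N" by simp
  moreover have "{z \<in> space (Sig \<Otimes>\<^sub>M Iy l). (fst z, snd z) \<notin> N} \<in> sets (Sig \<Otimes>\<^sub>M Iy l)"
  proof -
    have "{z \<in> space (Sig \<Otimes>\<^sub>M Iy l). (fst z, snd z) \<notin> N} = space (Sig \<Otimes>\<^sub>M Iy l) - N" by auto
    then show ?thesis using N(1) by auto
  qed
  ultimately have "AE y in Iy l. AE x in Sig. (x, y) \<notin> N"
    using Om.AE_commute[where P = "\<lambda>x y. (x, y) \<notin> N" and l = l] by simp
  then show ?thesis using AE_space[of "Iy l"]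
  proof eventually_elim
    case (elim y)
    note y = elim(2)
    from elim(1) show ?case
      using AE_space
    proof eventually_elim
      case (elim x)
      then have "(x, y) \<in> space (Sig \<Otimes>\<^sub>M Iy l)" using y by (simp add: space_pair_measure)
      then show ?case using elim(1) N(2) by blast
    qed
  qed
qed

lemma fc_measurable:
  assumes "f \<in> borel_measurable (Om l)"
  shows "fc \<xi> f \<in> borel_measurable (Iy l)"
proof -
  have t: "tr \<xi> \<in> borel_measurable Sig" by (intro borel_measurable_Sig) simp
  have "(\<lambda>(y, x). complex_of_real (f (x, y)) * cnj (tr \<xi> x)) \<in> borel_measurable (Iy l \<Otimes>\<^sub>M Sig)"
  proof -
    have "f \<in> borel_measurable (Sig \<Otimes>\<^sub>M Iy l)" using assms by (simp add: Om_eq_pair)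
    from measurable_compose[OF measurable_pair_swap' this]
    have [measurable]: "(\<lambda>z. f (snd z, fst z)) \<in> borel_measurable (Iy l \<Otimes>\<^sub>M Sig)"
      by (simp add: case_prod_unfold)
    have [measurable]: "(\<lambda>z. tr \<xi> (snd z)) \<in> borel_measurable (Iy l \<Otimes>\<^sub>M Sig)"
      using measurable_compose[OF measurable_snd t] .
    show ?thesis unfolding cnj_tr case_prod_unfold
      using measurable_compose[OF measurable_snd tr_Sig[of "- \<xi>"]] by measurable
  qed
  from sigma_finite_measure.borel_measurable_lebesgue_integral[OF sigma_finite_Sig this]
  show ?thesis by (simp add: fc_def[abs_def] fourier_alt)
qed

lemma integral_Om:
  fixes f :: "'n::finite pt \<Rightarrow> 'b::{banach, second_countable_topology}"
  assumes "integrable (Om l) f"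
  shows "(LINT z|Om l. f z) = (LINT y|Iy l. LINT x|Sig. f (x, y))"
  using Om.integral_snd[where f = "\<lambda>x y. f (x, y)"] assms by (simp add: Om_eq_pair)

lemma integrable_Om_slice:
  fixes f :: "'n::finite pt \<Rightarrow> 'b::{banach, second_countable_topology}"
  assumes "integrable (Om l) f"
  shows "integrable (Iy l) (\<lambda>y. LINT x|Sig. f (x, y))"
  using Om.integrable_snd[where f = "\<lambda>x y. f (x, y)"] assms by (simp add: Om_eq_pair)

lemma L2_norm_Om_slice:
  assumes "f \<in> L2 (Om l)"
  shows "(L2_norm (Om l) f)^2 = (LINT y|Iy l. (L2_norm Sig (\<lambda>x. f (x, y)))^2)"
    and "integrable (Iy l) (\<lambda>y. (L2_norm Sig (\<lambda>x. f (x, y)))^2)"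
  using integral_Om[OF L2_integrable_norm_sq[OF assms]] integrable_Om_slice[OF L2_integrable_norm_sq[OF assms]]
  by (simp_all add: L2_norm_sq_integral)

lemma fc_L2:
  assumes "f \<in> L2 (Om l)"
  shows "fc \<xi> f \<in> L2 (Iy l)"
proof (rule L2I[OF fc_measurable[OF L2_measurable[OF assms]]])
  show "integrable (Iy l) (\<lambda>y. (norm (fc \<xi> f y))^2)"
  proof (rule Bochner_Integration.integrable_bound[OF L2_norm_Om_slice(2)[OF assms]])
    show "AE y in Iy l. norm ((norm (fc \<xi> f y))^2) \<le> norm ((L2_norm Sig (\<lambda>x. f (x, y)))^2)"
      using AE_slice_L2[OF assms]
      by eventually_elim (auto simp: fc_def intro!: power_mono cmod_fourier_le)
  qed (use fc_measurable[OF L2_measurable[OF assms]] in measurable)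
qed

lemma L2_norm_fc_le:
  assumes "f \<in> L2 (Om l)"
  shows "fcn l \<xi> f \<le> L2_norm (Om l) f"
proof (rule power2_le_imp_le)
  show "(fcn l \<xi> f)^2 \<le> (L2_norm (Om l) f)^2"
    unfolding L2_norm_Om_slice(1)[OF assms] L2_norm_sq_integral[of "Iy l"]
  proof (rule integral_mono_AE[OF L2_integrable_norm_sq[OF fc_L2[OF assms]] L2_norm_Om_slice(2)[OF assms]])
    show "AE y in Iy l. (norm (fc \<xi> f y))^2 \<le> (L2_norm Sig (\<lambda>x. f (x, y)))^2"
      using AE_slice_L2[OF assms]
      by eventually_elim (auto simp: fc_def intro!: power_mono cmod_fourier_le)
  qed
qed (rule L2_norm_nonneg)

lemma fc_add:
  assumes "f \<in> L2 (Om l)" "g \<in> L2 (Om l)"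
  shows "AE y in Iy l. fc \<xi> (\<lambda>z. f z + g z) y = fc \<xi> f y + fc \<xi> g y"
  using AE_slice_L2[OF assms(1)] AE_slice_L2[OF assms(2)]
  by eventually_elim (simp add: fc_def fourier_add)

lemma fc_diff:
  assumes "f \<in> L2 (Om l)" "g \<in> L2 (Om l)"
  shows "AE y in Iy l. fc \<xi> (\<lambda>z. f z - g z) y = fc \<xi> f y - fc \<xi> g y"
  using AE_slice_L2[OF assms(1)] AE_slice_L2[OF assms(2)]
  by eventually_elim (simp add: fc_def fourier_diff)

lemma fc_scale: "fc \<xi> (\<lambda>z. c * f z) y = of_real c * fc \<xi> f y"
  by (simp add: fc_def fourier_scale)

lemma fc_cong_AE:
  assumes "f \<in> borel_measurable (Om l)" "g \<in> borel_measurable (Om l)" "AE z in Om l. f z = g z"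
  shows "AE y in Iy l. fc \<xi> f y = fc \<xi> g y"
  using AE_slice[OF assms(3)] AE_space
proof eventually_elim
  case (elim y)
  then show ?case
    unfolding fc_def by (intro fourier_cong_AE) (auto intro!: measurable_slice[OF assms(1)] measurable_slice[OF assms(2)])
qed

lemma fc_tendsto:
  assumes "\<And>k. f k \<in> L2 (Om l)" "g \<in> L2 (Om l)" "((\<lambda>k. L2_norm (Om l) (\<lambda>z. f k z - g z)) \<longlongrightarrow> 0) F"
  shows "((\<lambda>k. L2_norm (Iy l) (\<lambda>y. fc \<xi> (f k) y - fc \<xi> g y)) \<longlongrightarrow> 0) F"
proof (rule tendsto_sandwich[OF _ _ tendsto_const assms(3)])
  show "\<forall>\<^sub>F k in F. L2_norm (Iy l) (\<lambda>y. fc \<xi> (f k) y - fc \<xi> g y) \<le> L2_norm (Om l) (\<lambda>z. f k z - g z)"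
  proof (rule always_eventually, rule allI)
    fix k
    have "L2_norm (Iy l) (\<lambda>y. fc \<xi> (f k) y - fc \<xi> g y) = fcn l \<xi> (\<lambda>z. f k z - g z)"
    proof (rule L2_norm_cong_AE)
      show "AE y in Iy l. fc \<xi> (f k) y - fc \<xi> g y = fc \<xi> (\<lambda>z. f k z - g z) y"
        using fc_diff[OF assms(1)[of k] assms(2), of \<xi>] by eventually_elim simp
    qed (auto intro!: L2_measurable fc_L2 L2_diff assms)
    then show "L2_norm (Iy l) (\<lambda>y. fc \<xi> (f k) y - fc \<xi> g y) \<le> L2_norm (Om l) (\<lambda>z. f k z - g z)"
      using L2_norm_fc_le[OF L2_diff[OF assms(1)[of k] assms(2)]] by simp
  qed
qed (simp add: L2_norm_nonneg)

text \<open>The real function with vertical profile \<open>p\<close> at the single frequency \<xi>.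
  As a map on profiles it is the adjoint of \<open>fc \<xi>\<close>, see
  \<open>L2_inner_mode\<close>.\<close>

definition mode :: "int ^ 'n::finite \<Rightarrow> (real \<Rightarrow> complex) \<Rightarrow> 'n pt \<Rightarrow> real" where
  "mode \<xi> p z = Re (p (snd z) * tr \<xi> (fst z))"

lemma mode_measurable:
  assumes "p \<in> borel_measurable (Iy l)"
  shows "mode \<xi> p \<in> borel_measurable (Om l)"
proof -
  have t: "tr \<xi> \<in> borel_measurable Sig" by (intro borel_measurable_Sig) simp
  show ?thesis unfolding mode_def[abs_def] Om_eq_pair
    using measurable_compose[OF measurable_snd assms] measurable_compose[OF measurable_fst t] by measurable
qed

lemma L2_snd:
  fixes p :: "real \<Rightarrow> 'b::euclidean_space"
  assumes "p \<in> L2 (Iy l)"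
  shows "(\<lambda>z :: 'n::finite pt. p (snd z)) \<in> L2 (Om l)" "L2_norm (Om l) (\<lambda>z :: 'n pt. p (snd z)) = L2_norm (Iy l) p"
proof -
  have m: "(\<lambda>z :: 'n pt. p (snd z)) \<in> borel_measurable (Om l)"
    unfolding Om_eq_pair by (rule measurable_compose[OF measurable_snd L2_measurable[OF assms]])
  have "integrable (Sig \<Otimes>\<^sub>M Iy l) (\<lambda>z :: 'n pt. (norm (p (snd z)))^2)"
  proof (rule Om.Fubini_integrable)
    show "(\<lambda>z :: 'n pt. (norm (p (snd z)))^2) \<in> borel_measurable (Sig \<Otimes>\<^sub>M Iy l)"
      using m by (simp add: Om_eq_pair)
  qed (use L2_integrable_norm_sq[OF assms] finite_measure.integrable_const[OF finite_measure_Sig] in auto)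
  then have i: "integrable (Om l) (\<lambda>z :: 'n pt. (norm (p (snd z)))^2)" by (simp add: Om_eq_pair)
  show L: "(\<lambda>z :: 'n pt. p (snd z)) \<in> L2 (Om l)" by (rule L2I[OF m i])
  have "(L2_norm (Om l) (\<lambda>z :: 'n pt. p (snd z)))^2 = (L2_norm (Iy l) p)^2"
    using integral_Om[OF i] by (simp add: L2_norm_sq_integral)
  then show "L2_norm (Om l) (\<lambda>z :: 'n pt. p (snd z)) = L2_norm (Iy l) p"
    by (simp add: L2_norm_nonneg)
qed

lemma
  fixes \<xi> :: "int ^ 'n::finite"
  assumes "p \<in> L2 (Iy l)"
  shows mode_L2: "mode \<xi> p \<in> L2 (Om l)" and L2_norm_mode_le: "L2_norm (Om l) (mode \<xi> p) \<le> L2_norm (Iy l) p"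
proof -
  have b: "AE z in Om l. norm (mode \<xi> p z) \<le> norm (p (snd z))"
  proof (rule AE_I2)
    show "norm (mode \<xi> p z) \<le> norm (p (snd z))" for z
      using abs_Re_le_cmod[of "p (snd z) * tr \<xi> (fst z)"] by (simp only: mode_def norm_mult norm_tr real_norm_def mult_1_right)
  qed
  note s = L2_snd[OF assms, where 'n='n]
  have m: "mode \<xi> p \<in> borel_measurable (Om l)" by (rule mode_measurable[OF L2_measurable[OF assms]])
  show "mode \<xi> p \<in> L2 (Om l)" by (rule L2_bound[OF s(1) m b])
  show "L2_norm (Om l) (mode \<xi> p) \<le> L2_norm (Iy l) p"
    using L2_norm_mono_AE[OF s(1) b m] s(2) by simp
qed

text \<open>Pairing with a mode extracts one horizontal Fourier coefficient on almost every slice.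
  Through this duality the whole problem is reduced to the vertical variable.\<close>

lemma L2_inner_mode:
  assumes f: "f \<in> L2 (Om l)" and p: "p \<in> L2 (Iy l)"
  shows "L2_inner (Om l) f (mode \<xi> p) = L2_inner (Iy l) (fc \<xi> f) p"
proof -
  have "L2_inner (Om l) f (mode \<xi> p) = (LINT y|Iy l. LINT x|Sig. f (x, y) \<bullet> mode \<xi> p (x, y))"
    unfolding L2_inner_def by (rule integral_Om[OF L2_inner_integrable[OF f mode_L2[OF p]]])
  also have "\<dots> = (LINT y|Iy l. fc \<xi> f y \<bullet> p y)"
  proof (rule integral_cong_AE)
    show "(\<lambda>y. LINT x|Sig. f (x, y) \<bullet> mode \<xi> p (x, y)) \<in> borel_measurable (Iy l)"
      using integrable_Om_slice[OF L2_inner_integrable[OF f mode_L2[OF p]]] by auto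
    show "(\<lambda>y. fc \<xi> f y \<bullet> p y) \<in> borel_measurable (Iy l)"
      using fc_L2[OF f, THEN L2_measurable] p[THEN L2_measurable] by measurable
    show "AE y in Iy l. (LINT x|Sig. f (x, y) \<bullet> mode \<xi> p (x, y)) = fc \<xi> f y \<bullet> p y"
      using AE_slice_L2[OF f]
    proof eventually_elim
      case (elim y)
      have "(LINT x|Sig. f (x, y) \<bullet> mode \<xi> p (x, y)) =
          L2_inner Sig (\<lambda>x. complex_of_real (f (x, y))) (\<lambda>x. p y * tr \<xi> x)"
        unfolding L2_inner_def
        by (rule Bochner_Integration.integral_cong) (simp_all add: mode_def inner_complex_def algebra_simps)
      then show ?case using L2_inner_char[OF elim] by (simp add: fc_def)
    qed
  qed
  finally show ?thesis by (simp add: L2_inner_def)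
qed

lemma fc_eq_0_imp_AE_0:
  assumes "f \<in> L2 (Om l)" "\<And>\<xi>. AE y in Iy l. fc \<xi> f y = 0"
  shows "AE z in Om l. f z = 0"
proof -
  have "AE y in Iy l. \<forall>\<xi>. fc \<xi> f y = 0" using assms(2) by (simp add: AE_all_countable)
  then have "AE y in Iy l. (L2_norm Sig (\<lambda>x. f (x, y)))^2 = 0"
    using AE_slice_L2[OF assms(1)]
  proof eventually_elim
    case (elim y)
    then show ?case using fourier_eq_0_imp_AE_0[OF elim(2)] by (simp add: fc_def L2_norm_eq_0_iff[OF elim(2)])
  qed
  then have "(LINT y|Iy l. (L2_norm Sig (\<lambda>x. f (x, y)))^2) = 0"
    by (intro integral_eq_zero_AE)
  then have "L2_norm (Om l) f = 0" using L2_norm_Om_slice(1)[OF assms(1)] by simp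
  then show ?thesis using L2_norm_eq_0_iff[OF assms(1)] by simp
qed

text \<open>Parseval on almost every horizontal slice, then Tonelli to exchange the sum over
  frequencies with the integral over \<open>y\<close>.\<close>

theorem parseval_Om:
  assumes f: "f \<in> L2 (Om l)"
  shows "(\<Sum>\<^sup>+ \<xi>. ennreal ((fcn l \<xi> f)^2)) = ennreal ((L2_norm (Om l) f)^2)"
proof -
  have n: "ennreal ((fcn l \<xi> f)^2) = (\<integral>\<^sup>+ y. ennreal ((cmod (fc \<xi> f y))^2) \<partial>Iy l)" for \<xi>
    unfolding L2_norm_sq_integral
    by (rule nn_integral_eq_integral[symmetric]) (auto intro: L2_integrable_norm_sq[OF fc_L2[OF f]])
  have "ennreal ((L2_norm (Om l) f)^2) = (\<integral>\<^sup>+ y. ennreal ((L2_norm Sig (\<lambda>x. f (x, y)))^2) \<partial>Iy l)"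
    unfolding L2_norm_Om_slice(1)[OF f]
    by (rule nn_integral_eq_integral[symmetric]) (auto intro: L2_norm_Om_slice(2)[OF f])
  also have "\<dots> = (\<integral>\<^sup>+ y. \<integral>\<^sup>+ \<xi>. ennreal ((cmod (fc \<xi> f y))^2) \<partial>count_space UNIV \<partial>Iy l)"
    by (rule nn_integral_cong_AE)
      (use AE_slice_L2[OF f] in \<open>eventually_elim, simp add: fc_def parseval\<close>)
  also have "\<dots> = (\<integral>\<^sup>+ \<xi>. \<integral>\<^sup>+ y. ennreal ((cmod (fc \<xi> f y))^2) \<partial>Iy l \<partial>count_space UNIV)"
    using fc_measurable[OF L2_measurable[OF f]] by (intro nn_integral_count_space_nn_integral) auto
  finally show ?thesis by (simp add: n)
qed

section \<open>Smooth functions\<close>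

lemma dir_deriv_eq:
  assumes "(f has_derivative D) (at z)"
  shows "dir_deriv b f z = D b"
  using frechet_derivative_at[OF assms] by (simp add: dir_deriv_def)

lemma has_derivative_dir_deriv:
  assumes "f differentiable_on UNIV"
  shows "(f has_derivative (\<lambda>v. dir_deriv v f z)) (at z)"
proof -
  have "f differentiable (at z)" using assms by (simp add: differentiable_on_def)
  then show ?thesis unfolding dir_deriv_def[abs_def] by (simp add: frechet_derivative_works)
qed

lemma Ck_continuous: "Ck k f \<Longrightarrow> continuous_on UNIV f"
  by (cases k) (auto intro: differentiable_imp_continuous_on)

lemma Ck_Suc_D: "Ck (Suc k) f \<Longrightarrow> Ck k f"
proof (induction k arbitrary: f)
  case 0
  then show ?case using Ck_continuous[OF 0] by simp
next
  case (Suc k)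
  then show ?case by (metis Ck.simps(2))
qed

lemma Ck_SucI:
  fixes f :: "'a::euclidean_space \<Rightarrow> real"
  assumes "\<And>z. (f has_derivative D z) (at z)" "\<And>b. b \<in> Basis \<Longrightarrow> Ck k (\<lambda>z. D z b)"
  shows "Ck (Suc k) f"
proof -
  have "f differentiable_on UNIV"
    using assms(1) by (auto simp: differentiable_on_def differentiable_def)
  moreover have "dir_deriv b f = (\<lambda>z. D z b)" for b
    using dir_deriv_eq[OF assms(1)] by auto
  ultimately show ?thesis using assms(2) by simp
qed

lemma Ck_const: "Ck k (\<lambda>z. c)"
proof (induction k arbitrary: c)
  case (Suc k)
  show ?case by (rule Ck_SucI[where D = "\<lambda>z v. 0"]) (auto intro: Suc)
qed simp

lemma Ck_linear:
  assumes "bounded_linear f"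
  shows "Ck k f"
proof (cases k)
  case 0
  then show ?thesis using bounded_linear.continuous_on[OF assms, of UNIV "\<lambda>z. z"] by simp
next
  case (Suc j)
  have "Ck (Suc j) f"
    by (rule Ck_SucI[where D = "\<lambda>z. f"]) (auto intro: Ck_const bounded_linear_imp_has_derivative assms)
  then show ?thesis by (simp add: Suc)
qed

lemma Ck_add: "Ck k f \<Longrightarrow> Ck k g \<Longrightarrow> Ck k (\<lambda>z. f z + g z)"
proof (induction k arbitrary: f g)
  case 0
  then show ?case by (auto intro: continuous_on_add)
next
  case (Suc k)
  show ?case
    by (rule Ck_SucI[where D = "\<lambda>z v. dir_deriv v f z + dir_deriv v g z"])
      (use Suc in \<open>auto intro!: has_derivative_add has_derivative_dir_deriv Suc.IH\<close>)
qed

lemma Ck_mult: "Ck k f \<Longrightarrow> Ck k g \<Longrightarrow> Ck k (\<lambda>z. f z * g z)"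
proof (induction k arbitrary: f g)
  case 0
  then show ?case by (auto intro: continuous_on_mult)
next
  case (Suc k)
  show ?case
  proof (rule Ck_SucI[where D = "\<lambda>z v. f z * dir_deriv v g z + dir_deriv v f z * g z"])
    show "((\<lambda>z. f z * g z) has_derivative (\<lambda>v. f z * dir_deriv v g z + dir_deriv v f z * g z)) (at z)" for z
      using Suc.prems by (auto intro!: has_derivative_mult has_derivative_dir_deriv)
    show "Ck k (\<lambda>z. f z * dir_deriv b g z + dir_deriv b f z * g z)" if "b \<in> Basis" for b
      using Suc.prems that Suc.prems[THEN Ck_Suc_D] by (intro Ck_add Suc.IH) auto
  qed
qed

lemma Ck_cmult: "Ck k f \<Longrightarrow> Ck k (\<lambda>z. c * f z)"
  using Ck_mult[OF Ck_const] .

lemma Ck_minus: "Ck k f \<Longrightarrow> Ck k (\<lambda>z. - f z)"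
  using Ck_cmult[of k f "-1"] by simp

lemma Ck_diff: "Ck k f \<Longrightarrow> Ck k g \<Longrightarrow> Ck k (\<lambda>z. f z - g z)"
  using Ck_add[OF _ Ck_minus] by fastforce

lemma Ck_compose: "Ck k g \<Longrightarrow> Ck k f \<Longrightarrow> Ck k (\<lambda>z. g (f z))" for g :: "real \<Rightarrow> real"
proof (induction k arbitrary: g f)
  case 0
  then show ?case by (auto intro: continuous_on_compose2)
next
  case (Suc k)
  show ?case
  proof (rule Ck_SucI[where D = "\<lambda>z v. dir_deriv 1 g (f z) * dir_deriv v f z"])
    fix z
    have g: "(g has_derivative (\<lambda>v. dir_deriv v g (f z))) (at (f z))"
      using Suc.prems(1) by (auto intro: has_derivative_dir_deriv)
    interpret l: bounded_linear "\<lambda>v. dir_deriv v g (f z)" by (rule has_derivative_bounded_linear[OF g])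
    have "(\<lambda>v. dir_deriv v g (f z)) = (\<lambda>v. dir_deriv 1 g (f z) * v)"
    proof
      show "dir_deriv v g (f z) = dir_deriv 1 g (f z) * v" for v
        using l.scaleR[of v 1] by (simp only: real_scaleR_def mult_1_right mult.commute[of v])
    qed
    note g' = has_derivative_eq_rhs[OF g this]
    have f': "(f has_derivative (\<lambda>v. dir_deriv v f z)) (at z)"
      using Suc.prems(2) by (auto intro: has_derivative_dir_deriv)
    show "((\<lambda>z. g (f z)) has_derivative (\<lambda>v. dir_deriv 1 g (f z) * dir_deriv v f z)) (at z)"
      by (rule has_derivative_compose[OF f' g'])
  next
    fix b :: 'a assume "b \<in> Basis"
    then show "Ck k (\<lambda>z. dir_deriv 1 g (f z) * dir_deriv b f z)"
      using Suc.prems Suc.prems(2)[THEN Ck_Suc_D] by (intro Ck_mult Suc.IH[of "dir_deriv 1 g"]) auto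
  qed
qed

lemma Ck_real_SucI:
  fixes f :: "real \<Rightarrow> real"
  assumes "\<And>x. (f has_real_derivative f' x) (at x)" "Ck k f'"
  shows "Ck (Suc k) f"
  by (rule Ck_SucI[where D = "\<lambda>z v. f' z * v"])
    (use assms in \<open>auto simp: has_field_derivative_def\<close>)

lemma Ck_sin_cos: "Ck k (sin :: real \<Rightarrow> real) \<and> Ck k (cos :: real \<Rightarrow> real)"
proof (induction k)
  case 0
  show ?case by (auto intro: continuous_intros)
next
  case (Suc k)
  have "Ck (Suc k) (sin :: real \<Rightarrow> real)"
    by (rule Ck_real_SucI[where f' = cos]) (use Suc in \<open>auto intro: derivative_intros\<close>)
  moreover have "Ck (Suc k) (cos :: real \<Rightarrow> real)"
    by (rule Ck_real_SucI[where f' = "\<lambda>x. - sin x"]) (use Suc in \<open>auto intro: Ck_minus derivative_eq_intros\<close>)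
  ultimately show ?case ..
qed

lemma Ck_ident: "Ck k (\<lambda>x. x)"
  by (rule Ck_linear) (rule bounded_linear_ident)

lemma Ck_power: "Ck k (f :: 'a::euclidean_space \<Rightarrow> real) \<Longrightarrow> Ck k (\<lambda>x. f x ^ m)"
  by (induction m) (auto intro: Ck_const Ck_mult)

section \<open>Smooth steps and windows on the line\<close>

definition flat :: "nat \<Rightarrow> real \<Rightarrow> real" where
  "flat n x = (if x > 0 then exp (- inverse x) * inverse x ^ n else 0)"

lemma flat_tendsto_0: "((\<lambda>x. exp (- inverse x) * inverse x ^ n) \<longlongrightarrow> 0) (at_right (0::real))"
proof -
  have "((\<lambda>x::real. x ^ n / exp x) \<longlongrightarrow> 0) at_top" by (rule tendsto_power_div_exp_0)
  then have "((\<lambda>x::real. inverse x ^ n / exp (inverse x)) \<longlongrightarrow> 0) (at_right 0)"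
    by (rule filterlim_compose) (rule filterlim_inverse_at_top_right)
  moreover have "inverse x ^ n / exp (inverse x) = exp (- inverse x) * inverse x ^ n" for x :: real
    by (simp add: exp_minus divide_inverse mult.commute)
  ultimately show ?thesis by simp
qed

text \<open>The family \<open>flat n\<close> is closed under differentiation up to linear
  combinations, so smoothness follows by induction for all \<open>n\<close> at once. At 0 the
  quotient from the right is again of the form covered by \<open>flat_tendsto_0\<close>.\<close>

lemma flat_derivative: "(flat n has_real_derivative (flat (n + 2) x - real n * flat (n + 1) x)) (at x)"
proof -
  consider "x < 0" | "x = 0" | "x > 0" by linarith
  then show ?thesis
  proof cases
    case 1
    have "((\<lambda>_. 0) has_real_derivative 0) (at x)" by simp
    then have "(flat n has_real_derivative 0) (at x)"
      by (rule has_field_derivative_transform_within_open[of _ _ _ "{..<0}"]) (use 1 in \<open>auto simp: flat_def\<close>)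
    then show ?thesis using 1 by (simp add: flat_def)
  next
    case 2
    have "((\<lambda>h. flat n h / h) \<longlongrightarrow> 0) (at 0)"
    proof (rule filterlim_split_at)
      have "\<forall>\<^sub>F h in at_left (0::real). flat n h / h = 0"
        by (auto simp: eventually_at_filter flat_def)
      then show "((\<lambda>h. flat n h / h) \<longlongrightarrow> 0) (at_left 0)" by (rule tendsto_eventually)
      have "\<forall>\<^sub>F h in at_right (0::real). exp (- inverse h) * inverse h ^ (Suc n) = flat n h / h"
        by (auto simp: eventually_at_filter flat_def divide_inverse)
      then show "((\<lambda>h. flat n h / h) \<longlongrightarrow> 0) (at_right 0)"
        by (rule Lim_transform_eventually[OF flat_tendsto_0])
    qed
    then show ?thesis using 2 by (simp add: has_field_derivative_iff flat_def)
  next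
    case 3
    have i: "(inverse has_real_derivative - (inverse x ^ 2)) (at x)"
      using DERIV_inverse[of x UNIV] 3 by (simp add: numeral_2_eq_2)
    have e: "((\<lambda>x. exp (- inverse x)) has_real_derivative exp (- inverse x) * inverse x ^ 2) (at x)"
      using DERIV_fun_exp[OF DERIV_minus[OF i]] by simp
    have p: "((\<lambda>x. inverse x ^ n) has_real_derivative real n * (- (inverse x ^ 2) * inverse x ^ (n - Suc 0))) (at x)"
      using DERIV_power[OF i, of n] by simp
    have alg: "E * w ^ 2 * w ^ n + real n * (- (w ^ 2) * w ^ (n - Suc 0)) * E = E * w ^ (n + 2) - real n * (E * w ^ (n + 1))"
      for E w :: real by (cases n) (simp_all add: algebra_simps power2_eq_square)
    have "((\<lambda>x. exp (- inverse x) * inverse x ^ n) has_real_derivative (flat (n + 2) x - real n * flat (n + 1) x)) (at x)"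
      using DERIV_mult[OF e p] 3 unfolding alg by (simp add: flat_def)
    then show ?thesis
      by (rule has_field_derivative_transform_within_open[of _ _ _ "{0<..}"]) (use 3 in \<open>auto simp: flat_def\<close>)
  qed
qed

lemma Ck_flat: "Ck k (flat n)"
proof (induction k arbitrary: n)
  case 0
  have "continuous_on UNIV (flat n)"
    using flat_derivative by (auto intro!: continuous_at_imp_continuous_on DERIV_isCont)
  then show ?case by simp
next
  case (Suc k)
  show ?case by (rule Ck_real_SucI[OF flat_derivative]) (intro Ck_diff Ck_cmult Suc)
qed

definition hump :: "real \<Rightarrow> real" where
  "hump x = flat 0 x * flat 0 (1 - x)"

text \<open>The lower limit lies to the left of the support of \<open>hump\<close>. Hence every
  \<open>x > - 1/2\<close> is an interior point of an interval on which the fundamental theorem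
  applies, while for other \<open>x\<close> the function vanishes nearby.\<close>

definition humpint :: "real \<Rightarrow> real" where
  "humpint x = integral {-1..x} hump"

definition step :: "real \<Rightarrow> real" where
  "step x = humpint x / humpint 1"

lemma Ck_hump: "Ck k hump"
proof -
  have "Ck k (\<lambda>x. flat 0 (1 - x))" by (rule Ck_compose[OF Ck_flat]) (intro Ck_diff Ck_const Ck_ident)
  then show ?thesis unfolding hump_def[abs_def] by (intro Ck_mult Ck_flat)
qed

lemma hump_nonneg: "0 \<le> hump x" and hump_pos: "0 < x \<Longrightarrow> x < 1 \<Longrightarrow> 0 < hump x"
  and hump_0: "x \<le> 0 \<or> 1 \<le> x \<Longrightarrow> hump x = 0"
  by (auto simp: hump_def flat_def)

lemma humpint_neg: "x \<le> 0 \<Longrightarrow> humpint x = 0"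
proof -
  assume "x \<le> 0"
  then have "integral {-1..x} hump = integral {-1..x} (\<lambda>_. 0)"
    by (intro integral_cong) (auto intro: hump_0)
  then show ?thesis by (simp add: humpint_def)
qed

lemma humpint_derivative: "(humpint has_real_derivative hump x) (at x)"
proof (cases "x > - 1/2")
  case True
  have c: "continuous_on {-1..x + 1} hump"
    using Ck_continuous[OF Ck_hump] by (rule continuous_on_subset) simp
  have "(humpint has_vector_derivative hump x) (at x within {-1..x + 1})"
    unfolding humpint_def[abs_def] by (rule integral_has_vector_derivative[OF c]) (use True in auto)
  then have "(humpint has_vector_derivative hump x) (at x)"
    using True by (subst (asm) at_within_Icc_at) auto
  then show ?thesis by (simp add: has_real_derivative_iff_has_vector_derivative)
next
  case False
  have "((\<lambda>_. 0) has_real_derivative 0) (at x)" by simp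
  then have "(humpint has_real_derivative 0) (at x)"
    by (rule has_field_derivative_transform_within_open[of _ _ _ "{..<0}"]) (use False in \<open>auto simp: humpint_neg\<close>)
  then show ?thesis using False by (simp add: hump_0)
qed

lemma humpint_1_pos: "0 < humpint 1"
proof -
  have "humpint 0 < humpint 1"
  proof (rule DERIV_pos_imp_increasing_open[where f = humpint])
    show "\<exists>y. DERIV humpint x :> y \<and> 0 < y" if "0 < x" "x < 1" for x
      using humpint_derivative hump_pos that by blast
    show "continuous_on {0..1} humpint"
      using humpint_derivative by (auto intro!: continuous_at_imp_continuous_on DERIV_isCont)
  qed simp
  then show ?thesis by (simp add: humpint_neg)
qed

lemma humpint_mono: "x \<le> y \<Longrightarrow> humpint x \<le> humpint y"
proof (erule DERIV_nonneg_imp_nondecreasing[where f = humpint])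
  show "\<exists>y. DERIV humpint t :> y \<and> 0 \<le> y" for t
    using humpint_derivative[of t] hump_nonneg[of t] by blast
qed

lemma humpint_ge_1: "1 \<le> x \<Longrightarrow> humpint x = humpint 1"
proof (rule antisym)
  assume x: "1 \<le> x"
  show "humpint x \<le> humpint 1"
  proof (rule DERIV_nonpos_imp_nonincreasing[where f = humpint, OF x])
    show "\<exists>y. DERIV humpint t :> y \<and> y \<le> 0" if "1 \<le> t" for t
      using humpint_derivative[of t] hump_0[of t] that by auto
  qed
qed (rule humpint_mono)

lemma step_derivative: "(step has_real_derivative hump x / humpint 1) (at x)"
  unfolding step_def[abs_def] by (rule DERIV_cdivide[OF humpint_derivative])

lemma Ck_step: "Ck k step"
proof (cases k)
  case 0
  have "continuous_on UNIV step"
    using step_derivative by (auto intro!: continuous_at_imp_continuous_on DERIV_isCont)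
  then show ?thesis using 0 by simp
next
  case (Suc j)
  have "Ck j (\<lambda>x. hump x / humpint 1)"
    using Ck_cmult[OF Ck_hump, of j "1 / humpint 1"] by simp
  then show ?thesis unfolding Suc by (rule Ck_real_SucI[OF step_derivative])
qed

lemma step_le_0: "x \<le> 0 \<Longrightarrow> step x = 0" and step_ge_1: "1 \<le> x \<Longrightarrow> step x = 1"
  using humpint_1_pos humpint_ge_1[of x] by (auto simp: step_def humpint_neg)

lemma step_bounds: "0 \<le> step x" "step x \<le> 1"
proof -
  have "0 \<le> humpint x" using humpint_mono[of 0 x] humpint_mono[of x 0] humpint_neg[of x] humpint_neg[of 0] by (cases "x \<le> 0") auto
  then show "0 \<le> step x" using humpint_1_pos by (simp add: step_def)
  have "humpint x \<le> humpint 1" using humpint_mono[of x 1] humpint_ge_1[of x] by (cases "x \<le> 1") auto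
  then show "step x \<le> 1" using humpint_1_pos by (simp add: step_def)
qed

lemma step_scaled_tendsto: "(\<lambda>k. step (real k * (t - a))) \<longlonglongrightarrow> (if a < t then 1 else 0)"
proof (cases "a < t")
  case True
  obtain n where n: "1 < real n * (t - a)" using reals_Archimedean3[of "t - a"] True by auto
  have "step (real k * (t - a)) = 1" if "k \<ge> n" for k
  proof -
    have "real n * (t - a) \<le> real k * (t - a)" using that True by (intro mult_right_mono) auto
    then show ?thesis using n by (intro step_ge_1) simp
  qed
  then have "\<forall>\<^sub>F k in sequentially. step (real k * (t - a)) = 1" by (auto simp: eventually_sequentially)
  then show ?thesis using True by (auto intro: tendsto_eventually)
next
  case False
  then have "step (real k * (t - a)) = 0" for k by (intro step_le_0) (simp add: mult_nonneg_nonpos)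
  then show ?thesis using False by simp
qed

text \<open>A smooth approximation of the indicator of \<open>{a<..b}\<close>, supported up to
  \<open>b + 1 / k\<close>. Its derivative is the difference of two humps of unit mass next to
  \<open>a\<close> and \<open>b\<close>, which is what makes it useful as a test function in
  time.\<close>

definition window :: "nat \<Rightarrow> real \<Rightarrow> real \<Rightarrow> real \<Rightarrow> real" where
  "window k a b t = step (real k * (t - a)) - step (real k * (t - b))"

lemma Ck_step_affine: "Ck j (\<lambda>t. step (c * (t - a)))"
  by (rule Ck_compose[OF Ck_step]) (intro Ck_cmult Ck_diff Ck_ident Ck_const)

lemma smooth_window: "smooth (window k a b)"
  unfolding smooth_def window_def[abs_def] by (auto intro: Ck_diff Ck_step_affine)

lemma window_bound: "\<bar>window k a b t\<bar> \<le> 1"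
  using step_bounds[of "real k * (t - a)"] step_bounds[of "real k * (t - b)"] by (simp add: window_def abs_le_iff)

lemma window_support:
  assumes "k > 0" "a \<le> b" "window k a b t \<noteq> 0"
  shows "a \<le> t \<and> t \<le> b + 1 / real k"
proof (rule ccontr)
  assume "\<not> (a \<le> t \<and> t \<le> b + 1 / real k)"
  then consider "t < a" | "t > b + 1 / real k" by linarith
  then have "window k a b t = 0"
  proof cases
    case 1
    then show ?thesis using assms by (simp add: window_def step_le_0 mult_nonneg_nonpos)
  next
    case 2
    then have "1 \<le> real k * (t - b)" using assms(1) by (simp add: field_simps)
    moreover have "real k * (t - b) \<le> real k * (t - a)" using assms by (intro mult_left_mono) auto
    ultimately show ?thesis by (simp add: window_def step_ge_1)
  qed
  then show False using assms(3) by simp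
qed

lemma window_tendsto: "a \<le> b \<Longrightarrow> (\<lambda>k. window k a b t) \<longlonglongrightarrow> indicator {a<..b} t"
  unfolding window_def
  by (rule tendsto_eq_rhs[OF tendsto_diff[OF step_scaled_tendsto step_scaled_tendsto]]) (auto simp: indicator_def)

lemma window_derivative:
  "(window k a b has_real_derivative real k * (hump (real k * (t - a)) / humpint 1) - real k * (hump (real k * (t - b)) / humpint 1)) (at t)"
proof -
  have "((\<lambda>t. step (c * (t - a))) has_real_derivative c * (hump (c * (t - a)) / humpint 1)) (at t)" for c a
  proof -
    have "((\<lambda>t. c * (t - a)) has_real_derivative c) (at t)"
      by (auto intro!: derivative_eq_intros)
    from DERIV_chain2[OF step_derivative this] show ?thesis by (simp only: mult.commute)
  qed
  then show ?thesis unfolding window_def[abs_def] by (intro DERIV_diff)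
qed


section \<open>The fundamental lemma of the calculus of variations on an interval\<close>

lemma AE_zero_if_integral_sets_zero:
  fixes g :: "'a \<Rightarrow> real"
  assumes g: "integrable M g" and z: "\<And>A. A \<in> sets M \<Longrightarrow> (LINT x|M. indicator A x * g x) = 0"
  shows "AE x in M. g x = 0"
proof -
  have half: "AE x in M. f x \<le> 0" if f: "integrable M f" and zf: "\<And>A. A \<in> sets M \<Longrightarrow> (LINT x|M. indicator A x * f x) = 0" for f :: "'a \<Rightarrow> real"
  proof -
    define A where "A = {x \<in> space M. 0 < f x}"
    have A: "A \<in> sets M" unfolding A_def using f by measurable
    have i: "integrable M (\<lambda>x. indicator A x * f x)" using integrable_real_mult_indicator[OF A f] by (simp add: mult.commute)
    have n: "AE x in M. 0 \<le> indicator A x * f x" by (auto simp: A_def indicator_def)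
    have "AE x in M. indicator A x * f x = 0"
      using integral_nonneg_eq_0_iff_AE[OF i n] zf[OF A] by simp
    then show ?thesis using AE_space
      by eventually_elim (auto simp: A_def indicator_def split: if_splits)
  qed
  have "AE x in M. g x \<le> 0" by (rule half[OF g z])
  moreover have "AE x in M. - g x \<le> 0"
    by (rule half) (use g z in auto)
  ultimately show ?thesis by eventually_elim simp
qed

definition interval_test :: "real \<Rightarrow> (real \<Rightarrow> real) set" where
  "interval_test l = {\<eta>. smooth \<eta> \<and> (\<exists>\<delta>>0. \<forall>y. \<eta> y \<noteq> 0 \<longrightarrow> \<delta> \<le> y \<and> y \<le> l - \<delta>)}"

text \<open>Windows give vanishing integrals of \<open>g\<close> over half-open intervals away from
  the ends; these exhaust half-lines intersected with the interval, and half-lines generate the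
  Borel sets. Every passage is a dominated limit of integrals with constant value, which is the
  local fact \<open>dom\<close>.\<close>

lemma fundamental_lemma_interval:
  fixes g :: "real \<Rightarrow> real"
  assumes l: "l > 0" and g: "integrable (Iy l) g"
    and z: "\<And>\<eta>. \<eta> \<in> interval_test l \<Longrightarrow> (LINT y|Iy l. g y * \<eta> y) = 0"
  shows "AE y in Iy l. g y = 0"
proof (rule AE_zero_if_integral_sets_zero[OF g])
  note gm[measurable] = borel_measurable_integrable[OF g]
  have dom: "(LINT y|Iy l. indicator B y * g y) = c"
    if B: "B \<in> sets borel" and f: "\<And>k. f k \<in> borel_measurable borel" "\<And>k y. \<bar>f k y\<bar> \<le> 1" "\<And>y. y \<in> {0<..<l} \<Longrightarrow> (\<lambda>k. f k y) \<longlonglongrightarrow> indicator B y"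
      and c: "\<And>k. (LINT y|Iy l. f k y * g y) = c" for B and f :: "nat \<Rightarrow> real \<Rightarrow> real" and c
  proof -
    have [measurable]: "f k \<in> borel_measurable (Iy l)" "indicat_real B \<in> borel_measurable (Iy l)" for k
      using f(1) B by (auto intro!: borel_measurable_Iy)
    have "(\<lambda>k. LINT y|Iy l. f k y * g y) \<longlonglongrightarrow> (LINT y|Iy l. indicator B y * g y)"
    proof (rule integral_dominated_convergence[where w = "\<lambda>y. \<bar>g y\<bar>"])
      show "AE y in Iy l. (\<lambda>k. f k y * g y) \<longlonglongrightarrow> indicat_real B y * g y"
        using f(3) by (auto intro!: tendsto_mult)
      show "AE y in Iy l. norm (f k y * g y) \<le> \<bar>g y\<bar>" for k
        using f(2)[of k] by (auto simp: abs_mult intro!: mult_left_le_one_le)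
    qed (use g in auto)
    then show ?thesis by (simp add: c LIMSEQ_const_iff)
  qed
  have Ioc: "(LINT y|Iy l. indicator {a<..b} y * g y) = 0" if ab: "0 < a" "a \<le> b" "b < l" for a b
  proof -
    \<comment> \<open>Windows with index at least \<open>n\<close> end strictly before
      \<open>l\<close>, so the sequence starts there.\<close>
    obtain n where n: "1 / real n < l - b" "n > 0"
      using ab(3) by (metis diff_gt_0_iff_gt ex_inverse_of_nat_less inverse_eq_divide)
    show ?thesis
    proof (rule dom[where f = "\<lambda>k. window (k + n) a b"])
      show "(\<lambda>k. window (k + n) a b y) \<longlonglongrightarrow> indicat_real {a<..b} y" for y
        using LIMSEQ_ignore_initial_segment[OF window_tendsto[OF ab(2)]] .
      show "(LINT y|Iy l. window (k + n) a b y * g y) = 0" for k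
      proof -
        have k: "1 / real (k + n) \<le> 1 / real n" using n(2) by (intro divide_left_mono) auto
        have "window (k + n) a b \<in> interval_test l"
          unfolding interval_test_def
        proof (intro CollectI conjI smooth_window exI[of _ "min a (l - b - 1 / real n)"] allI impI)
          show "0 < min a (l - b - 1 / real n)" using n ab by simp
          fix y assume "window (k + n) a b y \<noteq> 0"
          from window_support[OF _ ab(2) this] n(2) k
          show "min a (l - b - 1 / real n) \<le> y" "y \<le> l - min a (l - b - 1 / real n)" by auto
        qed
        from z[OF this] show ?thesis by (simp add: mult.commute)
      qed
      show "window (k + n) a b \<in> borel_measurable borel" for k
        using smooth_window[of "k + n" a b, unfolded smooth_def, rule_format, of 0] by (auto intro!: borel_measurable_continuous_onI)
    qed (auto simp: window_bound)
  qed
  have lower: "(LINT y|Iy l. indicator {..b} y * g y) = 0" for b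
  proof (cases "b \<le> 0")
    case True
    have "(LINT y|Iy l. indicator {..b} y * g y) = (LINT y|Iy l. 0)"
      by (rule Bochner_Integration.integral_cong) (use True in \<open>auto simp: indicator_def\<close>)
    then show ?thesis by simp
  next
    case False
    \<comment> \<open>The third guarantees \<open>a k \<le> c k\<close> from the start:
      \<open>a k\<close> is at most \<open>d\<close> and \<open>c k\<close> is at least
      \<open>2 * d\<close>.\<close>
    define d where "d = min b l / 3"
    have d: "d > 0" using False l by (simp add: d_def)
    have d3: "3 * d \<le> b" "3 * d \<le> l" by (auto simp: d_def)
    define a where "a k = d / real (Suc k)" for k
    define c where "c k = min b (l - a k)" for k
    have a0: "a \<longlonglongrightarrow> 0" unfolding a_def using LIMSEQ_Suc[OF lim_const_over_n[of d]] by simp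
    have ad: "0 < a k" "a k \<le> d" for k using d by (auto simp: a_def field_simps)
    show ?thesis
    proof (rule dom[where f = "\<lambda>k. indicator {a k<..c k}"])
      show "(LINT y|Iy l. indicat_real {a k<..c k} y * g y) = 0" for k
        by (rule Ioc) (use ad[of k] d d3 in \<open>auto simp: c_def\<close>)
      show "(\<lambda>k. indicat_real {a k<..c k} y) \<longlonglongrightarrow> indicator {..b} y" if y: "y \<in> {0<..<l}" for y
      proof -
        have "\<forall>\<^sub>F k in sequentially. a k < min y (l - y)"
          by (rule order_tendstoD(2)[OF a0]) (use y in auto)
        then have "\<forall>\<^sub>F k in sequentially. indicat_real {a k<..c k} y = indicator {..b} y"
          by eventually_elim (auto simp: indicator_def c_def)
        then show ?thesis by (rule tendsto_eventually)
      qed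
    qed (auto simp: indicator_def)
  qed
  have all: "(LINT y|Iy l. indicator B y * g y) = 0" if B: "B \<in> sets borel" for B :: "real set"
  proof -
    have ii: "integrable (Iy l) (\<lambda>y. indicator C y * g y)" if "C \<in> sets borel" for C
    proof (rule Bochner_Integration.integrable_bound[OF g])
      have [measurable]: "indicat_real C \<in> borel_measurable (Iy l)" using that by (auto intro!: borel_measurable_Iy)
      show "(\<lambda>y. indicat_real C y * g y) \<in> borel_measurable (Iy l)" by measurable
    qed (auto simp: indicator_def)
    have tot: "(LINT y|Iy l. g y) = 0"
    proof -
      have "(LINT y|Iy l. g y) = (LINT y|Iy l. indicator {..l} y * g y)"
        by (rule Bochner_Integration.integral_cong) (auto simp: indicator_def)
      then show ?thesis using lower by simp
    qed
    have G: "range (\<lambda>a::real. {..a}) \<subseteq> Pow UNIV" by auto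
    have S: "Int_stable (range (\<lambda>a::real. {..a}))"
      by (auto simp: Int_stable_def)
    have "B \<in> sigma_sets UNIV (range (\<lambda>a::real. {..a}))"
      using B unfolding borel_eq_atMost by simp
    from S G this show ?thesis
    proof (induction rule: sigma_sets_induct_disjoint)
      case (basic A)
      then show ?case using lower by auto
    next
      case (compl A)
      then have A: "A \<in> sets borel" unfolding borel_eq_atMost by simp
      have "(LINT y|Iy l. indicator (UNIV - A) y * g y) = (LINT y|Iy l. g y - indicator A y * g y)"
        by (rule Bochner_Integration.integral_cong) (auto simp: indicator_def)
      also have "\<dots> = (LINT y|Iy l. g y) - (LINT y|Iy l. indicator A y * g y)"
        using g ii[OF A] by (rule Bochner_Integration.integral_diff)
      finally show ?case using compl tot by simp
    next
      case (union A)
      then have A: "A i \<in> sets borel" for i unfolding borel_eq_atMost by auto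
      have eq: "(\<Sum>i<n. indicat_real (A i) y) = indicator (\<Union>i<n. A i) y" for n y
        using union(1) by (subst indicator_UN_disjoint) (auto simp: disjoint_family_on_def)
      show ?case
      proof (rule dom[where f = "\<lambda>n. indicator (\<Union>i<n. A i)"])
        show "(LINT y|Iy l. indicat_real (\<Union>i<n. A i) y * g y) = 0" for n
          unfolding eq[symmetric] sum_distrib_right
          by (subst Bochner_Integration.integral_sum) (auto simp: ii A union(3))
        show "(\<lambda>n. indicat_real (\<Union>i<n. A i) y) \<longlonglongrightarrow> indicat_real (\<Union>i. A i) y" for y
          by (rule LIMSEQ_indicator_UN)
      qed (use A in \<open>auto simp: indicator_def\<close>)
    qed simp
  qed
  show "(LINT y|Iy l. indicator A y * g y) = 0" if "A \<in> sets (Iy l)" for A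
    using that by (intro all) (auto simp: sets_restrict_space_iff)
qed

section \<open>Smooth periodic functions and their Fourier coefficients\<close>

abbreviation ex :: "'n \<Rightarrow> ('n::finite) pt" where
  "ex i \<equiv> (axis i 1, 0)"

abbreviation ey :: "('n::finite) pt" where
  "ey \<equiv> (0, 1)"

lemma Basis_pt: "(Basis :: ('n::finite) pt set) = insert ey (range ex)"
  by (auto simp: Basis_prod_def Basis_vec_def)

lemma ex_Basis [simp]: "ex i \<in> Basis" and ey_Basis [simp]: "ey \<in> Basis"
  by (simp_all add: Basis_pt)

lemma inj_ex: "inj (ex :: 'n \<Rightarrow> ('n::finite) pt)"
  by (auto simp: inj_def axis_eq_axis)

lemma sum_Basis_pt:
  fixes f :: "('n::finite) pt \<Rightarrow> 'b::comm_monoid_add"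
  shows "sum f Basis = f ey + (\<Sum>i\<in>UNIV. f (ex i))"
proof -
  have "ey \<notin> range (ex :: 'n \<Rightarrow> 'n pt)" by auto
  then show ?thesis unfolding Basis_pt by (simp add: sum.reindex[OF inj_ex])
qed

lemma smooth_per_smooth: "\<phi> \<in> smooth_per \<Longrightarrow> Ck k \<phi>"
  by (simp add: smooth_per_def smooth_def)

lemma smooth_per_periodic: "\<phi> \<in> smooth_per \<Longrightarrow> \<phi> (x + axis i 1, y) = \<phi> (x, y)"
  by (simp add: smooth_per_def)

lemma smooth_per_continuous: "\<phi> \<in> smooth_per \<Longrightarrow> continuous_on UNIV \<phi>"
  using Ck_continuous smooth_per_smooth by blast

lemma smooth_per_has_derivative:
  assumes "\<phi> \<in> smooth_per"
  shows "(\<phi> has_derivative (\<lambda>v. dir_deriv v \<phi> z)) (at z)"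
  using smooth_per_smooth[OF assms, of 1] by (auto intro: has_derivative_dir_deriv)

lemma smooth_per_dir_deriv:
  assumes "\<phi> \<in> smooth_per" "b \<in> Basis"
  shows "dir_deriv b \<phi> \<in> smooth_per"
  unfolding smooth_per_def smooth_def
proof (intro CollectI conjI allI)
  show "Ck k (dir_deriv b \<phi>)" for k using smooth_per_smooth[OF assms(1), of "Suc k"] assms(2) by simp
  fix x y i
  have "((\<lambda>z. \<phi> (z + ex i)) has_derivative (\<lambda>v. dir_deriv v \<phi> ((x, y) + ex i))) (at (x, y))"
  proof (rule has_derivative_eq_rhs)
    show "((\<lambda>z. \<phi> (z + ex i)) has_derivative (\<lambda>v. dir_deriv (v + 0) \<phi> ((x, y) + ex i))) (at (x, y))"
      by (rule has_derivative_compose[OF has_derivative_add[OF has_derivative_ident has_derivative_const] smooth_per_has_derivative[OF assms(1)]])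
  qed simp
  moreover have "(\<lambda>z. \<phi> (z + ex i)) = \<phi>"
    using smooth_per_periodic[OF assms(1)] by (auto simp: fun_eq_iff)
  ultimately have "dir_deriv b \<phi> (x, y) = dir_deriv b \<phi> ((x, y) + ex i)"
    by (intro dir_deriv_eq) simp
  then show "dir_deriv b \<phi> (x + axis i 1, y) = dir_deriv b \<phi> (x, y)" by simp
qed

lemma smooth_per_add: "\<phi> \<in> smooth_per \<Longrightarrow> \<psi> \<in> smooth_per \<Longrightarrow> (\<lambda>z. \<phi> z + \<psi> z) \<in> smooth_per"
  and smooth_per_mult: "\<phi> \<in> smooth_per \<Longrightarrow> \<psi> \<in> smooth_per \<Longrightarrow> (\<lambda>z. \<phi> z * \<psi> z) \<in> smooth_per"
  and smooth_per_scale: "\<phi> \<in> smooth_per \<Longrightarrow> (\<lambda>z. c * \<phi> z) \<in> smooth_per"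
  by (auto simp: smooth_per_def smooth_def intro: Ck_add Ck_diff Ck_mult Ck_cmult)

lemma dir_deriv_mult:
  assumes "\<phi> \<in> smooth_per" "\<psi> \<in> smooth_per"
  shows "dir_deriv b (\<lambda>z. \<phi> z * \<psi> z) = (\<lambda>z. \<phi> z * dir_deriv b \<psi> z + dir_deriv b \<phi> z * \<psi> z)"
  by (rule ext, rule dir_deriv_eq[OF has_derivative_mult]) (auto intro: smooth_per_has_derivative assms)

lemma smooth_per_bounded:
  assumes "\<phi> \<in> smooth_per"
  shows "\<exists>B. \<forall>x\<in>cbox 0 ones. \<forall>y\<in>{a..b}. \<bar>\<phi> (x, y)\<bar> \<le> B"
proof -
  have "compact (\<phi> ` (cbox 0 ones \<times> {a..b}))"
    by (intro compact_continuous_image compact_Times compact_cbox continuous_on_subset[OF smooth_per_continuous[OF assms]])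
       (auto simp flip: box_real)
  then have "bounded (\<phi> ` (cbox 0 ones \<times> {a..b}))" by (rule compact_imp_bounded)
  then obtain B where "\<And>z. z \<in> \<phi> ` (cbox 0 ones \<times> {a..b}) \<Longrightarrow> norm z \<le> B" by (auto simp: bounded_iff)
  then show ?thesis by (intro exI[of _ B]) auto
qed

lemma smooth_per_L2:
  assumes "\<phi> \<in> smooth_per"
  shows "\<phi> \<in> L2 (Om l)"
proof -
  obtain B where B: "\<And>x y. x \<in> cbox 0 ones \<Longrightarrow> y \<in> {0..l} \<Longrightarrow> \<bar>\<phi> (x, y)\<bar> \<le> B"
    using smooth_per_bounded[OF assms] by blast
  have m: "\<phi> \<in> borel_measurable (Om l)"
    by (intro borel_measurable_Om borel_measurable_continuous_onI smooth_per_continuous assms)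
  show ?thesis
    by (rule L2_bounded[OF finite_measure_Om m, of B]) (use B cell_subset_cbox in \<open>fastforce intro!: AE_I2\<close>)
qed

lemma smooth_per_slice_continuous:
  assumes "\<phi> \<in> smooth_per"
  shows "continuous_on A (\<lambda>x. \<phi> (x, y))"
  by (rule continuous_on_compose2[OF smooth_per_continuous[OF assms]]) (auto intro!: continuous_intros)

lemma smooth_per_slice_L2:
  assumes "\<phi> \<in> smooth_per"
  shows "(\<lambda>x. \<phi> (x, y)) \<in> L2 Sig"
proof -
  obtain B where B: "\<And>x. x \<in> cbox 0 ones \<Longrightarrow> \<bar>\<phi> (x, y)\<bar> \<le> B"
    using smooth_per_bounded[OF assms, of y y] by auto
  have m: "(\<lambda>x. \<phi> (x, y)) \<in> borel_measurable Sig"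
    by (intro borel_measurable_Sig borel_measurable_continuous_onI smooth_per_slice_continuous assms)
  show ?thesis
    by (rule L2_bounded[OF finite_measure_Sig m, of B]) (use B cell_subset_cbox in \<open>fastforce intro!: AE_I2\<close>)
qed

lemma integral_Sig_cbox:
  fixes f :: "real ^ 'n::finite \<Rightarrow> 'b::euclidean_space"
  assumes c: "continuous_on UNIV f"
  shows "(LINT x|Sig. f x) = integral (cbox 0 ones) f"
proof -
  have i: "set_integrable lborel (cbox 0 (ones :: real ^ 'n)) f"
    unfolding set_integrable_def
    by (intro borel_integrable_compact compact_cbox continuous_on_subset[OF c]) auto
  have m: "f \<in> borel_measurable borel" by (rule borel_measurable_continuous_onI[OF c])
  have "(LINT x|Sig. f x) = (LINT x|lborel. indicator cell x *\<^sub>R f x)" by (rule integral_Sig)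
  also have "\<dots> = (LINT x|lborel. indicator (cbox 0 ones) x *\<^sub>R f x)"
  proof (rule integral_cong_AE)
    have "emeasure lborel (cbox 0 (ones :: real ^ 'n) - cell) = 0"
      by (subst emeasure_Diff) (auto simp: cell_subset_cbox emeasure_cell emeasure_lborel_cbox_eq inner_ones_Basis)
    then have "AE x in lborel. x \<notin> cbox 0 (ones :: real ^ 'n) - cell"
      by (intro AE_not_in) auto
    then show "AE x in lborel. indicat_real cell x *\<^sub>R f x = indicat_real (cbox 0 ones) x *\<^sub>R f x"
      by eventually_elim (use cell_subset_cbox in \<open>auto simp: indicator_def\<close>)
  qed (use m in auto)
  also have "\<dots> = integral (cbox 0 ones) f"
    using set_borel_integral_eq_integral(2)[OF i] by (simp add: set_lebesgue_integral_def)
  finally show ?thesis .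
qed

lemma integral_periodic_shift_continuous:
  fixes f :: "real ^ 'n::finite \<Rightarrow> 'b::euclidean_space"
  assumes c: "continuous_on UNIV f" and per: "\<And>x. f (x + axis i 1) = f x" and s: "0 \<le> s" "s \<le> 1"
  shows "(LINT x|Sig. f (x + s *\<^sub>R axis i 1)) = (LINT x|Sig. f x)"
proof -
  text \<open>Only the values in the slab \<open>0 \<le> x $ i < 2\<close> over the cell enter, and there \<open>f\<close> is bounded;
    truncating \<open>f\<close> at that bound keeps it periodic.\<close>
  have "compact (f ` cbox 0 (2 *\<^sub>R ones))"
    by (intro compact_continuous_image continuous_on_subset[OF c]) auto
  then obtain B where B: "\<And>x. x \<in> cbox 0 (2 *\<^sub>R ones) \<Longrightarrow> norm (f x) \<le> B"
    by (force dest!: compact_imp_bounded simp: bounded_iff)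
  define g where "g x = (if norm (f x) \<le> B then f x else 0)" for x
  have m: "f \<in> borel_measurable borel" by (rule borel_measurable_continuous_onI[OF c])
  have "(LINT x|Sig. g (x + s *\<^sub>R axis i 1)) = (LINT x|Sig. g x)"
    by (rule integral_periodic_shift[where B = "\<bar>B\<bar>"]) (use m s per in \<open>auto simp: g_def\<close>)
  moreover have "g x = f x" if "x \<in> cbox 0 (2 *\<^sub>R ones)" for x using B[OF that] by (simp add: g_def)
  moreover have "x \<in> cbox 0 (2 *\<^sub>R ones)" if "x \<in> cell" for x :: "real ^ 'n"
    unfolding mem_box_cart
  proof
    fix j
    have "0 \<le> x $ j" "x $ j < 1" using that by (auto simp: cell_def)
    then show "0 $ j \<le> x $ j \<and> x $ j \<le> (2 *\<^sub>R ones) $ j" by simp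
  qed
  moreover have "x + s *\<^sub>R axis i 1 \<in> cbox 0 (2 *\<^sub>R ones)" if "x \<in> cell" for x
    unfolding mem_box_cart
  proof
    fix j
    have "0 \<le> x $ j" "x $ j < 1" using that by (auto simp: cell_def)
    then show "0 $ j \<le> (x + s *\<^sub>R axis i 1) $ j \<and> (x + s *\<^sub>R axis i 1) $ j \<le> (2 *\<^sub>R ones) $ j"
      using s by (auto simp: axis_def)
  qed
  ultimately show ?thesis
    by (metis (mono_tags, lifting) Bochner_Integration.integral_cong space_Sig)
qed

lemma fourier_integrand_continuous:
  assumes "\<phi> \<in> smooth_per"
  shows "continuous_on A (\<lambda>(s, x). complex_of_real (\<phi> (x + s *\<^sub>R c, y + s * d)) * cnj (tr \<xi> x))"
  unfolding case_prod_unfold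
  by (intro continuous_intros continuous_on_compose2[OF smooth_per_continuous[OF assms]]
      continuous_on_compose2[OF tr_continuous]) auto

text \<open>One differentiation under the integral sign serves both directions: along
  \<open>ey\<close> it differentiates the vertical profile of the coefficient, along
  \<open>ex i\<close> a horizontal translate.\<close>

lemma fourier_line_derivative:
  assumes \<phi>: "\<phi> \<in> smooth_per" and b: "(c, d) \<in> Basis" and s: "s \<in> U" "convex U"
  shows "((\<lambda>s. fourier (\<lambda>x. \<phi> (x + s *\<^sub>R c, y + s * d)) \<xi>) has_vector_derivative
     fourier (\<lambda>x. dir_deriv (c, d) \<phi> (x + s *\<^sub>R c, y + s * d)) \<xi>) (at s within U)"
proof -
  have \<phi>': "dir_deriv (c, d) \<phi> \<in> smooth_per" by (rule smooth_per_dir_deriv[OF \<phi> b])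
  have F: "fourier (\<lambda>x. f (x + s *\<^sub>R c, y + s * d)) \<xi> =
      integral (cbox 0 ones) (\<lambda>x. complex_of_real (f (x + s *\<^sub>R c, y + s * d)) * cnj (tr \<xi> x))"
    if "f \<in> smooth_per" for f s
    unfolding fourier_alt
    by (rule integral_Sig_cbox, intro continuous_intros continuous_on_compose2[OF smooth_per_continuous[OF that]]
      continuous_on_compose2[OF tr_continuous]) auto
  show ?thesis unfolding F[OF \<phi>] F[OF \<phi>']
  proof (rule leibniz_rule_vector_derivative[OF _ _ _ s])
    fix t :: real and x :: "real ^ 'a"
    have l: "((\<lambda>t. (x + t *\<^sub>R c, y + t * d)) has_derivative (\<lambda>h. h *\<^sub>R (c, d))) (at t within U)"
      by (rule has_derivative_eq_rhs, rule has_derivative_Pair) (auto intro!: derivative_eq_intros)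
    have sc: "dir_deriv (h *\<^sub>R (c, d)) \<phi> z = h * dir_deriv (c, d) \<phi> z" for h z
      using linear_scale[OF has_derivative_linear[OF smooth_per_has_derivative[OF \<phi>, of z]], of h "(c, d)"] by simp
    have "((\<lambda>t. \<phi> (x + t *\<^sub>R c, y + t * d)) has_derivative
        (\<lambda>h. dir_deriv (h *\<^sub>R (c, d)) \<phi> (x + t *\<^sub>R c, y + t * d))) (at t within U)"
      using has_derivative_compose[OF l smooth_per_has_derivative[OF \<phi>]] by simp
    then have "((\<lambda>t. \<phi> (x + t *\<^sub>R c, y + t * d)) has_vector_derivative dir_deriv (c, d) \<phi> (x + t *\<^sub>R c, y + t * d)) (at t within U)"
      unfolding has_vector_derivative_def sc by simp
    from has_vector_derivative_mult_left[OF bounded_linear.has_vector_derivative[OF bounded_linear_of_real this], of "cnj (tr \<xi> x)"]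
    show "((\<lambda>t. complex_of_real (\<phi> (x + t *\<^sub>R c, y + t * d)) * cnj (tr \<xi> x)) has_vector_derivative
       complex_of_real (dir_deriv (c, d) \<phi> (x + t *\<^sub>R c, y + t * d)) * cnj (tr \<xi> x)) (at t within U)" by simp
  next
    show "continuous_on (U \<times> cbox 0 ones) (\<lambda>(s, x). complex_of_real (dir_deriv (c, d) \<phi> (x + s *\<^sub>R c, y + s * d)) * cnj (tr \<xi> x))"
      by (rule fourier_integrand_continuous[OF \<phi>'])
  next
    fix t :: real
    show "(\<lambda>x. complex_of_real (\<phi> (x + t *\<^sub>R c, y + t * d)) * cnj (tr \<xi> x)) integrable_on cbox 0 ones"
      by (intro integrable_continuous continuous_intros continuous_on_compose2[OF smooth_per_continuous[OF \<phi>]]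
        continuous_on_compose2[OF tr_continuous]) auto
  qed
qed

lemma fc_has_vector_derivative:
  assumes "\<phi> \<in> smooth_per"
  shows "(fc \<xi> \<phi> has_vector_derivative fc \<xi> (dir_deriv ey \<phi>) y) (at y within U)"
proof -
  have "((\<lambda>s. fourier (\<lambda>x. \<phi> (x + s *\<^sub>R 0, 0 + s * 1)) \<xi>) has_vector_derivative
     fourier (\<lambda>x. dir_deriv ey \<phi> (x + y *\<^sub>R 0, 0 + y * 1)) \<xi>) (at y within UNIV)"
    by (rule fourier_line_derivative[OF assms]) auto
  then show ?thesis
    by (auto simp: fc_def[abs_def] intro: has_vector_derivative_at_within)
qed

lemma fc_continuous: "\<phi> \<in> smooth_per \<Longrightarrow> continuous_on A (fc \<xi> \<phi>)"
  by (intro continuous_at_imp_continuous_on ballI has_vector_derivative_continuous[OF fc_has_vector_derivative])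

lemma Ck_fc:
  assumes "\<phi> \<in> smooth_per"
  shows "Ck k (\<lambda>y. Re (fc \<xi> \<phi> y)) \<and> Ck k (\<lambda>y. Im (fc \<xi> \<phi> y))"
  using assms
proof (induction k arbitrary: \<phi>)
  case 0
  then show ?case by (auto intro!: continuous_intros fc_continuous)
next
  case (Suc k)
  have d: "(fc \<xi> \<phi> has_vector_derivative fc \<xi> (dir_deriv ey \<phi>) y) (at y)" for y
    by (rule fc_has_vector_derivative[OF Suc.prems])
  have "((\<lambda>y. Re (fc \<xi> \<phi> y)) has_real_derivative Re (fc \<xi> (dir_deriv ey \<phi>) y)) (at y)"
    "((\<lambda>y. Im (fc \<xi> \<phi> y)) has_real_derivative Im (fc \<xi> (dir_deriv ey \<phi>) y)) (at y)" for y
    using bounded_linear.has_vector_derivative[OF bounded_linear_Re d]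
      bounded_linear.has_vector_derivative[OF bounded_linear_Im d]
    by (simp_all add: has_real_derivative_iff_has_vector_derivative)
  from Ck_real_SucI[OF this(1)] Ck_real_SucI[OF this(2)] show ?case
    using Suc.IH[OF smooth_per_dir_deriv[OF Suc.prems ey_Basis]] by blast
qed

text \<open>The coefficient of the translate by \<open>s\<close> along axis \<open>i\<close> is
  differentiated at \<open>s = 0\<close> in two ways: under the integral, and as the phase that
  translation produces. The phase formula is available for \<open>s\<close> in
  \<open>{0..1}\<close>, so one-sided derivatives are compared.\<close>

lemma fc_dir_deriv_ex:
  assumes \<phi>: "\<phi> \<in> smooth_per"
  shows "fc \<xi> (dir_deriv (ex i) \<phi>) y = 2 * pi * \<i> * of_int (\<xi> $ i) * fc \<xi> \<phi> y"
proof -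
  let ?w = "2 * pi * of_int (\<xi> $ i)"
  have J: "fourier (\<lambda>x. \<phi> (x + s *\<^sub>R axis i 1, y)) \<xi> = cis (?w * s) * fc \<xi> \<phi> y" if s: "s \<in> {0..1}" for s :: real
  proof -
    let ?f = "\<lambda>x. complex_of_real (\<phi> (x, y)) * cnj (tr \<xi> x)"
    have c: "continuous_on UNIV ?f"
      by (intro continuous_intros continuous_on_compose2[OF smooth_per_continuous[OF \<phi>]] tr_continuous) auto
    have per: "?f (x + axis i 1) = ?f x" for x
      by (simp add: smooth_per_periodic[OF \<phi>] tr_periodic)
    have shift: "(LINT x|Sig. ?f (x + s *\<^sub>R axis i 1)) = (LINT x|Sig. ?f x)"
      by (rule integral_periodic_shift_continuous[OF c per]) (use s in auto)
    have "cis (?w * s) * ?f (x + s *\<^sub>R axis i 1) = complex_of_real (\<phi> (x + s *\<^sub>R axis i 1, y)) * cnj (tr \<xi> x)" for x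
    proof -
      have "cis (?w * s) * cnj (tr \<xi> (x + s *\<^sub>R axis i 1)) = cnj (tr \<xi> x) * (cis (?w * s) * cnj (cis (?w * s)))"
        by (simp only: tr_shift complex_cnj_mult mult_ac)
      also have "cis (?w * s) * cnj (cis (?w * s)) = 1" by (simp only: cis_cnj cis_mult) simp
      finally show ?thesis by (simp only: mult.left_commute[of "cis (?w * s)"]) simp
    qed
    then have "fourier (\<lambda>x. \<phi> (x + s *\<^sub>R axis i 1, y)) \<xi> = (LINT x|Sig. cis (?w * s) * ?f (x + s *\<^sub>R axis i 1))"
      by (simp only: fourier_alt)
    also have "\<dots> = cis (?w * s) * (LINT x|Sig. ?f (x + s *\<^sub>R axis i 1))" by simp
    finally show ?thesis by (simp add: shift fc_def fourier_alt)
  qed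
  have d1: "((\<lambda>s. fourier (\<lambda>x. \<phi> (x + s *\<^sub>R axis i 1, y)) \<xi>) has_vector_derivative fc \<xi> (dir_deriv (ex i) \<phi>) y) (at 0 within {0..1})"
    using fourier_line_derivative[OF \<phi> ex_Basis[of i], of 0 "{0..1}" y \<xi>] by (simp add: fc_def)
  have "((\<lambda>s. cis (?w * s)) has_vector_derivative ?w *\<^sub>R (\<i> * cis (?w * 0))) (at 0 within {0..1})"
    by (auto simp: has_vector_derivative_complex_iff intro!: derivative_eq_intros)
  from has_vector_derivative_mult_left[OF this, of "fc \<xi> \<phi> y"]
  have d2: "((\<lambda>s. cis (?w * s) * fc \<xi> \<phi> y) has_vector_derivative (?w *\<^sub>R \<i>) * fc \<xi> \<phi> y) (at 0 within {0..1})" by simp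
  have d3: "((\<lambda>s. fourier (\<lambda>x. \<phi> (x + s *\<^sub>R axis i 1, y)) \<xi>) has_vector_derivative (?w *\<^sub>R \<i>) * fc \<xi> \<phi> y) (at 0 within {0..1})"
    by (rule has_vector_derivative_transform[OF _ J d2]) auto
  have "at 0 within {0..1::real} \<noteq> bot" by (simp add: trivial_limit_within)
  from vector_derivative_unique_within[OF this d1 d3]
  show ?thesis by (simp add: scaleR_conv_of_real mult_ac)
qed

lemma integral_Iy_FTC:
  fixes F :: "real \<Rightarrow> 'b::euclidean_space"
  assumes l: "l > 0" and F: "\<And>y. (F has_vector_derivative f y) (at y)" and c: "continuous_on UNIV f"
  shows "(LINT y|Iy l. f y) = F l - F 0"
proof -
  have m: "f \<in> borel_measurable borel" by (rule borel_measurable_continuous_onI[OF c])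
  have "(LINT y|Iy l. f y) = (LINT y|lborel. indicator {0<..<l} y *\<^sub>R f y)"
    by (subst integral_restrict_space) auto
  also have "\<dots> = (LINT y|lborel. indicator {0..l} y *\<^sub>R f y)"
  proof (rule integral_cong_AE)
    have "AE y in lborel. y \<noteq> 0" "AE y in lborel. y \<noteq> l" by (rule AE_lborel_singleton)+
    then show "AE y in lborel. indicat_real {0<..<l} y *\<^sub>R f y = indicat_real {0..l} y *\<^sub>R f y"
      by eventually_elim (auto simp: indicator_def)
  qed (use m in auto)
  also have "\<dots> = F l - F 0"
    by (rule integral_FTC_atLeastAtMost) (use l F c in \<open>auto intro: has_vector_derivative_at_within continuous_on_subset\<close>)
  finally show ?thesis .
qed

text \<open>The integral is that of the coefficient at frequency 0. A horizontal derivative carries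
  the factor 0 there; a vertical one integrates to boundary values, which vanish for a test
  function.\<close>

lemma integral_dir_deriv_test_fun:
  assumes l: "l > 0" and \<theta>: "\<theta> \<in> test_fun l" and b: "b \<in> Basis"
  shows "(LINT z|Om l. dir_deriv b \<theta> z) = 0"
proof -
  have s: "\<theta> \<in> smooth_per" using \<theta> by (simp add: test_fun_def)
  have s': "dir_deriv b \<theta> \<in> smooth_per" by (rule smooth_per_dir_deriv[OF s b])
  have "(LINT z|Om l. dir_deriv b \<theta> z) = (LINT y|Iy l. LINT x|Sig. dir_deriv b \<theta> (x, y))"
    by (rule integral_Om[OF L2_integrable[OF finite_measure_Om smooth_per_L2[OF s']]])
  also have "\<dots> = (LINT y|Iy l. Re (fc 0 (dir_deriv b \<theta>) y))"
    by (simp add: fc_def fourier_alt)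
  also have "\<dots> = 0"
  proof (cases "b = ey")
    case False
    then obtain i where "b = ex i" using b by (auto simp: Basis_pt)
    then show ?thesis by (simp add: fc_dir_deriv_ex[OF s])
  next
    case True
    obtain \<delta> where \<delta>: "\<delta> > 0" "\<And>x y. \<theta> (x, y) \<noteq> 0 \<Longrightarrow> \<delta> \<le> y \<and> y \<le> l - \<delta>" using \<theta> by (auto simp: test_fun_def)
    have "(LINT y|Iy l. Re (fc 0 (dir_deriv ey \<theta>) y)) = Re (fc 0 \<theta> l) - Re (fc 0 \<theta> 0)"
      by (rule integral_Iy_FTC[OF l])
        (auto intro!: bounded_linear.has_vector_derivative[OF bounded_linear_Re] fc_has_vector_derivative s
          continuous_intros fc_continuous smooth_per_dir_deriv)
    moreover have "\<theta> (x, l) = 0" "\<theta> (x, 0) = 0" for x using \<delta>(1) \<delta>(2)[of x l] \<delta>(2)[of x 0] by auto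
    ultimately show ?thesis using True by (simp add: fc_def)
  qed
  finally show ?thesis .
qed

lemma test_fun_mult: "\<phi> \<in> smooth_per \<Longrightarrow> \<psi> \<in> test_fun l \<Longrightarrow> (\<lambda>z. \<phi> z * \<psi> z) \<in> test_fun l"
  unfolding test_fun_def using smooth_per_mult by (auto 0 3)

text \<open>Integration by parts: the product with a test function is a test function, so the
  integral of its derivative is zero.\<close>

lemma is_weak_partial_smooth:
  assumes l: "l > 0" and \<phi>: "\<phi> \<in> smooth_per" and b: "b \<in> Basis"
  shows "is_weak_partial l b \<phi> (dir_deriv b \<phi>)"
  unfolding is_weak_partial_def
proof (intro conjI ballI)
  show L: "dir_deriv b \<phi> \<in> L2 (Om l)" by (intro smooth_per_L2 smooth_per_dir_deriv \<phi> b)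
  fix \<psi> :: "'a pt \<Rightarrow> real" assume \<psi>: "\<psi> \<in> test_fun l"
  then have \<psi>s: "\<psi> \<in> smooth_per" by (simp add: test_fun_def)
  have i: "integrable (Om l) (\<lambda>z. f z * g z)" if "f \<in> smooth_per" "g \<in> smooth_per" for f g :: "'a pt \<Rightarrow> real"
    using L2_inner_integrable[OF smooth_per_L2[OF that(1)] smooth_per_L2[OF that(2)]] by simp
  have "0 = (LINT z|Om l. \<phi> z * dir_deriv b \<psi> z + dir_deriv b \<phi> z * \<psi> z)"
    using integral_dir_deriv_test_fun[OF l test_fun_mult[OF \<phi> \<psi>] b] by (simp add: dir_deriv_mult[OF \<phi> \<psi>s])
  also have "\<dots> = (LINT z|Om l. \<phi> z * dir_deriv b \<psi> z) + (LINT z|Om l. dir_deriv b \<phi> z * \<psi> z)"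
    by (intro Bochner_Integration.integral_add i smooth_per_dir_deriv \<phi> \<psi>s b)
  finally show "(LINT z|Om l. \<phi> z * dir_deriv b \<psi> z) = - (LINT z|Om l. dir_deriv b \<phi> z * \<psi> z)" by simp
qed


section \<open>Modes with smooth profile\<close>

definition csmooth :: "(real \<Rightarrow> complex) \<Rightarrow> bool" where
  "csmooth p \<longleftrightarrow> smooth (\<lambda>y. Re (p y)) \<and> smooth (\<lambda>y. Im (p y))"

lemma csmooth_fc: "\<phi> \<in> smooth_per \<Longrightarrow> csmooth (fc \<xi> \<phi>)"
  using Ck_fc by (auto simp: csmooth_def smooth_def)

lemma bounded_linear_phase: "bounded_linear (\<lambda>z :: ('n::finite) pt. 2 * pi * (freq \<xi> \<bullet> fst z))"
  by (intro bounded_linear_const_mult bounded_linear_inner_right_comp bounded_linear_fst)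

lemma mode_alt:
  "mode \<xi> p z = Re (p (snd z)) * cos (2 * pi * (freq \<xi> \<bullet> fst z)) - Im (p (snd z)) * sin (2 * pi * (freq \<xi> \<bullet> fst z))"
  by (simp add: mode_def tr_def)

lemma mode_smooth_per:
  assumes "csmooth p"
  shows "mode \<xi> p \<in> smooth_per"
  unfolding smooth_per_def smooth_def
proof (intro CollectI conjI allI)
  fix k
  have r: "Ck k (\<lambda>z :: 'a pt. Re (p (snd z)))" "Ck k (\<lambda>z :: 'a pt. Im (p (snd z)))"
    using assms Ck_compose[of k "\<lambda>y. Re (p y)" "snd :: 'a pt \<Rightarrow> real"] Ck_compose[of k "\<lambda>y. Im (p y)" "snd :: 'a pt \<Rightarrow> real"]
      Ck_linear[OF bounded_linear_snd, of k]
    by (auto simp: csmooth_def smooth_def)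
  have t: "Ck k (\<lambda>z :: 'a pt. cos (2 * pi * (freq \<xi> \<bullet> fst z)))" "Ck k (\<lambda>z :: 'a pt. sin (2 * pi * (freq \<xi> \<bullet> fst z)))"
    by (rule Ck_compose, use Ck_sin_cos in blast, rule Ck_linear[OF bounded_linear_phase])+
  show "Ck k (mode \<xi> p)" unfolding mode_alt[abs_def] by (intro Ck_diff Ck_mult r t)
next
  show "mode \<xi> p (x + axis i 1, y) = mode \<xi> p (x, y)" for x y i by (simp add: mode_def tr_periodic)
qed

lemma dir_deriv_mode:
  assumes p: "\<And>y. (p has_vector_derivative p' y) (at y)"
  shows "dir_deriv v (mode \<xi> p) = (\<lambda>z. snd v * mode \<xi> p' z + mode \<xi> (\<lambda>y. 2 * pi * \<i> * of_real (freq \<xi> \<bullet> fst v) * p y) z)"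
proof
  fix z :: "'a pt"
  have s: "(snd has_derivative (snd :: 'a pt \<Rightarrow> real)) (at z)" by (rule bounded_linear_imp_has_derivative[OF bounded_linear_snd])
  have "((\<lambda>z :: 'a pt. p (snd z)) has_derivative (\<lambda>v. snd v *\<^sub>R p' (snd z))) (at z)"
    using has_derivative_compose[OF s p[unfolded has_vector_derivative_def]] .
  then have re: "((\<lambda>z :: 'a pt. Re (p (snd z))) has_derivative (\<lambda>v. Re (snd v *\<^sub>R p' (snd z)))) (at z)"
    and im: "((\<lambda>z :: 'a pt. Im (p (snd z))) has_derivative (\<lambda>v. Im (snd v *\<^sub>R p' (snd z)))) (at z)"
    by (rule bounded_linear.has_derivative[OF bounded_linear_Re], rule bounded_linear.has_derivative[OF bounded_linear_Im])
  have ph: "((\<lambda>z :: 'a pt. 2 * pi * (freq \<xi> \<bullet> fst z)) has_derivative (\<lambda>v. 2 * pi * (freq \<xi> \<bullet> fst v))) (at z)"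
    by (rule bounded_linear_imp_has_derivative[OF bounded_linear_phase])
  have "(mode \<xi> p has_derivative (\<lambda>v.
       (Re (p (snd z)) * (- sin (2 * pi * (freq \<xi> \<bullet> fst z)) * (2 * pi * (freq \<xi> \<bullet> fst v))) + Re (snd v *\<^sub>R p' (snd z)) * cos (2 * pi * (freq \<xi> \<bullet> fst z)))
     - (Im (p (snd z)) * (cos (2 * pi * (freq \<xi> \<bullet> fst z)) * (2 * pi * (freq \<xi> \<bullet> fst v))) + Im (snd v *\<^sub>R p' (snd z)) * sin (2 * pi * (freq \<xi> \<bullet> fst z))))) (at z)"
    unfolding mode_alt[abs_def]
    by (intro has_derivative_diff has_derivative_mult re im)
      (rule has_derivative_eq_rhs, rule has_derivative_compose[OF ph], (rule DERIV_cos[unfolded has_field_derivative_def] DERIV_sin[unfolded has_field_derivative_def]), simp)+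
  from dir_deriv_eq[OF this, of v]
  show "dir_deriv v (mode \<xi> p) z = snd v * mode \<xi> p' z + mode \<xi> (\<lambda>y. 2 * pi * \<i> * of_real (freq \<xi> \<bullet> fst v) * p y) z"
    by (simp add: mode_alt algebra_simps)
qed

text \<open>Projection onto a frequency commutes with differentiation. By approximation this passes
  to Sobolev functions in \<open>approx_H1_mode\<close>.\<close>

lemma mode_fc_dir_deriv:
  assumes \<phi>: "\<phi> \<in> smooth_per" and b: "b \<in> Basis"
  shows "dir_deriv b (mode \<xi> (fc \<xi> \<phi>)) = mode \<xi> (fc \<xi> (dir_deriv b \<phi>))"
proof (cases "b = ey")
  case True
  show ?thesis unfolding True
    by (subst dir_deriv_mode[OF fc_has_vector_derivative[OF \<phi>]]) (auto simp: mode_def)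
next
  case False
  then obtain i where i: "b = ex i" using b by (auto simp: Basis_pt)
  have "freq \<xi> \<bullet> axis i 1 = of_int (\<xi> $ i)" by (simp add: inner_axis freq_def)
  then show ?thesis unfolding i
    by (subst dir_deriv_mode[OF fc_has_vector_derivative[OF \<phi>]]) (auto simp: mode_def fc_dir_deriv_ex[OF \<phi>])
qed


section \<open>Uniqueness of weak derivatives\<close>

lemma mode_test_fun:
  assumes "\<eta> \<in> interval_test l"
  shows "mode \<xi> (\<lambda>y. c * of_real (\<eta> y)) \<in> test_fun l"
proof -
  have "csmooth (\<lambda>y. c * of_real (\<eta> y))"
    using assms by (auto simp: csmooth_def smooth_def interval_test_def intro: Ck_cmult)
  then have "mode \<xi> (\<lambda>y. c * of_real (\<eta> y)) \<in> smooth_per" by (rule mode_smooth_per)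
  moreover obtain \<delta> where "\<delta> > 0" "\<And>y. \<eta> y \<noteq> 0 \<Longrightarrow> \<delta> \<le> y \<and> y \<le> l - \<delta>"
    using assms by (auto simp: interval_test_def)
  then have "\<exists>\<delta>>0. \<forall>x y. mode \<xi> (\<lambda>y. c * of_real (\<eta> y)) (x, y) \<noteq> 0 \<longrightarrow> \<delta> \<le> y \<and> y \<le> l - \<delta>"
    by (intro exI[of _ \<delta>]) (auto simp: mode_def)
  ultimately show ?thesis by (simp add: test_fun_def)
qed

lemma interval_test_L2: "\<eta> \<in> interval_test l \<Longrightarrow> (\<lambda>y. c * complex_of_real (\<eta> y)) \<in> L2 (Iy l)"
proof -
  assume \<eta>: "\<eta> \<in> interval_test l"
  then have c: "continuous_on UNIV \<eta>" using Ck_continuous by (auto simp: interval_test_def smooth_def)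
  have "compact (\<eta> ` {0..l})" by (intro compact_continuous_image continuous_on_subset[OF c]) auto
  then obtain B where B: "\<And>y. y \<in> {0..l} \<Longrightarrow> \<bar>\<eta> y\<bar> \<le> B"
    by (force dest!: compact_imp_bounded simp: bounded_iff)
  have m: "(\<lambda>y. c * complex_of_real (\<eta> y)) \<in> borel_measurable (Iy l)"
    by (intro borel_measurable_Iy borel_measurable_continuous_onI continuous_intros c)
  show ?thesis
  proof (rule L2_bounded[OF finite_measure_Iy m, of "norm c * B"], rule AE_I2)
    fix y assume "y \<in> space (Iy l)"
    then show "norm (c * complex_of_real (\<eta> y)) \<le> norm c * B"
      using B[of y] by (auto simp: norm_mult intro!: mult_left_mono)
  qed
qed

text \<open>Modes with a compactly supported profile are test functions, so each Fourier coefficient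
  of \<open>f\<close> is orthogonal to all test functions of the interval and the one-dimensional
  fundamental lemma applies.\<close>

lemma AE_zero_if_orthogonal_test_fun:
  assumes l: "l > 0" and f: "f \<in> L2 (Om l)" and o: "\<And>\<phi>. \<phi> \<in> test_fun l \<Longrightarrow> (LINT z|Om l. f z * \<phi> z) = 0"
  shows "AE z in Om l. f z = 0"
proof (rule fc_eq_0_imp_AE_0[OF f])
  fix \<xi>
  note fcL = fc_L2[OF f, of \<xi>]
  have i: "integrable (Iy l) (fc \<xi> f)" by (rule L2_integrable[OF finite_measure_Iy fcL])
  have comp: "(LINT y|Iy l. (fc \<xi> f y \<bullet> c) * \<eta> y) = 0" if \<eta>: "\<eta> \<in> interval_test l" for \<eta> c
  proof -
    have "L2_inner (Om l) f (mode \<xi> (\<lambda>y. c * of_real (\<eta> y))) = 0"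
      using o[OF mode_test_fun[OF \<eta>]] by (simp add: L2_inner_def)
    then have "L2_inner (Iy l) (fc \<xi> f) (\<lambda>y. c * of_real (\<eta> y)) = 0"
      using L2_inner_mode[OF f interval_test_L2[OF \<eta>]] by simp
    then show ?thesis by (simp add: L2_inner_def inner_complex_def algebra_simps)
  qed
  have "AE y in Iy l. fc \<xi> f y \<bullet> c = 0" for c
    by (rule fundamental_lemma_interval[OF l]) (use i comp in \<open>auto intro!: integrable_inner_left\<close>)
  from this[of 1] this[of \<i>] show "AE y in Iy l. fc \<xi> f y = 0"
    by eventually_elim (simp add: complex_eq_iff inner_complex_def)
qed

lemma weak_partial_unique:
  assumes l: "l > 0" and g: "is_weak_partial l b f g" "is_weak_partial l b f g'"
  shows "AE z in Om l. g z = g' z"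
proof -
  have L: "g \<in> L2 (Om l)" "g' \<in> L2 (Om l)" using g by (auto simp: is_weak_partial_def)
  have "AE z in Om l. g z - g' z = 0"
  proof (rule AE_zero_if_orthogonal_test_fun[OF l L2_diff[OF L]])
    fix \<phi> :: "'a pt \<Rightarrow> real" assume \<phi>: "\<phi> \<in> test_fun l"
    then have \<phi>L: "\<phi> \<in> L2 (Om l)" by (auto simp: test_fun_def intro: smooth_per_L2)
    have "(LINT z|Om l. (g z - g' z) * \<phi> z) = (LINT z|Om l. g z * \<phi> z) - (LINT z|Om l. g' z * \<phi> z)"
      using L2_inner_diff_left[OF L \<phi>L] by (simp add: L2_inner_def)
    also have "\<dots> = 0" using g \<phi> by (auto simp: is_weak_partial_def)
    finally show "(LINT z|Om l. (g z - g' z) * \<phi> z) = 0" .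
  qed
  then show ?thesis by simp
qed

lemma is_weak_partial_weak_partial: "is_weak_partial l b f g \<Longrightarrow> is_weak_partial l b f (weak_partial l b f)"
  unfolding weak_partial_def by (rule someI[where P = "is_weak_partial l b f"])

lemma weak_partial_AE_eq:
  assumes "l > 0" "is_weak_partial l b f g"
  shows "AE z in Om l. weak_partial l b f z = g z"
  by (rule weak_partial_unique[OF assms(1) is_weak_partial_weak_partial[OF assms(2)] assms(2)])

lemma is_weak_partial_add:
  assumes "f \<in> L2 (Om l)" "f' \<in> L2 (Om l)" "is_weak_partial l b f g" "is_weak_partial l b f' g'" "b \<in> Basis"
  shows "is_weak_partial l b (\<lambda>z. f z + f' z) (\<lambda>z. g z + g' z)"
  unfolding is_weak_partial_def
proof (intro conjI ballI)
  have L: "g \<in> L2 (Om l)" "g' \<in> L2 (Om l)" using assms by (auto simp: is_weak_partial_def)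
  then show "(\<lambda>z. g z + g' z) \<in> L2 (Om l)" by (rule L2_add)
  fix \<phi> :: "'a pt \<Rightarrow> real" assume \<phi>: "\<phi> \<in> test_fun l"
  then have \<phi>L: "\<phi> \<in> L2 (Om l)" "dir_deriv b \<phi> \<in> L2 (Om l)"
    using assms(5) by (auto simp: test_fun_def intro: smooth_per_L2 smooth_per_dir_deriv)
  show "(LINT z|Om l. (f z + f' z) * dir_deriv b \<phi> z) = - (LINT z|Om l. (g z + g' z) * \<phi> z)"
    using L2_inner_add_left[OF assms(1,2) \<phi>L(2)] L2_inner_add_left[OF L \<phi>L(1)] assms(3,4) \<phi>
    by (auto simp: is_weak_partial_def L2_inner_def)
qed

lemma is_weak_partial_scale:
  assumes "is_weak_partial l b f g"
  shows "is_weak_partial l b (\<lambda>z. c * f z) (\<lambda>z. c * g z)"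
  using assms L2_scaleR[of g "Om l" c] by (auto simp: is_weak_partial_def mult.assoc)

section \<open>Sobolev functions as limits of smooth functions\<close>

text \<open>Convergence of smooth functions in H1 with the limits \<open>g\<close> of the
  derivatives named explicitly. This avoids handling the representatives chosen in
  \<open>weak_partial\<close>.\<close>

definition approx_H1 :: "real \<Rightarrow> (nat \<Rightarrow> ('n::finite) pt \<Rightarrow> real) \<Rightarrow> ('n pt \<Rightarrow> real) \<Rightarrow> ('n pt \<Rightarrow> 'n pt \<Rightarrow> real) \<Rightarrow> bool" where
  "approx_H1 l \<phi> f g \<longleftrightarrow> f \<in> L2 (Om l) \<and> (\<forall>k. \<phi> k \<in> smooth_per) \<and>
     (\<lambda>k. L2_norm (Om l) (\<lambda>z. \<phi> k z - f z)) \<longlonglongrightarrow> 0 \<and>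
     (\<forall>b\<in>Basis. g b \<in> L2 (Om l) \<and> (\<lambda>k. L2_norm (Om l) (\<lambda>z. dir_deriv b (\<phi> k) z - g b z)) \<longlonglongrightarrow> 0)"

lemma H1_weak_partial:
  assumes "f \<in> H1 l" "b \<in> Basis"
  shows "is_weak_partial l b f (weak_partial l b f)" "weak_partial l b f \<in> L2 (Om l)"
proof -
  show "is_weak_partial l b f (weak_partial l b f)"
    using assms is_weak_partial_weak_partial[of l b f] by (auto simp: H1_def)
  then show "weak_partial l b f \<in> L2 (Om l)" by (simp add: is_weak_partial_def)
qed

lemma approx_H1_weak_partial:
  assumes l: "l > 0" and a: "approx_H1 l \<phi> f g" and b: "b \<in> Basis"
  shows "is_weak_partial l b f (g b)"
  unfolding is_weak_partial_def
proof (intro conjI ballI)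
  have L: "f \<in> L2 (Om l)" "g b \<in> L2 (Om l)" "\<And>k. \<phi> k \<in> smooth_per" using a b by (auto simp: approx_H1_def)
  show "g b \<in> L2 (Om l)" by fact
  fix \<psi> :: "'a pt \<Rightarrow> real" assume \<psi>: "\<psi> \<in> test_fun l"
  then have \<psi>L: "\<psi> \<in> L2 (Om l)" "dir_deriv b \<psi> \<in> L2 (Om l)"
    using b by (auto simp: test_fun_def intro: smooth_per_L2 smooth_per_dir_deriv)
  have t1: "(\<lambda>k. L2_inner (Om l) (\<phi> k) (dir_deriv b \<psi>)) \<longlonglongrightarrow> L2_inner (Om l) f (dir_deriv b \<psi>)"
    using a \<psi>L L by (intro L2_inner_tendsto) (auto simp: approx_H1_def intro: smooth_per_L2)
  have t2: "(\<lambda>k. L2_inner (Om l) (dir_deriv b (\<phi> k)) \<psi>) \<longlonglongrightarrow> L2_inner (Om l) (g b) \<psi>"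
    using a \<psi>L L b by (intro L2_inner_tendsto) (auto simp: approx_H1_def intro!: smooth_per_L2 smooth_per_dir_deriv)
  have e: "L2_inner (Om l) (\<phi> k) (dir_deriv b \<psi>) = - L2_inner (Om l) (dir_deriv b (\<phi> k)) \<psi>" for k
    using is_weak_partial_smooth[OF l L(3) b, of k] \<psi> by (simp add: is_weak_partial_def L2_inner_def)
  have "L2_inner (Om l) f (dir_deriv b \<psi>) = - L2_inner (Om l) (g b) \<psi>"
    by (rule LIMSEQ_unique[OF t1[unfolded e] tendsto_minus[OF t2]])
  then show "(LINT z|Om l. f z * dir_deriv b \<psi> z) = - (LINT z|Om l. g b z * \<psi> z)"
    by (simp add: L2_inner_def)
qed

lemma approx_H1_in_H1: "l > 0 \<Longrightarrow> approx_H1 l \<phi> f g \<Longrightarrow> f \<in> H1 l"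
proof -
  assume a: "l > 0" "approx_H1 l \<phi> f g"
  then have "\<exists>g. is_weak_partial l b f g" if "b \<in> Basis" for b using approx_H1_weak_partial that by blast
  moreover have "f \<in> L2 (Om l)" using a(2) by (simp add: approx_H1_def)
  ultimately show ?thesis by (simp add: H1_def)
qed

lemma weak_partial_diff_smooth:
  assumes l: "l > 0" and \<phi>: "\<phi> \<in> smooth_per" and f: "f \<in> L2 (Om l)" and g: "is_weak_partial l b f g" and b: "b \<in> Basis"
  shows "L2_norm (Om l) (weak_partial l b (\<phi> - f)) = L2_norm (Om l) (\<lambda>z. dir_deriv b \<phi> z - g z)"
proof -
  have w: "is_weak_partial l b (\<phi> - f) (\<lambda>z. dir_deriv b \<phi> z - g z)"
    using is_weak_partial_add[OF smooth_per_L2[OF \<phi>] L2_minus[OF f] is_weak_partial_smooth[OF l \<phi> b], of "\<lambda>z. - g z"]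
      is_weak_partial_scale[OF g, of "-1"] b by (simp add: fun_diff_def)
  then have L: "(\<lambda>z. dir_deriv b \<phi> z - g z) \<in> L2 (Om l)" by (simp add: is_weak_partial_def)
  have L': "weak_partial l b (\<phi> - f) \<in> L2 (Om l)"
    using is_weak_partial_weak_partial[OF w] by (simp add: is_weak_partial_def)
  show ?thesis by (rule L2_norm_cong_AE[OF L2_measurable[OF L'] L2_measurable[OF L] weak_partial_AE_eq[OF l w]])
qed

text \<open>By uniqueness of weak derivatives the representatives chosen inside
  \<open>H1_norm\<close> agree almost everywhere with the prescribed \<open>g b\<close>, so the
  norms coincide.\<close>

lemma H1_norm_tendsto_iff:
  assumes l: "l > 0" and \<phi>: "\<And>k. \<phi> k \<in> smooth_per" and f: "f \<in> L2 (Om l)"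
    and g: "\<And>b. b \<in> Basis \<Longrightarrow> is_weak_partial l b f (g b)"
  shows "(\<lambda>k. H1_norm l (\<phi> k - f)) \<longlonglongrightarrow> 0 \<longleftrightarrow> approx_H1 l \<phi> f g"
proof -
  have gL: "g b \<in> L2 (Om l)" if "b \<in> Basis" for b using g[OF that] by (simp add: is_weak_partial_def)
  have H: "H1_norm l (\<phi> k - f) = sqrt ((L2_norm (Om l) (\<lambda>z. \<phi> k z - f z))^2 +
      (\<Sum>b\<in>Basis. (L2_norm (Om l) (\<lambda>z. dir_deriv b (\<phi> k) z - g b z))^2))" for k
  proof -
    have a: "L2_norm (Om l) (\<phi> k - f) = L2_norm (Om l) (\<lambda>z. \<phi> k z - f z)" by (simp add: fun_diff_def)
    have s: "(\<Sum>b\<in>Basis. (L2_norm (Om l) (weak_partial l b (\<phi> k - f)))^2) =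
        (\<Sum>b\<in>Basis. (L2_norm (Om l) (\<lambda>z. dir_deriv b (\<phi> k) z - g b z))^2)"
      by (rule sum.cong) (simp_all only: weak_partial_diff_smooth[OF l \<phi> f g])
    show ?thesis by (simp only: H1_norm_def a s)
  qed
  show ?thesis
  proof
    assume "(\<lambda>k. H1_norm l (\<phi> k - f)) \<longlonglongrightarrow> 0"
    moreover have "L2_norm (Om l) (\<lambda>z. \<phi> k z - f z) \<le> H1_norm l (\<phi> k - f)" for k
      unfolding H by (rule real_le_rsqrt) (simp add: sum_nonneg)
    moreover have "L2_norm (Om l) (\<lambda>z. dir_deriv b (\<phi> k) z - g b z) \<le> H1_norm l (\<phi> k - f)" if "b \<in> Basis" for k b
    proof -
      have "(L2_norm (Om l) (\<lambda>z. dir_deriv b (\<phi> k) z - g b z))^2 \<le> (\<Sum>b\<in>Basis. (L2_norm (Om l) (\<lambda>z. dir_deriv b (\<phi> k) z - g b z))^2)"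
        by (rule member_le_sum[OF that]) auto
      then show ?thesis unfolding H by (intro real_le_rsqrt) (simp add: add_increasing)
    qed
    ultimately show "approx_H1 l \<phi> f g"
      unfolding approx_H1_def using f \<phi> gL
      by (auto intro!: tendsto_sandwich[OF _ _ tendsto_const, where h = "\<lambda>k. H1_norm l (\<phi> k - f)"]
          always_eventually L2_norm_nonneg)
  next
    assume "approx_H1 l \<phi> f g"
    then have "(\<lambda>k. H1_norm l (\<phi> k - f)) \<longlonglongrightarrow> sqrt (0\<^sup>2 + (\<Sum>b\<in>(Basis :: 'a pt set). 0\<^sup>2))"
      unfolding H by (intro tendsto_intros) (auto simp: approx_H1_def)
    then show "(\<lambda>k. H1_norm l (\<phi> k - f)) \<longlonglongrightarrow> 0" by simp
  qed
qed

text \<open>A trace carries a smooth approximating sequence with it. For the components of a field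
  in \<open>V l\<close> the zero trace at the bottom supplies this sequence.\<close>

lemma has_traceE:
  assumes "l > 0" "has_trace l c f g"
  obtains \<phi> where "approx_H1 l \<phi> f (\<lambda>b. weak_partial l b f)" "f \<in> H1 l" "g \<in> L2 Sig"
    "(\<lambda>k. L2_norm Sig (\<lambda>x. \<phi> k (x, c) - g x)) \<longlonglongrightarrow> 0"
proof -
  obtain \<phi> where \<phi>: "f \<in> H1 l" "g \<in> L2 Sig" "\<And>k. \<phi> k \<in> smooth_per"
    "(\<lambda>k. H1_norm l (\<phi> k - f)) \<longlonglongrightarrow> 0" "(\<lambda>k. L2_norm Sig (\<lambda>x. \<phi> k (x, c) - g x)) \<longlonglongrightarrow> 0"
    using assms(2) by (auto simp: has_trace_def)
  have f: "f \<in> L2 (Om l)" using \<phi>(1) by (simp add: H1_def)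
  have "approx_H1 l \<phi> f (\<lambda>b. weak_partial l b f)"
    by (rule H1_norm_tendsto_iff[THEN iffD1]) (use assms(1) \<phi> f H1_weak_partial(1)[OF \<phi>(1)] in auto)
  from that[OF this \<phi>(1,2,5)] show ?thesis .
qed

lemma has_traceI:
  assumes l: "l > 0" and a: "approx_H1 l \<phi> f g" and t: "k \<in> L2 Sig" "(\<lambda>n. L2_norm Sig (\<lambda>x. \<phi> n (x, c) - k x)) \<longlonglongrightarrow> 0"
  shows "has_trace l c f k"
proof -
  have \<phi>: "\<And>k. \<phi> k \<in> smooth_per" and f: "f \<in> L2 (Om l)" using a by (auto simp: approx_H1_def)
  have "(\<lambda>k. H1_norm l (\<phi> k - f)) \<longlonglongrightarrow> 0"
    by (rule H1_norm_tendsto_iff[THEN iffD2]) (use l \<phi> f a approx_H1_weak_partial[OF l a] in auto)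
  then show ?thesis unfolding has_trace_def
    by (intro conjI exI[of _ \<phi>] allI approx_H1_in_H1[OF l a] t \<phi>)
qed

lemma approx_H1_const: "\<phi> \<in> smooth_per \<Longrightarrow> approx_H1 l (\<lambda>_. \<phi>) \<phi> (\<lambda>b. dir_deriv b \<phi>)"
  by (auto simp: approx_H1_def intro: smooth_per_L2 smooth_per_dir_deriv)

lemma has_trace_smooth: "l > 0 \<Longrightarrow> \<phi> \<in> smooth_per \<Longrightarrow> has_trace l c \<phi> (\<lambda>x. \<phi> (x, c))"
  by (rule has_traceI[OF _ approx_H1_const]) (auto intro: smooth_per_slice_L2)

lemma tendsto_L2_norm_lincomb:
  fixes f f' :: "nat \<Rightarrow> 'a \<Rightarrow> real"
  assumes L: "\<And>k. f k \<in> L2 M" "g \<in> L2 M" "\<And>k. f' k \<in> L2 M" "g' \<in> L2 M"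
    and "(\<lambda>k. L2_norm M (\<lambda>z. f k z - g z)) \<longlonglongrightarrow> 0" "(\<lambda>k. L2_norm M (\<lambda>z. f' k z - g' z)) \<longlonglongrightarrow> 0"
  shows "(\<lambda>k. L2_norm M (\<lambda>z. (a * f k z + b * f' k z) - (a * g z + b * g' z))) \<longlonglongrightarrow> 0"
proof (rule tendsto_sandwich[OF _ _ tendsto_const])
  show "(\<lambda>k. \<bar>a\<bar> * L2_norm M (\<lambda>z. f k z - g z) + \<bar>b\<bar> * L2_norm M (\<lambda>z. f' k z - g' z)) \<longlonglongrightarrow> 0"
    using assms by (auto intro!: tendsto_eq_intros)
  show "\<forall>\<^sub>F k in sequentially. L2_norm M (\<lambda>z. (a * f k z + b * f' k z) - (a * g z + b * g' z)) \<le>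
     \<bar>a\<bar> * L2_norm M (\<lambda>z. f k z - g z) + \<bar>b\<bar> * L2_norm M (\<lambda>z. f' k z - g' z)"
  proof (rule always_eventually, rule allI)
    fix k
    have "(\<lambda>z. (a * f k z + b * f' k z) - (a * g z + b * g' z)) = (\<lambda>z. a *\<^sub>R (f k z - g z) + b *\<^sub>R (f' k z - g' z))"
      by (auto simp: algebra_simps)
    then show "L2_norm M (\<lambda>z. (a * f k z + b * f' k z) - (a * g z + b * g' z)) \<le>
       \<bar>a\<bar> * L2_norm M (\<lambda>z. f k z - g z) + \<bar>b\<bar> * L2_norm M (\<lambda>z. f' k z - g' z)"
      using L2_norm_triangle[OF L2_scaleR[OF L2_diff[OF L(1,2)]] L2_scaleR[OF L2_diff[OF L(3,4)]], of a k b k]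
      by (simp only: L2_norm_scaleR)
  qed
qed (simp add: L2_norm_nonneg)

lemma L2_lincomb: "f \<in> L2 M \<Longrightarrow> g \<in> L2 M \<Longrightarrow> (\<lambda>z. a * f z + b * g z) \<in> L2 M" for f g :: "'a \<Rightarrow> real"
  using L2_add[OF L2_scaleR L2_scaleR] by fastforce

lemma dir_deriv_lincomb:
  assumes "\<phi> \<in> smooth_per" "\<psi> \<in> smooth_per"
  shows "dir_deriv v (\<lambda>z. a * \<phi> z + b * \<psi> z) = (\<lambda>z. a * dir_deriv v \<phi> z + b * dir_deriv v \<psi> z)"
  by (rule ext, rule dir_deriv_eq[OF has_derivative_add[OF has_derivative_mult_right has_derivative_mult_right]])
    (auto intro: smooth_per_has_derivative assms)

lemma has_trace_lincomb:
  assumes l: "l > 0" and t: "has_trace l c f g" "has_trace l c f' g'"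
  shows "has_trace l c (\<lambda>z. a * f z + b * f' z) (\<lambda>x. a * g x + b * g' x)"
proof -
  obtain \<phi> where \<phi>: "approx_H1 l \<phi> f (\<lambda>b. weak_partial l b f)" "g \<in> L2 Sig"
    "(\<lambda>k. L2_norm Sig (\<lambda>x. \<phi> k (x, c) - g x)) \<longlonglongrightarrow> 0" by (rule has_traceE[OF l t(1)])
  obtain \<psi> where \<psi>: "approx_H1 l \<psi> f' (\<lambda>b. weak_partial l b f')" "g' \<in> L2 Sig"
    "(\<lambda>k. L2_norm Sig (\<lambda>x. \<psi> k (x, c) - g' x)) \<longlonglongrightarrow> 0" by (rule has_traceE[OF l t(2)])
  have s: "\<phi> k \<in> smooth_per" "\<psi> k \<in> smooth_per" for k using \<phi> \<psi> by (auto simp: approx_H1_def)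
  have "approx_H1 l (\<lambda>k z. a * \<phi> k z + b * \<psi> k z) (\<lambda>z. a * f z + b * f' z)
      (\<lambda>v z. a * weak_partial l v f z + b * weak_partial l v f' z)"
    unfolding approx_H1_def
  proof (intro conjI allI ballI)
    show "(\<lambda>z. a * f z + b * f' z) \<in> L2 (Om l)" using \<phi>(1) \<psi>(1) by (auto simp: approx_H1_def intro: L2_lincomb)
    show "(\<lambda>z. a * \<phi> k z + b * \<psi> k z) \<in> smooth_per" for k by (intro smooth_per_add smooth_per_scale s)
    show "(\<lambda>k. L2_norm (Om l) (\<lambda>z. (a * \<phi> k z + b * \<psi> k z) - (a * f z + b * f' z))) \<longlonglongrightarrow> 0"
      using \<phi>(1) \<psi>(1) by (intro tendsto_L2_norm_lincomb) (auto simp: approx_H1_def intro: smooth_per_L2)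
    fix v :: "'a pt" assume v: "v \<in> Basis"
    show "(\<lambda>z. a * weak_partial l v f z + b * weak_partial l v f' z) \<in> L2 (Om l)"
      using \<phi>(1) \<psi>(1) v by (auto simp: approx_H1_def intro: L2_lincomb)
    show "(\<lambda>k. L2_norm (Om l) (\<lambda>z. dir_deriv v (\<lambda>z. a * \<phi> k z + b * \<psi> k z) z - (a * weak_partial l v f z + b * weak_partial l v f' z))) \<longlonglongrightarrow> 0"
      unfolding dir_deriv_lincomb[OF s]
      using \<phi>(1) \<psi>(1) v by (intro tendsto_L2_norm_lincomb) (auto simp: approx_H1_def intro!: smooth_per_L2 smooth_per_dir_deriv)
  qed
  then show ?thesis
    by (rule has_traceI[OF l]) (auto intro!: L2_lincomb tendsto_L2_norm_lincomb \<phi> \<psi> smooth_per_slice_L2 s)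
qed


section \<open>Fourier coefficients of Sobolev functions and of their traces\<close>

lemma L2_ident_mult:
  fixes p :: "real \<Rightarrow> complex"
  assumes "p \<in> L2 (Iy l)"
  shows "(\<lambda>y. complex_of_real (y - a) * p y) \<in> L2 (Iy l)"
proof (rule L2_bound[OF L2_scaleR[OF assms, of "l + \<bar>a\<bar>"]])
  have "(\<lambda>y. complex_of_real (y - a)) \<in> borel_measurable (Iy l)"
    by (intro borel_measurable_Iy borel_measurable_continuous_onI continuous_intros)
  then show "(\<lambda>y. complex_of_real (y - a) * p y) \<in> borel_measurable (Iy l)"
    using L2_measurable[OF assms] by measurable
  show "AE y in Iy l. norm (complex_of_real (y - a) * p y) \<le> norm ((l + \<bar>a\<bar>) *\<^sub>R p y)"
  proof (rule AE_I2)
    fix y assume "y \<in> space (Iy l)"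
    then have "\<bar>y - a\<bar> \<le> \<bar>l + \<bar>a\<bar>\<bar>" by auto
    then show "norm (complex_of_real (y - a) * p y) \<le> norm ((l + \<bar>a\<bar>) *\<^sub>R p y)"
      unfolding norm_mult norm_scaleR norm_of_real by (intro mult_right_mono) auto
  qed
qed

lemma L2_integral_tendsto:
  fixes f :: "nat \<Rightarrow> 'a \<Rightarrow> 'b::euclidean_space"
  assumes M: "finite_measure M" and L: "\<And>k. f k \<in> L2 M" "g \<in> L2 M" and t: "(\<lambda>k. L2_norm M (\<lambda>z. f k z - g z)) \<longlonglongrightarrow> 0"
  shows "(\<lambda>k. LINT z|M. f k z) \<longlonglongrightarrow> (LINT z|M. g z)"
proof (rule LIM_zero_cancel)
  show "(\<lambda>k. (LINT z|M. f k z) - (LINT z|M. g z)) \<longlonglongrightarrow> 0"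
  proof (rule Lim_null_comparison)
    show "(\<lambda>k. sqrt (measure M (space M)) * L2_norm M (\<lambda>z. f k z - g z)) \<longlonglongrightarrow> 0"
      using t by (auto intro!: tendsto_eq_intros)
    show "\<forall>\<^sub>F k in sequentially. norm ((LINT z|M. f k z) - (LINT z|M. g z)) \<le> sqrt (measure M (space M)) * L2_norm M (\<lambda>z. f k z - g z)"
    proof (rule always_eventually, rule allI)
      fix k
      have "(LINT z|M. f k z) - (LINT z|M. g z) = (LINT z|M. f k z - g z)"
        using L2_integrable[OF M L(1)] L2_integrable[OF M L(2)] by simp
      then show "norm ((LINT z|M. f k z) - (LINT z|M. g z)) \<le> sqrt (measure M (space M)) * L2_norm M (\<lambda>z. f k z - g z)"
        using norm_integral_le_L2_norm[OF M L2_diff[OF L(1,2)], of k] by simp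
    qed
  qed
qed

lemma fourier_tendsto:
  assumes "\<And>k. f k \<in> L2 Sig" "g \<in> L2 Sig" "(\<lambda>k. L2_norm Sig (\<lambda>x. f k x - g x)) \<longlonglongrightarrow> 0"
  shows "(\<lambda>k. fourier (f k) \<xi>) \<longlonglongrightarrow> fourier g \<xi>"
proof (rule LIM_zero_cancel, rule Lim_null_comparison[OF always_eventually assms(3)], rule allI)
  show "norm (fourier (f k) \<xi> - fourier g \<xi>) \<le> L2_norm Sig (\<lambda>x. f k x - g x)" for k
    using cmod_fourier_le[OF L2_diff[OF assms(1)[of k] assms(2)]] assms by (simp add: fourier_diff)
qed

text \<open>Integrates the derivative of \<open>(y - (l - c)) * fc \<xi> f y\<close>, whose weight
  vanishes at the end opposite to \<open>c\<close>; first for smooth functions, then in the limit.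
  The right-hand side no longer mentions the boundary, which yields uniqueness of traces.\<close>

lemma fourier_trace:
  assumes l: "l > 0" and t: "has_trace l c f g" and c: "c = 0 \<or> c = l"
  shows "l * fourier g \<xi> = (LINT y|Iy l. fc \<xi> f y) + (LINT y|Iy l. of_real (y - (l - c)) * fc \<xi> (weak_partial l ey f) y)"
proof -
  obtain \<phi> where \<phi>: "approx_H1 l \<phi> f (\<lambda>b. weak_partial l b f)" "g \<in> L2 Sig"
    "(\<lambda>k. L2_norm Sig (\<lambda>x. \<phi> k (x, c) - g x)) \<longlonglongrightarrow> 0" by (rule has_traceE[OF l t])
  have s: "\<phi> k \<in> smooth_per" for k using \<phi> by (auto simp: approx_H1_def)
  have s': "dir_deriv ey (\<phi> k) \<in> smooth_per" for k by (rule smooth_per_dir_deriv[OF s]) simp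
  have fL: "f \<in> L2 (Om l)" "weak_partial l ey f \<in> L2 (Om l)" using \<phi>(1) by (auto simp: approx_H1_def)
  have eq: "l * fourier (\<lambda>x. \<phi> k (x, c)) \<xi> = (LINT y|Iy l. fc \<xi> (\<phi> k) y) + (LINT y|Iy l. of_real (y - (l - c)) * fc \<xi> (dir_deriv ey (\<phi> k)) y)" for k
  proof -
    have "(LINT y|Iy l. fc \<xi> (\<phi> k) y + of_real (y - (l - c)) * fc \<xi> (dir_deriv ey (\<phi> k)) y) =
        of_real (l - (l - c)) * fc \<xi> (\<phi> k) l - of_real (0 - (l - c)) * fc \<xi> (\<phi> k) 0"
    proof (rule integral_Iy_FTC[OF l])
      fix y
      have "((\<lambda>y. complex_of_real (y - (l - c))) has_vector_derivative 1) (at y)"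
        by (auto simp: has_vector_derivative_def intro!: derivative_eq_intros simp: scaleR_conv_of_real)
      from has_vector_derivative_mult[OF this fc_has_vector_derivative[OF s]]
      show "((\<lambda>y. complex_of_real (y - (l - c)) * fc \<xi> (\<phi> k) y) has_vector_derivative
        fc \<xi> (\<phi> k) y + of_real (y - (l - c)) * fc \<xi> (dir_deriv ey (\<phi> k)) y) (at y)"
        by (simp add: add.commute)
      show "continuous_on UNIV (\<lambda>y. fc \<xi> (\<phi> k) y + of_real (y - (l - c)) * fc \<xi> (dir_deriv ey (\<phi> k)) y)"
        by (intro continuous_intros fc_continuous s s')
    qed
    also have "\<dots> = l * fc \<xi> (\<phi> k) c" using c by auto
    finally have F: "(LINT y|Iy l. fc \<xi> (\<phi> k) y + of_real (y - (l - c)) * fc \<xi> (dir_deriv ey (\<phi> k)) y) = l * fc \<xi> (\<phi> k) c" .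
    have i: "integrable (Iy l) (fc \<xi> (\<phi> k))" "integrable (Iy l) (\<lambda>y. of_real (y - (l - c)) * fc \<xi> (dir_deriv ey (\<phi> k)) y)"
      by (intro L2_integrable finite_measure_Iy L2_ident_mult fc_L2 smooth_per_L2 s s')+
    have fc0: "fourier (\<lambda>x. \<phi> k (x, c)) \<xi> = fc \<xi> (\<phi> k) c" by (simp add: fc_def)
    show ?thesis by (simp only: fc0 F[symmetric] Bochner_Integration.integral_add[OF i])
  qed
  have "(\<lambda>k. l * fourier (\<lambda>x. \<phi> k (x, c)) \<xi>) \<longlonglongrightarrow> l * fourier g \<xi>"
    by (intro tendsto_intros fourier_tendsto \<phi> smooth_per_slice_L2 s)
  moreover have "(\<lambda>k. LINT y|Iy l. fc \<xi> (\<phi> k) y) \<longlonglongrightarrow> (LINT y|Iy l. fc \<xi> f y)"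
    using \<phi>(1) by (intro L2_integral_tendsto finite_measure_Iy fc_L2 fc_tendsto[OF smooth_per_L2[OF s] fL(1)] smooth_per_L2[OF s] fL) (auto simp: approx_H1_def)
  moreover have "(\<lambda>k. LINT y|Iy l. of_real (y - (l - c)) * fc \<xi> (dir_deriv ey (\<phi> k)) y) \<longlonglongrightarrow>
     (LINT y|Iy l. of_real (y - (l - c)) * fc \<xi> (weak_partial l ey f) y)"
  proof (rule L2_integral_tendsto[OF finite_measure_Iy L2_ident_mult L2_ident_mult])
    have t: "(\<lambda>k. L2_norm (Iy l) (\<lambda>y. fc \<xi> (dir_deriv ey (\<phi> k)) y - fc \<xi> (weak_partial l ey f) y)) \<longlonglongrightarrow> 0"
      using \<phi>(1) by (intro fc_tendsto[OF smooth_per_L2[OF s'] fL(2)]) (auto simp: approx_H1_def)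
    let ?C = "2 * l"
    show "(\<lambda>k. L2_norm (Iy l) (\<lambda>y. of_real (y - (l - c)) * fc \<xi> (dir_deriv ey (\<phi> k)) y - of_real (y - (l - c)) * fc \<xi> (weak_partial l ey f) y)) \<longlonglongrightarrow> 0"
    proof (rule tendsto_sandwich[OF _ _ tendsto_const])
      show "(\<lambda>k. ?C * L2_norm (Iy l) (\<lambda>y. fc \<xi> (dir_deriv ey (\<phi> k)) y - fc \<xi> (weak_partial l ey f) y)) \<longlonglongrightarrow> 0"
        using t by (auto intro!: tendsto_eq_intros)
      show "\<forall>\<^sub>F k in sequentially. L2_norm (Iy l) (\<lambda>y. of_real (y - (l - c)) * fc \<xi> (dir_deriv ey (\<phi> k)) y - of_real (y - (l - c)) * fc \<xi> (weak_partial l ey f) y)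
        \<le> ?C * L2_norm (Iy l) (\<lambda>y. fc \<xi> (dir_deriv ey (\<phi> k)) y - fc \<xi> (weak_partial l ey f) y)"
      proof (rule always_eventually, rule allI)
        fix k
        have DL: "(\<lambda>y. fc \<xi> (dir_deriv ey (\<phi> k)) y - fc \<xi> (weak_partial l ey f) y) \<in> L2 (Iy l)"
          by (intro L2_diff fc_L2 smooth_per_L2 s' fL)
        have "L2_norm (Iy l) (\<lambda>y. of_real (y - (l - c)) * (fc \<xi> (dir_deriv ey (\<phi> k)) y - fc \<xi> (weak_partial l ey f) y))
          \<le> L2_norm (Iy l) (\<lambda>y. ?C *\<^sub>R (fc \<xi> (dir_deriv ey (\<phi> k)) y - fc \<xi> (weak_partial l ey f) y))"
        proof (rule L2_norm_mono_AE[OF L2_scaleR[OF DL] _ L2_measurable[OF L2_ident_mult[OF DL]]], rule AE_I2)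
          fix y assume "y \<in> space (Iy l)"
          then have "\<bar>y - (l - c)\<bar> \<le> \<bar>?C\<bar>" using c l by auto
          then show "norm (of_real (y - (l - c)) * (fc \<xi> (dir_deriv ey (\<phi> k)) y - fc \<xi> (weak_partial l ey f) y))
             \<le> norm (?C *\<^sub>R (fc \<xi> (dir_deriv ey (\<phi> k)) y - fc \<xi> (weak_partial l ey f) y))"
            unfolding norm_mult norm_scaleR norm_of_real by (intro mult_right_mono) auto
        qed
        then show "L2_norm (Iy l) (\<lambda>y. of_real (y - (l - c)) * fc \<xi> (dir_deriv ey (\<phi> k)) y - of_real (y - (l - c)) * fc \<xi> (weak_partial l ey f) y)
          \<le> ?C * L2_norm (Iy l) (\<lambda>y. fc \<xi> (dir_deriv ey (\<phi> k)) y - fc \<xi> (weak_partial l ey f) y)"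
          unfolding L2_norm_scaleR right_diff_distrib using l by simp
      qed
    qed (simp add: L2_norm_nonneg)
  qed (intro fc_L2 smooth_per_L2[OF s'] fL)+
  ultimately show ?thesis
    unfolding eq by (rule LIMSEQ_unique[OF _ tendsto_add])
qed

lemma has_trace_unique:
  assumes l: "l > 0" and c: "c = 0 \<or> c = l" and t: "has_trace l c f g" "has_trace l c f g'"
  shows "AE x in Sig. g x = g' x"
proof (rule fourier_eq_imp_AE_eq)
  show "g \<in> L2 Sig" "g' \<in> L2 Sig" using t by (auto simp: has_trace_def)
  fix \<xi>
  have "l * fourier g \<xi> = l * fourier g' \<xi>"
    by (simp only: fourier_trace[OF l t(1) c] fourier_trace[OF l t(2) c])
  then show "fourier g \<xi> = fourier g' \<xi>" using l by simp
qed

lemma bdry_trace_AE_eq: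
  assumes "l > 0" "c = 0 \<or> c = l" "has_trace l c f g"
  shows "AE x in Sig. bdry_trace l c f x = g x" "bdry_trace l c f \<in> L2 Sig"
proof -
  have h: "has_trace l c f (bdry_trace l c f)" unfolding bdry_trace_def by (rule someI[where P = "has_trace l c f", OF assms(3)])
  show "AE x in Sig. bdry_trace l c f x = g x" by (rule has_trace_unique[OF assms(1,2) h assms(3)])
  show "bdry_trace l c f \<in> L2 Sig" using h by (simp add: has_trace_def)
qed

text \<open>The difference of the two cases of \<open>fourier_trace\<close>: their weights
  \<open>y\<close> and \<open>y - l\<close> differ by the constant \<open>l\<close>, and the zero
  bottom trace eliminates the integral of \<open>f\<close>.\<close>

lemma fourier_top_trace:
  assumes l: "l > 0" and t: "has_trace l 0 f (\<lambda>x. 0)" "has_trace l l f g"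
  shows "fourier g \<xi> = (LINT y|Iy l. fc \<xi> (weak_partial l ey f) y)"
proof -
  let ?p = "fc \<xi> (weak_partial l ey f)"
  have "f \<in> H1 l" using t by (simp add: has_trace_def)
  then have pL: "?p \<in> L2 (Iy l)" by (intro fc_L2 H1_weak_partial) auto
  have i: "integrable (Iy l) (\<lambda>y. of_real (y - a) * ?p y)" "integrable (Iy l) ?p" for a
    by (intro L2_integrable finite_measure_Iy L2_ident_mult pL)+
  have "(LINT y|Iy l. fc \<xi> f y) + (LINT y|Iy l. of_real (y - l) * ?p y) = 0"
    using fourier_trace[OF l t(1), of \<xi>] by simp
  then have e0: "(LINT y|Iy l. fc \<xi> f y) = - (LINT y|Iy l. of_real (y - l) * ?p y)"
    by (simp only: eq_neg_iff_add_eq_0)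
  have "l * fourier g \<xi> = (LINT y|Iy l. fc \<xi> f y) + (LINT y|Iy l. of_real (y - 0) * ?p y)"
    using fourier_trace[OF l t(2), of \<xi>] by simp
  also have "\<dots> = (LINT y|Iy l. of_real (y - 0) * ?p y) - (LINT y|Iy l. of_real (y - l) * ?p y)"
    unfolding e0 by (simp only: uminus_add_conv_diff)
  also have "\<dots> = (LINT y|Iy l. of_real (y - 0) * ?p y - of_real (y - l) * ?p y)"
    by (rule Bochner_Integration.integral_diff[symmetric]) (rule i)+
  also have "\<dots> = (LINT y|Iy l. of_real l * ?p y)" by (simp add: algebra_simps)
  also have "\<dots> = l * (LINT y|Iy l. ?p y)" by simp
  finally show ?thesis using l by simp
qed

text \<open>Both sides are L2 limits of the coefficients of the derivatives of one smooth
  approximating sequence.\<close>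

lemma fc_weak_partial_ex:
  assumes l: "l > 0" and t: "has_trace l c f g"
  shows "AE y in Iy l. fc \<xi> (weak_partial l (ex i) f) y = 2 * pi * \<i> * of_int (\<xi> $ i) * fc \<xi> f y"
proof -
  obtain \<phi> where \<phi>: "approx_H1 l \<phi> f (\<lambda>b. weak_partial l b f)" by (rule has_traceE[OF l t])
  have s: "\<phi> k \<in> smooth_per" for k using \<phi> by (auto simp: approx_H1_def)
  have s': "dir_deriv (ex i) (\<phi> k) \<in> smooth_per" for k by (rule smooth_per_dir_deriv[OF s]) simp
  have fL: "f \<in> L2 (Om l)" "weak_partial l (ex i) f \<in> L2 (Om l)" using \<phi>(1) by (auto simp: approx_H1_def)
  let ?c = "2 * pi * \<i> * of_int (\<xi> $ i)"
  have cL: "(\<lambda>y. ?c * p y) \<in> L2 (Iy l)" and cn: "L2_norm (Iy l) (\<lambda>y. ?c * p y) = cmod ?c * L2_norm (Iy l) p" if p: "p \<in> L2 (Iy l)" for p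
  proof -
    have m: "(\<lambda>y. ?c * p y) \<in> borel_measurable (Iy l)" using L2_measurable[OF p] by measurable
    show "(\<lambda>y. ?c * p y) \<in> L2 (Iy l)"
      by (rule L2_bound[OF L2_scaleR[OF p, of "cmod ?c"] m]) (simp add: norm_mult)
    have "(L2_norm (Iy l) (\<lambda>y. ?c * p y))^2 = (cmod ?c * L2_norm (Iy l) p)^2"
      by (simp only: L2_norm_sq_integral power_mult_distrib norm_mult) simp
    then show "L2_norm (Iy l) (\<lambda>y. ?c * p y) = cmod ?c * L2_norm (Iy l) p"
      by (simp only: power2_eq_iff_nonneg L2_norm_nonneg norm_ge_zero mult_nonneg_nonneg)
  qed
  show ?thesis
  proof (rule L2_limit_unique[where f = "\<lambda>k. fc \<xi> (dir_deriv (ex i) (\<phi> k))"])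
    show "(\<lambda>k. L2_norm (Iy l) (\<lambda>y. fc \<xi> (dir_deriv (ex i) (\<phi> k)) y - fc \<xi> (weak_partial l (ex i) f) y)) \<longlonglongrightarrow> 0"
      using \<phi>(1) by (intro fc_tendsto[OF smooth_per_L2[OF s'] fL(2)]) (auto simp: approx_H1_def)
    have t: "(\<lambda>k. L2_norm (Iy l) (\<lambda>y. fc \<xi> (\<phi> k) y - fc \<xi> f y)) \<longlonglongrightarrow> 0"
      using \<phi>(1) by (intro fc_tendsto[OF smooth_per_L2[OF s] fL(1)]) (auto simp: approx_H1_def)
    have e: "L2_norm (Iy l) (\<lambda>y. fc \<xi> (dir_deriv (ex i) (\<phi> k)) y - ?c * fc \<xi> f y) =
       cmod ?c * L2_norm (Iy l) (\<lambda>y. fc \<xi> (\<phi> k) y - fc \<xi> f y)" for k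
      unfolding fc_dir_deriv_ex[OF s] right_diff_distrib[symmetric]
      by (rule cn) (intro L2_diff fc_L2 smooth_per_L2 s fL)
    show "(\<lambda>k. L2_norm (Iy l) (\<lambda>y. fc \<xi> (dir_deriv (ex i) (\<phi> k)) y - ?c * fc \<xi> f y)) \<longlonglongrightarrow> 0"
      unfolding e using tendsto_mult_right_zero[OF t] .
  qed (intro cL fc_L2 smooth_per_L2[OF s'] fL)+
qed

lemma integral_Iy_mono_domain:
  fixes h :: "real \<Rightarrow> real"
  assumes "integrable (Iy l) h" "\<And>t. 0 \<le> h t" "y \<le> l"
  shows "(LINT t|Iy y. h t) \<le> (LINT t|Iy l. h t)"
proof -
  have i: "integrable lborel (\<lambda>t. indicator {0<..<l} t *\<^sub>R h t)"
    using assms(1) by (subst (asm) integrable_restrict_space) auto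
  have "(LINT t|Iy y. h t) = (LINT t|lborel. indicator {0<..<y} t *\<^sub>R h t)" by (subst integral_restrict_space) auto
  also have "\<dots> \<le> (LINT t|lborel. indicator {0<..<l} t *\<^sub>R h t)"
    using assms by (intro integral_mono' i) (auto simp: indicator_def)
  also have "\<dots> = (LINT t|Iy l. h t)" by (subst integral_restrict_space) auto
  finally show ?thesis .
qed

lemma measure_Iy: "l > 0 \<Longrightarrow> measure (Iy l) (space (Iy l)) = l"
  using emeasure_Iy[of l] by (simp add: measure_def)

text \<open>For a smooth function the coefficient at \<open>y\<close> differs from its bottom value
  by at most \<open>sqrt l\<close> times the norm of the derivative; taking the norm in
  \<open>y\<close> contributes a second \<open>sqrt l\<close>. In the limit the bottom value
  disappears.\<close>

lemma fc_poincare: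
  assumes l: "l > 0" and t: "has_trace l 0 f (\<lambda>x. 0)"
  shows "fcn l \<xi> f \<le> l * fcn l \<xi> (weak_partial l ey f)"
proof -
  obtain \<phi> where \<phi>: "approx_H1 l \<phi> f (\<lambda>b. weak_partial l b f)" 
    "(\<lambda>k. L2_norm Sig (\<lambda>x. \<phi> k (x, 0) - 0)) \<longlonglongrightarrow> 0" by (rule has_traceE[OF l t])
  have s: "\<phi> k \<in> smooth_per" for k using \<phi> by (auto simp: approx_H1_def)
  have s': "dir_deriv ey (\<phi> k) \<in> smooth_per" for k by (rule smooth_per_dir_deriv[OF s]) simp
  have fL: "f \<in> L2 (Om l)" "weak_partial l ey f \<in> L2 (Om l)" using \<phi>(1) by (auto simp: approx_H1_def)
  have dL: "fc \<xi> (dir_deriv ey (\<phi> k)) \<in> L2 (Iy l)" for k by (intro fc_L2 smooth_per_L2 s')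
  have b: "fcn l \<xi> (\<phi> k) \<le> sqrt l * cmod (fc \<xi> (\<phi> k) 0) + l * fcn l \<xi> (dir_deriv ey (\<phi> k))" for k
  proof -
    let ?B = "cmod (fc \<xi> (\<phi> k) 0) + sqrt l * fcn l \<xi> (dir_deriv ey (\<phi> k))"
    have B0: "?B \<ge> 0" using l by (intro add_nonneg_nonneg mult_nonneg_nonneg L2_norm_nonneg) auto
    have p: "cmod (fc \<xi> (\<phi> k) y) \<le> ?B" if y: "0 < y" "y < l" for y
    proof -
      have "fc \<xi> (\<phi> k) y = fc \<xi> (\<phi> k) 0 + (LINT t|Iy y. fc \<xi> (dir_deriv ey (\<phi> k)) t)"
        using integral_Iy_FTC[OF y(1) fc_has_vector_derivative[OF s] fc_continuous[OF s'], of \<xi> k] by simp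
      then have "cmod (fc \<xi> (\<phi> k) y) \<le> cmod (fc \<xi> (\<phi> k) 0) + cmod (LINT t|Iy y. fc \<xi> (dir_deriv ey (\<phi> k)) t)"
        using norm_triangle_ineq by metis
      also have "cmod (LINT t|Iy y. fc \<xi> (dir_deriv ey (\<phi> k)) t) \<le> (LINT t|Iy y. cmod (fc \<xi> (dir_deriv ey (\<phi> k)) t))"
        by (rule integral_norm_bound)
      also have "\<dots> \<le> (LINT t|Iy l. cmod (fc \<xi> (dir_deriv ey (\<phi> k)) t))"
        using y by (intro integral_Iy_mono_domain integrable_norm L2_integrable[OF finite_measure_Iy dL]) auto
      also have "\<dots> \<le> norm (LINT t|Iy l. cmod (fc \<xi> (dir_deriv ey (\<phi> k)) t))" by simp
      also have "\<dots> \<le> sqrt (measure (Iy l) (space (Iy l))) * L2_norm (Iy l) (\<lambda>t. cmod (fc \<xi> (dir_deriv ey (\<phi> k)) t))"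
        by (rule norm_integral_le_L2_norm[OF finite_measure_Iy L2_bound[OF dL]]) (use L2_measurable[OF dL] in auto)
      also have "L2_norm (Iy l) (\<lambda>t. cmod (fc \<xi> (dir_deriv ey (\<phi> k)) t)) = fcn l \<xi> (dir_deriv ey (\<phi> k))"
        by (simp add: L2_norm_def L2_inner_def power2_norm_eq_inner[symmetric] power2_eq_square)
      finally show ?thesis by (simp only: measure_Iy[OF l])
    qed
    have BL: "(\<lambda>y. ?B) \<in> L2 (Iy l)" by (rule L2_bounded[OF finite_measure_Iy, where B = "?B"]) (use B0 in auto)
    have "fcn l \<xi> (\<phi> k) \<le> L2_norm (Iy l) (\<lambda>y. ?B)"
      using p B0 by (intro L2_norm_mono_AE[OF BL] AE_I2 L2_measurable fc_L2 smooth_per_L2 s) auto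
    also have "\<dots> = sqrt l * ?B"
    proof -
      have "(L2_norm (Iy l) (\<lambda>y. ?B))^2 = l * ?B\<^sup>2"
        unfolding L2_norm_sq_integral using measure_Iy[OF l] by simp
      also have "\<dots> = (sqrt l * ?B)^2" using l by (simp add: power_mult_distrib)
      finally show ?thesis using B0 l by (subst (asm) power2_eq_iff_nonneg) (auto simp: L2_norm_nonneg)
    qed
    also have "\<dots> = sqrt l * cmod (fc \<xi> (\<phi> k) 0) + l * fcn l \<xi> (dir_deriv ey (\<phi> k))"
      using l by (simp add: distrib_left flip: mult.assoc)
    finally show ?thesis .
  qed
  have l1: "(\<lambda>k. fcn l \<xi> (\<phi> k)) \<longlonglongrightarrow> fcn l \<xi> f"
    using \<phi>(1) by (intro L2_norm_tendsto fc_L2 fc_tendsto[OF smooth_per_L2[OF s] fL(1)] smooth_per_L2[OF s] fL) (auto simp: approx_H1_def)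
  have l2: "(\<lambda>k. fcn l \<xi> (dir_deriv ey (\<phi> k))) \<longlonglongrightarrow> fcn l \<xi> (weak_partial l ey f)"
    using \<phi>(1) by (intro L2_norm_tendsto fc_L2 fc_tendsto[OF smooth_per_L2[OF s'] fL(2)] smooth_per_L2[OF s'] fL) (auto simp: approx_H1_def)
  have l3: "(\<lambda>k. fc \<xi> (\<phi> k) 0) \<longlonglongrightarrow> 0"
    using fourier_tendsto[OF smooth_per_slice_L2[OF s] L2_zero \<phi>(2), of \<xi>] by (simp add: fc_def)
  have "(\<lambda>k. sqrt l * cmod (fc \<xi> (\<phi> k) 0) + l * fcn l \<xi> (dir_deriv ey (\<phi> k))) \<longlonglongrightarrow>
      sqrt l * cmod 0 + l * fcn l \<xi> (weak_partial l ey f)"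
    by (intro tendsto_intros l2 l3)
  from LIMSEQ_le[OF l1 this] b show ?thesis by auto
qed


section \<open>Projection onto one frequency\<close>

lemma mode_cong_AE:
  fixes \<xi> :: "int ^ 'n::finite"
  assumes "p \<in> L2 (Iy l)" "p' \<in> L2 (Iy l)" "AE y in Iy l. p y = p' y"
  shows "AE z in Om l. mode \<xi> p z = mode \<xi> p' z"
proof -
  have d: "mode \<xi> p z - mode \<xi> p' z = mode \<xi> (\<lambda>y. p y - p' y) z" for z by (simp add: mode_def algebra_simps)
  have "L2_norm (Iy l) (\<lambda>y. p y - p' y) = 0"
    using L2_norm_eq_0_iff[OF L2_diff[OF assms(1,2)]] assms(3) by simp
  then have "L2_norm (Om l) (mode \<xi> (\<lambda>y. p y - p' y)) = 0"
    using L2_norm_mode_le[OF L2_diff[OF assms(1,2)], of \<xi>] L2_norm_nonneg[of "Om l" "mode \<xi> (\<lambda>y. p y - p' y)"] by simp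
  then have "AE z in Om l. mode \<xi> (\<lambda>y. p y - p' y) z = 0"
    using L2_norm_eq_0_iff[OF mode_L2[OF L2_diff[OF assms(1,2)], of \<xi>]] by simp
  then show ?thesis by eventually_elim (simp only: d[symmetric] right_minus_eq)
qed

lemma mode_fc_tendsto:
  fixes \<xi> :: "int ^ 'n::finite"
  assumes "\<And>k. f k \<in> L2 (Om l)" "g \<in> L2 (Om l)" "(\<lambda>k. L2_norm (Om l) (\<lambda>z. f k z - g z)) \<longlonglongrightarrow> 0"
  shows "(\<lambda>k. L2_norm (Om l) (\<lambda>z. mode \<xi> (fc \<xi> (f k)) z - mode \<xi> (fc \<xi> g) z)) \<longlonglongrightarrow> 0"
proof (rule tendsto_sandwich[OF _ _ tendsto_const fc_tendsto[OF assms, of \<xi>]])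
  have d: "(\<lambda>z. mode \<xi> (fc \<xi> (f k)) z - mode \<xi> (fc \<xi> g) z) = mode \<xi> (\<lambda>y. fc \<xi> (f k) y - fc \<xi> g y)" for k
    by (auto simp: mode_def algebra_simps)
  show "\<forall>\<^sub>F k in sequentially. L2_norm (Om l) (\<lambda>z. mode \<xi> (fc \<xi> (f k)) z - mode \<xi> (fc \<xi> g) z) \<le> L2_norm (Iy l) (\<lambda>y. fc \<xi> (f k) y - fc \<xi> g y)"
    unfolding d by (intro always_eventually allI L2_norm_mode_le L2_diff fc_L2 assms)
qed (simp add: L2_norm_nonneg)

lemma approx_H1_mode:
  assumes a: "approx_H1 l \<phi> f g"
  shows "approx_H1 l (\<lambda>k. mode \<xi> (fc \<xi> (\<phi> k))) (mode \<xi> (fc \<xi> f)) (\<lambda>b. mode \<xi> (fc \<xi> (g b)))"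
  unfolding approx_H1_def
proof (intro conjI allI ballI)
  have s: "\<phi> k \<in> smooth_per" for k using a by (auto simp: approx_H1_def)
  show "mode \<xi> (fc \<xi> f) \<in> L2 (Om l)" using a by (auto simp: approx_H1_def intro!: mode_L2 fc_L2)
  show "mode \<xi> (fc \<xi> (\<phi> k)) \<in> smooth_per" for k by (intro mode_smooth_per csmooth_fc s)
  show "(\<lambda>k. L2_norm (Om l) (\<lambda>z. mode \<xi> (fc \<xi> (\<phi> k)) z - mode \<xi> (fc \<xi> f) z)) \<longlonglongrightarrow> 0"
    using a by (intro mode_fc_tendsto smooth_per_L2[OF s]) (auto simp: approx_H1_def)
  fix b :: "'a pt" assume b: "b \<in> Basis"
  show "mode \<xi> (fc \<xi> (g b)) \<in> L2 (Om l)" using a b by (auto simp: approx_H1_def intro!: mode_L2 fc_L2)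
  show "(\<lambda>k. L2_norm (Om l) (\<lambda>z. dir_deriv b (mode \<xi> (fc \<xi> (\<phi> k))) z - mode \<xi> (fc \<xi> (g b)) z)) \<longlonglongrightarrow> 0"
    unfolding mode_fc_dir_deriv[OF s b]
    using a b by (intro mode_fc_tendsto smooth_per_L2[OF smooth_per_dir_deriv[OF s b]]) (auto simp: approx_H1_def)
qed

text \<open>The projections of a smooth approximating sequence approximate the projected function.
  Their boundary values converge because a Fourier coefficient is bounded by the L2 norm.\<close>

lemma has_trace_mode:
  assumes l: "l > 0" and t: "has_trace l c f g"
  shows "has_trace l c (mode \<xi> (fc \<xi> f)) (\<lambda>x. Re (fourier g \<xi> * tr \<xi> x))"
    and "b \<in> Basis \<Longrightarrow> is_weak_partial l b (mode \<xi> (fc \<xi> f)) (mode \<xi> (fc \<xi> (weak_partial l b f)))"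
proof -
  obtain \<phi> where \<phi>: "approx_H1 l \<phi> f (\<lambda>b. weak_partial l b f)" "g \<in> L2 Sig"
    "(\<lambda>k. L2_norm Sig (\<lambda>x. \<phi> k (x, c) - g x)) \<longlonglongrightarrow> 0" by (rule has_traceE[OF l t])
  have s: "\<phi> k \<in> smooth_per" for k using \<phi> by (auto simp: approx_H1_def)
  have mL: "(\<lambda>x. Re (w * tr \<xi> x)) \<in> L2 Sig" and Mn: "L2_norm Sig (\<lambda>x. Re (w * tr \<xi> x)) \<le> cmod w" for w
  proof -
    have m: "(\<lambda>x. Re (w * tr \<xi> x)) \<in> borel_measurable Sig" by measurable
    have cL: "(\<lambda>x :: real ^ 'a. w) \<in> L2 Sig" by (rule L2_bounded[OF finite_measure_Sig, of _ "cmod w"]) auto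
    have b: "norm (Re (w * tr \<xi> x)) \<le> norm w" for x
      using abs_Re_le_cmod[of "w * tr \<xi> x"] by (simp only: norm_mult norm_tr real_norm_def mult_1_right)
    show "(\<lambda>x. Re (w * tr \<xi> x)) \<in> L2 Sig" by (rule L2_bound[OF cL m]) (use b in auto)
    have "L2_norm Sig (\<lambda>x. Re (w * tr \<xi> x)) \<le> L2_norm Sig (\<lambda>x :: real ^ 'a. w)"
      by (rule L2_norm_mono_AE[OF cL _ m]) (use b in auto)
    also have "\<dots> = cmod w" by (simp add: L2_norm_def L2_inner_def norm_eq_sqrt_inner)
    finally show "L2_norm Sig (\<lambda>x. Re (w * tr \<xi> x)) \<le> cmod w" .
  qed
  show "has_trace l c (mode \<xi> (fc \<xi> f)) (\<lambda>x. Re (fourier g \<xi> * tr \<xi> x))"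
  proof (rule has_traceI[OF l approx_H1_mode[OF \<phi>(1)] mL])
    have "(\<lambda>k. fc \<xi> (\<phi> k) c - fourier g \<xi>) \<longlonglongrightarrow> 0"
      using LIM_zero[OF fourier_tendsto[OF smooth_per_slice_L2[OF s] \<phi>(2,3), of \<xi>]] by (simp add: fc_def)
    then have t0: "(\<lambda>k. cmod (fc \<xi> (\<phi> k) c - fourier g \<xi>)) \<longlonglongrightarrow> 0" by (rule tendsto_norm_zero)
    have e: "(\<lambda>x. mode \<xi> (fc \<xi> (\<phi> k)) (x, c) - Re (fourier g \<xi> * tr \<xi> x)) = (\<lambda>x. Re ((fc \<xi> (\<phi> k) c - fourier g \<xi>) * tr \<xi> x))" for k
      by (auto simp: mode_def algebra_simps)
    show "(\<lambda>k. L2_norm Sig (\<lambda>x. mode \<xi> (fc \<xi> (\<phi> k)) (x, c) - Re (fourier g \<xi> * tr \<xi> x))) \<longlonglongrightarrow> 0"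
      unfolding e
      by (rule tendsto_sandwich[OF _ _ tendsto_const t0]; rule always_eventually, rule allI, rule L2_norm_nonneg Mn)
  qed
  show "is_weak_partial l b (mode \<xi> (fc \<xi> f)) (mode \<xi> (fc \<xi> (weak_partial l b f)))" if "b \<in> Basis"
    by (rule approx_H1_weak_partial[OF l approx_H1_mode[OF \<phi>(1)] that])
qed

section \<open>Solenoidal fields and their frequency components\<close>

lemma L2_field:
  fixes u :: "'a \<Rightarrow> 'b::euclidean_space"
  assumes "\<And>c. c \<in> Basis \<Longrightarrow> (\<lambda>z. u z \<bullet> c) \<in> L2 M"
  shows "u \<in> L2 M"
proof -
  have "(\<lambda>z. (u z \<bullet> c) *\<^sub>R c) \<in> L2 M" if c: "c \<in> Basis" for c
    by (rule L2_bound[OF assms[OF c]]) (use L2_measurable[OF assms[OF c]] c in auto)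
  then have "(\<lambda>z. \<Sum>c\<in>Basis. (u z \<bullet> c) *\<^sub>R c) \<in> L2 M" by (rule L2_sum)
  then show ?thesis by (simp add: euclidean_representation)
qed

lemma L2_comp: "u \<in> L2 M \<Longrightarrow> c \<in> Basis \<Longrightarrow> (\<lambda>z. u z \<bullet> c) \<in> L2 M"
  by (rule L2_component) auto

lemma L2_inner_components:
  fixes u v :: "'a \<Rightarrow> 'b::euclidean_space"
  assumes "u \<in> L2 M" "v \<in> L2 M"
  shows "L2_inner M u v = (\<Sum>c\<in>Basis. L2_inner M (\<lambda>z. u z \<bullet> c) (\<lambda>z. v z \<bullet> c))"
proof -
  have "L2_inner M u v = (LINT z|M. (\<Sum>c\<in>Basis. (u z \<bullet> c) \<bullet> (v z \<bullet> c)))"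
    unfolding L2_inner_def by (rule Bochner_Integration.integral_cong[OF refl], subst euclidean_inner) simp
  also have "\<dots> = (\<Sum>c\<in>Basis. LINT z|M. (u z \<bullet> c) \<bullet> (v z \<bullet> c))"
    by (rule Bochner_Integration.integral_sum) (intro L2_inner_integrable L2_comp assms)
  finally show ?thesis by (simp add: L2_inner_def)
qed

lemma V_D:
  assumes "u \<in> V l" "c \<in> Basis"
  shows V_trace_0: "has_trace l 0 (\<lambda>z. u z \<bullet> c) (\<lambda>x. 0)"
    and V_H1: "(\<lambda>z. u z \<bullet> c) \<in> H1 l"
  using assms by (auto simp: V_def H1_field_def)

lemma V_in_L2: "u \<in> V l \<Longrightarrow> u \<in> L2 (Om l)"
  by (simp add: V_def H1_field_def)

lemma pd_weak:
  assumes "u \<in> V l" "b \<in> Basis" "c \<in> Basis"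
  shows "is_weak_partial l b (\<lambda>z. u z \<bullet> c) (pd l u b c)" "pd l u b c \<in> L2 (Om l)"
  unfolding pd_def by (rule H1_weak_partial[OF V_H1[OF assms(1,3)] assms(2)])+

lemma VI:
  assumes "\<And>c. c \<in> Basis \<Longrightarrow> has_trace l 0 (\<lambda>z. u z \<bullet> c) (\<lambda>x. 0)" "AE z in Om l. divergence l u z = 0"
  shows "u \<in> V l"
proof -
  have "(\<lambda>z. u z \<bullet> c) \<in> H1 l" if "c \<in> Basis" for c using assms(1)[OF that] by (simp add: has_trace_def)
  moreover from this have "u \<in> L2 (Om l)" using L2_field[of u "Om l"] by (simp add: H1_def)
  ultimately show ?thesis using assms by (simp add: V_def H1_field_def)
qed

lemma sym_grad_L2:
  "u \<in> V l \<Longrightarrow> b \<in> Basis \<Longrightarrow> c \<in> Basis \<Longrightarrow> sym_grad l u b c \<in> L2 (Om l)"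
  unfolding sym_grad_def[abs_def] by (intro L2_add pd_weak)

lemma lincomb_weak_partial:
  assumes "u \<in> V l" "v \<in> V l" and b: "b \<in> Basis" and c: "c \<in> Basis"
  shows "is_weak_partial l b (\<lambda>z. (a *\<^sub>R u z + a' *\<^sub>R v z) \<bullet> c) (\<lambda>z. a * pd l u b c z + a' * pd l v b c z)"
proof -
  have L: "(\<lambda>z. u z \<bullet> c) \<in> L2 (Om l)" "(\<lambda>z. v z \<bullet> c) \<in> L2 (Om l)"
    using V_H1[OF assms(1) c] V_H1[OF assms(2) c] by (auto simp: H1_def)
  have L': "(\<lambda>z. a * (u z \<bullet> c)) \<in> L2 (Om l)" "(\<lambda>z. a' * (v z \<bullet> c)) \<in> L2 (Om l)"
    using L2_scaleR[OF L(1), of a] L2_scaleR[OF L(2), of a'] by (simp_all only: real_scaleR_def)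
  have "is_weak_partial l b (\<lambda>z. a * (u z \<bullet> c) + a' * (v z \<bullet> c)) (\<lambda>z. a * pd l u b c z + a' * pd l v b c z)"
    by (rule is_weak_partial_add[OF L' is_weak_partial_scale[OF pd_weak(1)[OF assms(1) b c]] is_weak_partial_scale[OF pd_weak(1)[OF assms(2) b c]] b])
  then show ?thesis by (simp only: inner_add_left inner_scaleR_left)
qed

lemma pd_lincomb:
  assumes "l > 0" "u \<in> V l" "v \<in> V l" "b \<in> Basis" "c \<in> Basis"
  shows "AE z in Om l. pd l (\<lambda>z. a *\<^sub>R u z + a' *\<^sub>R v z) b c z = a * pd l u b c z + a' * pd l v b c z"
  unfolding pd_def[of l "\<lambda>z. a *\<^sub>R u z + a' *\<^sub>R v z"]
  by (rule weak_partial_AE_eq[OF assms(1) lincomb_weak_partial[OF assms(2-)]])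

lemma V_lincomb:
  assumes l: "l > 0" and u: "u \<in> V l" and v: "v \<in> V l"
  shows "(\<lambda>z. a *\<^sub>R u z + a' *\<^sub>R v z) \<in> V l"
proof (rule VI)
  show "has_trace l 0 (\<lambda>z. (a *\<^sub>R u z + a' *\<^sub>R v z) \<bullet> c) (\<lambda>x. 0)" if c: "c \<in> Basis" for c
    using has_trace_lincomb[OF l V_trace_0[OF u c] V_trace_0[OF v c], of a a'] by (simp add: inner_add_left)
  have "AE z in Om l. \<forall>b\<in>Basis. pd l (\<lambda>z. a *\<^sub>R u z + a' *\<^sub>R v z) b b z = a * pd l u b b z + a' * pd l v b b z"
    by (intro AE_finite_allI) (auto intro: pd_lincomb[OF l u v])
  moreover have "AE z in Om l. divergence l u z = 0" "AE z in Om l. divergence l v z = 0"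
    using u v by (auto simp: V_def)
  ultimately show "AE z in Om l. divergence l (\<lambda>z. a *\<^sub>R u z + a' *\<^sub>R v z) z = 0"
  proof eventually_elim
    case (elim z)
    have "divergence l (\<lambda>z. a *\<^sub>R u z + a' *\<^sub>R v z) z = a * divergence l u z + a' * divergence l v z"
      using elim(1) by (simp add: divergence_def sum.distrib sum_distrib_left)
    then show ?case using elim by simp
  qed
qed

lemma sym_grad_lincomb:
  assumes "l > 0" "u \<in> V l" "v \<in> V l" "b \<in> Basis" "c \<in> Basis"
  shows "AE z in Om l. sym_grad l (\<lambda>z. a *\<^sub>R u z + a' *\<^sub>R v z) b c z = a * sym_grad l u b c z + a' * sym_grad l v b c z"
  using pd_lincomb[OF assms, of a a'] pd_lincomb[OF assms(1-3,5,4), of a a']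
  by eventually_elim (simp add: sym_grad_def algebra_simps)

lemma V_norm_nonneg: "0 \<le> V_norm l u"
  unfolding V_norm_def V_inner_def by (intro real_sqrt_ge_zero sum_nonneg L2_inner_nonneg)

lemma pd_le_V_norm:
  assumes "b \<in> Basis" "c \<in> Basis"
  shows "L2_norm (Om l) (pd l u b c) \<le> V_norm l u"
proof -
  have "L2_inner (Om l) (pd l u b c) (pd l u b c) \<le> (\<Sum>c\<in>Basis. L2_inner (Om l) (pd l u b c) (pd l u b c))"
    by (rule member_le_sum[OF assms(2)]) (auto intro: L2_inner_nonneg)
  also have "\<dots> \<le> V_inner l u u" unfolding V_inner_def
    by (rule member_le_sum[OF assms(1), of "\<lambda>b. \<Sum>c\<in>Basis. L2_inner (Om l) (pd l u b c) (pd l u b c)"])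
      (auto intro!: sum_nonneg L2_inner_nonneg)
  finally show ?thesis unfolding L2_norm_def V_norm_def by simp
qed

text \<open>Normalised so that \<open>L2_inner_proj\<close> carries no constant. For nonzero \<xi>
  it is half of the orthogonal projection onto the real fields with frequencies \<xi> and -\<xi>;
  compare \<open>fc_mode\<close>.\<close>

definition proj :: "int ^ 'n::finite \<Rightarrow> 'n field \<Rightarrow> 'n field" where
  "proj \<xi> u z = (\<Sum>c\<in>Basis. mode \<xi> (fc \<xi> (\<lambda>z. u z \<bullet> c)) z *\<^sub>R c)"

lemma proj_comp: "c \<in> Basis \<Longrightarrow> proj \<xi> u z \<bullet> c = mode \<xi> (fc \<xi> (\<lambda>z. u z \<bullet> c)) z"
  by (simp add: proj_def inner_sum_left inner_Basis if_distrib cong: if_cong)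

lemma snd_eq_inner: "snd w = w \<bullet> ey"
  by (cases w) simp

lemma fc_zero [simp]: "fc \<xi> (\<lambda>z. 0) y = 0"
  by (simp add: fc_def)

lemma pd_proj:
  assumes l: "l > 0" and u: "u \<in> V l" and b: "b \<in> Basis" and c: "c \<in> Basis"
  shows "AE z in Om l. pd l (proj \<xi> u) b c z = mode \<xi> (fc \<xi> (pd l u b c)) z"
proof -
  have "is_weak_partial l b (\<lambda>z. proj \<xi> u z \<bullet> c) (mode \<xi> (fc \<xi> (pd l u b c)))"
    unfolding proj_comp[OF c] pd_def using has_trace_mode(2)[OF l V_trace_0[OF u c] b, of \<xi>] by simp
  from weak_partial_AE_eq[OF l this] show ?thesis by (simp add: pd_def)
qed

lemma fc_sum:
  assumes "\<And>i. i \<in> A \<Longrightarrow> f i \<in> L2 (Om l)"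
  shows "AE y in Iy l. fc \<xi> (\<lambda>z. \<Sum>i\<in>A. f i z) y = (\<Sum>i\<in>A. fc \<xi> (f i) y)"
  using assms
proof (induction A rule: infinite_finite_induct)
  case (insert x F)
  have "AE y in Iy l. fc \<xi> (\<lambda>z. f x z + (\<Sum>i\<in>F. f i z)) y = fc \<xi> (f x) y + fc \<xi> (\<lambda>z. \<Sum>i\<in>F. f i z) y"
    by (rule fc_add) (use insert.prems in \<open>auto intro: L2_sum\<close>)
  moreover have "AE y in Iy l. fc \<xi> (\<lambda>z. \<Sum>i\<in>F. f i z) y = (\<Sum>i\<in>F. fc \<xi> (f i) y)"
    using insert by auto
  ultimately show ?case by eventually_elim (simp add: insert.hyps)
qed auto

text \<open>Derivatives commute with the projection (\<open>pd_proj\<close>), so the divergence of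
  the projection is the mode built from the coefficient of the divergence. This makes
  \<open>proj \<xi> v\<close> an admissible test field.\<close>

lemma proj_V:
  assumes l: "l > 0" and u: "u \<in> V l"
  shows "proj \<xi> u \<in> V l"
proof (rule VI)
  show "has_trace l 0 (\<lambda>z. proj \<xi> u z \<bullet> c) (\<lambda>x. 0)" if c: "c \<in> Basis" for c
    unfolding proj_comp[OF c] using has_trace_mode(1)[OF l V_trace_0[OF u c], of \<xi>] by simp
  let ?D = "\<lambda>z. \<Sum>b\<in>Basis. pd l u b b z"
  have DL: "?D \<in> L2 (Om l)" by (intro L2_sum pd_weak(2)[OF u])
  have D0: "AE z in Om l. ?D z = 0" using u by (simp add: V_def divergence_def)
  have "AE y in Iy l. fc \<xi> ?D y = fc \<xi> (\<lambda>z. 0) y"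
    by (rule fc_cong_AE[OF L2_measurable[OF DL] _ D0]) simp
  moreover have "AE y in Iy l. fc \<xi> ?D y = (\<Sum>b\<in>Basis. fc \<xi> (pd l u b b) y)"
    by (rule fc_sum) (rule pd_weak(2)[OF u])
  ultimately have s0: "AE y in Iy l. (\<Sum>b\<in>Basis. fc \<xi> (pd l u b b) y) = 0" by eventually_elim simp
  have "AE z in Om l. mode \<xi> (\<lambda>y. \<Sum>b\<in>Basis. fc \<xi> (pd l u b b) y) z = mode \<xi> (\<lambda>y. 0) z"
    by (rule mode_cong_AE) (use s0 in \<open>auto intro!: L2_sum fc_L2 pd_weak(2)[OF u] L2_zero\<close>)
  moreover have "AE z in Om l. \<forall>b\<in>Basis. pd l (proj \<xi> u) b b z = mode \<xi> (fc \<xi> (pd l u b b)) z"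
    by (intro AE_finite_allI) (auto intro: pd_proj[OF l u])
  ultimately show "AE z in Om l. divergence l (proj \<xi> u) z = 0"
  proof eventually_elim
    case (elim z)
    have "divergence l (proj \<xi> u) z = (\<Sum>b\<in>Basis. Re (fc \<xi> (pd l u b b) (snd z) * tr \<xi> (fst z)))"
      unfolding divergence_def by (rule sum.cong) (use elim(2) in \<open>auto simp only: mode_def\<close>)
    also have "\<dots> = Re ((\<Sum>b\<in>Basis. fc \<xi> (pd l u b b) (snd z)) * tr \<xi> (fst z))"
      by (simp only: Re_sum sum_distrib_right)
    also have "\<dots> = 0" using elim(1) by (simp only: mode_def) simp
    finally show ?case .
  qed
qed

lemma proj_top_trace:
  assumes l: "l > 0" and t: "has_trace l l (\<lambda>z. snd (u z)) g"
  shows "has_trace l l (\<lambda>z. snd (proj \<xi> u z)) (\<lambda>x. Re (fourier g \<xi> * tr \<xi> x))"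
  using has_trace_mode(1)[OF l t, of \<xi>] by (simp add: snd_eq_inner proj_comp)


section \<open>The bilinear forms at one frequency\<close>

definition qf :: "int ^ 'n::finite \<Rightarrow> real \<Rightarrow> 'n field \<Rightarrow> 'n field \<Rightarrow> real" where
  "qf \<xi> l u v = (\<Sum>c\<in>Basis. L2_inner (Iy l) (fc \<xi> (\<lambda>z. u z \<bullet> c)) (fc \<xi> (\<lambda>z. v z \<bullet> c)))"

definition df :: "int ^ 'n::finite \<Rightarrow> real \<Rightarrow> 'n field \<Rightarrow> 'n field \<Rightarrow> real" where
  "df \<xi> l u v = (\<Sum>b\<in>Basis. \<Sum>c\<in>Basis. L2_inner (Iy l) (fc \<xi> (sym_grad l u b c)) (fc \<xi> (sym_grad l v b c)))"

text \<open>The Fourier coefficient of the normal trace at the top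
  (\<open>fourier_top_trace_bf\<close>). Written through the vertical derivative it is defined,
  linear and bounded on all of \<open>V l\<close>, whose definition prescribes a trace at the bottom
  only.\<close>

definition bf :: "int ^ 'n::finite \<Rightarrow> real \<Rightarrow> 'n field \<Rightarrow> complex" where
  "bf \<xi> l v = (LINT y|Iy l. fc \<xi> (pd l v ey ey) y)"

lemma qf_commute: "qf \<xi> l u v = qf \<xi> l v u" and df_commute: "df \<xi> l u v = df \<xi> l v u"
  by (simp_all add: qf_def df_def L2_inner_commute[of _ "fc \<xi> (\<lambda>z. u z \<bullet> _)"] L2_inner_commute[of _ "fc \<xi> (sym_grad l u _ _)"])

lemma qf_nonneg: "0 \<le> qf \<xi> l u u" and df_nonneg: "0 \<le> df \<xi> l u u"
  by (auto simp: qf_def df_def intro!: sum_nonneg L2_inner_nonneg)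

lemma L2_proj: "u \<in> L2 (Om l) \<Longrightarrow> proj \<xi> u \<in> L2 (Om l)"
  by (rule L2_field) (auto simp: proj_comp intro!: mode_L2 fc_L2 L2_comp)

text \<open>Adjointness of \<open>mode\<close> and \<open>fc\<close> in every component. A term of
  the weak equation tested with \<open>proj \<xi> v\<close> thus sees only coefficients at
  \<xi>.\<close>

lemma L2_inner_proj:
  assumes "u \<in> L2 (Om l)" "v \<in> L2 (Om l)"
  shows "L2_inner (Om l) u (proj \<xi> v) = qf \<xi> l u v"
proof -
  have "L2_inner (Om l) u (proj \<xi> v) = (\<Sum>c\<in>Basis. L2_inner (Om l) (\<lambda>z. u z \<bullet> c) (\<lambda>z. proj \<xi> v z \<bullet> c))"
    by (rule L2_inner_components[OF assms(1) L2_proj[OF assms(2)]])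
  also have "\<dots> = qf \<xi> l u v" unfolding qf_def
  proof (rule sum.cong[OF refl])
    fix c :: "'a pt" assume c: "c \<in> Basis"
    show "L2_inner (Om l) (\<lambda>z. u z \<bullet> c) (\<lambda>z. proj \<xi> v z \<bullet> c) = L2_inner (Iy l) (fc \<xi> (\<lambda>z. u z \<bullet> c)) (fc \<xi> (\<lambda>z. v z \<bullet> c))"
      using L2_inner_mode[OF L2_comp[OF assms(1) c] fc_L2[OF L2_comp[OF assms(2) c]], of \<xi>]
      by (simp add: proj_comp[OF c])
  qed
  finally show ?thesis .
qed

text \<open>The symmetric gradient of the projection is the mode of the corresponding coefficient,
  so adjointness applies entry by entry.\<close>

lemma sym_grad_inner_proj:
  assumes l: "l > 0" and u: "u \<in> V l" and v: "v \<in> V l"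
  shows "sym_grad_inner l u (proj \<xi> v) = df \<xi> l u v"
  unfolding sym_grad_inner_def df_def
proof (intro sum.cong[OF refl])
  fix b c :: "'a pt" assume b: "b \<in> Basis" and c: "c \<in> Basis"
  have s: "sym_grad l v b c \<in> L2 (Om l)" by (rule sym_grad_L2[OF v b c])
  have p: "pd l v b c \<in> L2 (Om l)" "pd l v c b \<in> L2 (Om l)" using pd_weak(2)[OF v] b c by auto
  have e1: "AE z in Om l. sym_grad l (proj \<xi> v) b c z = mode \<xi> (\<lambda>y. fc \<xi> (pd l v b c) y + fc \<xi> (pd l v c b) y) z"
    using pd_proj[OF l v b c, of \<xi>] pd_proj[OF l v c b, of \<xi>]
    by eventually_elim (simp add: sym_grad_def mode_def algebra_simps)
  have "AE y in Iy l. fc \<xi> (\<lambda>z. pd l v b c z + pd l v c b z) y = fc \<xi> (pd l v b c) y + fc \<xi> (pd l v c b) y"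
    by (rule fc_add[OF p])
  then have "AE z in Om l. mode \<xi> (fc \<xi> (\<lambda>z. pd l v b c z + pd l v c b z)) z = mode \<xi> (\<lambda>y. fc \<xi> (pd l v b c) y + fc \<xi> (pd l v c b) y) z"
    by (intro mode_cong_AE fc_L2 L2_add p)
  with e1 have e: "AE z in Om l. sym_grad l (proj \<xi> v) b c z = mode \<xi> (fc \<xi> (sym_grad l v b c)) z"
    unfolding sym_grad_def[abs_def] by eventually_elim simp
  have "L2_inner (Om l) (sym_grad l u b c) (sym_grad l (proj \<xi> v) b c) = L2_inner (Om l) (sym_grad l u b c) (mode \<xi> (fc \<xi> (sym_grad l v b c)))"
    by (rule L2_inner_cong_AE) (use e in \<open>auto intro!: L2_measurable sym_grad_L2 u v proj_V l b c mode_L2 fc_L2\<close>)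
  also have "\<dots> = L2_inner (Iy l) (fc \<xi> (sym_grad l u b c)) (fc \<xi> (sym_grad l v b c))"
    by (rule L2_inner_mode[OF sym_grad_L2[OF u b c] fc_L2[OF s]])
  finally show "L2_inner (Om l) (sym_grad l u b c) (sym_grad l (proj \<xi> v) b c) =
    L2_inner (Iy l) (fc \<xi> (sym_grad l u b c)) (fc \<xi> (sym_grad l v b c))" .
qed

lemma fourier_top_trace_bf:
  assumes l: "l > 0" and v: "v \<in> V l" and t: "has_trace l l (\<lambda>z. snd (v z)) g"
  shows "fourier g \<xi> = bf \<xi> l v"
  using fourier_top_trace[OF l V_trace_0[OF v ey_Basis], of g \<xi>] t by (simp add: bf_def pd_def snd_eq_inner)

text \<open>Linearity is transported to the slab by \<open>L2_inner_mode\<close>, where an identity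
  that holds almost everywhere is enough.\<close>

lemma L2_inner_fc_lincomb:
  assumes "f \<in> L2 (Om l)" "g \<in> L2 (Om l)" "h \<in> L2 (Om l)" "p \<in> L2 (Iy l)" "AE z in Om l. h z = a * f z + b * g z"
  shows "L2_inner (Iy l) (fc \<xi> h) p = a * L2_inner (Iy l) (fc \<xi> f) p + b * L2_inner (Iy l) (fc \<xi> g) p"
proof -
  have "L2_inner (Om l) h (mode \<xi> p) = L2_inner (Om l) (\<lambda>z. a *\<^sub>R f z + b *\<^sub>R g z) (mode \<xi> p)"
    by (rule L2_inner_cong_AE) (use assms in \<open>auto intro!: L2_measurable L2_lincomb mode_L2\<close>)
  also have "\<dots> = a * L2_inner (Om l) f (mode \<xi> p) + b * L2_inner (Om l) g (mode \<xi> p)"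
    using assms by (simp only: L2_inner_add_left L2_scaleR mode_L2 L2_inner_scaleR_left)
  finally show ?thesis using assms by (simp only: L2_inner_mode)
qed

lemma qf_lincomb:
  assumes "u \<in> L2 (Om l)" "v \<in> L2 (Om l)" "w \<in> L2 (Om l)"
  shows "qf \<xi> l (\<lambda>z. a *\<^sub>R u z + b *\<^sub>R v z) w = a * qf \<xi> l u w + b * qf \<xi> l v w"
proof -
  have "L2_inner (Iy l) (fc \<xi> (\<lambda>z. (a *\<^sub>R u z + b *\<^sub>R v z) \<bullet> c)) (fc \<xi> (\<lambda>z. w z \<bullet> c)) =
      a * L2_inner (Iy l) (fc \<xi> (\<lambda>z. u z \<bullet> c)) (fc \<xi> (\<lambda>z. w z \<bullet> c)) + b * L2_inner (Iy l) (fc \<xi> (\<lambda>z. v z \<bullet> c)) (fc \<xi> (\<lambda>z. w z \<bullet> c))"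
    if c: "c \<in> Basis" for c
    by (rule L2_inner_fc_lincomb[OF L2_comp[OF assms(1) c] L2_comp[OF assms(2) c]
          L2_comp[OF L2_add[OF L2_scaleR[OF assms(1)] L2_scaleR[OF assms(2)]] c] fc_L2[OF L2_comp[OF assms(3) c]]])
      (simp add: inner_add_left)
  then show ?thesis by (simp add: qf_def sum.distrib sum_distrib_left)
qed

lemma qf_lincomb_right:
  assumes "u \<in> L2 (Om l)" "v \<in> L2 (Om l)" "w \<in> L2 (Om l)"
  shows "qf \<xi> l w (\<lambda>z. a *\<^sub>R u z + b *\<^sub>R v z) = a * qf \<xi> l w u + b * qf \<xi> l w v"
  using qf_lincomb[OF assms] by (simp only: qf_commute[of \<xi> l w])

lemma df_lincomb:
  assumes l: "l > 0" and V: "u \<in> V l" "v \<in> V l" "w \<in> V l"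
  shows "df \<xi> l (\<lambda>z. a *\<^sub>R u z + b *\<^sub>R v z) w = a * df \<xi> l u w + b * df \<xi> l v w"
proof -
  have "L2_inner (Iy l) (fc \<xi> (sym_grad l (\<lambda>z. a *\<^sub>R u z + b *\<^sub>R v z) i j)) (fc \<xi> (sym_grad l w i j)) =
      a * L2_inner (Iy l) (fc \<xi> (sym_grad l u i j)) (fc \<xi> (sym_grad l w i j)) + b * L2_inner (Iy l) (fc \<xi> (sym_grad l v i j)) (fc \<xi> (sym_grad l w i j))"
    if "i \<in> Basis" "j \<in> Basis" for i j
    using that by (intro L2_inner_fc_lincomb sym_grad_lincomb[OF l V(1,2)] sym_grad_L2 fc_L2 V V_lincomb l)
  then show ?thesis by (simp add: df_def sum.distrib sum_distrib_left)
qed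

lemma df_lincomb_right:
  assumes l: "l > 0" and V: "u \<in> V l" "v \<in> V l" "w \<in> V l"
  shows "df \<xi> l w (\<lambda>z. a *\<^sub>R u z + b *\<^sub>R v z) = a * df \<xi> l w u + b * df \<xi> l w v"
  using df_lincomb[OF assms] by (simp only: df_commute[of \<xi> l w])

lemma bf_lincomb:
  assumes l: "l > 0" and V: "u \<in> V l" "v \<in> V l"
  shows "bf \<xi> l (\<lambda>z. a *\<^sub>R u z + b *\<^sub>R v z) = of_real a * bf \<xi> l u + of_real b * bf \<xi> l v"
proof -
  have p: "pd l u ey ey \<in> L2 (Om l)" "pd l v ey ey \<in> L2 (Om l)" "pd l (\<lambda>z. a *\<^sub>R u z + b *\<^sub>R v z) ey ey \<in> L2 (Om l)"
    by (intro pd_weak(2) V V_lincomb l; simp)+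
  have pl: "(\<lambda>z. a * pd l u ey ey z) \<in> L2 (Om l)" "(\<lambda>z. b * pd l v ey ey z) \<in> L2 (Om l)"
    using L2_scaleR[OF p(1), of a] L2_scaleR[OF p(2), of b] by simp_all
  have "AE z in Om l. pd l (\<lambda>z. a *\<^sub>R u z + b *\<^sub>R v z) ey ey z = a * pd l u ey ey z + b * pd l v ey ey z"
    by (rule pd_lincomb[OF l V]) simp_all
  then have "AE y in Iy l. fc \<xi> (pd l (\<lambda>z. a *\<^sub>R u z + b *\<^sub>R v z) ey ey) y = fc \<xi> (\<lambda>z. a * pd l u ey ey z + b * pd l v ey ey z) y"
    by (intro fc_cong_AE L2_measurable p L2_lincomb)
  moreover have "AE y in Iy l. fc \<xi> (\<lambda>z. a * pd l u ey ey z + b * pd l v ey ey z) y = fc \<xi> (\<lambda>z. a * pd l u ey ey z) y + fc \<xi> (\<lambda>z. b * pd l v ey ey z) y"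
    by (rule fc_add[OF pl])
  ultimately have e: "AE y in Iy l. fc \<xi> (pd l (\<lambda>z. a *\<^sub>R u z + b *\<^sub>R v z) ey ey) y = of_real a * fc \<xi> (pd l u ey ey) y + of_real b * fc \<xi> (pd l v ey ey) y"
    by eventually_elim (simp add: fc_scale)
  have i: "integrable (Iy l) (fc \<xi> (pd l u ey ey))" "integrable (Iy l) (fc \<xi> (pd l v ey ey))" "integrable (Iy l) (fc \<xi> (pd l (\<lambda>z. a *\<^sub>R u z + b *\<^sub>R v z) ey ey))"
    by (intro L2_integrable finite_measure_Iy fc_L2 p)+
  have "bf \<xi> l (\<lambda>z. a *\<^sub>R u z + b *\<^sub>R v z) = (LINT y|Iy l. of_real a * fc \<xi> (pd l u ey ey) y + of_real b * fc \<xi> (pd l v ey ey) y)"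
    unfolding bf_def by (rule integral_cong_AE[OF _ _ e]) (use i in auto)
  then show ?thesis using i by (simp add: bf_def)
qed

lemma qf_Cauchy_Schwarz:
  assumes u: "u \<in> L2 (Om l)" and v: "v \<in> L2 (Om l)"
  shows "\<bar>qf \<xi> l u v\<bar> \<le> sqrt (qf \<xi> l u u) * sqrt (qf \<xi> l v v)"
proof (rule psd_Cauchy_Schwarz[OF _ qf_nonneg qf_nonneg])
  fix t :: real
  have w: "(\<lambda>z. 1 *\<^sub>R u z + t *\<^sub>R v z) \<in> L2 (Om l)" by (intro L2_add L2_scaleR u v)
  have "0 \<le> qf \<xi> l (\<lambda>z. 1 *\<^sub>R u z + t *\<^sub>R v z) (\<lambda>z. 1 *\<^sub>R u z + t *\<^sub>R v z)" by (rule qf_nonneg)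
  also have "\<dots> = qf \<xi> l u u + 2 * t * qf \<xi> l u v + t^2 * qf \<xi> l v v"
    unfolding qf_lincomb[OF u v w] qf_lincomb_right[OF u v u] qf_lincomb_right[OF u v v] qf_commute[of \<xi> l v u]
    by (simp add: algebra_simps power2_eq_square)
  finally show "0 \<le> qf \<xi> l u u + 2 * t * qf \<xi> l u v + t^2 * qf \<xi> l v v" .
qed

lemma df_Cauchy_Schwarz:
  assumes l: "l > 0" and u: "u \<in> V l" and v: "v \<in> V l"
  shows "\<bar>df \<xi> l u v\<bar> \<le> sqrt (df \<xi> l u u) * sqrt (df \<xi> l v v)"
proof (rule psd_Cauchy_Schwarz[OF _ df_nonneg df_nonneg])
  fix t :: real
  have w: "(\<lambda>z. 1 *\<^sub>R u z + t *\<^sub>R v z) \<in> V l" by (intro V_lincomb l u v)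
  have "0 \<le> df \<xi> l (\<lambda>z. 1 *\<^sub>R u z + t *\<^sub>R v z) (\<lambda>z. 1 *\<^sub>R u z + t *\<^sub>R v z)" by (rule df_nonneg)
  also have "\<dots> = df \<xi> l u u + 2 * t * df \<xi> l u v + t^2 * df \<xi> l v v"
    unfolding df_lincomb[OF l u v w] df_lincomb_right[OF l u v u] df_lincomb_right[OF l u v v] df_commute[of \<xi> l v u]
    by (simp add: algebra_simps power2_eq_square)
  finally show "0 \<le> df \<xi> l u u + 2 * t * df \<xi> l u v + t^2 * df \<xi> l v v" .
qed

lemma qf_eq_norms: "qf \<xi> l u u = (\<Sum>c\<in>Basis. (fcn l \<xi> (\<lambda>z. u z \<bullet> c))^2)"
  by (simp add: qf_def L2_norm_sq)

lemma df_eq_norms: "df \<xi> l u u = (\<Sum>b\<in>Basis. \<Sum>c\<in>Basis. (fcn l \<xi> (sym_grad l u b c))^2)"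
  by (simp add: df_def L2_norm_sq)

lemma qf_le_L2_norm:
  assumes u: "u \<in> L2 (Om l)"
  shows "qf \<xi> l u u \<le> (L2_norm (Om l) u)^2"
proof -
  have "(L2_norm (Om l) u)^2 = (\<Sum>c\<in>Basis. (L2_norm (Om l) (\<lambda>z. u z \<bullet> c))^2)"
    by (simp only: L2_norm_sq L2_inner_components[OF u u])
  then show ?thesis unfolding qf_eq_norms
    by (simp only:) (intro sum_mono power_mono L2_norm_fc_le L2_comp[OF u] L2_norm_nonneg)
qed

lemma abs_qf_le:
  assumes "u \<in> L2 (Om l)" "v \<in> L2 (Om l)"
  shows "\<bar>qf \<xi> l u v\<bar> \<le> L2_norm (Om l) u * L2_norm (Om l) v"
proof -
  have "sqrt (qf \<xi> l w w) \<le> L2_norm (Om l) w" if "w \<in> L2 (Om l)" for w :: "'a field"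
    using qf_le_L2_norm[OF that, of \<xi>] L2_norm_nonneg by (intro real_le_lsqrt) auto
  then have "sqrt (qf \<xi> l u u) * sqrt (qf \<xi> l v v) \<le> L2_norm (Om l) u * L2_norm (Om l) v"
    using assms by (intro mult_mono) (auto simp: L2_norm_nonneg qf_nonneg)
  then show ?thesis using qf_Cauchy_Schwarz[OF assms, of \<xi>] by linarith
qed

lemma df_le_V_norm:
  fixes u :: "('n::finite) field"
  assumes u: "u \<in> V l"
  shows "df \<xi> l u u \<le> (2 * real DIM('n pt) * V_norm l u)\<^sup>2"
proof -
  have "fcn l \<xi> (sym_grad l u b c) \<le> 2 * V_norm l u" if "b \<in> Basis" "c \<in> Basis" for b c
  proof -
    have "fcn l \<xi> (sym_grad l u b c) \<le> L2_norm (Om l) (sym_grad l u b c)"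
      by (rule L2_norm_fc_le[OF sym_grad_L2[OF u that]])
    also have "\<dots> \<le> L2_norm (Om l) (pd l u b c) + L2_norm (Om l) (pd l u c b)"
      unfolding sym_grad_def[abs_def] using that by (intro L2_norm_triangle pd_weak(2)[OF u])
    also have "\<dots> \<le> 2 * V_norm l u"
      using pd_le_V_norm[OF that, of l u] pd_le_V_norm[OF that(2,1), of l u] by simp
    finally show ?thesis .
  qed
  then have "df \<xi> l u u \<le> (\<Sum>b\<in>(Basis :: 'n pt set). \<Sum>c\<in>(Basis :: 'n pt set). (2 * V_norm l u)\<^sup>2)"
    unfolding df_eq_norms by (intro sum_mono power_mono L2_norm_nonneg)
  also have "\<dots> = (2 * real DIM('n pt) * V_norm l u)\<^sup>2" by (simp add: power2_eq_square algebra_simps)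
  finally show ?thesis .
qed

lemma abs_df_le:
  fixes u v :: "('n::finite) field"
  assumes "l > 0" "u \<in> V l" "v \<in> V l"
  shows "\<bar>df \<xi> l u v\<bar> \<le> (2 * real DIM('n pt))\<^sup>2 * V_norm l v * V_norm l u"
proof -
  have "sqrt (df \<xi> l w w) \<le> 2 * real DIM('n pt) * V_norm l w" if "w \<in> V l" for w :: "'n field"
    using df_le_V_norm[OF that, of \<xi>] V_norm_nonneg[of l w] by (intro real_le_lsqrt) (auto simp: df_nonneg)
  then have "sqrt (df \<xi> l u u) * sqrt (df \<xi> l v v) \<le> (2 * real DIM('n pt) * V_norm l u) * (2 * real DIM('n pt) * V_norm l v)"
    using assms by (intro mult_mono) (auto simp: V_norm_nonneg df_nonneg)
  then show ?thesis using df_Cauchy_Schwarz[OF assms, of \<xi>] by (simp add: power2_eq_square mult_ac)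
qed

lemma cmod_bf_le:
  assumes l: "l > 0" and v: "v \<in> V l"
  shows "cmod (bf \<xi> l v) \<le> sqrt l * fcn l \<xi> (pd l v ey ey)"
  unfolding bf_def
  using norm_integral_le_L2_norm[OF finite_measure_Iy fc_L2[OF pd_weak(2)[OF v ey_Basis ey_Basis]], of \<xi>]
  by (simp only: measure_Iy[OF l])

lemma cmod_bf_le_V_norm:
  assumes l: "l > 0" and v: "v \<in> V l"
  shows "cmod (bf \<xi> l v) \<le> sqrt l * V_norm l v"
proof -
  have "fcn l \<xi> (pd l v ey ey) \<le> V_norm l v"
    using L2_norm_fc_le[OF pd_weak(2)[OF v ey_Basis ey_Basis], of \<xi>] pd_le_V_norm[OF ey_Basis ey_Basis, of l v] by linarith
  then have "sqrt l * fcn l \<xi> (pd l v ey ey) \<le> sqrt l * V_norm l v" using l by (intro mult_left_mono) auto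
  then show ?thesis using cmod_bf_le[OF assms, of \<xi>] by linarith
qed


section \<open>Coercivity\<close>

lemma fc_sym_grad_diag: "fc \<xi> (sym_grad l u b b) y = 2 * fc \<xi> (pd l u b b) y"
  using fc_scale[of \<xi> 2 "pd l u b b" y] by (simp add: sym_grad_def[abs_def])

lemma fc_sym_grad:
  assumes "u \<in> V l" "b \<in> Basis" "c \<in> Basis"
  shows "AE y in Iy l. fc \<xi> (sym_grad l u b c) y = fc \<xi> (pd l u b c) y + fc \<xi> (pd l u c b) y"
  unfolding sym_grad_def[abs_def] using assms by (intro fc_add pd_weak(2))

lemma L2_norm_fc_diag:
  "(fcn l \<xi> (sym_grad l u b b))^2 = 4 * (fcn l \<xi> (pd l u b b))^2"
  unfolding L2_norm_sq_integral fc_sym_grad_diag by (simp add: norm_mult power_mult_distrib)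

lemma df_ge_entry:
  assumes "b \<in> Basis" "c \<in> Basis"
  shows "(fcn l \<xi> (sym_grad l u b c))^2 \<le> (\<Sum>c\<in>Basis. (fcn l \<xi> (sym_grad l u b c))^2)"
  by (rule member_le_sum[OF assms(2)]) auto

lemma df_ge_row:
  assumes "b \<in> Basis"
  shows "(\<Sum>c\<in>Basis. (fcn l \<xi> (sym_grad l u b c))^2) \<le> df \<xi> l u u"
  unfolding df_eq_norms by (rule member_le_sum[OF assms, of "\<lambda>b. \<Sum>c\<in>Basis. (fcn l \<xi> (sym_grad l u b c))^2"]) (auto intro: sum_nonneg)

lemma df_ge_vertical: "4 * (fcn l \<xi> (pd l u ey ey))^2 \<le> df \<xi> l u u"
  using df_ge_entry[OF ey_Basis ey_Basis, of l \<xi> u] df_ge_row[OF ey_Basis, of l \<xi> u] by (simp add: L2_norm_fc_diag)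

text \<open>The flux integrates the vertical derivative of the vertical component, which is half of
  a diagonal entry of the symmetric gradient.\<close>

lemma bf_le_df:
  assumes l: "l > 0" and v: "v \<in> V l"
  shows "(cmod (bf \<xi> l v))^2 \<le> l * df \<xi> l v v"
proof -
  have "(cmod (bf \<xi> l v))^2 \<le> (sqrt l * fcn l \<xi> (pd l v ey ey))^2"
    using cmod_bf_le[OF assms, of \<xi>] by (intro power_mono) auto
  also have "\<dots> = l * (fcn l \<xi> (pd l v ey ey))^2" using l by (simp add: power_mult_distrib)
  also have "\<dots> \<le> l * df \<xi> l v v"
    using df_ge_vertical[of l \<xi> v] l zero_le_power2[of "fcn l \<xi> (pd l v ey ey)"] by (intro mult_left_mono) linarith+
  finally show ?thesis .
qed

lemma pd_eq_weak_partial: "pd l u b c = weak_partial l b (\<lambda>z. u z \<bullet> c)"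
  by (simp add: pd_def)

lemma fc_poincare_V:
  assumes l: "l > 0" and u: "u \<in> V l" and c: "c \<in> Basis"
  shows "(fcn l \<xi> (\<lambda>z. u z \<bullet> c))^2 \<le> l\<^sup>2 * (fcn l \<xi> (pd l u ey c))^2"
  using power_mono[OF fc_poincare[OF l V_trace_0[OF u c], of \<xi>] L2_norm_nonneg, of 2]
  by (simp add: power_mult_distrib pd_eq_weak_partial)

text \<open>The horizontal block of the symmetric gradient has symbol \<open>\<xi>\<^sub>i a\<^sub>j + \<xi>\<^sub>j a\<^sub>i\<close>, whose square sum
  is \<open>2 |\<xi>|\<^sup>2 |a|\<^sup>2 + 2 |\<xi> \<cdot> a|\<^sup>2\<close>; this replaces Korn's inequality.\<close>

lemma symmetric_symbol_bound:
  fixes x :: "'n::finite \<Rightarrow> real" and a :: "'n \<Rightarrow> complex"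
  shows "2 * (\<Sum>i\<in>UNIV. (x i)\<^sup>2) * (\<Sum>j\<in>UNIV. (cmod (a j))^2) \<le> (\<Sum>i\<in>UNIV. \<Sum>j\<in>UNIV. (cmod (of_real (x i) * a j + of_real (x j) * a i))^2)"
proof -
  have e: "(cmod (of_real (x i) * a j + of_real (x j) * a i))^2 =
     (x i)\<^sup>2 * (cmod (a j))^2 + (x j)\<^sup>2 * (cmod (a i))^2 + 2 * Re ((of_real (x i) * cnj (a i)) * (of_real (x j) * a j))" for i j
    unfolding cmod_power2 by (simp add: power2_eq_square algebra_simps)
  have "(\<Sum>i\<in>UNIV. \<Sum>j\<in>UNIV. Re ((of_real (x i) * cnj (a i)) * (of_real (x j) * a j))) =
      Re ((\<Sum>i\<in>UNIV. of_real (x i) * cnj (a i)) * (\<Sum>j\<in>UNIV. of_real (x j) * a j))"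
    by (simp add: sum_product)
  also have "(\<Sum>i\<in>UNIV. of_real (x i) * cnj (a i)) = cnj (\<Sum>j\<in>UNIV. of_real (x j) * a j)" by simp
  also have "Re (cnj w * w) = (cmod w)^2" for w unfolding cmod_power2 by (simp add: power2_eq_square)
  finally have "0 \<le> (\<Sum>i\<in>UNIV. \<Sum>j\<in>UNIV. Re ((of_real (x i) * cnj (a i)) * (of_real (x j) * a j)))" by simp
  moreover have "(\<Sum>i\<in>UNIV. \<Sum>j\<in>UNIV. (x i)\<^sup>2 * (cmod (a j))^2) = (\<Sum>i\<in>UNIV. (x i)\<^sup>2) * (\<Sum>j\<in>UNIV. (cmod (a j))^2)"
    by (simp add: sum_product)
  moreover have "(\<Sum>i\<in>UNIV. \<Sum>j\<in>UNIV. (x j)\<^sup>2 * (cmod (a i))^2) = (\<Sum>i\<in>UNIV. (x i)\<^sup>2) * (\<Sum>j\<in>UNIV. (cmod (a j))^2)"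
    by (subst sum.swap) (simp add: sum_product)
  ultimately show ?thesis unfolding e by (simp add: sum.distrib flip: sum_distrib_left)
qed

lemma norm_freq_sq: "(norm (freq \<xi>))^2 = (\<Sum>i\<in>UNIV. (of_int (\<xi> $ i))\<^sup>2)"
  unfolding power2_norm_eq_inner by (simp add: inner_vec_def freq_def power2_eq_square)

lemma norm_freq_ge_1:
  assumes "\<xi> \<noteq> 0"
  shows "1 \<le> norm (freq \<xi>)"
proof -
  obtain i where i: "\<xi> $ i \<noteq> 0" using assms by (metis vec_eq_iff zero_index)
  have "1 \<le> \<bar>real_of_int (\<xi> $ i)\<bar>" using i by linarith
  also have "\<dots> \<le> norm (freq \<xi>)" using component_le_norm_cart[of "freq \<xi>" i] by (simp add: freq_def)
  finally show ?thesis .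
qed

text \<open>The constant is the factor 2 of \<open>symmetric_symbol_bound\<close> times
  \<open>(2 * pi)\<^sup>2\<close> from the two horizontal derivatives.\<close>

lemma df_ge_horizontal:
  assumes l: "l > 0" and u: "u \<in> V l"
  shows "8 * pi\<^sup>2 * (norm (freq \<xi>))^2 * (\<Sum>j\<in>UNIV. (fcn l \<xi> (\<lambda>z. u z \<bullet> ex j))^2) \<le> df \<xi> l u u"
proof -
  let ?a = "\<lambda>j. fc \<xi> (\<lambda>z. u z \<bullet> ex j)" and ?x = "\<lambda>i. real_of_int (\<xi> $ i)"
  have aL: "?a j \<in> L2 (Iy l)" for j by (intro fc_L2 L2_comp V_in_L2 u) simp
  have sL: "fc \<xi> (sym_grad l u (ex i) (ex j)) \<in> L2 (Iy l)" for i j by (intro fc_L2 sym_grad_L2 u) simp_all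
  have "AE y in Iy l. \<forall>i j. fc \<xi> (sym_grad l u (ex i) (ex j)) y = 2 * pi * \<i> * (of_real (?x i) * ?a j y + of_real (?x j) * ?a i y)"
  proof -
    have "AE y in Iy l. fc \<xi> (sym_grad l u (ex i) (ex j)) y = 2 * pi * \<i> * (of_real (?x i) * ?a j y + of_real (?x j) * ?a i y)" for i j
      using fc_sym_grad[OF u ex_Basis[of i] ex_Basis[of j], of \<xi>]
        fc_weak_partial_ex[OF l V_trace_0[OF u ex_Basis[of j]], of \<xi> i]
        fc_weak_partial_ex[OF l V_trace_0[OF u ex_Basis[of i]], of \<xi> j]
      unfolding pd_eq_weak_partial by eventually_elim (simp add: algebra_simps)
    then show ?thesis by (simp add: AE_all_countable)
  qed
  then have p: "AE y in Iy l. 8 * pi\<^sup>2 * (norm (freq \<xi>))^2 * (\<Sum>j\<in>UNIV. (norm (?a j y))^2) \<le>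
      (\<Sum>i\<in>UNIV. \<Sum>j\<in>UNIV. (norm (fc \<xi> (sym_grad l u (ex i) (ex j)) y))^2)"
  proof eventually_elim
    case (elim y)
    have "(norm (fc \<xi> (sym_grad l u (ex i) (ex j)) y))^2 = 4 * pi\<^sup>2 * (cmod (of_real (?x i) * ?a j y + of_real (?x j) * ?a i y))^2" for i j
      using elim by (simp add: norm_mult power_mult_distrib)
    then have "(\<Sum>i\<in>UNIV. \<Sum>j\<in>UNIV. (norm (fc \<xi> (sym_grad l u (ex i) (ex j)) y))^2) =
       4 * pi\<^sup>2 * (\<Sum>i\<in>UNIV. \<Sum>j\<in>UNIV. (cmod (of_real (?x i) * ?a j y + of_real (?x j) * ?a i y))^2)"
      by (simp add: sum_distrib_left)
    also have "\<dots> \<ge> 4 * pi\<^sup>2 * (2 * (\<Sum>i\<in>UNIV. (?x i)\<^sup>2) * (\<Sum>j\<in>UNIV. (cmod (?a j y))^2))"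
      by (intro mult_left_mono symmetric_symbol_bound) simp
    finally show ?case by (simp add: norm_freq_sq)
  qed
  have "8 * pi\<^sup>2 * (norm (freq \<xi>))^2 * (\<Sum>j\<in>UNIV. (L2_norm (Iy l) (?a j))^2) =
      (LINT y|Iy l. 8 * pi\<^sup>2 * (norm (freq \<xi>))^2 * (\<Sum>j\<in>UNIV. (norm (?a j y))^2))"
    using L2_integrable_norm_sq[OF aL] by (simp add: L2_norm_sq_integral)
  also have "\<dots> \<le> (LINT y|Iy l. (\<Sum>i\<in>UNIV. \<Sum>j\<in>UNIV. (norm (fc \<xi> (sym_grad l u (ex i) (ex j)) y))^2))"
    using L2_integrable_norm_sq[OF aL] L2_integrable_norm_sq[OF sL] by (intro integral_mono_AE p) auto
  also have "\<dots> = (\<Sum>i\<in>UNIV. \<Sum>j\<in>UNIV. (fcn l \<xi> (sym_grad l u (ex i) (ex j)))^2)"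
    using L2_integrable_norm_sq[OF sL] by (simp add: L2_norm_sq_integral)
  also have "\<dots> \<le> df \<xi> l u u"
    unfolding df_eq_norms sum_Basis_pt by (simp add: sum_nonneg sum.distrib add_nonneg_nonneg)
  finally show ?thesis .
qed

lemma qf_split: "qf \<xi> l u u = (fcn l \<xi> (\<lambda>z. u z \<bullet> ey))^2 + (\<Sum>j\<in>UNIV. (fcn l \<xi> (\<lambda>z. u z \<bullet> ex j))^2)"
  by (simp only: qf_eq_norms sum_Basis_pt)

text \<open>The Korn-Poincare inequality at one frequency. The vertical component is controlled by
  its diagonal entry and Poincare. The horizontal ones are controlled by their own block if \<xi> is
  nonzero; at frequency 0 horizontal derivatives vanish, so the mixed entry is the vertical
  derivative alone and Poincare applies again. The constant adds \<open>l\<^sup>2\<close> and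
  \<open>1 + l\<^sup>2\<close>.\<close>

lemma qf_le_df:
  assumes l: "l > 0" and u: "u \<in> V l"
  shows "qf \<xi> l u u \<le> (1 + 2 * l^2) * df \<xi> l u u"
proof -
  have D0: "0 \<le> df \<xi> l u u" by (rule df_nonneg)
  have v: "(fcn l \<xi> (\<lambda>z. u z \<bullet> ey))^2 \<le> l\<^sup>2 * df \<xi> l u u"
  proof -
    have "(fcn l \<xi> (pd l u ey ey))^2 \<le> df \<xi> l u u"
      using df_ge_vertical[of l \<xi> u] zero_le_power2[of "fcn l \<xi> (pd l u ey ey)"] by linarith
    then have "l\<^sup>2 * (fcn l \<xi> (pd l u ey ey))^2 \<le> l\<^sup>2 * df \<xi> l u u" by (intro mult_left_mono) auto
    then show ?thesis using fc_poincare_V[OF l u ey_Basis, of \<xi>] by linarith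
  qed
  have h: "(\<Sum>j\<in>UNIV. (fcn l \<xi> (\<lambda>z. u z \<bullet> ex j))^2) \<le> (1 + l^2) * df \<xi> l u u"
  proof (cases "\<xi> = 0")
    case False
    let ?S = "\<Sum>j\<in>UNIV. (fcn l \<xi> (\<lambda>z. u z \<bullet> ex j))^2"
    have S0: "0 \<le> ?S" by (intro sum_nonneg) auto
    have "1 \<le> (norm (freq \<xi>))^2" using norm_freq_ge_1[OF False] by simp
    moreover have "1 \<le> 8 * pi\<^sup>2"
    proof -
      have "1 \<le> pi\<^sup>2" using pi_ge_two by (intro one_le_power) simp
      then show ?thesis by simp
    qed
    ultimately have "1 * 1 \<le> 8 * pi\<^sup>2 * (norm (freq \<xi>))^2" by (intro mult_mono) auto
    then have "1 * ?S \<le> 8 * pi\<^sup>2 * (norm (freq \<xi>))^2 * ?S" using S0 by (intro mult_right_mono) auto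
    also have "\<dots> \<le> df \<xi> l u u" by (rule df_ge_horizontal[OF l u])
    also have "\<dots> \<le> (1 + l^2) * df \<xi> l u u" using D0 by (simp add: distrib_right)
    finally show ?thesis by simp
  next
    case True
    have e: "(fcn l \<xi> (\<lambda>z. u z \<bullet> ex j))^2 \<le> l\<^sup>2 * (fcn l \<xi> (sym_grad l u ey (ex j)))^2" for j
    proof -
      have "AE y in Iy l. fc \<xi> (sym_grad l u ey (ex j)) y = fc \<xi> (pd l u ey (ex j)) y"
        using fc_sym_grad[OF u ey_Basis ex_Basis[of j], of \<xi>] fc_weak_partial_ex[OF l V_trace_0[OF u ey_Basis], of \<xi> j]
        unfolding pd_eq_weak_partial by eventually_elim (simp add: True)
      then have "fcn l \<xi> (sym_grad l u ey (ex j)) = fcn l \<xi> (pd l u ey (ex j))"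
        by (intro L2_norm_cong_AE L2_measurable fc_L2 sym_grad_L2 pd_weak(2) u) simp_all
      then show ?thesis using fc_poincare_V[OF l u ex_Basis[of j], of \<xi>] by simp
    qed
    have "(\<Sum>j\<in>UNIV. (fcn l \<xi> (\<lambda>z. u z \<bullet> ex j))^2) \<le> (\<Sum>j\<in>UNIV. l\<^sup>2 * (fcn l \<xi> (sym_grad l u ey (ex j)))^2)"
      by (intro sum_mono e)
    also have "\<dots> \<le> l\<^sup>2 * (\<Sum>c\<in>Basis. (fcn l \<xi> (sym_grad l u ey c))^2)"
      unfolding sum_Basis_pt by (simp add: sum_distrib_left distrib_left)
    also have "\<dots> \<le> l\<^sup>2 * df \<xi> l u u" by (intro mult_left_mono df_ge_row) simp_all
    also have "\<dots> \<le> (1 + l^2) * df \<xi> l u u" using D0 by (simp add: distrib_right)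
    finally show ?thesis .
  qed
  have "qf \<xi> l u u \<le> l\<^sup>2 * df \<xi> l u u + (1 + l^2) * df \<xi> l u u" unfolding qf_split using v h by linarith
  also have "\<dots> = (1 + 2 * l^2) * df \<xi> l u u" by (simp add: algebra_simps)
  finally show ?thesis .
qed

section \<open>A solenoidal lift of boundary data\<close>

text \<open>The real part spreads the mode over the frequencies \<xi> and -\<xi>, which are distinct
  here; each receives half.\<close>

lemma fourier_Re_tr:
  assumes "\<xi> \<noteq> 0"
  shows "fourier (\<lambda>x. Re (w * tr \<xi> x)) \<xi> = w / 2"
proof -
  have ne: "- \<xi> + - \<xi> \<noteq> 0"
  proof
    assume e: "- \<xi> + - \<xi> = 0"
    have "\<xi> $ i = 0" for i using arg_cong[OF e, of "\<lambda>v. v $ i"] by simp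
    then show False using assms by (simp add: vec_eq_iff)
  qed
  have "complex_of_real (Re (w * tr \<xi> x)) * cnj (tr \<xi> x) = w / 2 * (tr \<xi> x * cnj (tr \<xi> x)) + cnj w / 2 * tr (- \<xi> + - \<xi>) x" for x
  proof -
    have "complex_of_real (Re (w * tr \<xi> x)) = (w * tr \<xi> x + cnj (w * tr \<xi> x)) / 2" by (simp add: complex_eq_iff)
    moreover have "(w * t + u * s) / 2 * s = w / 2 * (t * s) + u / 2 * (s * s)" for t u s :: complex
      by (simp add: field_simps)
    ultimately show ?thesis by (simp only: tr_mult[symmetric] cnj_tr[symmetric] complex_cnj_mult)
  qed
  then have "fourier (\<lambda>x. Re (w * tr \<xi> x)) \<xi> = (LINT x|Sig. w / 2 * (tr \<xi> x * cnj (tr \<xi> x)) + cnj w / 2 * tr (- \<xi> + - \<xi>) x)"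
    by (simp only: fourier_alt)
  also have "\<dots> = w / 2 * (LINT x|Sig. tr \<xi> x * cnj (tr \<xi> x)) + cnj w / 2 * (LINT x|Sig. tr (- \<xi> + - \<xi>) x)"
    by (subst Bochner_Integration.integral_add) (simp_all only: integrable_tr integrable_mult_right cnj_tr tr_mult integral_mult_right_zero)
  also have "\<dots> = w / 2" using ne by (simp only: integral_tr_cnj_tr integral_tr) simp
  finally show ?thesis .
qed

lemma fc_mode:
  assumes "\<xi> \<noteq> 0"
  shows "fc \<xi> (mode \<xi> p) y = p y / 2"
  using fourier_Re_tr[OF assms, of "p y"] by (simp add: fc_def mode_def del: times_complex.sel)

lemma csmooth_lincomb:
  assumes "\<And>k. Ck k f" "\<And>k. Ck k g"
  shows "csmooth (\<lambda>y. a * of_real (f y) + b * of_real (g y))"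
  using assms by (auto simp: csmooth_def smooth_def intro!: Ck_add Ck_cmult)

text \<open>The vertical profile is \<open>f\<close> and the horizontal one is determined by solenoidality when \<open>g\<close> is
  the derivative of \<open>f\<close>.\<close>

definition profile :: "int ^ 'n::finite \<Rightarrow> complex \<Rightarrow> (real \<Rightarrow> real) \<Rightarrow> (real \<Rightarrow> real) \<Rightarrow> 'n pt \<Rightarrow> real \<Rightarrow> complex" where
  "profile \<xi> z f g c y = z * of_real (snd c) * of_real (f y) +
     z * \<i> * of_real ((freq \<xi> \<bullet> fst c) / (2 * pi * (norm (freq \<xi>))^2)) * of_real (g y)"

text \<open>The factor 2 cancels the half of \<open>fc_mode\<close>, so the coefficient of the lift
  at \<xi> is the profile itself (\<open>fc_lift\<close>).\<close>

definition lift :: "int ^ 'n::finite \<Rightarrow> (real \<Rightarrow> real) \<Rightarrow> (real \<Rightarrow> real) \<Rightarrow> complex \<Rightarrow> 'n field" where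
  "lift \<xi> f g z p = (\<Sum>c\<in>Basis. mode \<xi> (\<lambda>y. 2 * profile \<xi> z f g c y) p *\<^sub>R c)"

lemma lift_comp: "c \<in> Basis \<Longrightarrow> lift \<xi> f g z p \<bullet> c = mode \<xi> (\<lambda>y. 2 * profile \<xi> z f g c y) p"
  by (simp add: lift_def inner_sum_left inner_Basis if_distrib cong: if_cong)

lemma lift_lincomb: "lift \<xi> f g (of_real a * z + of_real b * z') = (\<lambda>p. a *\<^sub>R lift \<xi> f g z p + b *\<^sub>R lift \<xi> f g z' p)"
proof
  fix p
  show "lift \<xi> f g (of_real a * z + of_real b * z') p = a *\<^sub>R lift \<xi> f g z p + b *\<^sub>R lift \<xi> f g z' p"
  proof (rule euclidean_eqI)
    fix c :: "'a pt" assume c: "c \<in> Basis"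
    have "profile \<xi> (of_real a * z + of_real b * z') f g c y = of_real a * profile \<xi> z f g c y + of_real b * profile \<xi> z' f g c y" for y
      unfolding profile_def by (simp only: ring_distribs mult_ac add_ac)
    then show "lift \<xi> f g (of_real a * z + of_real b * z') p \<bullet> c = (a *\<^sub>R lift \<xi> f g z p + b *\<^sub>R lift \<xi> f g z' p) \<bullet> c"
      unfolding inner_add_left inner_scaleR_left lift_comp[OF c] mode_def by (simp add: algebra_simps)
  qed
qed

lemma snd_lift: "snd (lift \<xi> f g z p) = mode \<xi> (\<lambda>y. 2 * profile \<xi> z f g ey y) p"
  by (simp only: snd_eq_inner lift_comp[OF ey_Basis])

lemma sum_freq_sq: "(\<Sum>c\<in>(Basis :: ('n::finite) pt set). (freq \<xi> \<bullet> fst c)\<^sup>2) = (norm (freq \<xi>))^2"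
  unfolding norm_freq_sq by (simp add: sum_Basis_pt inner_axis freq_def)

text \<open>\<open>f\<close> shapes the vertical component, its derivative \<open>g\<close> the
  horizontal ones, and \<open>h\<close> enters the dissipation. The zeros at the bottom make both
  kinds of component satisfy the boundary condition, and \<open>f l = 1\<close> makes the flux of
  the lift equal to the given number (\<open>bf_lift\<close>).\<close>

locale lift_profile =
  fixes \<xi> :: "int ^ 'n::finite" and l :: real and f g h :: "real \<Rightarrow> real"
  assumes l: "l > 0" and \<xi>: "\<xi> \<noteq> 0"
    and smooth_fgh: "\<And>k. Ck k f" "\<And>k. Ck k g" "\<And>k. Ck k h"
    and derivs: "\<And>y. (f has_real_derivative g y) (at y)" "\<And>y. (g has_real_derivative h y) (at y)"
    and boundary: "f 0 = 0" "g 0 = 0" "f l = 1"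
begin

abbreviation "P z \<equiv> profile \<xi> z f g"
abbreviation "P' z \<equiv> profile \<xi> z g h"
abbreviation "W \<equiv> lift \<xi> f g"

lemma freq_ne: "norm (freq \<xi>) \<noteq> 0"
  using \<xi> by simp

lemma csmooth_profile: "csmooth (\<lambda>y. 2 * P z c y)"
proof -
  have "(\<lambda>y. 2 * P z c y) = (\<lambda>y. (2 * (z * of_real (snd c))) * of_real (f y) +
      (2 * (z * \<i> * of_real ((freq \<xi> \<bullet> fst c) / (2 * pi * (norm (freq \<xi>))^2)))) * of_real (g y))"
    unfolding profile_def by (simp only: ring_distribs mult_ac)
  then show ?thesis by (simp only: csmooth_lincomb[OF smooth_fgh(1,2)])
qed

lemma mode_profile_smooth: "mode \<xi> (\<lambda>y. 2 * P z c y) \<in> smooth_per"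
  by (rule mode_smooth_per[OF csmooth_profile])

lemma profile_derivative: "((\<lambda>y. 2 * P z c y) has_vector_derivative 2 * P' z c y) (at y)"
proof -
  have d: "((\<lambda>y. complex_of_real (k y)) has_vector_derivative of_real (k' y)) (at y)"
    if "(k has_real_derivative k' y) (at y)" for k k' :: "real \<Rightarrow> real"
    using has_vector_derivative_of_real[OF that] .
  have "((\<lambda>y. P z c y) has_vector_derivative P' z c y) (at y)"
    unfolding profile_def by (intro has_vector_derivative_add has_vector_derivative_mult_right d derivs)
  then show ?thesis by (rule has_vector_derivative_mult_right)
qed

lemma pd_lift:
  assumes "b \<in> Basis" "c \<in> Basis"
  shows "AE p in Om l. pd l (W z) b c p = dir_deriv b (mode \<xi> (\<lambda>y. 2 * P z c y)) p"
  unfolding pd_def lift_comp[OF assms(2)]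
  by (rule weak_partial_AE_eq[OF l is_weak_partial_smooth[OF l mode_profile_smooth assms(1)]])

lemma dir_deriv_profile_ey: "dir_deriv ey (mode \<xi> (\<lambda>y. 2 * P z c y)) = mode \<xi> (\<lambda>y. 2 * P' z c y)"
  by (subst dir_deriv_mode[OF profile_derivative]) (auto simp: mode_def)

lemma dir_deriv_profile_ex: "dir_deriv (ex i) (mode \<xi> (\<lambda>y. 2 * P z c y)) = mode \<xi> (\<lambda>y. 2 * (2 * pi * \<i> * of_int (\<xi> $ i) * P z c y))"
proof -
  have "freq \<xi> \<bullet> axis i 1 = real_of_int (\<xi> $ i)" by (simp add: inner_axis freq_def)
  then have e: "(\<lambda>y. 2 * pi * \<i> * of_real (freq \<xi> \<bullet> fst (ex i :: 'n pt)) * (2 * P z c y)) = (\<lambda>y. 2 * (2 * pi * \<i> * of_int (\<xi> $ i) * P z c y))"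
    by (simp add: mult_ac)
  show ?thesis by (simp only: dir_deriv_mode[OF profile_derivative] e) simp
qed

lemma lift_V: "W z \<in> V l"
proof (rule VI)
  show "has_trace l 0 (\<lambda>p. W z p \<bullet> c) (\<lambda>x. 0)" if c: "c \<in> Basis" for c
  proof -
    have "(\<lambda>x. mode \<xi> (\<lambda>y. 2 * P z c y) (x, 0)) = (\<lambda>x. 0)"
      by (simp add: mode_def profile_def boundary)
    from has_trace_smooth[OF l mode_profile_smooth[of z c], of 0, unfolded this] show ?thesis
      by (simp only: lift_comp[OF c])
  qed
  have "AE p in Om l. \<forall>b\<in>Basis. pd l (W z) b b p = dir_deriv b (mode \<xi> (\<lambda>y. 2 * P z b y)) p"
    by (intro AE_finite_allI) (auto intro: pd_lift)
  then show "AE p in Om l. divergence l (W z) p = 0"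
  proof eventually_elim
    case (elim p)
    let ?y = "snd p" and ?t = "tr \<xi> (fst p)" and ?n = "(norm (freq \<xi>))^2"
    have n: "?n \<noteq> 0" using freq_ne by simp
    have ey: "2 * P' z ey ?y * ?t = 2 * z * of_real (g ?y) * ?t" by (simp add: profile_def)
    \<comment> \<open>The two imaginary units combine to -1 and the factors \<open>2 * pi\<close>
      cancel. Axis \<open>i\<close> contributes minus the vertical derivative times the share of its
      component in |\<xi>|^2, and the shares add up to 1.\<close>
    have ex: "2 * (2 * pi * \<i> * of_int (\<xi> $ i) * P z (ex i) ?y) * ?t = - (of_real ((of_int (\<xi> $ i))\<^sup>2 / ?n) * (2 * z * of_real (g ?y) * ?t))" for i
    proof -
      have fr: "freq \<xi> \<bullet> axis i 1 = real_of_int (\<xi> $ i)" by (simp add: inner_axis freq_def)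
      have Pex: "P z (ex i) ?y = z * \<i> * of_real (real_of_int (\<xi> $ i) / (2 * pi * ?n)) * of_real (g ?y)"
        by (simp add: profile_def fr)
      have "2 * (2 * pi * \<i> * of_int (\<xi> $ i) * P z (ex i) ?y) * ?t =
         (\<i> * \<i>) * (of_real (2 * pi * real_of_int (\<xi> $ i) * (real_of_int (\<xi> $ i) / (2 * pi * ?n))) * (2 * z * of_real (g ?y) * ?t))"
        unfolding Pex by (simp only: of_real_mult of_real_numeral of_real_of_int_eq mult_ac)
      also have "2 * pi * real_of_int (\<xi> $ i) * (real_of_int (\<xi> $ i) / (2 * pi * ?n)) = (of_int (\<xi> $ i))\<^sup>2 / ?n"
        by (simp add: power2_eq_square)
      finally show ?thesis by (simp only: i_squared mult_minus1)
    qed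
    have "divergence l (W z) p = Re (2 * P' z ey ?y * ?t) + (\<Sum>i\<in>UNIV. Re (2 * (2 * pi * \<i> * of_int (\<xi> $ i) * P z (ex i) ?y) * ?t))"
      unfolding divergence_def sum_Basis_pt
      using elim by (simp only: ey_Basis ex_Basis dir_deriv_profile_ey dir_deriv_profile_ex mode_def)
    also have "\<dots> = Re (2 * z * of_real (g ?y) * ?t) + (\<Sum>i\<in>UNIV. - ((of_int (\<xi> $ i))\<^sup>2 / ?n) * Re (2 * z * of_real (g ?y) * ?t))"
    proof -
      have "Re (- (of_real c * w)) = - c * Re w" for c w by simp
      then show ?thesis by (simp only: ex ey)
    qed
    also have "\<dots> = Re (2 * z * of_real (g ?y) * ?t) * (1 - (\<Sum>i\<in>UNIV. (of_int (\<xi> $ i))\<^sup>2) / ?n)"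
      by (simp only: sum_distrib_right[symmetric] sum_negf sum_divide_distrib[symmetric]) (simp only: algebra_simps)
    also have "\<dots> = 0" using n by (simp only: norm_freq_sq[symmetric]) simp
    finally show ?case .
  qed
qed

lemma lift_top_trace: "has_trace l l (\<lambda>p. snd (W z p)) (\<lambda>x. mode \<xi> (\<lambda>y. 2 * P z ey y) (x, l))"
  unfolding snd_lift by (rule has_trace_smooth[OF l mode_profile_smooth])

lemma bf_lift: "bf \<xi> l (W z) = z"
proof -
  have "bf \<xi> l (W z) = fc \<xi> (mode \<xi> (\<lambda>y. 2 * P z ey y)) l"
    unfolding fc_def by (rule fourier_top_trace_bf[OF l lift_V lift_top_trace, symmetric])
  then show ?thesis by (simp add: fc_mode[OF \<xi>] profile_def boundary)
qed

lemma fc_lift: "c \<in> Basis \<Longrightarrow> fc \<xi> (\<lambda>p. W z p \<bullet> c) = P z c"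
  by (rule ext) (simp only: lift_comp fc_mode[OF \<xi>], simp)

lemma continuous_profile:
  assumes "\<And>k. Ck k a" "\<And>k. Ck k b"
  shows "continuous_on UNIV (profile \<xi> z a b c)"
  unfolding profile_def[abs_def] using assms Ck_continuous by (intro continuous_intros) auto

lemma continuous_L2_Iy:
  fixes p :: "real \<Rightarrow> 'b::euclidean_space"
  assumes c: "continuous_on UNIV p"
  shows "p \<in> L2 (Iy l)"
proof -
  have "compact (p ` {0..l})" by (intro compact_continuous_image continuous_on_subset[OF c]) auto
  then obtain B where B: "\<And>y. y \<in> {0..l} \<Longrightarrow> norm (p y) \<le> B"
    by (force dest!: compact_imp_bounded simp: bounded_iff)
  show ?thesis
    by (rule L2_bounded[OF finite_measure_Iy, where B = B])
      (use B in \<open>auto intro!: AE_I2 borel_measurable_Iy borel_measurable_continuous_onI c\<close>)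
qed

text \<open>Kept general in \<open>a\<close> and \<open>b\<close>: the pair (\<open>f\<close>,
  \<open>g\<close>) describes the lift and the pair (\<open>g\<close>, \<open>h\<close>) its
  vertical derivative.\<close>

lemma sum_profile_norms:
  assumes a: "\<And>k. Ck k a" and b: "\<And>k. Ck k b"
  shows "(\<Sum>c\<in>Basis. (L2_norm (Iy l) (profile \<xi> z a b c))^2) =
    (cmod z)\<^sup>2 * ((LINT y|Iy l. (a y)\<^sup>2) + (LINT y|Iy l. (b y)\<^sup>2) / (4 * pi\<^sup>2 * (norm (freq \<xi>))^2))"
proof -
  let ?n = "norm (freq \<xi>)"
  have ca: "continuous_on UNIV a" "continuous_on UNIV b" using assms Ck_continuous by auto
  have i: "integrable (Iy l) (\<lambda>y. (a y)\<^sup>2)" "integrable (Iy l) (\<lambda>y. (b y)\<^sup>2)"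
    using L2_integrable_norm_sq[OF continuous_L2_Iy[OF ca(1)]] L2_integrable_norm_sq[OF continuous_L2_Iy[OF ca(2)]] by simp_all
  have pt: "(norm (profile \<xi> z a b c y))^2 = (cmod z)^2 * ((snd c)\<^sup>2 * (a y)\<^sup>2 + (freq \<xi> \<bullet> fst c)\<^sup>2 / (2 * pi * ?n\<^sup>2)\<^sup>2 * (b y)\<^sup>2)" for c y
  proof -
    have "profile \<xi> z a b c y = z * Complex (snd c * a y) ((freq \<xi> \<bullet> fst c) / (2 * pi * ?n\<^sup>2) * b y)"
      by (simp add: profile_def complex_eq_iff algebra_simps)
    then show ?thesis by (simp add: norm_mult power_mult_distrib cmod_power2 power_divide)
  qed
  have "(\<Sum>c\<in>Basis. (L2_norm (Iy l) (profile \<xi> z a b c))^2) =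
     (\<Sum>c\<in>Basis. (cmod z)^2 * ((snd c)\<^sup>2 * (LINT y|Iy l. (a y)\<^sup>2) + (freq \<xi> \<bullet> fst c)\<^sup>2 / (2 * pi * ?n\<^sup>2)\<^sup>2 * (LINT y|Iy l. (b y)\<^sup>2)))"
    unfolding L2_norm_sq_integral pt using i by simp
  also have "\<dots> = (cmod z)^2 * ((\<Sum>c\<in>(Basis :: 'n pt set). (snd c)\<^sup>2) * (LINT y|Iy l. (a y)\<^sup>2) +
      (\<Sum>c\<in>(Basis :: 'n pt set). (freq \<xi> \<bullet> fst c)\<^sup>2) / (2 * pi * ?n\<^sup>2)\<^sup>2 * (LINT y|Iy l. (b y)\<^sup>2))"
    by (simp only: sum_distrib_left[symmetric] sum.distrib sum_distrib_right[symmetric] sum_divide_distrib[symmetric])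
  also have "(\<Sum>c\<in>(Basis :: 'n pt set). (snd c)\<^sup>2) = 1" by (simp add: sum_Basis_pt)
  also have "(\<Sum>c\<in>(Basis :: 'n pt set). (freq \<xi> \<bullet> fst c)\<^sup>2) = ?n\<^sup>2" by (rule sum_freq_sq)
  also have "?n\<^sup>2 / (2 * pi * ?n\<^sup>2)\<^sup>2 * (LINT y|Iy l. (b y)\<^sup>2) = (LINT y|Iy l. (b y)\<^sup>2) / (4 * pi\<^sup>2 * ?n\<^sup>2)"
    using freq_ne by (simp add: power_mult_distrib power2_eq_square field_simps)
  finally show ?thesis by simp
qed

lemma qf_lift: "qf \<xi> l (W z) (W z) = (cmod z)^2 * ((LINT y|Iy l. (f y)\<^sup>2) + (LINT y|Iy l. (g y)\<^sup>2) / (4 * pi\<^sup>2 * (norm (freq \<xi>))^2))"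
  unfolding sum_profile_norms[OF smooth_fgh(1,2), symmetric] qf_eq_norms
  by (rule sum.cong) (simp_all only: fc_lift)

end

lemma df_le_gradient:
  assumes u: "u \<in> V l"
  shows "df \<xi> l u u \<le> 4 * (\<Sum>b\<in>Basis. \<Sum>c\<in>Basis. (fcn l \<xi> (pd l u b c))^2)"
proof -
  let ?N = "\<lambda>b c. (fcn l \<xi> (pd l u b c))^2"
  have "(fcn l \<xi> (sym_grad l u b c))^2 \<le> 2 * ?N b c + 2 * ?N c b" if "b \<in> Basis" "c \<in> Basis" for b c
  proof -
    have L: "fc \<xi> (pd l u b c) \<in> L2 (Iy l)" "fc \<xi> (pd l u c b) \<in> L2 (Iy l)" "fc \<xi> (sym_grad l u b c) \<in> L2 (Iy l)"
      using that by (auto intro!: fc_L2 pd_weak(2) sym_grad_L2 u)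
    have "fcn l \<xi> (sym_grad l u b c) = L2_norm (Iy l) (\<lambda>y. fc \<xi> (pd l u b c) y + fc \<xi> (pd l u c b) y)"
      by (rule L2_norm_cong_AE[OF L2_measurable L2_measurable fc_sym_grad[OF u that]]) (intro L L2_add)+
    also have "\<dots> \<le> fcn l \<xi> (pd l u b c) + fcn l \<xi> (pd l u c b)"
      by (rule L2_norm_triangle[OF L(1,2)])
    finally have "(fcn l \<xi> (sym_grad l u b c))^2 \<le> (fcn l \<xi> (pd l u b c) + fcn l \<xi> (pd l u c b))^2"
      by (intro power_mono L2_norm_nonneg)
    also have "\<dots> \<le> 2 * ?N b c + 2 * ?N c b"
      using sum_squares_bound[of "fcn l \<xi> (pd l u b c)" "fcn l \<xi> (pd l u c b)"] by (simp add: power2_sum)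
    finally show ?thesis .
  qed
  then have "df \<xi> l u u \<le> (\<Sum>b\<in>Basis. \<Sum>c\<in>Basis. 2 * ?N b c + 2 * ?N c b)"
    unfolding df_eq_norms by (intro sum_mono)
  also have "\<dots> = 2 * (\<Sum>b\<in>Basis. \<Sum>c\<in>Basis. ?N b c) + 2 * (\<Sum>b\<in>Basis. \<Sum>c\<in>Basis. ?N c b)"
    by (simp only: sum.distrib sum_distrib_left)
  also have "(\<Sum>b\<in>Basis. \<Sum>c\<in>Basis. ?N c b) = (\<Sum>b\<in>Basis. \<Sum>c\<in>Basis. ?N b c)" by (rule sum.swap)
  finally show ?thesis by simp
qed

context lift_profile begin

lemma fc_pd_ey_norm: "c \<in> Basis \<Longrightarrow> fcn l \<xi> (pd l (W z) ey c) = L2_norm (Iy l) (P' z c)"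
proof (rule L2_norm_cong_AE)
  assume c: "c \<in> Basis"
  have dL: "dir_deriv ey (mode \<xi> (\<lambda>y. 2 * P z c y)) \<in> L2 (Om l)" "pd l (W z) ey c \<in> L2 (Om l)"
    by (intro smooth_per_L2 smooth_per_dir_deriv mode_profile_smooth ey_Basis) (rule pd_weak(2)[OF lift_V ey_Basis c])
  show "fc \<xi> (pd l (W z) ey c) \<in> borel_measurable (Iy l)" by (intro L2_measurable fc_L2 dL)
  show "P' z c \<in> borel_measurable (Iy l)"
    by (intro borel_measurable_Iy borel_measurable_continuous_onI continuous_profile smooth_fgh)
  have "AE y in Iy l. fc \<xi> (pd l (W z) ey c) y = fc \<xi> (dir_deriv ey (mode \<xi> (\<lambda>y. 2 * P z c y))) y"
    by (rule fc_cong_AE[OF L2_measurable[OF dL(2)] L2_measurable[OF dL(1)] pd_lift[OF ey_Basis c]])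
  then show "AE y in Iy l. fc \<xi> (pd l (W z) ey c) y = P' z c y"
    unfolding dir_deriv_profile_ey fc_mode[OF \<xi>] by simp
qed

lemma fc_pd_ex_norm:
  assumes c: "c \<in> Basis"
  shows "(fcn l \<xi> (pd l (W z) (ex i) c))^2 = 4 * pi\<^sup>2 * (of_int (\<xi> $ i))\<^sup>2 * (L2_norm (Iy l) (P z c))^2"
proof -
  have e: "AE y in Iy l. fc \<xi> (pd l (W z) (ex i) c) y = 2 * pi * \<i> * of_int (\<xi> $ i) * P z c y"
    using fc_weak_partial_ex[OF l V_trace_0[OF lift_V[of z] c], where \<xi> = \<xi> and i = i] by (simp only: fc_lift[OF c] pd_eq_weak_partial)
  have m: "P z c \<in> borel_measurable (Iy l)"
    by (intro borel_measurable_Iy borel_measurable_continuous_onI continuous_profile smooth_fgh)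
  have "fcn l \<xi> (pd l (W z) (ex i) c) = L2_norm (Iy l) (\<lambda>y. 2 * pi * \<i> * of_int (\<xi> $ i) * P z c y)"
    by (rule L2_norm_cong_AE[OF _ _ e]) (use m in \<open>auto intro!: L2_measurable[OF fc_L2[OF pd_weak(2)[OF lift_V _ c]]]\<close>)
  then show ?thesis by (simp add: L2_norm_sq_integral norm_mult power_mult_distrib)
qed

lemma df_lift_le: "df \<xi> l (W z) (W z) \<le> 4 * (cmod z)^2 * (2 * (LINT y|Iy l. (g y)\<^sup>2) + (LINT y|Iy l. (h y)\<^sup>2) / (4 * pi\<^sup>2 * (norm (freq \<xi>))^2)
    + 4 * pi\<^sup>2 * (norm (freq \<xi>))^2 * (LINT y|Iy l. (f y)\<^sup>2))"
proof -
  let ?n = "norm (freq \<xi>)"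
  have "(\<Sum>b\<in>Basis. \<Sum>c\<in>Basis. (fcn l \<xi> (pd l (W z) b c))^2) =
      (\<Sum>c\<in>Basis. (L2_norm (Iy l) (P' z c))^2) + (\<Sum>i\<in>UNIV. \<Sum>c\<in>Basis. 4 * pi\<^sup>2 * (of_int (\<xi> $ i))\<^sup>2 * (L2_norm (Iy l) (P z c))^2)"
    unfolding sum_Basis_pt[of "\<lambda>b. \<Sum>c\<in>Basis. (fcn l \<xi> (pd l (W z) b c))^2"]
    by (intro arg_cong2[where f = "(+)"] sum.cong refl) (simp_all only: fc_pd_ey_norm fc_pd_ex_norm)
  also have "(\<Sum>i\<in>UNIV. \<Sum>c\<in>Basis. 4 * pi\<^sup>2 * (of_int (\<xi> $ i))\<^sup>2 * (L2_norm (Iy l) (P z c))^2) =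
      4 * pi\<^sup>2 * ?n\<^sup>2 * (\<Sum>c\<in>Basis. (L2_norm (Iy l) (P z c))^2)"
    unfolding norm_freq_sq by (simp only: sum_distrib_left[of "4 * pi\<^sup>2"] sum_product)
  also have "4 * pi\<^sup>2 * ?n\<^sup>2 * (\<Sum>c\<in>Basis. (L2_norm (Iy l) (P z c))^2) =
      (cmod z)\<^sup>2 * (4 * pi\<^sup>2 * ?n\<^sup>2 * (LINT y|Iy l. (f y)\<^sup>2) + (LINT y|Iy l. (g y)\<^sup>2))"
    unfolding sum_profile_norms[OF smooth_fgh(1,2)] using freq_ne by (simp add: field_simps)
  also have "(\<Sum>c\<in>Basis. (L2_norm (Iy l) (P' z c))^2) =
      (cmod z)\<^sup>2 * ((LINT y|Iy l. (g y)\<^sup>2) + (LINT y|Iy l. (h y)\<^sup>2) / (4 * pi\<^sup>2 * ?n\<^sup>2))"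
    by (rule sum_profile_norms[OF smooth_fgh(2,3)])
  finally show ?thesis using df_le_gradient[OF lift_V, of \<xi> z] by (simp add: algebra_simps)
qed

end

section \<open>The boundary layer profile and its constants\<close>

lemma integral_power_Iy:
  assumes l: "l > 0"
  shows "(LINT y|Iy l. ((y / l) ^ k)\<^sup>2) = l / (2 * real k + 1)"
proof -
  have "(LINT y|Iy l. ((y / l) ^ k)\<^sup>2) = l / (2 * real k + 1) * (l / l) ^ (2 * k + 1) - l / (2 * real k + 1) * (0 / l) ^ (2 * k + 1)"
  proof (rule integral_Iy_FTC[OF l])
    fix y
    have "((\<lambda>y. y / l) has_real_derivative 1 / l) (at y)" using l by (auto intro!: derivative_eq_intros)
    from DERIV_cmult[OF DERIV_power[OF this, of "2 * k + 1"], of "l / (2 * real k + 1)"]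
    have "((\<lambda>y. l / (2 * real k + 1) * (y / l) ^ (2 * k + 1)) has_real_derivative
        l / (2 * real k + 1) * (real (2 * k + 1) * (1 / l * (y / l) ^ (2 * k + 1 - Suc 0)))) (at y)" by simp
    moreover have "l / (2 * real k + 1) * (real (2 * k + 1) * (1 / l * (y / l) ^ (2 * k + 1 - Suc 0))) = ((y / l) ^ k)\<^sup>2"
    proof -
      have "l / D * (D * (1 / l * w)) = w" if "D \<noteq> 0" for D w using l that by (simp add: field_simps)
      moreover have "2 * real k + 1 \<noteq> 0" using of_nat_0_le_iff[of k] by linarith
      moreover have "real (2 * k + 1) = 2 * real k + 1" by simp
      ultimately have "l / (2 * real k + 1) * (real (2 * k + 1) * (1 / l * w)) = w" for w by metis
      moreover have "(y / l) ^ (2 * k + 1 - Suc 0) = ((y / l) ^ k)\<^sup>2" by (simp add: power_mult[symmetric] mult.commute)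
      ultimately show ?thesis by simp
    qed
    ultimately show "((\<lambda>y. l / (2 * real k + 1) * (y / l) ^ (2 * k + 1)) has_vector_derivative ((y / l) ^ k)\<^sup>2) (at y)"
      by (simp only: has_real_derivative_iff_has_vector_derivative)
  qed (intro continuous_intros, use l in auto)
  then show ?thesis using l by simp
qed

text \<open>The lift decays like \<open>(y / l) ^ m\<close> away from the top with \<open>m\<close> of the order of \<open>|\<xi>|\<close>, so it lives in a
  boundary layer of width \<open>1 / |\<xi>|\<close>; this makes its dissipation of order \<open>|\<xi>|\<close>.\<close>

lemma boundary_lift_exists:
  assumes l: "l > 0"
  shows "\<exists>C>0. \<forall>\<xi> :: int ^ 'n::finite. \<xi> \<noteq> 0 \<longrightarrow> (\<exists>w :: complex \<Rightarrow> 'n field.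
     (\<forall>z. w z \<in> V l \<and> (\<exists>k. has_trace l l (\<lambda>p. snd (w z p)) k) \<and> bf \<xi> l (w z) = z \<and>
        qf \<xi> l (w z) (w z) \<le> C * (cmod z)^2 \<and> df \<xi> l (w z) (w z) \<le> C * norm (freq \<xi>) * (cmod z)^2) \<and>
     (\<forall>a b z z'. w (of_real a * z + of_real b * z') = (\<lambda>p. a *\<^sub>R w z p + b *\<^sub>R w z' p)))"
proof -
  \<comment> \<open>The first two terms bound \<open>qf\<close>, the last one \<open>df\<close>;
    they collect the bounds \<open>l / x\<close>, \<open>3 * x / l\<close> and
    \<open>27 * x ^ 3 / l ^ 3\<close> for the squared norms of \<open>f\<close>, \<open>g\<close>
    and \<open>h\<close> proved below.\<close>
  define C where "C = l + 3 / l + 4 * (6 / l + 27 / l ^ 3 + 4 * pi\<^sup>2 * l)"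
  have C: "C > 0" using l by (simp add: C_def add_pos_pos)
  show ?thesis
  proof (intro exI[of _ C] conjI C allI impI)
    fix \<xi> :: "int ^ 'n" assume \<xi>: "\<xi> \<noteq> 0"
    define x where "x = norm (freq \<xi>)"
    have x: "1 \<le> x" using norm_freq_ge_1[OF \<xi>] by (simp add: x_def)
    \<comment> \<open>With this \<open>k\<close> the exponent \<open>k + 2\<close> of
      \<open>f\<close> lies between \<open>x + 1\<close> and \<open>x + 2\<close>, hence is
      comparable to the frequency; the extra 2 leaves a factor vanishing at the bottom after one
      derivative and a nonnegative power after two.\<close>
    define k where "k = nat \<lceil>x\<rceil> - 1"
    have kx: "x \<le> real k + 1" "real k \<le> x"
      using x by (auto simp: k_def of_nat_diff) linarith+
    define f where "f y = (y / l) ^ (k + 2)" for y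
    define g where "g y = (real k + 2) / l * (y / l) ^ (k + 1)" for y
    define h where "h y = (real k + 2) * (real k + 1) / l\<^sup>2 * (y / l) ^ k" for y
    have lin: "Ck j (\<lambda>y. y / l)" for j using Ck_cmult[OF Ck_ident, of j "1 / l"] by simp
    have d: "((\<lambda>y. (y / l) ^ Suc j) has_real_derivative (real j + 1) / l * (y / l) ^ j) (at y)" for y j
    proof -
      have "((\<lambda>y. y / l) has_real_derivative 1 / l) (at y)" using l by (auto intro!: derivative_eq_intros)
      from DERIV_power[OF this, of "Suc j"] show ?thesis by (simp add: mult_ac add.commute)
    qed
    interpret lift_profile \<xi> l f g h
    proof
      show "Ck j f" "Ck j g" "Ck j h" for j
        unfolding f_def[abs_def] g_def[abs_def] h_def[abs_def] by (intro Ck_cmult Ck_power lin)+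
      show "(f has_real_derivative g y) (at y)" for y
        using d[of "k + 1" y] by (simp add: f_def[abs_def] g_def add.commute)
      show "(g has_real_derivative h y) (at y)" for y
        using DERIV_cmult[OF d[of k y], of "(real k + 2) / l"]
        by (simp add: g_def[abs_def] h_def power2_eq_square mult_ac add.commute)
    qed (use l \<xi> in \<open>auto simp: f_def g_def\<close>)
    have If: "(LINT y|Iy l. (f y)\<^sup>2) = l / (2 * real (k + 2) + 1)"
      unfolding f_def by (rule integral_power_Iy[OF l])
    have Ig: "(LINT y|Iy l. (g y)\<^sup>2) = ((real k + 2) / l)\<^sup>2 * (l / (2 * real (k + 1) + 1))"
      unfolding g_def power_mult_distrib[of "(real k + 2) / l"] by (simp only: integral_mult_right_zero integral_power_Iy[OF l])
    have Ih: "(LINT y|Iy l. (h y)\<^sup>2) = ((real k + 2) * (real k + 1) / l\<^sup>2)\<^sup>2 * (l / (2 * real k + 1))"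
      unfolding h_def power_mult_distrib[of "(real k + 2) * (real k + 1) / l\<^sup>2"] by (simp only: integral_mult_right_zero integral_power_Iy[OF l])
    have k3: "real k + 2 \<le> 3 * x" using kx x by linarith
    have bf: "(LINT y|Iy l. (f y)\<^sup>2) \<le> l / x"
      unfolding If using l x kx by (intro divide_left_mono) auto
    have bg: "(LINT y|Iy l. (g y)\<^sup>2) \<le> 3 * x / l"
    proof -
      have "(LINT y|Iy l. (g y)\<^sup>2) \<le> ((real k + 2) / l)\<^sup>2 * (l / (real k + 2))"
        unfolding Ig using l by (intro mult_left_mono divide_left_mono) auto
      also have "\<dots> = (real k + 2) / l"
      proof -
        have "(K / l)\<^sup>2 * (l / K) = K / l" if "K > 0" for K using l that by (simp add: power2_eq_square field_simps)
        then show ?thesis by simp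
      qed
      also have "\<dots> \<le> 3 * x / l" using k3 l by (intro divide_right_mono) auto
      finally show ?thesis .
    qed
    have bh: "(LINT y|Iy l. (h y)\<^sup>2) \<le> 27 * x ^ 3 / l ^ 3"
    proof -
      have "(LINT y|Iy l. (h y)\<^sup>2) \<le> ((real k + 2) * (real k + 1) / l\<^sup>2)\<^sup>2 * (l / (real k + 1))"
        unfolding Ih using l by (intro mult_left_mono divide_left_mono) auto
      also have "\<dots> = (real k + 2)\<^sup>2 * (real k + 1) / l ^ 3"
      proof -
        have "(K * J / l\<^sup>2)\<^sup>2 * (l / J) = K\<^sup>2 * J / l ^ 3" if "J > 0" for K J
          using l that by (simp add: power2_eq_square power3_eq_cube field_simps)
        then show ?thesis by simp
      qed
      also have "\<dots> \<le> (3 * x)\<^sup>2 * (3 * x) / l ^ 3"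
        using k3 l by (intro divide_right_mono mult_mono power_mono) auto
      also have "\<dots> = 27 * x ^ 3 / l ^ 3" by (simp add: power2_eq_square power3_eq_cube)
      finally show ?thesis .
    qed
    have pi1: "1 \<le> 4 * pi\<^sup>2"
    proof -
      have "1 \<le> pi\<^sup>2" using pi_ge_two by (intro one_le_power) simp
      then show ?thesis by simp
    qed
    have div: "t / (4 * pi\<^sup>2 * x^2) \<le> t / x\<^sup>2" if "0 \<le> t" for t
    proof (rule divide_left_mono[OF _ that])
      show "x\<^sup>2 \<le> 4 * pi\<^sup>2 * x^2" using mult_right_mono[OF pi1, of "x\<^sup>2"] by simp
    qed (use x pi1 in auto)
    have I0: "0 \<le> (LINT y|Iy l. (k y)\<^sup>2)" for k :: "real \<Rightarrow> real" by simp
    have g2: "(LINT y|Iy l. (g y)\<^sup>2) / (4 * pi\<^sup>2 * x^2) \<le> 3 / l"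
    proof -
      have "(LINT y|Iy l. (g y)\<^sup>2) / x\<^sup>2 \<le> (3 * x / l) / x\<^sup>2" using bg by (rule divide_right_mono) simp
      also have "\<dots> = (3 / l) / x" using x by (simp add: power2_eq_square)
      also have "\<dots> \<le> (3 / l) / 1" using x l by (intro divide_left_mono) auto
      finally show ?thesis using div[OF I0[of g]] by linarith
    qed
    have h2: "(LINT y|Iy l. (h y)\<^sup>2) / (4 * pi\<^sup>2 * x^2) \<le> 27 / l ^ 3 * x"
    proof -
      have "(LINT y|Iy l. (h y)\<^sup>2) / x\<^sup>2 \<le> (27 * x ^ 3 / l ^ 3) / x\<^sup>2" using bh by (rule divide_right_mono) simp
      also have "\<dots> = 27 / l ^ 3 * x" using x by (simp add: power2_eq_square power3_eq_cube)
      finally show ?thesis using div[OF I0[of h]] by linarith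
    qed
    have f2: "4 * pi\<^sup>2 * x^2 * (LINT y|Iy l. (f y)\<^sup>2) \<le> 4 * pi\<^sup>2 * l * x"
    proof -
      have "4 * pi\<^sup>2 * x^2 * (LINT y|Iy l. (f y)\<^sup>2) \<le> 4 * pi\<^sup>2 * x^2 * (l / x)" using bf by (intro mult_left_mono) auto
      also have "\<dots> = 4 * pi\<^sup>2 * l * x" using x by (simp add: power2_eq_square)
      finally show ?thesis .
    qed
    have q: "qf \<xi> l (W z) (W z) \<le> C * (cmod z)^2" for z
    proof -
      have "l / x \<le> l / 1" using l x by (intro divide_left_mono) auto
      then have "(LINT y|Iy l. (f y)\<^sup>2) + (LINT y|Iy l. (g y)\<^sup>2) / (4 * pi\<^sup>2 * x^2) \<le> l + 3 / l" using bf g2 by simp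
      also have "\<dots> \<le> C"
      proof -
        have E0: "0 \<le> 6 / l + 27 / l ^ 3 + 4 * pi\<^sup>2 * l" using l by simp
        show ?thesis unfolding C_def le_add_same_cancel1 by (rule mult_nonneg_nonneg[OF _ E0]) simp
      qed
      finally show ?thesis unfolding qf_lift x_def[symmetric] by (subst mult.commute) (rule mult_right_mono, simp_all)
    qed
    have dd: "df \<xi> l (W z) (W z) \<le> C * x * (cmod z)^2" for z
    proof -
      have "2 * (LINT y|Iy l. (g y)\<^sup>2) + (LINT y|Iy l. (h y)\<^sup>2) / (4 * pi\<^sup>2 * x^2) + 4 * pi\<^sup>2 * x^2 * (LINT y|Iy l. (f y)\<^sup>2)
         \<le> (6 / l + 27 / l ^ 3 + 4 * pi\<^sup>2 * l) * x"
      proof -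
        have "2 * (LINT y|Iy l. (g y)\<^sup>2) \<le> 6 / l * x" using bg by simp
        then show ?thesis unfolding distrib_right using h2 f2 by linarith
      qed
      then have "4 * (cmod z)^2 * (2 * (LINT y|Iy l. (g y)\<^sup>2) + (LINT y|Iy l. (h y)\<^sup>2) / (4 * pi\<^sup>2 * x^2) + 4 * pi\<^sup>2 * x^2 * (LINT y|Iy l. (f y)\<^sup>2))
         \<le> 4 * (cmod z)^2 * ((6 / l + 27 / l ^ 3 + 4 * pi\<^sup>2 * l) * x)"
        by (intro mult_left_mono) auto
      also have "\<dots> = (4 * (6 / l + 27 / l ^ 3 + 4 * pi\<^sup>2 * l)) * x * (cmod z)^2" by (simp only: mult_ac)
      also have "\<dots> \<le> C * x * (cmod z)^2"
      proof (intro mult_right_mono)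
        have "0 \<le> l + 3 / l" using l by simp
        then show "4 * (6 / l + 27 / l ^ 3 + 4 * pi\<^sup>2 * l) \<le> C" unfolding C_def by linarith
      qed (use x in auto)
      finally show ?thesis using df_lift_le[of z] unfolding x_def[symmetric] by linarith
    qed
    show "\<exists>w. (\<forall>z. w z \<in> V l \<and> (\<exists>k. has_trace l l (\<lambda>p. snd (w z p)) k) \<and> bf \<xi> l (w z) = z \<and>
        qf \<xi> l (w z) (w z) \<le> C * (cmod z)^2 \<and> df \<xi> l (w z) (w z) \<le> C * norm (freq \<xi>) * (cmod z)^2) \<and>
     (\<forall>a b z z'. w (of_real a * z + of_real b * z') = (\<lambda>p. a *\<^sub>R w z p + b *\<^sub>R w z' p))"
      using lift_V lift_top_trace bf_lift q dd lift_lincomb[of \<xi> f g] unfolding x_def by (intro exI[of _ W]) blast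
  qed
qed

section \<open>Functions of time\<close>

text \<open>Completeness of Lebesgue measure.\<close>

lemma borel_measurable_lebesgue_on_AE:
  fixes f g :: "'a::euclidean_space \<Rightarrow> 'b::euclidean_space"
  assumes S: "S \<in> sets lebesgue" and f: "f \<in> borel_measurable (lebesgue_on S)" and e: "AE t in lebesgue_on S. f t = g t"
  shows "g \<in> borel_measurable (lebesgue_on S)"
proof -
  have "(\<lambda>t. indicator S t *\<^sub>R f t) \<in> borel_measurable lebesgue"
    using f S by (subst (asm) borel_measurable_restrict_space_iff) auto
  moreover have "AE t in lebesgue. t \<in> S \<longrightarrow> f t = g t"
    using e S by (subst (asm) AE_restrict_space_iff) auto
  then have "AE t in lebesgue. indicat_real S t *\<^sub>R f t = indicat_real S t *\<^sub>R g t"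
    by eventually_elim (auto simp: indicator_def)
  ultimately have "(\<lambda>t. indicator S t *\<^sub>R g t) \<in> borel_measurable lebesgue"
    by (rule borel_measurable_AE)
  then show ?thesis using S by (subst borel_measurable_restrict_space_iff) auto
qed

text \<open>If one side is not measurable then neither is the other, and both integrals take the
  default value 0. Hence the lemma applies to scalar pairings such as \<open>u' t v\<close> before
  their measurability is known.\<close>

lemma integral_lebesgue_on_cong_AE:
  fixes f g :: "'a::euclidean_space \<Rightarrow> 'b::euclidean_space"
  assumes S: "S \<in> sets lebesgue" and e: "AE t in lebesgue_on S. f t = g t"
  shows "(LINT t|lebesgue_on S. f t) = (LINT t|lebesgue_on S. g t)"
proof (cases "f \<in> borel_measurable (lebesgue_on S)")
  case True
  show ?thesis
    by (rule integral_cong_AE[OF True borel_measurable_lebesgue_on_AE[OF S True e] e])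
next
  case False
  moreover have "g \<notin> borel_measurable (lebesgue_on S)"
  proof
    assume g: "g \<in> borel_measurable (lebesgue_on S)"
    have "AE t in lebesgue_on S. g t = f t" using e by eventually_elim simp
    from borel_measurable_lebesgue_on_AE[OF S g this] False show False by simp
  qed
  ultimately show ?thesis
    by (metis borel_measurable_integrable not_integrable_integral_eq)
qed

text \<open>A functional that is Lipschitz on \<open>X\<close> maps the approximating simple
  functions to real or vector valued ones that converge almost everywhere. The measurability in time
  of \<open>df\<close> and \<open>bf\<close> along a solution comes from here.\<close>

lemma strongly_measurable_functional:
  fixes \<phi> :: "'x::minus \<Rightarrow> 'b::euclidean_space"
  assumes I: "I \<in> sets lebesgue" and f: "strongly_measurable I X nrm f" and X: "AE t in lebesgue_on I. f t \<in> X"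
    and lip: "\<And>x y. x \<in> X \<Longrightarrow> y \<in> X \<Longrightarrow> norm (\<phi> x - \<phi> y) \<le> C * nrm (x - y)"
  shows "(\<lambda>t. \<phi> (f t)) \<in> borel_measurable (lebesgue_on I)"
proof -
  obtain s where s: "\<And>k. simple_function (lebesgue_on I) (s k)" "\<And>k. s k ` I \<subseteq> X"
    "AE t in lebesgue_on I. (\<lambda>k. nrm (s k t - f t)) \<longlonglongrightarrow> 0"
    using f by (auto simp: strongly_measurable_def)
  have m: "(\<lambda>t. \<phi> (s k t)) \<in> borel_measurable (lebesgue_on I)" for k
    using simple_function_compose[OF s(1), of \<phi> k] by (intro borel_measurable_simple_function) (simp add: comp_def)
  have "AE t in lebesgue_on I. (\<lambda>k. \<phi> (s k t)) \<longlonglongrightarrow> \<phi> (f t)"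
    using s(3) X AE_space
  proof eventually_elim
    case (elim t)
    have "norm (\<phi> (s k t) - \<phi> (f t)) \<le> C * nrm (s k t - f t)" for k
      using s(2)[of k] elim by (intro lip) auto
    moreover have "(\<lambda>k. C * nrm (s k t - f t)) \<longlonglongrightarrow> 0" using elim by (auto intro!: tendsto_eq_intros)
    ultimately have "(\<lambda>k. \<phi> (s k t) - \<phi> (f t)) \<longlonglongrightarrow> 0"
      by (intro Lim_null_comparison[where f = "\<lambda>k. \<phi> (s k t) - \<phi> (f t)"]) (auto intro: always_eventually)
    then show ?case by (rule LIM_zero_cancel)
  qed
  then have e: "AE t in lebesgue_on I. lim (\<lambda>k. \<phi> (s k t)) = \<phi> (f t)"
    by eventually_elim (rule limI)
  have "(\<lambda>t. lim (\<lambda>k. \<phi> (s k t))) \<in> borel_measurable (lebesgue_on I)"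
    by (rule borel_measurable_lim_metric[OF m])
  then show ?thesis by (rule borel_measurable_lebesgue_on_AE[OF I _ e])
qed

lemma AE_half_line:
  assumes "\<And>T. T > 0 \<Longrightarrow> AE t in lebesgue_on {0..T}. P t"
  shows "AE t in lebesgue_on {0::real..}. P t"
proof -
  have "AE t in lebesgue. t \<in> {0..real (Suc n)} \<longrightarrow> P t" for n
  proof -
    have "AE t in lebesgue_on {0..real (Suc n)}. P t" by (rule assms) simp
    then show ?thesis by (subst (asm) AE_restrict_space_iff) auto
  qed
  then have "AE t in lebesgue. \<forall>n. t \<in> {0..real (Suc n)} \<longrightarrow> P t" unfolding AE_all_countable by blast
  then have "AE t in lebesgue. t \<in> {0..} \<longrightarrow> P t"
  proof eventually_elim
    case (elim t)
    obtain n where "t \<le> real n" using real_arch_simple by blast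
    then have "t \<le> real (Suc n)" by simp
    then show ?case using elim by auto
  qed
  then show ?thesis by (subst AE_restrict_space_iff) auto
qed

lemma AE_subinterval:
  assumes "AE t in lebesgue_on A. P t" "B \<subseteq> A" "A \<in> sets lebesgue" "B \<in> sets lebesgue"
  shows "AE t in lebesgue_on B. P t"
  using assms by (auto simp: AE_restrict_space_iff intro: AE_mp)

section \<open>From distributional time derivatives to integral identities\<close>

lemma integrable_hump: "integrable lborel hump" "(LINT t|lborel. hump t) = humpint 1"
proof -
  have e: "hump t = indicator {0..1} t *\<^sub>R hump t" for t by (auto simp: indicator_def intro: hump_0)
  have c: "continuous_on {0..1} hump" using Ck_continuous[OF Ck_hump[of 0]] by (rule continuous_on_subset) simp
  show "integrable lborel hump"
    using borel_integrable_compact[OF compact_Icc c] by (simp only: e[symmetric])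
  have "(LINT t|lborel. indicator {0..1} t *\<^sub>R hump t) = humpint 1 - humpint 0"
    by (rule integral_FTC_atLeastAtMost[OF _ _ c])
      (auto intro!: has_vector_derivative_at_within humpint_derivative[unfolded has_real_derivative_iff_has_vector_derivative])
  then show "(LINT t|lborel. hump t) = humpint 1" by (simp only: e[symmetric]) (simp add: humpint_neg)
qed

text \<open>Rescaling around \<open>a\<close> moves the parameter into the argument of
  \<open>F\<close>; the support of \<open>hump\<close> in the unit interval keeps that argument in a
  compact set, so dominated convergence applies. The mass lies to the right of
  \<open>a\<close>.\<close>

lemma hump_approximate_identity:
  fixes F :: "real \<Rightarrow> real"
  assumes c: "continuous_on UNIV F"
  shows "(\<lambda>n. LINT t|lborel. real (Suc n) * (hump (real (Suc n) * (t - a)) / humpint 1) * F t) \<longlonglongrightarrow> F a"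
proof -
  have hm [measurable]: "hump \<in> borel_measurable borel" using Ck_continuous[OF Ck_hump[of 0]] by (rule borel_measurable_continuous_onI)
  have Fm [measurable]: "F \<in> borel_measurable borel" by (rule borel_measurable_continuous_onI[OF c])
  have e1: "(LINT t|lborel. real (Suc n) * (hump (real (Suc n) * (t - a)) / humpint 1) * F t) =
      (LINT t|lborel. hump t / humpint 1 * F (a + (1 / real (Suc n)) * t))" for n
  proof -
    define N where "N = real (Suc n)"
    have N: "N > 0" by (simp add: N_def)
    have "(LINT t|lborel. N * (hump (N * (t - a)) / humpint 1) * F t) =
       \<bar>1 / N\<bar> *\<^sub>R (LINT t|lborel. N * (hump (N * (a + 1 / N * t - a)) / humpint 1) * F (a + 1 / N * t))"
      by (rule lborel_integral_real_affine) (use N in simp)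
    also have "\<dots> = (LINT t|lborel. 1 / N * (N * (hump (N * (a + 1 / N * t - a)) / humpint 1) * F (a + 1 / N * t)))"
    proof -
      have "\<bar>1 / N\<bar> = 1 / N" using N by simp
      then show ?thesis by (simp only: real_scaleR_def integral_mult_right_zero)
    qed
    also have "\<dots> = (LINT t|lborel. hump t / humpint 1 * F (a + (1 / N) * t))"
    proof (rule Bochner_Integration.integral_cong[OF refl])
      fix t
      have e: "N * (a + 1 / N * t - a) = t" using N by simp
      show "1 / N * (N * (hump (N * (a + 1 / N * t - a)) / humpint 1) * F (a + 1 / N * t)) = hump t / humpint 1 * F (a + (1 / N) * t)"
        unfolding e using N by simp
    qed
    finally show ?thesis by (simp only: N_def)
  qed
  have lim: "(\<lambda>n. LINT t|lborel. hump t / humpint 1 * F (a + (1 / real (Suc n)) * t)) \<longlonglongrightarrow> (LINT t|lborel. hump t / humpint 1 * F a)"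
  proof -
    have "compact (F ` {a..a + 1})" by (intro compact_continuous_image continuous_on_subset[OF c]) auto
    then obtain B where B: "\<And>t. t \<in> {a..a + 1} \<Longrightarrow> \<bar>F t\<bar> \<le> B"
      by (force dest!: compact_imp_bounded simp: bounded_iff)
    show ?thesis
    proof (rule integral_dominated_convergence[where w = "\<lambda>t. hump t / humpint 1 * B"])
      show "integrable lborel (\<lambda>t. hump t / humpint 1 * B)" using integrable_hump by simp
      show "AE t in lborel. (\<lambda>n. hump t / humpint 1 * F (a + (1 / real (Suc n)) * t)) \<longlonglongrightarrow> hump t / humpint 1 * F a"
      proof (rule AE_I2)
        fix t
        have "(\<lambda>n. a + (1 / real (Suc n)) * t) \<longlonglongrightarrow> a + 0 * t"
          by (intro tendsto_intros LIMSEQ_Suc lim_1_over_n)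
        then have "(\<lambda>n. F (a + (1 / real (Suc n)) * t)) \<longlonglongrightarrow> F a"
          using c by (intro isCont_tendsto_compose[of a F]) (auto simp: continuous_on_eq_continuous_at)
        then show "(\<lambda>n. hump t / humpint 1 * F (a + (1 / real (Suc n)) * t)) \<longlonglongrightarrow> hump t / humpint 1 * F a"
          by (intro tendsto_intros)
      qed
      show "AE t in lborel. norm (hump t / humpint 1 * F (a + (1 / real (Suc n)) * t)) \<le> hump t / humpint 1 * B" for n
      proof (rule AE_I2)
        fix t
        show "norm (hump t / humpint 1 * F (a + (1 / real (Suc n)) * t)) \<le> hump t / humpint 1 * B"
        proof (cases "0 < t \<and> t < 1")
          case True
          then have "(1 / real (Suc n)) * t \<le> 1 * 1" by (intro mult_mono) auto
          then have "\<bar>F (a + (1 / real (Suc n)) * t)\<bar> \<le> B" using True by (intro B) auto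
          then show ?thesis using hump_nonneg[of t] humpint_1_pos by (simp add: abs_mult divide_right_mono mult_left_mono)
        qed (auto simp: hump_0)
      qed
    qed measurable
  qed
  have e2: "(LINT t|lborel. hump t / humpint 1 * F a) = F a"
    using integrable_hump humpint_1_pos by simp
  show ?thesis using lim unfolding e1 e2 .
qed

lemma window_time_test:
  assumes "0 < a" "a \<le> b"
  shows "window (Suc n) a b \<in> time_test"
  unfolding time_test_def
proof (intro CollectI conjI smooth_window)
  have "\<forall>t. window (Suc n) a b t \<noteq> 0 \<longrightarrow> a \<le> t \<and> t \<le> b + 1 / real (Suc n)"
    using window_support[OF _ assms(2)] by blast
  then show "\<exists>a'>0. \<exists>b'. \<forall>t. window (Suc n) a b t \<noteq> 0 \<longrightarrow> a' \<le> t \<and> t \<le> b'"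
    using assms(1) by blast
qed

lemma integral_lebesgue_on_lborel:
  fixes f :: "real \<Rightarrow> real"
  assumes "f \<in> borel_measurable borel" "\<And>t. t \<notin> S \<Longrightarrow> f t = 0" "S \<in> sets lebesgue"
  shows "(LINT t|lebesgue_on S. f t) = (LINT t|lborel. f t)"
proof -
  have "(LINT t|lebesgue_on S. f t) = (LINT t|lebesgue. indicator S t *\<^sub>R f t)"
    using assms(3) by (subst integral_restrict_space) auto
  also have "(\<lambda>t. indicator S t *\<^sub>R f t) = f" using assms(2) by (auto simp: indicator_def fun_eq_iff)
  also have "(LINT t|lebesgue. f t) = (LINT t|lborel. f t)" using assms(1) by (simp add: integral_completion)
  finally show ?thesis .
qed

text \<open>Windows are inserted as test functions. On one side they tend to the indicator of the
  interval, on the other their derivatives are approximate identities at the two end points, where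
  \<open>f\<close> is continuous.\<close>

lemma weak_derivative_integral:
  fixes f k :: "real \<Rightarrow> real"
  assumes f: "continuous_on {0..} f" and k: "\<And>T. T > 0 \<Longrightarrow> integrable (lebesgue_on {0..T}) k"
    and w: "\<And>\<psi>. \<psi> \<in> time_test \<Longrightarrow> (LINT t|lebesgue_on {0..}. \<psi> t * k t) = - (LINT t|lebesgue_on {0..}. deriv \<psi> t * f t)"
    and ab: "0 \<le> a" "a \<le> b"
  shows "f b - f a = (LINT t|lebesgue_on {a..b}. k t)"
proof -
  \<comment> \<open>Constant extension to negative times, so that the approximate identities may be
    integrated over the whole line.\<close>
  define F where "F t = f (max 0 t)" for t
  have F: "continuous_on UNIV F"
    unfolding F_def by (intro continuous_on_compose2[OF f] continuous_intros) auto
  have Fm [measurable]: "F \<in> borel_measurable borel" by (rule borel_measurable_continuous_onI[OF F])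
  \<comment> \<open>The interval contains the supports of all windows used, since
    \<open>1 / Suc n\<close> is at most 1; on it \<open>k\<close> is integrable.\<close>
  define K where "K t = indicator {0..b + 1} t *\<^sub>R k t" for t
  have K: "integrable lebesgue K"
  proof -
    have "integrable (lebesgue_on {0..b + 1}) k" by (rule k) (use ab in simp)
    then show ?thesis unfolding K_def by (subst (asm) integrable_restrict_space) auto
  qed
  have Km: "K \<in> borel_measurable lebesgue" using K by simp
  have ind: "(LINT t|lebesgue. indicator {a'<..b} t * K t) = (LINT t|lebesgue_on {a'..b}. k t)" if "0 \<le> a'" for a'
  proof -
    have "(LINT t|lebesgue. indicator {a'<..b} t * K t) = (LINT t|lebesgue. indicator {a'..b} t * K t)"
    proof (rule integral_cong_AE)
      have "AE t in lborel. t \<noteq> a'" by (rule AE_lborel_singleton)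
      then have "AE t in lebesgue. t \<noteq> a'" by (rule AE_completion)
      then show "AE t in lebesgue. indicat_real {a'<..b} t * K t = indicat_real {a'..b} t * K t"
        by eventually_elim (auto simp: indicator_def)
    qed (intro borel_measurable_times borel_measurable_indicator Km; simp)+
    also have "\<dots> = (LINT t|lebesgue. indicator {a'..b} t *\<^sub>R k t)"
      using that by (intro Bochner_Integration.integral_cong) (auto simp: K_def indicator_def)
    also have "\<dots> = (LINT t|lebesgue_on {a'..b}. k t)" by (subst integral_restrict_space) auto
    finally show ?thesis .
  qed
  have step: "f b - f a' = (LINT t|lebesgue. indicator {a'<..b} t * K t)" if a': "0 < a'" "a' \<le> b" for a'
  proof -
    let ?\<psi> = "\<lambda>n. window (Suc n) a' b"
    let ?g = "\<lambda>n c t. real (Suc n) * (hump (real (Suc n) * (t - c)) / humpint 1)"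
    have hm [measurable]: "hump \<in> borel_measurable borel" using Ck_continuous[OF Ck_hump[of 0]] by (rule borel_measurable_continuous_onI)
    have d: "deriv (?\<psi> n) t = ?g n a' t - ?g n b t" for n t
      by (rule DERIV_imp_deriv[OF window_derivative])
    have hz: "hump (real (Suc n) * (t - c)) = 0" if "t \<le> c" for t c n
      using that by (intro hump_0) (simp add: mult_nonneg_nonpos)
    have gi: "integrable lborel (\<lambda>t. ?g n c t * F t)" for n c
    proof -
      have "continuous_on {c..c + 1} (\<lambda>t. ?g n c t * F t)"
        using humpint_1_pos by (intro continuous_intros continuous_on_compose2[OF Ck_continuous[OF Ck_hump[of 0]]] continuous_on_subset[OF F]) auto
      from borel_integrable_compact[OF compact_Icc this]
      have "integrable lborel (\<lambda>t. indicator {c..c + 1} t *\<^sub>R (?g n c t * F t))" by simp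
      moreover have "indicator {c..c + 1} t *\<^sub>R (?g n c t * F t) = ?g n c t * F t" for t
      proof (cases "t > c + 1")
        case True
        have "1 * 1 \<le> real (Suc n) * (t - c)" using True by (intro mult_mono) auto
        then show ?thesis by (simp add: hump_0)
      next
        case False
        show ?thesis
        proof (cases "c \<le> t")
          case True
          then show ?thesis using False by (simp add: indicator_def)
        next
          case c: False
          have "hump (real (Suc n) * (t - c)) = 0" by (rule hz) (use c in simp)
          then show ?thesis by (simp del: of_nat_Suc)
        qed
      qed
      ultimately show ?thesis by (simp only:)
    qed
    have R: "(LINT t|lebesgue_on {0..}. deriv (?\<psi> n) t * f t) = (LINT t|lborel. ?g n a' t * F t) - (LINT t|lborel. ?g n b t * F t)" for n
    proof -
      have "(LINT t|lebesgue_on {0..}. deriv (?\<psi> n) t * f t) = (LINT t|lebesgue_on {0..}. (?g n a' t - ?g n b t) * F t)"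
        by (rule Bochner_Integration.integral_cong) (auto simp: F_def d)
      also have "\<dots> = (LINT t|lborel. (?g n a' t - ?g n b t) * F t)"
      proof (rule integral_lebesgue_on_lborel)
        show "(?g n a' t - ?g n b t) * F t = 0" if "t \<notin> {0..}" for t
          using that a' hz[of t a' n] hz[of t b n] by simp
      qed auto
      also have "\<dots> = (LINT t|lborel. ?g n a' t * F t) - (LINT t|lborel. ?g n b t * F t)"
        using gi by (simp only: left_diff_distrib Bochner_Integration.integral_diff)
      finally show ?thesis .
    qed
    have L: "(LINT t|lebesgue_on {0..}. ?\<psi> n t * k t) = (LINT t|lebesgue. ?\<psi> n t * K t)" for n
    proof -
      have z: "?\<psi> n t = 0" if "t < 0 \<or> t > b + 1" for t
      proof (rule ccontr)
        assume "?\<psi> n t \<noteq> 0"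
        from window_support[OF _ a'(2) this] have "a' \<le> t" "t \<le> b + 1 / real (Suc n)" by auto
        moreover have "1 / real (Suc n) \<le> 1" by simp
        ultimately show False using that a' by linarith
      qed
      have "(LINT t|lebesgue_on {0..}. ?\<psi> n t * k t) = (LINT t|lebesgue. indicator {0..} t *\<^sub>R (?\<psi> n t * k t))"
        by (subst integral_restrict_space) auto
      also have "\<dots> = (LINT t|lebesgue. ?\<psi> n t * K t)"
        by (rule Bochner_Integration.integral_cong) (auto simp: K_def indicator_def z)
      finally show ?thesis .
    qed
    have "(\<lambda>n. LINT t|lebesgue. ?\<psi> n t * K t) \<longlonglongrightarrow> (LINT t|lebesgue. indicator {a'<..b} t * K t)"
    proof (rule integral_dominated_convergence[where w = "\<lambda>t. \<bar>K t\<bar>"])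
      show "(\<lambda>t. indicat_real {a'<..b} t * K t) \<in> borel_measurable lebesgue"
        by (intro borel_measurable_times borel_measurable_indicator Km) simp
      show "(\<lambda>t. ?\<psi> n t * K t) \<in> borel_measurable lebesgue" for n
      proof -
        have "?\<psi> n \<in> borel_measurable borel"
          using smooth_window[of "Suc n" a' b, unfolded smooth_def, rule_format, of 0] by (auto intro!: borel_measurable_continuous_onI)
        then have "?\<psi> n \<in> borel_measurable lebesgue" by (auto intro: measurable_completion)
        then show ?thesis using Km by measurable
      qed
      show "AE t in lebesgue. (\<lambda>n. ?\<psi> n t * K t) \<longlonglongrightarrow> indicat_real {a'<..b} t * K t"
        by (intro AE_I2 tendsto_intros LIMSEQ_Suc window_tendsto a')
      show "AE t in lebesgue. norm (?\<psi> n t * K t) \<le> \<bar>K t\<bar>" for n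
        using window_bound[of "Suc n" a' b] by (auto simp: abs_mult intro!: mult_left_le_one_le)
    qed (use K in auto)
    moreover have "(LINT t|lebesgue. ?\<psi> n t * K t) = (LINT t|lborel. ?g n b t * F t) - (LINT t|lborel. ?g n a' t * F t)" for n
      using w[OF window_time_test[OF a'], of n] by (simp only: L R)
    moreover have "(\<lambda>n. (LINT t|lborel. ?g n b t * F t) - (LINT t|lborel. ?g n a' t * F t)) \<longlonglongrightarrow> F b - F a'"
      by (intro tendsto_diff hump_approximate_identity F)
    ultimately have "F b - F a' = (LINT t|lebesgue. indicator {a'<..b} t * K t)"
      by (simp add: LIMSEQ_unique)
    then show ?thesis using a' by (simp add: F_def)
  qed
  show ?thesis
  proof (cases "0 < a")
    case True
    then show ?thesis using step[OF True ab(2)] ind[OF ab(1)] by simp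
  next
    case False
    then have a0: "a = 0" using ab by simp
    show ?thesis
    proof (cases "b = 0")
      case True
      have "(LINT t|lebesgue. indicator {0<..b} t * K t) = 0" using True by simp
      then show ?thesis using ind[of 0] a0 True by simp
    next
      case False
      then have b: "b > 0" using ab a0 by simp
      \<comment> \<open>Test functions vanish near time 0, so the left end point 0 is reached only
        as a limit of positive times.\<close>
      let ?a = "\<lambda>n. b / real (Suc n)"
      have a_lim: "?a \<longlonglongrightarrow> 0" using LIMSEQ_Suc[OF lim_const_over_n[of b]] by simp
      have ap: "0 < ?a n" "?a n \<le> b" for n using b by (auto simp: field_simps)
      have "(\<lambda>n. LINT t|lebesgue. indicator {?a n<..b} t * K t) \<longlonglongrightarrow> (LINT t|lebesgue. indicator {0<..b} t * K t)"
      proof (rule integral_dominated_convergence[where w = "\<lambda>t. \<bar>K t\<bar>"])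
        show "AE t in lebesgue. (\<lambda>n. indicat_real {?a n<..b} t * K t) \<longlonglongrightarrow> indicat_real {0<..b} t * K t"
        proof (rule AE_I2)
          fix t
          have "(\<lambda>n. indicat_real {?a n<..b} t) \<longlonglongrightarrow> indicat_real {0<..b} t"
          proof (cases "0 < t")
            case True
            have "\<forall>\<^sub>F n in sequentially. ?a n < t" by (rule order_tendstoD(2)[OF a_lim True])
            then have "\<forall>\<^sub>F n in sequentially. indicat_real {?a n<..b} t = indicat_real {0<..b} t"
              by eventually_elim (use True in \<open>auto simp: indicator_def\<close>)
            then show ?thesis by (rule tendsto_eventually)
          next
            case False
            have "indicat_real {?a n<..b} t = 0" for n using ap(1)[of n] False by (auto simp: indicator_def simp del: of_nat_Suc)
            then show ?thesis using False by simp
          qed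
          then show "(\<lambda>n. indicat_real {?a n<..b} t * K t) \<longlonglongrightarrow> indicat_real {0<..b} t * K t" by (intro tendsto_intros)
        qed
        show "(\<lambda>t. indicat_real {0<..b} t * K t) \<in> borel_measurable lebesgue"
          "(\<lambda>t. indicat_real {?a n<..b} t * K t) \<in> borel_measurable lebesgue" for n
          by (intro borel_measurable_times borel_measurable_indicator Km; simp)+
        show "AE t in lebesgue. norm (indicat_real {?a n<..b} t * K t) \<le> \<bar>K t\<bar>" for n
          by (auto simp: indicator_def)
        show "integrable lebesgue (\<lambda>t. \<bar>K t\<bar>)" using K by simp
      qed
      moreover have "(LINT t|lebesgue. indicator {?a n<..b} t * K t) = F b - F (?a n)" for n
        using step[OF ap] ap(1)[of n] b by (simp add: F_def max_def del: of_nat_Suc)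
      moreover have "(\<lambda>n. F b - F (?a n)) \<longlonglongrightarrow> F b - F 0"
        using F by (intro tendsto_intros isCont_tendsto_compose[OF _ a_lim]) (auto simp: continuous_on_eq_continuous_at)
      ultimately have "F b - F 0 = (LINT t|lebesgue. indicator {0<..b} t * K t)"
        by (simp add: LIMSEQ_unique)
      then show ?thesis using ind[of 0] a0 b by (simp add: F_def)
    qed
  qed
qed

section \<open>Weak solutions at one frequency\<close>

text \<open>The surface term of the equation involves the top trace of the test field, and
  \<open>V l\<close> prescribes the bottom trace only. The kinematic condition puts
  \<open>u t\<close> into this set for almost every \<open>t\<close>.\<close>

definition traced :: "real \<Rightarrow> ('n::finite) field set" where
  "traced l = {v \<in> V l. \<exists>k. has_trace l l (\<lambda>z. snd (v z)) k}"

lemma traced_V: "v \<in> traced l \<Longrightarrow> v \<in> V l"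
  by (simp add: traced_def)

lemma traced_lincomb:
  assumes l: "l > 0" and u: "u \<in> traced l" and v: "v \<in> traced l"
  shows "(\<lambda>z. a *\<^sub>R u z + b *\<^sub>R v z) \<in> traced l"
proof -
  obtain j k where "has_trace l l (\<lambda>z. snd (u z)) j" "has_trace l l (\<lambda>z. snd (v z)) k"
    using u v by (auto simp: traced_def)
  from has_trace_lincomb[OF l this, of a b]
  have "has_trace l l (\<lambda>z. snd (a *\<^sub>R u z + b *\<^sub>R v z)) (\<lambda>x. a * j x + b * k x)" by simp
  then show ?thesis using V_lincomb[OF l traced_V[OF u] traced_V[OF v], of a b] unfolding traced_def by blast
qed

lemma field_diff_lincomb: "(u - v :: ('n::finite) field) = (\<lambda>z. 1 *\<^sub>R u z + (-1) *\<^sub>R v z)"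
  by (simp add: fun_eq_iff)

lemma V_norm_diff_self:
  fixes u :: "('n::finite) field"
  assumes "l > 0" "u \<in> V l"
  shows "V_norm l (u - u) = 0"
proof -
  let ?w = "\<lambda>z. 1 *\<^sub>R u z + (-1) *\<^sub>R u z"
  have "L2_inner (Om l) (pd l ?w b c) (pd l ?w b c) = 0" if bc: "b \<in> Basis" "c \<in> Basis" for b c
  proof -
    have m: "pd l ?w b c \<in> borel_measurable (Om l)"
      by (intro L2_measurable pd_weak(2) V_lincomb assms bc)
    have "L2_inner (Om l) (pd l ?w b c) (pd l ?w b c) = L2_inner (Om l) (\<lambda>z :: 'n pt. 0 :: real) (\<lambda>z. 0)"
      by (rule L2_inner_cong_AE) (use m pd_lincomb[OF assms(1,2,2) bc, of 1 "-1"] in auto)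
    then show ?thesis by (simp add: L2_inner_def)
  qed
  then show ?thesis unfolding field_diff_lincomb V_norm_def V_inner_def by simp
qed

text \<open>Test fields that are constant in time are admissible. The null set of times at which the
  equation may fail can depend on the field, which is why each field is treated separately.\<close>

lemma const_L2_time:
  assumes "l > 0" "v \<in> V l"
  shows "(\<lambda>_. v) \<in> L2_time {0..T} (V l) (V_norm l)"
proof -
  have "strongly_measurable {0..T} (V l) (V_norm l) (\<lambda>_. v)"
    unfolding strongly_measurable_def
    by (rule exI[of _ "\<lambda>_ _. v"]) (use assms in \<open>auto simp: V_norm_diff_self\<close>)
  then show ?thesis using assms
    by (simp add: L2_time_def emeasure_restrict_space ennreal_mult_less_top emeasure_lborel_Icc_eq)
qed

text \<open>The reverse triangle inequality. The root is taken because \<open>df\<close> on the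
  diagonal is quadratic and hence not globally Lipschitz, while
  \<open>strongly_measurable_functional\<close> asks for a global constant.\<close>

lemma sqrt_df_lipschitz:
  fixes u v :: "('n::finite) field"
  assumes l: "l > 0" and u: "u \<in> V l" and v: "v \<in> V l"
  shows "\<bar>sqrt (df \<xi> l u u) - sqrt (df \<xi> l v v)\<bar> \<le> 2 * real DIM('n pt) * V_norm l (u - v)"
proof -
  have w: "(\<lambda>z. 1 *\<^sub>R u z + (-1) *\<^sub>R v z) \<in> V l" by (intro V_lincomb l u v)
  have "df \<xi> l (u - v) (u - v) = df \<xi> l u u - 2 * df \<xi> l u v + df \<xi> l v v"
    unfolding field_diff_lincomb df_lincomb[OF l u v w] df_lincomb_right[OF l u v u] df_lincomb_right[OF l u v v] df_commute[of \<xi> l v u]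
    by (simp add: algebra_simps)
  moreover have "(sqrt (df \<xi> l u u) - sqrt (df \<xi> l v v))^2 = df \<xi> l u u - 2 * (sqrt (df \<xi> l u u) * sqrt (df \<xi> l v v)) + df \<xi> l v v"
    by (simp add: power2_diff df_nonneg)
  ultimately have "(sqrt (df \<xi> l u u) - sqrt (df \<xi> l v v))^2 \<le> df \<xi> l (u - v) (u - v)"
    using df_Cauchy_Schwarz[OF l u v, of \<xi>] by linarith
  also have "\<dots> \<le> (2 * real DIM('n pt) * V_norm l (u - v))\<^sup>2"
    by (rule df_le_V_norm) (use w in \<open>simp only: field_diff_lincomb\<close>)
  finally show ?thesis by (simp add: abs_le_square_iff[symmetric] abs_mult V_norm_nonneg)
qed

lemma L2_inner_Re_char:
  assumes "f \<in> L2 Sig"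
  shows "L2_inner Sig f (\<lambda>x. Re (c * tr \<xi> x)) = fourier f \<xi> \<bullet> c"
  unfolding L2_inner_char[OF assms, of c, symmetric] L2_inner_def
  by (simp add: inner_complex_def)

lemma Re_char_L2: "(\<lambda>x. Re (c * tr \<xi> x)) \<in> L2 Sig"
proof (rule L2_bounded[OF finite_measure_Sig, where B = "cmod c"])
  show "(\<lambda>x. Re (c * tr \<xi> x)) \<in> borel_measurable Sig" by (intro borel_measurable_Sig) measurable
  show "AE x in Sig. norm (Re (c * tr \<xi> x)) \<le> cmod c"
    by (intro AE_I2) (metis abs_Re_le_cmod mult.right_neutral norm_mult norm_tr real_norm_def)
qed

lemma fourier_M_op:
  assumes "h \<in> dom_M \<mu>"
  shows "M_op \<mu> h \<in> L2 Sig" "fourier (M_op \<mu> h) \<xi> = of_real (\<mu> \<xi>) * fourier h \<xi>"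
proof -
  have "is_M \<mu> h (M_op \<mu> h)"
    unfolding M_op_def using assms by (auto simp: dom_M_def intro: someI_ex[where P = "is_M \<mu> h"])
  then show "M_op \<mu> h \<in> L2 Sig" "fourier (M_op \<mu> h) \<xi> = of_real (\<mu> \<xi>) * fourier h \<xi>"
    by (auto simp: is_M_def)
qed

text \<open>The top trace of \<open>proj \<xi> v\<close> is a single real mode, so the pairing
  extracts the coefficient of \<open>M_op \<mu> h\<close> at \<xi>, where the operator multiplies by
  \<open>\<mu> \<xi>\<close>.\<close>

lemma integral_M_op_trace_proj:
  assumes l: "l > 0" and h: "h \<in> dom_M \<mu>" and v: "v \<in> traced l"
  shows "(LINT x|Sig. M_op \<mu> h x * bdry_trace l l (\<lambda>z. snd (proj \<xi> v z)) x) = \<mu> \<xi> * (fourier h \<xi> \<bullet> bf \<xi> l v)"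
proof -
  obtain k where k: "has_trace l l (\<lambda>z. snd (v z)) k" using v by (auto simp: traced_def)
  let ?p = "\<lambda>x. Re (bf \<xi> l v * tr \<xi> x)"
  have "has_trace l l (\<lambda>z. snd (proj \<xi> v z)) ?p"
    using proj_top_trace[OF l k, of \<xi>] by (simp only: fourier_top_trace_bf[OF l traced_V[OF v] k])
  from bdry_trace_AE_eq[OF l _ this] have b: "AE x in Sig. bdry_trace l l (\<lambda>z. snd (proj \<xi> v z)) x = ?p x"
    "bdry_trace l l (\<lambda>z. snd (proj \<xi> v z)) \<in> L2 Sig" by auto
  have "L2_inner Sig (M_op \<mu> h) (bdry_trace l l (\<lambda>z. snd (proj \<xi> v z))) = L2_inner Sig (M_op \<mu> h) ?p"
    by (rule L2_inner_cong_AE) (use b fourier_M_op[OF h] Re_char_L2 in \<open>auto simp: L2_measurable\<close>)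
  also have "\<dots> = \<mu> \<xi> * (fourier h \<xi> \<bullet> bf \<xi> l v)"
    unfolding L2_inner_Re_char[OF fourier_M_op(1)[OF h]] fourier_M_op(2)[OF h] by (simp add: inner_complex_def algebra_simps)
  finally show ?thesis by (simp add: L2_inner_def)
qed

text \<open>What the decay argument uses of a weak solution at frequency \<xi>, with
  \<open>m\<close> for the symbol and \<open>H\<close> for the coefficient of \<open>h\<close>. Both
  equations are integrated in time and hold for all end points, with a fixed test field in
  \<open>u_eq\<close>; membership of \<open>u t\<close> in \<open>traced l\<close> holds for almost
  every time only.\<close>

locale frequency_evolution =
  fixes l m :: real and \<xi> :: "int ^ 'n::finite" and u :: "real \<Rightarrow> 'n field" and H :: "real \<Rightarrow> complex"
  assumes l: "l > 0"
    and u_L2: "\<And>t. 0 \<le> t \<Longrightarrow> u t \<in> L2 (Om l)"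
    and u_cont: "\<And>t. 0 \<le> t \<Longrightarrow> ((\<lambda>\<tau>. L2_norm (Om l) (u \<tau> - u t)) \<longlongrightarrow> 0) (at t within {0..})"
    and H_cont: "continuous_on {0..} H"
    and u_traced: "AE t in lebesgue_on {0..}. u t \<in> traced l"
    and df_integrable: "\<And>T v. T > 0 \<Longrightarrow> v \<in> V l \<Longrightarrow> integrable (lebesgue_on {0..T}) (\<lambda>t. df \<xi> l (u t) v)"
    and df_diag_integrable: "\<And>T. T > 0 \<Longrightarrow> integrable (lebesgue_on {0..T}) (\<lambda>t. df \<xi> l (u t) (u t))"
    and bf_integrable: "\<And>T. T > 0 \<Longrightarrow> integrable (lebesgue_on {0..T}) (\<lambda>t. bf \<xi> l (u t))"
    and u_eq: "\<And>a b v. 0 \<le> a \<Longrightarrow> a \<le> b \<Longrightarrow> v \<in> traced l \<Longrightarrow>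
      qf \<xi> l (u b) v - qf \<xi> l (u a) v =
        (LINT t|lebesgue_on {a..b}. - (1/2 * df \<xi> l (u t) v + m * (H t \<bullet> bf \<xi> l v)))"
    and H_eq: "\<And>a b. 0 \<le> a \<Longrightarrow> a \<le> b \<Longrightarrow> H b - H a = (LINT t|lebesgue_on {a..b}. bf \<xi> l (u t))"

lemma qf_continuous:
  fixes u :: "real \<Rightarrow> ('n::finite) field"
  assumes u: "\<And>t. 0 \<le> t \<Longrightarrow> u t \<in> L2 (Om l)"
    and c: "\<And>t. 0 \<le> t \<Longrightarrow> ((\<lambda>\<tau>. L2_norm (Om l) (u \<tau> - u t)) \<longlongrightarrow> 0) (at t within {0..})"
    and v: "v \<in> L2 (Om l)"
  shows "continuous_on {0..} (\<lambda>t. qf \<xi> l (u t) v)"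
  unfolding continuous_on_def
proof
  fix t :: real assume "t \<in> {0..}"
  then have t: "0 \<le> t" by simp
  have "\<forall>\<^sub>F \<tau> in at t within {0..}. norm (qf \<xi> l (u \<tau>) v - qf \<xi> l (u t) v) \<le> L2_norm (Om l) (u \<tau> - u t) * L2_norm (Om l) v"
    unfolding eventually_at_filter
  proof (intro always_eventually allI impI)
    fix \<tau> :: real assume "\<tau> \<in> {0..}"
    then have \<tau>: "u \<tau> \<in> L2 (Om l)" using u by simp
    have "qf \<xi> l (u \<tau> - u t) v = qf \<xi> l (u \<tau>) v - qf \<xi> l (u t) v"
      unfolding field_diff_lincomb qf_lincomb[OF \<tau> u[OF t] v] by simp
    moreover have "u \<tau> - u t \<in> L2 (Om l)" unfolding field_diff_lincomb by (intro L2_add L2_scaleR \<tau> u[OF t])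
    ultimately show "norm (qf \<xi> l (u \<tau>) v - qf \<xi> l (u t) v) \<le> L2_norm (Om l) (u \<tau> - u t) * L2_norm (Om l) v"
      using abs_qf_le[of "u \<tau> - u t" l v \<xi>] v by simp
  qed
  moreover have "((\<lambda>\<tau>. L2_norm (Om l) (u \<tau> - u t) * L2_norm (Om l) v) \<longlongrightarrow> 0) (at t within {0..})"
    using tendsto_mult_right[OF c[OF t], of "L2_norm (Om l) v"] by simp
  ultimately have "((\<lambda>\<tau>. qf \<xi> l (u \<tau>) v - qf \<xi> l (u t) v) \<longlongrightarrow> 0) (at t within {0..})"
    by (rule Lim_null_comparison)
  then show "((\<lambda>\<tau>. qf \<xi> l (u \<tau>) v) \<longlongrightarrow> qf \<xi> l (u t) v) (at t within {0..})" by (rule LIM_zero_cancel)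
qed

lemma fourier_continuous:
  assumes h: "h \<in> cont_time (L2 Sig) (L2_norm Sig)"
  shows "continuous_on {0..} (\<lambda>t. fourier (h t) \<xi>)"
  unfolding continuous_on_def
proof
  fix t :: real assume "t \<in> {0..}"
  then have t: "0 \<le> t" by simp
  have hL: "h \<tau> \<in> L2 Sig" if "0 \<le> \<tau>" for \<tau> using h that by (simp add: cont_time_def)
  have "\<forall>\<^sub>F \<tau> in at t within {0..}. norm (fourier (h \<tau>) \<xi> - fourier (h t) \<xi>) \<le> L2_norm Sig (h \<tau> - h t)"
    unfolding eventually_at_filter
  proof (intro always_eventually allI impI)
    fix \<tau> :: real assume "\<tau> \<in> {0..}"
    then have \<tau>: "h \<tau> \<in> L2 Sig" using hL by simp
    show "norm (fourier (h \<tau>) \<xi> - fourier (h t) \<xi>) \<le> L2_norm Sig (h \<tau> - h t)"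
      using cmod_fourier_le[OF L2_diff[OF \<tau> hL[OF t]], of \<xi>] fourier_diff[OF \<tau> hL[OF t], of \<xi>]
      by (simp add: fun_diff_def)
  qed
  moreover have "((\<lambda>\<tau>. L2_norm Sig (h \<tau> - h t)) \<longlongrightarrow> 0) (at t within {0..})" using h t by (simp add: cont_time_def)
  ultimately have "((\<lambda>\<tau>. fourier (h \<tau>) \<xi> - fourier (h t) \<xi>) \<longlongrightarrow> 0) (at t within {0..})"
    by (rule Lim_null_comparison)
  then show "((\<lambda>\<tau>. fourier (h \<tau>) \<xi>) \<longlongrightarrow> fourier (h t) \<xi>) (at t within {0..})" by (rule LIM_zero_cancel)
qed

text \<open>The bounds of \<open>df\<close> and \<open>bf\<close> by \<open>V_norm\<close> provide
  the Lipschitz constants for measurability. The diagonal of \<open>df\<close> is dominated by the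
  square of \<open>V_norm\<close> and in turn dominates the other two integrands up to
  constants.\<close>

lemma L2_loc_V_integrable:
  fixes u :: "real \<Rightarrow> ('n::finite) field"
  assumes l: "l > 0" and u: "u \<in> L2_loc (V l) (V_norm l)" and T: "T > 0"
  shows "integrable (lebesgue_on {0..T}) (\<lambda>t. df \<xi> l (u t) (u t))"
    and "v \<in> V l \<Longrightarrow> integrable (lebesgue_on {0..T}) (\<lambda>t. df \<xi> l (u t) v)"
    and "integrable (lebesgue_on {0..T}) (\<lambda>t. bf \<xi> l (u t))"
proof -
  have L: "AE t in lebesgue_on {0..T}. u t \<in> V l" "strongly_measurable {0..T} (V l) (V_norm l) u"
    "(\<integral>\<^sup>+ t. ennreal ((V_norm l (u t))\<^sup>2) \<partial>lebesgue_on {0..T}) < \<infinity>"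
    using u T by (auto simp: L2_loc_def L2_time_def)
  have S: "{0..T} \<in> sets lebesgue" by simp
  let ?P = "\<lambda>t. sqrt (df \<xi> l (u t) (u t))"
  let ?D = "2 * real DIM('n pt)"
  have Pm: "?P \<in> borel_measurable (lebesgue_on {0..T})"
    by (rule strongly_measurable_functional[OF S L(2) L(1), where \<phi> = "\<lambda>x. sqrt (df \<xi> l x x)" and C = ?D])
      (simp only: real_norm_def sqrt_df_lipschitz[OF l])
  then have m: "(\<lambda>t. df \<xi> l (u t) (u t)) \<in> borel_measurable (lebesgue_on {0..T})"
    using borel_measurable_power[OF Pm, of 2] by (simp add: df_nonneg)
  have D: "?D\<^sup>2 > 0" by simp
  have "integrable (lebesgue_on {0..T}) (\<lambda>t. df \<xi> l (u t) (u t) / ?D\<^sup>2)"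
  proof (rule integrableI_bounded)
    show "(\<lambda>t. df \<xi> l (u t) (u t) / ?D\<^sup>2) \<in> borel_measurable (lebesgue_on {0..T})"
      by (intro borel_measurable_divide m borel_measurable_const)
    have "(\<integral>\<^sup>+ t. ennreal (norm (df \<xi> l (u t) (u t) / ?D\<^sup>2)) \<partial>lebesgue_on {0..T}) \<le>
        (\<integral>\<^sup>+ t. ennreal ((V_norm l (u t))\<^sup>2) \<partial>lebesgue_on {0..T})"
    proof (rule nn_integral_mono_AE)
      show "AE t in lebesgue_on {0..T}. ennreal (norm (df \<xi> l (u t) (u t) / ?D\<^sup>2)) \<le> ennreal ((V_norm l (u t))\<^sup>2)"
        using L(1)
      proof eventually_elim
        case (elim t)
        have "df \<xi> l (u t) (u t) \<le> (V_norm l (u t))\<^sup>2 * ?D\<^sup>2"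
          using df_le_V_norm[OF elim, of \<xi>] by (simp only: power_mult_distrib mult.commute)
        then have "df \<xi> l (u t) (u t) / ?D\<^sup>2 \<le> (V_norm l (u t))\<^sup>2" by (simp only: pos_divide_le_eq[OF D])
        moreover have "norm (df \<xi> l (u t) (u t) / ?D\<^sup>2) = df \<xi> l (u t) (u t) / ?D\<^sup>2"
          using df_nonneg[of \<xi> l "u t"] D by (simp only: real_norm_def abs_of_nonneg divide_nonneg_pos)
        ultimately show ?case by (simp only: ennreal_leI)
      qed
    qed
    then show "(\<integral>\<^sup>+ t. ennreal (norm (df \<xi> l (u t) (u t) / ?D\<^sup>2)) \<partial>lebesgue_on {0..T}) < \<infinity>"
      using L(3) by (rule le_less_trans)
  qed
  from integrable_mult_right[OF this, of "?D\<^sup>2"] show d: "integrable (lebesgue_on {0..T}) (\<lambda>t. df \<xi> l (u t) (u t))"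
    using D by simp
  have one: "integrable (lebesgue_on {0..T}) (\<lambda>t. 1 :: real)" by (rule continuous_imp_integrable_real) simp
  show "integrable (lebesgue_on {0..T}) (\<lambda>t. df \<xi> l (u t) v)" if v: "v \<in> V l"
  proof (rule Bochner_Integration.integrable_bound[where f = "\<lambda>t. df \<xi> l (u t) (u t) + df \<xi> l v v"])
    show "integrable (lebesgue_on {0..T}) (\<lambda>t. df \<xi> l (u t) (u t) + df \<xi> l v v)"
      using d integrable_mult_right[OF one, of "df \<xi> l v v"] by simp
    show "(\<lambda>t. df \<xi> l (u t) v) \<in> borel_measurable (lebesgue_on {0..T})"
    proof (rule strongly_measurable_functional[OF S L(2) L(1), where \<phi> = "\<lambda>x. df \<xi> l x v" and C = "?D\<^sup>2 * V_norm l v"])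
      fix x y :: "'n field" assume xy: "x \<in> V l" "y \<in> V l"
      have "df \<xi> l (x - y) v = df \<xi> l x v - df \<xi> l y v"
        unfolding field_diff_lincomb df_lincomb[OF l xy v] by simp
      moreover have "x - y \<in> V l" unfolding field_diff_lincomb by (intro V_lincomb l xy)
      ultimately show "norm (df \<xi> l x v - df \<xi> l y v) \<le> ?D\<^sup>2 * V_norm l v * V_norm l (x - y)"
        using abs_df_le[OF l _ v, of "x - y" \<xi>] by simp
    qed
    show "AE t in lebesgue_on {0..T}. norm (df \<xi> l (u t) v) \<le> norm (df \<xi> l (u t) (u t) + df \<xi> l v v)"
      using L(1)
    proof eventually_elim
      case (elim t)
      have "0 \<le> (sqrt (df \<xi> l (u t) (u t)) - sqrt (df \<xi> l v v))^2" by simp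
      then have "2 * (sqrt (df \<xi> l (u t) (u t)) * sqrt (df \<xi> l v v)) \<le> df \<xi> l (u t) (u t) + df \<xi> l v v"
        by (simp add: power2_diff df_nonneg)
      moreover have "0 \<le> sqrt (df \<xi> l (u t) (u t)) * sqrt (df \<xi> l v v)" by (simp add: df_nonneg)
      ultimately have "\<bar>df \<xi> l (u t) v\<bar> \<le> df \<xi> l (u t) (u t) + df \<xi> l v v"
        using df_Cauchy_Schwarz[OF l elim v, of \<xi>] by linarith
      then show ?case by simp
    qed
  qed
  show "integrable (lebesgue_on {0..T}) (\<lambda>t. bf \<xi> l (u t))"
  proof (rule Bochner_Integration.integrable_bound[where f = "\<lambda>t. 1 + l * df \<xi> l (u t) (u t)"])
    show "integrable (lebesgue_on {0..T}) (\<lambda>t. 1 + l * df \<xi> l (u t) (u t))"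
      using d one by simp
    show "(\<lambda>t. bf \<xi> l (u t)) \<in> borel_measurable (lebesgue_on {0..T})"
    proof (rule strongly_measurable_functional[OF S L(2) L(1), where \<phi> = "\<lambda>x. bf \<xi> l x" and C = "sqrt l"])
      fix x y :: "'n field" assume xy: "x \<in> V l" "y \<in> V l"
      have "bf \<xi> l (x - y) = bf \<xi> l x - bf \<xi> l y"
        unfolding field_diff_lincomb bf_lincomb[OF l xy] by simp
      moreover have "x - y \<in> V l" unfolding field_diff_lincomb by (intro V_lincomb l xy)
      ultimately show "norm (bf \<xi> l x - bf \<xi> l y) \<le> sqrt l * V_norm l (x - y)"
        using cmod_bf_le_V_norm[OF l, of "x - y" \<xi>] by simp
    qed
    show "AE t in lebesgue_on {0..T}. norm (bf \<xi> l (u t)) \<le> norm (1 + l * df \<xi> l (u t) (u t))"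
      using L(1)
    proof eventually_elim
      case (elim t)
      have "2 * cmod (bf \<xi> l (u t)) \<le> 1 + (cmod (bf \<xi> l (u t)))^2"
        using sum_squares_bound[of 1 "cmod (bf \<xi> l (u t))"] by simp
      then show ?case using bf_le_df[OF l elim, of \<xi>] norm_ge_zero[of "bf \<xi> l (u t)"] by simp
    qed
  qed
qed

text \<open>Testing with the constant field \<open>proj \<xi> v\<close> turns every term of the
  equation into one at frequency \<xi>. The continuous representatives then allow
  \<open>weak_derivative_integral\<close> to produce identities between any two times.\<close>

lemma weak_solution_frequency_evolution:
  fixes u :: "real \<Rightarrow> ('n::finite) field"
  assumes l: "l > 0" and w: "weak_solution l \<mu> u h u\<^sub>0 h\<^sub>0"
  shows "frequency_evolution l (\<mu> \<xi>) \<xi> u (\<lambda>t. fourier (h t) \<xi>)"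
proof -
  have uV: "u \<in> L2_loc (V l) (V_norm l)" and uC: "u \<in> cont_time (L2 (Om l)) (L2_norm (Om l))"
    and hC: "h \<in> cont_time (L2 Sig) (L2_norm Sig)"
    and hM: "AE t in lebesgue_on {0..}. h t \<in> dom_M \<mu>"
    using w unfolding weak_solution_def by auto
  obtain u' h' where uD: "V_time_deriv l u u'" and h'L: "h' \<in> L2_loc (Hs (1/2)) (Hs_norm (1/2))" and hD: "Sig_time_deriv h h'"
    and eq: "\<And>T v. T > 0 \<Longrightarrow> v \<in> L2_time {0..T} (V l) (V_norm l) \<Longrightarrow> AE t in lebesgue_on {0..T}.
           u' t (v t) + 1/2 * sym_grad_inner l (u t) (v t)
             + (LINT x|Sig. M_op \<mu> (h t) x * bdry_trace l l (\<lambda>z. snd (v t z)) x) = 0"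
    and kin: "AE t in lebesgue_on {0..}. has_trace l l (\<lambda>z. snd (u t z)) (h' t)"
    using w unfolding weak_solution_def by auto
  have uL: "u t \<in> L2 (Om l)" if "0 \<le> t" for t using uC that by (simp add: cont_time_def)
  have uc: "((\<lambda>\<tau>. L2_norm (Om l) (u \<tau> - u t)) \<longlongrightarrow> 0) (at t within {0..})" if "0 \<le> t" for t
    using uC that by (simp add: cont_time_def)
  have hL: "h t \<in> L2 Sig" if "0 \<le> t" for t using hC that by (simp add: cont_time_def)
  have Hc: "continuous_on {0..} (\<lambda>t. fourier (h t) \<xi>)" by (rule fourier_continuous[OF hC])
  have uV': "AE t in lebesgue_on {0..}. u t \<in> V l"
    by (rule AE_half_line) (use uV in \<open>auto simp: L2_loc_def L2_time_def\<close>)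
  have tr: "AE t in lebesgue_on {0..}. u t \<in> traced l"
    using uV' kin by eventually_elim (auto simp: traced_def)
  have sp: "AE t in lebesgue_on {0..}. 0 \<le> t"
    by (rule AE_I2) simp
  show ?thesis
  proof
    show "qf \<xi> l (u b) v - qf \<xi> l (u a) v =
        (LINT t|lebesgue_on {a..b}. - (1/2 * df \<xi> l (u t) v + \<mu> \<xi> * (fourier (h t) \<xi> \<bullet> bf \<xi> l v)))"
      if ab: "0 \<le> a" "a \<le> b" and v: "v \<in> traced l" for a b v
    proof (rule weak_derivative_integral[OF qf_continuous[OF uL uc] _ _ ab])
      show vL: "v \<in> L2 (Om l)" by (rule V_in_L2[OF traced_V[OF v]])
      have pV: "proj \<xi> v \<in> V l" by (rule proj_V[OF l traced_V[OF v]])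
      let ?R = "\<lambda>t. - (1/2 * df \<xi> l (u t) v + \<mu> \<xi> * (fourier (h t) \<xi> \<bullet> bf \<xi> l v))"
      show "integrable (lebesgue_on {0..T}) ?R" if T: "T > 0" for T
      proof -
        have "continuous_on {0..T} (\<lambda>t. fourier (h t) \<xi> \<bullet> bf \<xi> l v)"
          by (intro continuous_intros continuous_on_subset[OF Hc]) auto
        from continuous_imp_integrable_real[OF this]
        show ?thesis using L2_loc_V_integrable(2)[OF l uV T traced_V[OF v], of \<xi>] by simp
      qed
      have R: "AE t in lebesgue_on {0..}. u' t (proj \<xi> v) = ?R t"
      proof -
        have "AE t in lebesgue_on {0..}. u' t (proj \<xi> v) + 1/2 * sym_grad_inner l (u t) (proj \<xi> v)
             + (LINT x|Sig. M_op \<mu> (h t) x * bdry_trace l l (\<lambda>z. snd (proj \<xi> v z)) x) = 0"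
          by (rule AE_half_line) (rule eq[OF _ const_L2_time[OF l pV]])
        then show ?thesis using hM uV'
          by eventually_elim (simp add: integral_M_op_trace_proj[OF l _ v] sym_grad_inner_proj[OF l _ traced_V[OF v]])
      qed
      fix \<psi> assume \<psi>: "\<psi> \<in> time_test"
      have "(LINT t|lebesgue_on {0..}. \<psi> t * ?R t) = (LINT t|lebesgue_on {0..}. \<psi> t * u' t (proj \<xi> v))"
        by (rule integral_lebesgue_on_cong_AE) (use R in \<open>auto elim!: eventually_mono\<close>)
      also have "\<dots> = - (LINT t|lebesgue_on {0..}. deriv \<psi> t * L2_inner (Om l) (u t) (proj \<xi> v))"
        using uD \<psi> pV unfolding V_time_deriv_def by blast
      also have "(LINT t|lebesgue_on {0..}. deriv \<psi> t * L2_inner (Om l) (u t) (proj \<xi> v)) = (LINT t|lebesgue_on {0..}. deriv \<psi> t * qf \<xi> l (u t) v)"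
        by (rule Bochner_Integration.integral_cong) (simp_all add: L2_inner_proj[OF uL vL])
      finally show "(LINT t|lebesgue_on {0..}. \<psi> t * ?R t) = - (LINT t|lebesgue_on {0..}. deriv \<psi> t * qf \<xi> l (u t) v)" .
    qed
    show "fourier (h b) \<xi> - fourier (h a) \<xi> = (LINT t|lebesgue_on {a..b}. bf \<xi> l (u t))" if ab: "0 \<le> a" "a \<le> b" for a b
    proof -
      have i: "integrable (lebesgue_on {0..T}) (\<lambda>t. bf \<xi> l (u t))" if "T > 0" for T
        by (rule L2_loc_V_integrable(3)[OF l uV that])
      have i': "integrable (lebesgue_on {a..b}) (\<lambda>t. bf \<xi> l (u t))"
        by (rule Equivalence_Lebesgue_Henstock_Integration.integrable_subinterval[OF i[of "b + 1"]]) (use ab in auto)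
      \<comment> \<open>\<open>weak_derivative_integral\<close> is about real functions, so the
        complex identity is tested in every direction \<open>c\<close>; the real function
        \<open>?\<phi>\<close> realises the inner product with \<open>c\<close> on the
        torus.\<close>
      have "(fourier (h b) \<xi> - fourier (h a) \<xi>) \<bullet> c = (LINT t|lebesgue_on {a..b}. bf \<xi> l (u t)) \<bullet> c" for c
      proof -
        have "fourier (h b) \<xi> \<bullet> c - fourier (h a) \<xi> \<bullet> c = (LINT t|lebesgue_on {a..b}. bf \<xi> l (u t) \<bullet> c)"
        proof (rule weak_derivative_integral[OF _ _ _ ab])
          show "continuous_on {0..} (\<lambda>t. fourier (h t) \<xi> \<bullet> c)" by (intro continuous_intros Hc)
          show "integrable (lebesgue_on {0..T}) (\<lambda>t. bf \<xi> l (u t) \<bullet> c)" if "T > 0" for T using i[OF that] by simp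
          fix \<psi> assume \<psi>: "\<psi> \<in> time_test"
          let ?\<phi> = "\<lambda>x. Re (c * tr \<xi> x)"
          have "AE t in lebesgue_on {0..}. L2_inner Sig (h' t) ?\<phi> = bf \<xi> l (u t) \<bullet> c"
            using kin uV'
          proof eventually_elim
            case (elim t)
            then have "h' t \<in> L2 Sig" by (simp add: has_trace_def)
            then show ?case by (simp only: L2_inner_Re_char fourier_top_trace_bf[OF l elim(2,1)])
          qed
          then have "(LINT t|lebesgue_on {0..}. \<psi> t * (bf \<xi> l (u t) \<bullet> c)) = (LINT t|lebesgue_on {0..}. \<psi> t * L2_inner Sig (h' t) ?\<phi>)"
            by (intro integral_lebesgue_on_cong_AE) (auto elim!: eventually_mono)
          also have "\<dots> = - (LINT t|lebesgue_on {0..}. deriv \<psi> t * L2_inner Sig (h t) ?\<phi>)"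
            using hD \<psi> Re_char_L2[of c \<xi>] unfolding Sig_time_deriv_def by blast
          also have "(LINT t|lebesgue_on {0..}. deriv \<psi> t * L2_inner Sig (h t) ?\<phi>) = (LINT t|lebesgue_on {0..}. deriv \<psi> t * (fourier (h t) \<xi> \<bullet> c))"
            by (rule Bochner_Integration.integral_cong) (use hL in \<open>auto simp only: L2_inner_Re_char space_restrict_space Int_iff atLeast_iff\<close>)
          finally show "(LINT t|lebesgue_on {0..}. \<psi> t * (bf \<xi> l (u t) \<bullet> c)) = - (LINT t|lebesgue_on {0..}. deriv \<psi> t * (fourier (h t) \<xi> \<bullet> c))" .
        qed
        then show ?thesis using i' by (simp add: inner_diff_left)
      qed
      then show ?thesis using vector_eq_rdot by blast
    qed
  qed (fact l uL uc Hc tr L2_loc_V_integrable[OF l uV])+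
qed

section \<open>Decay of kernels with a dissipation of positive type\<close>

text \<open>Both iterated integrals exist, with parameters in \<open>G\<close>, and have the common
  value \<open>I\<close>. This is the part of Fubini's theorem that the argument uses; it is checked
  term by term, without joint measurability of \<open>A\<close>.\<close>

definition swappable :: "'a measure \<Rightarrow> 'a set \<Rightarrow> ('a \<Rightarrow> 'a \<Rightarrow> real) \<Rightarrow> real \<Rightarrow> bool" where
  "swappable M G A I \<longleftrightarrow> (\<exists>J J'. (\<forall>y\<in>G. has_bochner_integral M (\<lambda>x. A x y) (J y)) \<and>
     (\<forall>x\<in>G. has_bochner_integral M (A x) (J' x)) \<and> has_bochner_integral M J I \<and> has_bochner_integral M J' I)"

lemma swappable_add:
  assumes "swappable M G A I" "swappable M G B I'"
  shows "swappable M G (\<lambda>x y. A x y + B x y) (I + I')"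
proof -
  obtain J J' where A: "\<And>y. y \<in> G \<Longrightarrow> has_bochner_integral M (\<lambda>x. A x y) (J y)"
    "\<And>x. x \<in> G \<Longrightarrow> has_bochner_integral M (A x) (J' x)" "has_bochner_integral M J I" "has_bochner_integral M J' I"
    using assms(1) unfolding swappable_def by blast
  obtain K K' where B: "\<And>y. y \<in> G \<Longrightarrow> has_bochner_integral M (\<lambda>x. B x y) (K y)"
    "\<And>x. x \<in> G \<Longrightarrow> has_bochner_integral M (B x) (K' x)" "has_bochner_integral M K I'" "has_bochner_integral M K' I'"
    using assms(2) unfolding swappable_def by blast
  show ?thesis unfolding swappable_def
    by (rule exI[of _ "\<lambda>y. J y + K y"], rule exI[of _ "\<lambda>y. J' y + K' y"]) (intro conjI ballI has_bochner_integral_add A B)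
qed

lemma swappable_scale:
  assumes "swappable M G A I"
  shows "swappable M G (\<lambda>x y. c * A x y) (c * I)"
proof -
  obtain J J' where A: "\<And>y. y \<in> G \<Longrightarrow> has_bochner_integral M (\<lambda>x. A x y) (J y)"
    "\<And>x. x \<in> G \<Longrightarrow> has_bochner_integral M (A x) (J' x)" "has_bochner_integral M J I" "has_bochner_integral M J' I"
    using assms(1) unfolding swappable_def by blast
  show ?thesis unfolding swappable_def
    by (rule exI[of _ "\<lambda>y. c * J y"], rule exI[of _ "\<lambda>y. c * J' y"]) (intro conjI ballI has_bochner_integral_mult_right A)
qed

lemma swappable_sum:
  assumes "finite S" "\<And>k. k \<in> S \<Longrightarrow> \<exists>I. swappable M G (A k) I"
  shows "\<exists>I. swappable M G (\<lambda>x y. \<Sum>k\<in>S. A k x y) I"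
  using assms
proof (induction S rule: finite_induct)
  case empty
  have "swappable M G (\<lambda>x y. 0) 0" unfolding swappable_def
    by (rule exI[of _ "\<lambda>y. 0"], rule exI[of _ "\<lambda>y. 0"]) (simp add: has_bochner_integral_zero)
  then show ?case by auto
next
  case (insert k S)
  obtain I where I: "swappable M G (A k) I" using insert.prems[of k] by auto
  obtain I' where I': "swappable M G (\<lambda>x y. \<Sum>k\<in>S. A k x y) I'" using insert.IH insert.prems by auto
  from swappable_add[OF I I'] show ?case using insert(1,2) by auto
qed

lemma swappable_transpose: "swappable M G A I \<Longrightarrow> swappable M G (\<lambda>x y. A y x) I"
  unfolding swappable_def by blast

lemma swappable_mult:
  assumes "integrable M f" "integrable M h"
  shows "swappable M G (\<lambda>x y. f x * h y) ((LINT x|M. f x) * (LINT x|M. h x))"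
  unfolding swappable_def
proof (rule exI[of _ "\<lambda>y. (LINT x|M. f x) * h y"], rule exI[of _ "\<lambda>x. f x * (LINT x|M. h x)"], intro conjI ballI)
qed (intro has_bochner_integral_mult_left has_bochner_integral_mult_right has_bochner_integral_integrable assms)+

lemma swappable_symmetric:
  assumes "\<And>x y. A x y = A y x" "\<And>y. y \<in> G \<Longrightarrow> has_bochner_integral M (\<lambda>x. A x y) (J y)" "has_bochner_integral M J I"
  shows "swappable M G A I"
  unfolding swappable_def
proof (rule exI[of _ J], rule exI[of _ J], intro conjI ballI assms)
  fix x assume "x \<in> G"
  from assms(2)[OF this] show "has_bochner_integral M (A x) (J x)" by (subst (asm) assms(1))
qed

text \<open>
  The iterated integral is the limit of the expectation of \<open>(\<Sum>i j. K (x i) (x j)) / n\<^sup>2\<close> for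
  independent random points. Integrating over the points one at a time avoids any measurability of
  \<open>K\<close> with respect to the product measure.
\<close>

lemma psd_iterated_integral_nonneg:
  fixes K :: "'a \<Rightarrow> 'a \<Rightarrow> real"
  assumes M: "finite_measure M" and L: "measure M (space M) > 0" and G: "AE x in M. x \<in> G"
    and sym: "\<And>x y. K x y = K y x"
    and i: "\<And>y. y \<in> G \<Longrightarrow> has_bochner_integral M (\<lambda>x. K x y) (J y)" and J: "has_bochner_integral M J I"
    and d: "integrable M (\<lambda>x. K x x)"
    and psd: "\<And>xs. set xs \<subseteq> G \<Longrightarrow> 0 \<le> (\<Sum>x\<leftarrow>xs. \<Sum>y\<leftarrow>xs. K x y)"
  shows "0 \<le> I"
proof -
  interpret finite_measure M by (rule M)
  define L where "L = measure M (space M)"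
  define D where "D = (LINT x|M. K x x)"
  have Lp: "L > 0" using L by (simp add: L_def)
  have sl: "has_bochner_integral M (\<lambda>x. \<Sum>y\<leftarrow>xs. K x y) (\<Sum>y\<leftarrow>xs. J y)" if "set xs \<subseteq> G" for xs
    using that by (induction xs) (auto intro: i)
  \<comment> \<open>The double sum over the points \<open>xs\<close> and \<open>n\<close> further
    points, with the latter integrated out and the result multiplied by the power 2 -
    \<open>n\<close> of \<open>L\<close>. The four terms are the pairs inside \<open>xs\<close>, the
    mixed pairs, the diagonal of the new points and their off-diagonal pairs.\<close>
  have claim: "0 \<le> L\<^sup>2 * (\<Sum>x\<leftarrow>xs. \<Sum>y\<leftarrow>xs. K x y) + 2 * real n * L * (\<Sum>y\<leftarrow>xs. J y) + real n * L * D + real n * (real n - 1) * I"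
    if "set xs \<subseteq> G" for n xs
    using that
  proof (induction n arbitrary: xs)
    case 0
    then show ?case using psd[of xs] by simp
  next
    case (Suc n)
    let ?S = "\<Sum>x\<leftarrow>xs. \<Sum>y\<leftarrow>xs. K x y"
    let ?\<phi> = "\<lambda>x. L\<^sup>2 * (K x x + 2 * (\<Sum>y\<leftarrow>xs. K x y)) + 2 * real n * L * J x +
       (L^2 * ?S + 2 * real n * L * (\<Sum>y\<leftarrow>xs. J y) + real n * L * D + real n * (real n - 1) * I)"
    have "0 \<le> ?\<phi> x" if x: "x \<in> G" for x
    proof -
      have "(\<Sum>y\<leftarrow>xs. K y x) = (\<Sum>y\<leftarrow>xs. K x y)" by (simp only: sym[of _ x])
      then have e: "(\<Sum>z\<leftarrow>x # xs. \<Sum>y\<leftarrow>x # xs. K z y) = K x x + 2 * (\<Sum>y\<leftarrow>xs. K x y) + ?S"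
        by (simp add: sum_list_addf)
      show ?thesis using Suc.IH[of "x # xs"] Suc.prems x unfolding e by (simp add: algebra_simps)
    qed
    then have "AE x in M. 0 \<le> ?\<phi> x" using G by (auto elim!: eventually_mono)
    then have "0 \<le> (LINT x|M. ?\<phi> x)" by (rule integral_nonneg_AE)
    moreover have "has_bochner_integral M ?\<phi> (L^2 * (D + 2 * (\<Sum>y\<leftarrow>xs. J y)) + 2 * real n * L * I +
       L * (L^2 * ?S + 2 * real n * L * (\<Sum>y\<leftarrow>xs. J y) + real n * L * D + real n * (real n - 1) * I))"
    proof (intro has_bochner_integral_add has_bochner_integral_mult_right sl[OF Suc.prems] J)
      show "has_bochner_integral M (\<lambda>x. K x x) D" unfolding D_def by (rule has_bochner_integral_integrable[OF d])
      show "has_bochner_integral M (\<lambda>x. c) (L * c)" for c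
        using has_bochner_integral_integrable[of M "\<lambda>x. c"] by (simp add: L_def)
    qed
    ultimately have "0 \<le> L\<^sup>2 * (D + 2 * (\<Sum>y\<leftarrow>xs. J y)) + 2 * real n * L * I +
       L * (L^2 * ?S + 2 * real n * L * (\<Sum>y\<leftarrow>xs. J y) + real n * L * D + real n * (real n - 1) * I)"
      by (simp add: has_bochner_integral_integral_eq)
    also have "\<dots> = L * (L^2 * ?S + 2 * real (Suc n) * L * (\<Sum>y\<leftarrow>xs. J y) + real (Suc n) * L * D + real (Suc n) * (real (Suc n) - 1) * I)"
      by (simp add: algebra_simps power2_eq_square)
    finally show ?case using Lp by (simp only: zero_le_mult_iff) linarith
  qed
  show ?thesis
  proof (rule ccontr)
    assume "\<not> 0 \<le> I"
    then have I: "I < 0" by simp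
    \<comment> \<open>With no fixed points left, the claim divided by the number of points says that
      \<open>L * D + n * I\<close> is nonnegative for every \<open>n\<close>; the diagonal loses
      against the off-diagonal pairs for large \<open>n\<close>.\<close>
    obtain n where n: "L * D / (- I) < real n" using reals_Archimedean2 by blast
    have "0 \<le> real (Suc n) * (L * D + real n * I)"
      using claim[of "[]" "Suc n"] by (simp add: algebra_simps)
    then have "0 \<le> L * D + real n * I" by (simp add: zero_le_mult_iff)
    moreover have "L * D < real n * (- I)" using n I by (simp add: field_simps)
    ultimately show False by simp
  qed
qed

section \<open>Averages over squares of times\<close>

lemma window_integral_derivative:
  fixes f :: "real \<Rightarrow> real"
  assumes f: "continuous_on UNIV f" and d: "\<delta> \<ge> 0"
  shows "((\<lambda>t. integral {t..t + \<delta>} f) has_real_derivative f (t + \<delta>) - f t) (at t)"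
proof -
  have "\<exists>F. \<forall>x :: real. -\<infinity> < ereal x \<longrightarrow> ereal x < \<infinity> \<longrightarrow> (F has_vector_derivative f x) (at x)"
    by (rule einterval_antiderivative) (use f in \<open>auto simp: continuous_on_eq_continuous_at\<close>)
  then obtain F where F: "\<And>x. (F has_vector_derivative f x) (at x)" by auto
  have "integral {t..t + \<delta>} f = F (t + \<delta>) - F t" for t
    by (rule integral_unique[OF fundamental_theorem_of_calculus]) (use d in \<open>auto intro: has_vector_derivative_at_within F\<close>)
  moreover have "((\<lambda>t. F (t + \<delta>) - F t) has_real_derivative f (t + \<delta>) - f t) (at t)"
  proof (intro DERIV_diff)
    show "(F has_real_derivative f t) (at t)" using F[of t] by (simp add: has_real_derivative_iff_has_vector_derivative)
    have "(F has_real_derivative f (t + \<delta>)) (at (t + \<delta>))" using F[of "t + \<delta>"] by (simp add: has_real_derivative_iff_has_vector_derivative)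
    then show "((\<lambda>t. F (t + \<delta>)) has_real_derivative f (t + \<delta>)) (at t)" by (simp add: DERIV_shift)
  qed
  ultimately show ?thesis by simp
qed

lemma continuous_on_compose_binary:
  assumes "continuous_on S (\<lambda>(x, y). f x y)" "continuous_on T a" "continuous_on T b" "\<And>z. z \<in> T \<Longrightarrow> (a z, b z) \<in> S"
  shows "continuous_on T (\<lambda>z. f (a z) (b z))"
  using continuous_on_compose2[OF assms(1), of T "\<lambda>z. (a z, b z)"] assms(2-) by (auto intro: continuous_on_Pair)

lemma continuous_on_window_integral:
  fixes k :: "real \<Rightarrow> real \<Rightarrow> real"
  assumes k: "continuous_on UNIV (\<lambda>(x, y). k x y)" and d: "\<delta> \<ge> 0"
  shows "continuous_on UNIV (\<lambda>(x, s). integral {s..s + \<delta>} (k x))"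
proof -
  have "continuous_on UNIV (\<lambda>p. integral (cbox 0 \<delta>) (\<lambda>y. k (fst p) (snd p + y)))"
  proof (rule integral_continuous_on_param)
    show "continuous_on (UNIV \<times> cbox 0 \<delta>) (\<lambda>(p, y). k (fst p) (snd p + y))"
      unfolding case_prod_unfold by (intro continuous_on_compose_binary[OF k] continuous_intros) simp
  qed
  moreover have "integral {s..s + \<delta>} (k x) = integral (cbox 0 \<delta>) (\<lambda>y. k x (s + y))" for x s
    using integral_shift_Icc_real[of 0 \<delta> "k x" s] by (simp add: comp_def add.commute)
  ultimately show ?thesis by (simp add: case_prod_unfold)
qed

text \<open>The average \<open>P t s\<close> over a rectangle is symmetric, so on the diagonal its
  two partial derivatives agree and the chain rule gives twice one of them. Each partial derivative
  is a one-dimensional window derivative, and its continuity gives joint differentiability.\<close>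

lemma square_window_integral_derivative:
  fixes k :: "real \<Rightarrow> real \<Rightarrow> real"
  assumes k: "continuous_on UNIV (\<lambda>(x, y). k x y)" and sym: "\<And>x y. k x y = k y x" and d: "\<delta> \<ge> 0"
  shows "((\<lambda>t. integral {t..t + \<delta>} (\<lambda>x. integral {t..t + \<delta>} (k x))) has_real_derivative
     2 * integral {t..t + \<delta>} (\<lambda>y. k (t + \<delta>) y - k t y)) (at t)"
proof -
  define q where "q x s = integral {s..s + \<delta>} (k x)" for x s
  define P where "P t s = integral {t..t + \<delta>} (\<lambda>x. q x s)" for t s
  define p where "p t s = q (t + \<delta>) s - q t s" for t s
  have kx: "continuous_on S (k x)" for x S
    by (intro continuous_on_compose_binary[OF k] continuous_intros) simp
  have q: "continuous_on UNIV (\<lambda>(x, s). q x s)"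
    unfolding q_def by (rule continuous_on_window_integral[OF k d])
  have qs: "continuous_on UNIV (\<lambda>x. q x s)" for s
    by (intro continuous_on_compose_binary[OF q] continuous_intros) simp
  have P1: "((\<lambda>t. P t s) has_real_derivative p t s) (at t)" for t s
    unfolding P_def p_def by (rule window_integral_derivative[OF qs d])
  have Ps: "P t s = P s t" for t s
  proof -
    have "integral (cbox t (t + \<delta>)) (\<lambda>x. integral (cbox s (s + \<delta>)) (k x)) =
        integral (cbox s (s + \<delta>)) (\<lambda>y. integral (cbox t (t + \<delta>)) (\<lambda>x. k x y))"
      by (rule integral_swap_continuous) (rule continuous_on_subset[OF k], simp)
    moreover have "(\<lambda>x. k x y) = k y" for y by (rule ext) (rule sym)
    ultimately show ?thesis by (simp add: P_def q_def)
  qed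
  have pc: "continuous_on UNIV (\<lambda>(x, y). p y x)"
  proof -
    have "continuous_on UNIV (\<lambda>z. q (snd z + \<delta>) (fst z) - q (snd z) (fst z))"
      by (intro continuous_on_diff continuous_on_compose_binary[OF q] continuous_intros) simp_all
    then show ?thesis by (simp add: p_def case_prod_unfold)
  qed
  have "((\<lambda>(x, y). P x y) has_derivative (\<lambda>(tx, ty). p t t * tx + blinfun_apply (p t t *\<^sub>R id_blinfun) ty)) (at (t, t) within UNIV \<times> UNIV)"
  proof (rule has_derivative_partialsI[where fy = "\<lambda>x y. p y x *\<^sub>R id_blinfun"])
    show "((\<lambda>x. P x t) has_derivative (*) (p t t)) (at t)" using P1 by (simp add: has_field_derivative_def)
    show "((\<lambda>y. P x y) has_derivative blinfun_apply (p y x *\<^sub>R id_blinfun)) (at y)" for x y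
    proof -
      have "blinfun_apply (p y x *\<^sub>R id_blinfun) = (*) (p y x)" by (auto simp: blinfun.scaleR_left)
      then show ?thesis using P1[of x y] by (simp add: has_field_derivative_def Ps[of x])
    qed
    have "continuous_on UNIV (\<lambda>z. (case z of (x, y) \<Rightarrow> p y x) *\<^sub>R (id_blinfun :: real \<Rightarrow>\<^sub>L real))"
      by (intro continuous_intros pc)
    then have "continuous_on UNIV (\<lambda>(x, y). p y x *\<^sub>R (id_blinfun :: real \<Rightarrow>\<^sub>L real))" by (simp add: case_prod_unfold)
    then show "continuous (at (t, t) within UNIV \<times> UNIV) (\<lambda>(x, y). p y x *\<^sub>R (id_blinfun :: real \<Rightarrow>\<^sub>L real))"
      by (simp add: continuous_on_eq_continuous_at)
  qed auto
  then have D: "((\<lambda>z. P (fst z) (snd z)) has_derivative (\<lambda>z. p t t * fst z + p t t * snd z)) (at (t, t))"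
    by (simp add: case_prod_unfold blinfun.scaleR_left)
  have "((\<lambda>x. (x, x)) has_derivative (\<lambda>x. (x, x))) (at t)" by (auto intro!: derivative_eq_intros)
  from diff_chain_at[OF this D] have "((\<lambda>x. P x x) has_derivative (\<lambda>h. p t t * h + p t t * h)) (at t)"
    by (simp add: comp_def)
  then have "((\<lambda>x. P x x) has_real_derivative 2 * p t t) (at t)"
    unfolding has_field_derivative_def by (rule has_derivative_eq_rhs) (simp add: fun_eq_iff)
  moreover have "p t t = integral {t..t + \<delta>} (\<lambda>y. k (t + \<delta>) y - k t y)"
    unfolding p_def q_def by (rule Henstock_Kurzweil_Integration.integral_diff[symmetric]) (intro integrable_continuous_interval kx)+
  ultimately show ?thesis by (simp add: P_def q_def)
qed

text \<open>The common iterated integral \<open>X\<close> of \<open>A\<close> is the left-hand side,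
  because \<open>A\<close> is the derivative of \<open>g\<close> in the first argument.
  Nonnegativity of the integral of the kernel reads \<open>- 2 * X - 2 * c * F \<ge> 0\<close>, with
  \<open>F\<close> the double integral of \<open>g\<close>.\<close>

lemma psd_kernel_window_inequality:
  fixes g A :: "real \<Rightarrow> real \<Rightarrow> real"
  assumes g: "continuous_on UNIV (\<lambda>(x, y). g x y)" and gs: "\<And>x y. g x y = g y x"
    and ab: "a < b" and G: "AE t in lebesgue_on {a..b}. t \<in> G"
    and sw: "swappable (lebesgue_on {a..b}) G A X"
    and der: "\<And>y. y \<in> G \<Longrightarrow> (LINT x|lebesgue_on {a..b}. A x y) = g b y - g a y"
    and diag: "integrable (lebesgue_on {a..b}) (\<lambda>x. A x x)"
    and psd: "\<And>xs. set xs \<subseteq> G \<Longrightarrow> 0 \<le> (\<Sum>x\<leftarrow>xs. \<Sum>y\<leftarrow>xs. - (A x y + A y x) - 2 * c * g x y)"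
  shows "integral {a..b} (\<lambda>y. g b y - g a y) \<le> - c * integral {a..b} (\<lambda>x. integral {a..b} (g x))"
proof -
  let ?M = "lebesgue_on {a..b}"
  have gx: "continuous_on S (g x)" for x S
    by (intro continuous_on_compose_binary[OF g] continuous_intros) simp
  have hb: "has_bochner_integral ?M f (integral {a..b} f)" if "continuous_on {a..b} f" for f :: "real \<Rightarrow> real"
    using has_bochner_integral_integrable[OF continuous_imp_integrable_real[OF that]]
      lebesgue_integral_eq_integral[OF continuous_imp_integrable_real[OF that]] by simp
  have Jc: "continuous_on {a..b} (\<lambda>x. integral {a..b} (g x))"
    using integral_continuous_on_param[of "{a..b}" a b g] continuous_on_subset[OF g] by auto
  let ?F = "integral {a..b} (\<lambda>x. integral {a..b} (g x))"
  have sg: "swappable ?M G g ?F"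
    by (rule swappable_symmetric[OF gs _ hb[OF Jc]]) (subst gs, rule hb[OF gx])
  let ?K = "\<lambda>x y. - 1 * (A x y + A y x) + - (2 * c) * g x y"
  have "swappable ?M G ?K (- 1 * (X + X) + - (2 * c) * ?F)"
    by (intro swappable_add swappable_scale sw swappable_transpose[OF sw] sg)
  then obtain J where J: "\<And>y. y \<in> G \<Longrightarrow> has_bochner_integral ?M (\<lambda>x. ?K x y) (J y)"
    "has_bochner_integral ?M J (- 1 * (X + X) + - (2 * c) * ?F)" unfolding swappable_def by blast
  have "0 \<le> - 1 * (X + X) + - (2 * c) * ?F"
  proof (rule psd_iterated_integral_nonneg[where K = ?K, OF _ _ G _ J])
    have em: "emeasure lborel {a..b} = ennreal (b - a)" using ab by simp
    show "finite_measure ?M"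
      by (rule finite_measureI) (simp add: emeasure_restrict_space em)
    show "measure ?M (space ?M) > 0" using ab by (simp add: measure_restrict_space)
    show "?K x y = ?K y x" for x y by (simp add: gs[of x])
    show "integrable ?M (\<lambda>x. ?K x x)"
    proof -
      have "continuous_on {a..b} (\<lambda>x. g x x)"
        by (intro continuous_on_compose_binary[OF g] continuous_intros) simp
      from continuous_imp_integrable_real[OF this] show ?thesis using diag by simp
    qed
    show "0 \<le> (\<Sum>x\<leftarrow>xs. \<Sum>y\<leftarrow>xs. ?K x y)" if "set xs \<subseteq> G" for xs
      using psd[OF that] by simp
  qed
  moreover have "X = integral {a..b} (\<lambda>y. g b y - g a y)"
  proof -
    obtain J where J: "\<And>y. y \<in> G \<Longrightarrow> has_bochner_integral ?M (\<lambda>x. A x y) (J y)" "has_bochner_integral ?M J X"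
      using sw unfolding swappable_def by blast
    have "J y = g b y - g a y" if "y \<in> G" for y
      using has_bochner_integral_integral_eq[OF J(1)[OF that]] der[OF that] by simp
    then have "AE y in ?M. J y = g b y - g a y" using G by (auto elim!: eventually_mono)
    moreover have "has_bochner_integral ?M (\<lambda>y. g b y - g a y) (integral {a..b} (\<lambda>y. g b y - g a y))"
      by (rule hb) (intro continuous_intros gx)
    ultimately show ?thesis using has_bochner_integral_eq_AE[OF J(2)] by blast
  qed
  ultimately show ?thesis by simp
qed

text \<open>The window inequality says that the square average \<open>F \<delta>\<close> has
  derivative at most \<open>- 2 * c * F \<delta>\<close>, hence decays exponentially for every side
  length; dividing by \<open>\<delta>\<^sup>2\<close> and letting \<open>\<delta>\<close> tend to 0
  recovers the diagonal of \<open>g\<close>.\<close>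

lemma psd_kernel_decay:
  fixes g A :: "real \<Rightarrow> real \<Rightarrow> real"
  assumes g: "continuous_on ({0..} \<times> {0..}) (\<lambda>(x, y). g x y)" and gs: "\<And>x y. g x y = g y x"
    and G: "AE t in lebesgue_on {0..}. t \<in> G" "G \<subseteq> {0..}"
    and sw: "\<And>a b. 0 \<le> a \<Longrightarrow> a < b \<Longrightarrow> \<exists>X. swappable (lebesgue_on {a..b}) G A X"
    and der: "\<And>a b y. 0 \<le> a \<Longrightarrow> a < b \<Longrightarrow> y \<in> G \<Longrightarrow> (LINT x|lebesgue_on {a..b}. A x y) = g b y - g a y"
    and diag: "\<And>a b. 0 \<le> a \<Longrightarrow> a < b \<Longrightarrow> integrable (lebesgue_on {a..b}) (\<lambda>x. A x x)"
    and psd: "\<And>xs. set xs \<subseteq> G \<Longrightarrow> 0 \<le> (\<Sum>x\<leftarrow>xs. \<Sum>y\<leftarrow>xs. - (A x y + A y x) - 2 * c * g x y)"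
    and t: "0 \<le> t"
  shows "g t t \<le> exp (- 2 * c * t) * g 0 0"
proof -
  \<comment> \<open>Extension to negative times, so that the square average has a two-sided
    derivative also at time 0.\<close>
  define k where "k x y = g (max 0 x) (max 0 y)" for x y
  have k: "continuous_on UNIV (\<lambda>(x, y). k x y)"
    unfolding k_def case_prod_unfold by (intro continuous_on_compose_binary[OF g] continuous_intros) simp
  have ks: "k x y = k y x" for x y unfolding k_def by (rule gs)
  have kg: "k x y = g x y" if "0 \<le> x" "0 \<le> y" for x y using that by (simp add: k_def max_def)
  have kx: "continuous_on S (k x)" for x S
    by (intro continuous_on_compose_binary[OF k] continuous_intros) simp
  define F where "F \<delta> t = integral {t..t + \<delta>} (\<lambda>x. integral {t..t + \<delta>} (k x))" for \<delta> t
  have dec: "F \<delta> t \<le> exp (- 2 * c * t) * F \<delta> 0" if d: "\<delta> > 0" for \<delta>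
  proof -
    have "exp (2 * c * t) * F \<delta> t \<le> exp (2 * c * 0) * F \<delta> 0"
    proof (rule DERIV_nonpos_imp_nonincreasing[where f = "\<lambda>t. exp (2 * c * t) * F \<delta> t", OF t])
      fix a assume a: "0 \<le> a" "a \<le> t"
      let ?d = "2 * integral {a..a + \<delta>} (\<lambda>y. k (a + \<delta>) y - k a y)"
      have "(F \<delta> has_real_derivative ?d) (at a)"
        unfolding F_def by (rule square_window_integral_derivative[OF k ks]) (use d in simp)
      then have D: "((\<lambda>t. exp (2 * c * t) * F \<delta> t) has_real_derivative exp (2 * c * a) * ?d + 2 * c * exp (2 * c * a) * F \<delta> a) (at a)"
        by (rule DERIV_mult'[rotated]) (auto intro!: derivative_eq_intros)
      have ab: "a < a + \<delta>" using d by simp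
      obtain X where X: "swappable (lebesgue_on {a..a + \<delta>}) G A X" using sw[OF a(1) ab] by blast
      have "integral {a..a + \<delta>} (\<lambda>y. k (a + \<delta>) y - k a y) \<le> - c * F \<delta> a" unfolding F_def
      proof (rule psd_kernel_window_inequality[OF k ks ab _ X _ diag[OF a(1) ab]])
        show "AE t in lebesgue_on {a..a + \<delta>}. t \<in> G" by (rule AE_subinterval[OF G(1)]) (use a in auto)
        show "(LINT x|lebesgue_on {a..a + \<delta>}. A x y) = k (a + \<delta>) y - k a y" if "y \<in> G" for y
          using der[OF a(1) ab that] that G(2) a d by (subst (1 2) kg) auto
        show "0 \<le> (\<Sum>x\<leftarrow>xs. \<Sum>y\<leftarrow>xs. - (A x y + A y x) - 2 * c * k x y)" if xs: "set xs \<subseteq> G" for xs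
        proof -
          have "(\<Sum>x\<leftarrow>xs. \<Sum>y\<leftarrow>xs. - (A x y + A y x) - 2 * c * k x y) = (\<Sum>x\<leftarrow>xs. \<Sum>y\<leftarrow>xs. - (A x y + A y x) - 2 * c * g x y)"
            using xs G(2) by (intro arg_cong[where f = sum_list] map_cong refl) (auto simp: kg subset_iff)
          then show ?thesis using psd[OF xs] by simp
        qed
      qed
      then have "exp (2 * c * a) * (2 * c * F \<delta> a + ?d) \<le> 0"
        by (intro mult_nonneg_nonpos) (auto simp: algebra_simps)
      then show "\<exists>y. ((\<lambda>t. exp (2 * c * t) * F \<delta> t) has_real_derivative y) (at a) \<and> y \<le> 0"
        using D by (intro exI[of _ "exp (2 * c * a) * ?d + 2 * c * exp (2 * c * a) * F \<delta> a"]) (simp add: algebra_simps)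
    qed
    then have "exp (- 2 * c * t) * (exp (2 * c * t) * F \<delta> t) \<le> exp (- 2 * c * t) * F \<delta> 0"
      by (intro mult_left_mono) simp_all
    then show ?thesis by (simp add: mult.assoc[symmetric] exp_add[symmetric])
  qed
  \<comment> \<open>By continuity the average over a small square is its area times the corner
    value, up to a small multiple of the area.\<close>
  have near: "\<exists>d>0. \<forall>\<delta>. 0 < \<delta> \<and> \<delta> < d \<longrightarrow> \<bar>F \<delta> a - \<delta>\<^sup>2 * k a a\<bar> \<le> \<delta>\<^sup>2 * e" if e: "e > 0" for a e
  proof -
    have "isCont (\<lambda>(x, y). k x y) (a, a)" using k by (simp add: continuous_on_eq_continuous_at)
    then obtain d where d: "d > 0" "\<And>z. dist z (a, a) < d \<Longrightarrow> dist (case z of (x, y) \<Rightarrow> k x y) (k a a) < e"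
      using e unfolding continuous_at_eps_delta by (metis (no_types, lifting) case_prod_conv)
    have "\<bar>F \<delta> a - \<delta>\<^sup>2 * k a a\<bar> \<le> \<delta>\<^sup>2 * e" if \<delta>: "0 < \<delta>" "\<delta> < d / 2" for \<delta>
    proof -
      have kb: "\<bar>k x y - k a a\<bar> \<le> e" if "x \<in> {a..a + \<delta>}" "y \<in> {a..a + \<delta>}" for x y
      proof -
        have "dist (x, y) (a, a) \<le> dist x a + dist y a"
          by (simp add: dist_Pair_Pair sqrt_sum_squares_le_sum)
        also have "\<dots> < d" using that \<delta> by (auto simp: dist_real_def)
        finally show ?thesis using d(2)[of "(x, y)"] by (simp add: dist_real_def)
      qed
      have i1: "\<delta> * (k a a - e) \<le> integral {a..a + \<delta>} (k x) \<and> integral {a..a + \<delta>} (k x) \<le> \<delta> * (k a a + e)"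
        if x: "x \<in> {a..a + \<delta>}" for x
      proof
        have i: "k x integrable_on {a..a + \<delta>}" by (rule integrable_continuous_interval[OF kx])
        have "integral {a..a + \<delta>} (\<lambda>y. k a a - e) \<le> integral {a..a + \<delta>} (k x)"
          by (rule integral_le[OF _ i]) (use kb[OF x] in \<open>auto simp: abs_le_iff\<close>, smt (verit) kb x atLeastAtMost_iff)
        then show "\<delta> * (k a a - e) \<le> integral {a..a + \<delta>} (k x)" using \<delta> by simp
        have "integral {a..a + \<delta>} (k x) \<le> integral {a..a + \<delta>} (\<lambda>y. k a a + e)"
          by (rule integral_le[OF i]) (use kb[OF x] in \<open>auto simp: abs_le_iff\<close>, smt (verit) kb x atLeastAtMost_iff)
        then show "integral {a..a + \<delta>} (k x) \<le> \<delta> * (k a a + e)" using \<delta> by simp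
      qed
      have j: "(\<lambda>x. integral {a..a + \<delta>} (k x)) integrable_on {a..a + \<delta>}"
        using integral_continuous_on_param[of "{a..a + \<delta>}" a "a + \<delta>" k] continuous_on_subset[OF k]
        by (auto intro!: integrable_continuous_interval)
      have "integral {a..a + \<delta>} (\<lambda>x. \<delta> * (k a a - e)) \<le> F \<delta> a" "F \<delta> a \<le> integral {a..a + \<delta>} (\<lambda>x. \<delta> * (k a a + e))"
        unfolding F_def by (intro integral_le j; use i1 in auto)+
      then show ?thesis using \<delta> by (auto simp: abs_le_iff algebra_simps power2_eq_square)
    qed
    then show ?thesis using d(1) by (intro exI[of _ "d / 2"]) auto
  qed
  have "k t t \<le> exp (- 2 * c * t) * k 0 0 + e" if e: "e > 0" for e
  proof -
    define e' where "e' = e / (1 + exp (- 2 * c * t))"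
    have ep: "1 + exp (- 2 * c * t) > 0" by (simp add: add_pos_pos)
    have e': "e' > 0" "e' * (1 + exp (- 2 * c * t)) = e" using e ep by (auto simp: e'_def)
    obtain d1 where d1: "d1 > 0" "\<And>\<delta>. 0 < \<delta> \<and> \<delta> < d1 \<Longrightarrow> \<bar>F \<delta> t - \<delta>\<^sup>2 * k t t\<bar> \<le> \<delta>\<^sup>2 * e'" using near[OF e'(1)] by blast
    obtain d2 where d2: "d2 > 0" "\<And>\<delta>. 0 < \<delta> \<and> \<delta> < d2 \<Longrightarrow> \<bar>F \<delta> 0 - \<delta>\<^sup>2 * k 0 0\<bar> \<le> \<delta>\<^sup>2 * e'" using near[OF e'(1)] by blast
    define \<delta> where "\<delta> = min d1 d2 / 2"
    have \<delta>: "0 < \<delta>" "\<delta> < d1" "\<delta> < d2" using d1(1) d2(1) by (auto simp: \<delta>_def)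
    have "\<delta>\<^sup>2 * (k t t - e') \<le> F \<delta> t" using d1(2)[of \<delta>] \<delta> by (simp add: algebra_simps)
    also have "\<dots> \<le> exp (- 2 * c * t) * F \<delta> 0" by (rule dec[OF \<delta>(1)])
    also have "\<dots> \<le> exp (- 2 * c * t) * (\<delta>^2 * (k 0 0 + e'))"
      using d2(2)[of \<delta>] \<delta> by (intro mult_left_mono) (simp_all add: algebra_simps)
    finally have "\<delta>\<^sup>2 * (k t t - e') \<le> \<delta>\<^sup>2 * (exp (- 2 * c * t) * (k 0 0 + e'))" by (simp only: mult_ac)
    then have "k t t - e' \<le> exp (- 2 * c * t) * (k 0 0 + e')" using \<delta>(1) by simp
    then show ?thesis using e'(2) by (simp add: algebra_simps)
  qed
  then have "k t t \<le> exp (- 2 * c * t) * k 0 0" by (rule field_le_epsilon)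
  then show ?thesis using t by (simp add: kg)
qed

section \<open>Exponential decay at one frequency\<close>

lemma sum_Basis_complex: "(\<Sum>k\<in>(Basis :: complex set). f k) = f 1 + f \<i>"
  by (simp add: Basis_complex_def)

lemma inner_complex_Basis: "(z :: complex) \<bullet> w = (\<Sum>k\<in>Basis. (z \<bullet> k) * (w \<bullet> k))"
  by (rule euclidean_inner)

lemma integrable_mult_continuous:
  fixes f g :: "real \<Rightarrow> real"
  assumes f: "integrable (lebesgue_on {a..b}) f" and g: "continuous_on {a..b} g"
  shows "integrable (lebesgue_on {a..b}) (\<lambda>t. f t * g t)"
proof -
  have "bounded (g ` {a..b})" by (intro compact_imp_bounded compact_continuous_image g) simp
  then obtain B where "\<forall>y\<in>g ` {a..b}. norm y \<le> B" unfolding bounded_iff by blast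
  then have B: "\<bar>g t\<bar> \<le> B" if "t \<in> {a..b}" for t using that by simp
  show ?thesis
  proof (rule Bochner_Integration.integrable_bound[where f = "\<lambda>t. B * f t"])
    show "integrable (lebesgue_on {a..b}) (\<lambda>t. B * f t)" using f by simp
    show "(\<lambda>t. f t * g t) \<in> borel_measurable (lebesgue_on {a..b})"
      using f continuous_imp_integrable_real[OF g] by (intro borel_measurable_times borel_measurable_integrable)
    show "AE t in lebesgue_on {a..b}. norm (f t * g t) \<le> norm (B * f t)"
    proof (rule AE_I2)
      fix t assume "t \<in> space (lebesgue_on {a..b})"
      then have "\<bar>g t\<bar> \<le> B" using B by simp
      then have "\<bar>g t\<bar> \<le> \<bar>B\<bar>" by simp
      then show "norm (f t * g t) \<le> norm (B * f t)" by (simp only: real_norm_def abs_mult mult.commute[of "\<bar>B\<bar>"] mult_left_mono abs_ge_zero)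
    qed
  qed
qed

lemma sum_list_product:
  fixes f h :: "'a \<Rightarrow> real"
  shows "(\<Sum>x\<leftarrow>xs. \<Sum>y\<leftarrow>ys. f x * h y) = (\<Sum>x\<leftarrow>xs. f x) * (\<Sum>y\<leftarrow>ys. h y)"
  by (simp add: sum_list_const_mult sum_list_mult_const)

lemma sum_list_inner_left: "(\<Sum>x\<leftarrow>xs. f x \<bullet> c) = (\<Sum>x\<leftarrow>xs. f x) \<bullet> c"
  by (induction xs) (auto simp: inner_add_left)

context frequency_evolution
begin

abbreviation "Qf \<equiv> qf \<xi> l"
abbreviation "Df \<equiv> df \<xi> l"
abbreviation "Bf \<equiv> bf \<xi> l"

lemma H_continuous: "0 \<le> a \<Longrightarrow> continuous_on {a..b} H"
  by (rule continuous_on_subset[OF H_cont]) auto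

lemma qf_u_continuous: "v \<in> L2 (Om l) \<Longrightarrow> continuous_on {0..} (\<lambda>t. Qf (u t) v)"
  by (rule qf_continuous[OF u_L2 u_cont])

lemma integrable_Icc:
  assumes "\<And>T. T > 0 \<Longrightarrow> integrable (lebesgue_on {0..T}) f" "0 \<le> a"
  shows "integrable (lebesgue_on {a..b}) (f :: real \<Rightarrow> 'b::euclidean_space)"
  by (rule Equivalence_Lebesgue_Henstock_Integration.integrable_subinterval[OF assms(1)[of "max b 1"]])
    (use assms(2) in auto)

lemma has_integral_u:
  assumes ab: "0 \<le> a" "a \<le> b" and v: "v \<in> traced l"
  shows "has_bochner_integral (lebesgue_on {a..b}) (\<lambda>t. - (1/2 * Df (u t) v + m * (H t \<bullet> Bf v)))
     (Qf (u b) v - Qf (u a) v)"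
  unfolding u_eq[OF ab v]
proof (rule has_bochner_integral_integrable)
  have "integrable (lebesgue_on {a..b}) (\<lambda>t. H t \<bullet> Bf v)"
    by (intro continuous_imp_integrable_real continuous_intros H_continuous ab)
  then show "integrable (lebesgue_on {a..b}) (\<lambda>t. - (1/2 * Df (u t) v + m * (H t \<bullet> Bf v)))"
    using integrable_Icc[OF df_integrable[OF _ traced_V[OF v]] ab(1), of b] by simp
qed

lemma has_integral_H:
  assumes ab: "0 \<le> a" "a \<le> b"
  shows "has_bochner_integral (lebesgue_on {a..b}) (\<lambda>t. Bf (u t) \<bullet> c) ((H b - H a) \<bullet> c)"
  unfolding H_eq[OF ab]
  by (intro has_bochner_integral_inner_left has_bochner_integral_integrable integrable_Icc[OF bf_integrable ab(1)])

text \<open>The integral of \<open>Df (u x) (u y)\<close> over \<open>x\<close> has a closed form by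
  the momentum equation tested with \<open>u y\<close>: boundary terms that are continuous in
  \<open>y\<close> plus a multiple of the flux of \<open>u y\<close>. This makes it integrable in
  \<open>y\<close>, and symmetry settles the other order.\<close>

lemma swappable_df:
  assumes ab: "0 \<le> a" "a < b" and G: "G = {t. 0 \<le> t \<and> u t \<in> traced l}"
  shows "\<exists>X. swappable (lebesgue_on {a..b}) G (\<lambda>x y. Df (u x) (u y)) X"
proof -
  let ?M = "lebesgue_on {a..b}"
  define N where "N = (LINT t|?M. H t)"
  have N: "has_bochner_integral ?M H N" unfolding N_def
    by (intro has_bochner_integral_integrable continuous_imp_integrable_real H_continuous ab)
  define J where "J y = - 2 * (Qf (u y) (u b) - Qf (u y) (u a)) + - (2 * m) * (Bf (u y) \<bullet> N)" for y
  have J: "has_bochner_integral ?M (\<lambda>x. Df (u x) (u y)) (J y)" if y: "y \<in> G" for y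
  proof -
    have v: "u y \<in> traced l" using y G by simp
    have "has_bochner_integral ?M (\<lambda>t. - 2 * - (1/2 * Df (u t) (u y) + m * (H t \<bullet> Bf (u y))) + - (2 * m) * (H t \<bullet> Bf (u y)))
       (- 2 * (Qf (u b) (u y) - Qf (u a) (u y)) + - (2 * m) * (N \<bullet> Bf (u y)))"
      using ab v N by (intro has_bochner_integral_add has_bochner_integral_mult_right has_integral_u has_bochner_integral_inner_left) auto
    then show ?thesis by (simp add: J_def qf_commute[of \<xi> l "u y"] inner_commute algebra_simps)
  qed
  have "continuous_on {a..b} (\<lambda>y. Qf (u y) (u b) - Qf (u y) (u a))"
    by (intro continuous_intros continuous_on_subset[OF qf_u_continuous]) (use ab u_L2 in auto)
  from continuous_imp_integrable_real[OF this]
  have "integrable ?M J" unfolding J_def using integrable_Icc[OF bf_integrable ab(1), of b]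
    by (intro Bochner_Integration.integrable_add integrable_mult_right integrable_inner_left) auto
  then show ?thesis
    using swappable_symmetric[where A = "\<lambda>x y. Df (u x) (u y)", OF df_commute J has_bochner_integral_integrable] by blast
qed

text \<open>The form at (\<open>u x\<close>, \<open>u y\<close>) is its value at the differences
  from (\<open>u a\<close>, \<open>u b\<close>), which is bounded by the product of two small norms,
  plus terms in which one argument is frozen.\<close>

lemma qf_jointly_continuous: "continuous_on ({0..} \<times> {0..}) (\<lambda>z. Qf (u (fst z)) (u (snd z)))"
  unfolding continuous_on_def
proof
  fix p :: "real \<times> real" assume p: "p \<in> {0..} \<times> {0..}"
  obtain a b where ab: "p = (a, b)" "0 \<le> a" "0 \<le> b" using p by (cases p) auto
  let ?S = "{0..} \<times> {0..} :: (real \<times> real) set"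
  have N: "continuous (at a within {0..}) (\<lambda>x. L2_norm (Om l) (u x - u a))" if "0 \<le> a" for a
  proof -
    have "L2_norm (Om l) (u a - u a) = 0" by (simp add: L2_norm_def L2_inner_def)
    then show ?thesis using u_cont[OF that] by (simp add: continuous_within)
  qed
  have fs: "(fst \<longlongrightarrow> a) (at (a, b) within ?S)" "(snd \<longlongrightarrow> b) (at (a, b) within ?S)"
    using tendsto_fst[OF tendsto_ident_at, of "(a, b)" ?S] tendsto_snd[OF tendsto_ident_at, of "(a, b)" ?S] by simp_all
  have N1: "((\<lambda>z. L2_norm (Om l) (u (fst z) - u a)) \<longlongrightarrow> L2_norm (Om l) (u a - u a)) (at p within ?S)"
    using continuous_within_compose2[of p ?S fst "\<lambda>x. L2_norm (Om l) (u x - u a)"] N[OF ab(2)] ab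
    by (simp add: continuous_within fst_image_times fs)
  have N2: "((\<lambda>z. L2_norm (Om l) (u (snd z) - u b)) \<longlongrightarrow> L2_norm (Om l) (u b - u b)) (at p within ?S)"
    using continuous_within_compose2[of p ?S snd "\<lambda>x. L2_norm (Om l) (u x - u b)"] N[OF ab(3)] ab
    by (simp add: continuous_within snd_image_times fs)
  have z: "L2_norm (Om l) (u t - u t) = 0" for t by (simp add: L2_norm_def L2_inner_def)
  have "((\<lambda>z. L2_norm (Om l) (u (fst z) - u a) * L2_norm (Om l) (u (snd z) - u b)) \<longlongrightarrow> 0) (at p within ?S)"
    using tendsto_mult[OF N1 N2] by (simp add: z)
  moreover have "\<forall>\<^sub>F z in at p within ?S. norm (Qf (u (fst z) - u a) (u (snd z) - u b)) \<le>
      L2_norm (Om l) (u (fst z) - u a) * L2_norm (Om l) (u (snd z) - u b)"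
    unfolding eventually_at_filter
  proof (intro always_eventually allI impI)
    fix z :: "real \<times> real" assume "z \<in> ?S"
    then have "u (fst z) - u a \<in> L2 (Om l)" "u (snd z) - u b \<in> L2 (Om l)"
      using ab u_L2 unfolding fun_diff_def by (auto intro!: L2_diff)
    then show "norm (Qf (u (fst z) - u a) (u (snd z) - u b)) \<le> L2_norm (Om l) (u (fst z) - u a) * L2_norm (Om l) (u (snd z) - u b)"
      using abs_qf_le by simp
  qed
  ultimately have d: "((\<lambda>z. Qf (u (fst z) - u a) (u (snd z) - u b)) \<longlongrightarrow> 0) (at p within ?S)"
    by (rule Lim_null_comparison[rotated])
  have "continuous_on ?S (\<lambda>z. Qf (u (fst z)) (u b))"
    by (rule continuous_on_compose2[OF qf_u_continuous[OF u_L2[OF ab(3)]]]; auto intro!: continuous_intros)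
  then have c1: "((\<lambda>z. Qf (u (fst z)) (u b)) \<longlongrightarrow> Qf (u a) (u b)) (at p within ?S)"
    using p ab by (auto simp: continuous_on_def)
  have "continuous_on ?S (\<lambda>z. Qf (u (snd z)) (u a))"
    by (rule continuous_on_compose2[OF qf_u_continuous[OF u_L2[OF ab(2)]]]; auto intro!: continuous_intros)
  then have c2: "((\<lambda>z. Qf (u (snd z)) (u a)) \<longlongrightarrow> Qf (u b) (u a)) (at p within ?S)"
    using p ab by (auto simp: continuous_on_def)
  have "((\<lambda>z. Qf (u (fst z) - u a) (u (snd z) - u b) + Qf (u (fst z)) (u b) + Qf (u (snd z)) (u a) - Qf (u a) (u b)) \<longlongrightarrow>
      0 + Qf (u a) (u b) + Qf (u b) (u a) - Qf (u a) (u b)) (at p within ?S)"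
    by (intro tendsto_intros d c1 c2)
  then have "((\<lambda>z. Qf (u (fst z) - u a) (u (snd z) - u b) + Qf (u (fst z)) (u b) + Qf (u (snd z)) (u a) - Qf (u a) (u b)) \<longlongrightarrow>
      Qf (u a) (u b)) (at p within ?S)"
    by (simp add: qf_commute[of \<xi> l "u b"])
  moreover have "\<forall>\<^sub>F z in at p within ?S. Qf (u (fst z) - u a) (u (snd z) - u b) + Qf (u (fst z)) (u b) + Qf (u (snd z)) (u a) - Qf (u a) (u b) =
      Qf (u (fst z)) (u (snd z))"
    unfolding eventually_at_filter
  proof (intro always_eventually allI impI)
    fix z :: "real \<times> real" assume z: "z \<in> ?S"
    obtain x y where xy: "z = (x, y)" "0 \<le> x" "0 \<le> y" using z by (cases z) auto
    have L: "u x \<in> L2 (Om l)" "u y \<in> L2 (Om l)" "u a \<in> L2 (Om l)" "u b \<in> L2 (Om l)"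
      using xy ab u_L2 by auto
    have yb: "u y - u b \<in> L2 (Om l)" unfolding field_diff_lincomb using L by (intro L2_add L2_scaleR)
    have "Qf (u x - u a) (u y - u b) = Qf (u x) (u y - u b) - Qf (u a) (u y - u b)"
      using qf_lincomb[OF L(1,3) yb, of \<xi> 1 "-1"] by (simp add: field_diff_lincomb)
    also have "\<dots> = Qf (u x) (u y) - Qf (u x) (u b) - Qf (u a) (u y) + Qf (u a) (u b)"
      using qf_lincomb_right[OF L(2,4,1), of \<xi> 1 "-1"] qf_lincomb_right[OF L(2,4,3), of \<xi> 1 "-1"] by (simp add: field_diff_lincomb)
    finally show "Qf (u (fst z) - u a) (u (snd z) - u b) + Qf (u (fst z)) (u b) + Qf (u (snd z)) (u a) - Qf (u a) (u b) =
      Qf (u (fst z)) (u (snd z))"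
      by (simp add: xy qf_commute[of \<xi> l "u y" "u a"])
  qed
  ultimately have "((\<lambda>z. Qf (u (fst z)) (u (snd z))) \<longlongrightarrow> Qf (u a) (u b)) (at p within ?S)"
    using tendsto_cong by force
  then show "((\<lambda>z. Qf (u (fst z)) (u (snd z))) \<longlongrightarrow> Qf (u (fst p)) (u (snd p))) (at p within ?S)"
    by (simp add: ab(1))
qed

text \<open>Gathers the values of \<open>u\<close> at a list of times into one field
  \<open>U\<close>, so that a double sum over the list becomes the form at \<open>U\<close>. The
  field \<open>w\<close> supplies the zero field for the empty list.\<close>

lemma sum_list_u:
  fixes w :: "'n field"
  assumes xs: "\<And>x. x \<in> set xs \<Longrightarrow> u x \<in> traced l" and W: "w \<in> traced l"
  shows "\<exists>U\<in>traced l. (\<forall>v\<in>V l. Df U v = (\<Sum>x\<leftarrow>xs. Df (u x) v)) \<and>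
     (\<forall>v\<in>V l. Qf U v = (\<Sum>x\<leftarrow>xs. Qf (u x) v)) \<and> Bf U = (\<Sum>x\<leftarrow>xs. Bf (u x))"
  using xs
proof (induction xs)
  case Nil
  have wV: "w \<in> V l" by (rule traced_V[OF W])
  show ?case
  proof (intro bexI[of _ "\<lambda>z. 0 *\<^sub>R w z + 0 *\<^sub>R w z"] conjI ballI)
    show "(\<lambda>z. 0 *\<^sub>R w z + 0 *\<^sub>R w z) \<in> traced l" by (rule traced_lincomb[OF l W W])
    show "Bf (\<lambda>z. 0 *\<^sub>R w z + 0 *\<^sub>R w z) = (\<Sum>x\<leftarrow>[]. Bf (u x))" unfolding bf_lincomb[OF l wV wV] by simp
    fix v :: "'n field" assume v: "v \<in> V l"
    show "Df (\<lambda>z. 0 *\<^sub>R w z + 0 *\<^sub>R w z) v = (\<Sum>x\<leftarrow>[]. Df (u x) v)" unfolding df_lincomb[OF l wV wV v] by simp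
    show "Qf (\<lambda>z. 0 *\<^sub>R w z + 0 *\<^sub>R w z) v = (\<Sum>x\<leftarrow>[]. Qf (u x) v)"
      unfolding qf_lincomb[OF V_in_L2[OF wV] V_in_L2[OF wV] V_in_L2[OF v]] by simp
  qed
next
  case (Cons x xs)
  then obtain U where U: "U \<in> traced l" "\<And>v. v \<in> V l \<Longrightarrow> Df U v = (\<Sum>x\<leftarrow>xs. Df (u x) v)"
    "\<And>v. v \<in> V l \<Longrightarrow> Qf U v = (\<Sum>x\<leftarrow>xs. Qf (u x) v)" "Bf U = (\<Sum>x\<leftarrow>xs. Bf (u x))"
    by auto
  have xt: "u x \<in> traced l" using Cons.prems by simp
  have xV: "u x \<in> V l" and UV: "U \<in> V l" by (auto intro: traced_V xt U)
  show ?case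
  proof (intro bexI[of _ "\<lambda>z. 1 *\<^sub>R u x z + 1 *\<^sub>R U z"] conjI ballI)
    show "(\<lambda>z. 1 *\<^sub>R u x z + 1 *\<^sub>R U z) \<in> traced l" by (rule traced_lincomb[OF l xt U(1)])
    show "Bf (\<lambda>z. 1 *\<^sub>R u x z + 1 *\<^sub>R U z) = (\<Sum>x\<leftarrow>x # xs. Bf (u x))" unfolding bf_lincomb[OF l xV UV] U(4) by simp
    fix v :: "'n field" assume v: "v \<in> V l"
    show "Df (\<lambda>z. 1 *\<^sub>R u x z + 1 *\<^sub>R U z) v = (\<Sum>x\<leftarrow>x # xs. Df (u x) v)" unfolding df_lincomb[OF l xV UV v] U(2)[OF v] by simp
    show "Qf (\<lambda>z. 1 *\<^sub>R u x z + 1 *\<^sub>R U z) v = (\<Sum>x\<leftarrow>x # xs. Qf (u x) v)"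
      unfolding qf_lincomb[OF V_in_L2[OF xV] V_in_L2[OF UV] V_in_L2[OF v]] U(3)[OF v] by simp
  qed
qed

text \<open>\<open>coercive\<close> is the decay inequality as a statement about a field and a
  number, freed from time. \<open>S\<close> holds the admissible numbers and is closed under
  addition because sums of values of \<open>H\<close> are inserted; it is \<open>{0}\<close> at
  frequency 0 and \<open>UNIV\<close> otherwise. The sums over \<open>Basis\<close> stand for the
  real-linear lift of a complex number expanded in 1 and the imaginary unit.\<close>

lemma decay:
  fixes W :: "complex \<Rightarrow> 'n field" and \<epsilon> c :: real and S :: "complex set"
  assumes W: "\<And>k. W k \<in> traced l" and S: "0 \<in> S" "\<And>z z'. z \<in> S \<Longrightarrow> z' \<in> S \<Longrightarrow> z + z' \<in> S" "\<And>t. 0 \<le> t \<Longrightarrow> H t \<in> S"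
    and coercive: "\<And>U z. U \<in> traced l \<Longrightarrow> z \<in> S \<Longrightarrow>
      0 \<le> 1/2 * Df U U + \<epsilon> * (\<Sum>k\<in>Basis. (1/2 * Df U (W k) + m * (z \<bullet> Bf (W k))) * (z \<bullet> k) - (Bf U \<bullet> k) * Qf U (W k))
        - c * (Qf U U + m * (z \<bullet> z) + 2 * \<epsilon> * (\<Sum>k\<in>Basis. Qf U (W k) * (z \<bullet> k)))"
    and t: "0 \<le> t"
  shows "Qf (u t) (u t) + m * (H t \<bullet> H t) + 2 * \<epsilon> * (\<Sum>k\<in>Basis. Qf (u t) (W k) * (H t \<bullet> k))
    \<le> exp (- 2 * c * t) * (Qf (u 0) (u 0) + m * (H 0 \<bullet> H 0) + 2 * \<epsilon> * (\<Sum>k\<in>Basis. Qf (u 0) (W k) * (H 0 \<bullet> k)))"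
proof -
  \<comment> \<open>The polarisation of half the modified energy: twice the diagonal of
    \<open>g\<close> is the functional of the conclusion.\<close>
  define g where "g x y = 1/2 * Qf (u x) (u y) + m/2 * (H x \<bullet> H y) +
     \<epsilon>/2 * (\<Sum>k\<in>Basis. Qf (u x) (W k) * (H y \<bullet> k) + Qf (u y) (W k) * (H x \<bullet> k))" for x y
  \<comment> \<open>The derivative of \<open>g\<close> in its first argument, from
    \<open>u_eq\<close> and \<open>H_eq\<close>; \<open>y\<close> is restricted to \<open>G\<close>
    so that \<open>u y\<close> is an admissible test field. On the diagonal the two surface terms
    outside the sum cancel, which is the energy balance.\<close>
  define A where "A x y = 1/2 * - (1/2 * Df (u x) (u y) + m * (H x \<bullet> Bf (u y))) + m/2 * (Bf (u x) \<bullet> H y) +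
     \<epsilon>/2 * (\<Sum>k\<in>Basis. - (1/2 * Df (u x) (W k) + m * (H x \<bullet> Bf (W k))) * (H y \<bullet> k) + (Bf (u x) \<bullet> k) * Qf (u y) (W k))" for x y
  define G where "G = {t. 0 \<le> t \<and> u t \<in> traced l}"
  have WV: "W k \<in> V l" for k by (rule traced_V[OF W])
  have WL: "W k \<in> L2 (Om l)" for k by (rule V_in_L2[OF WV])
  \<comment> \<open>Apart from \<open>Df (u x) (u y)\<close>, all terms become finite sums of
    products of a function of \<open>x\<close> and a function of \<open>y\<close>, once inner
    products of complex numbers are split into coordinates. For such products
    \<open>swappable_mult\<close> suffices.\<close>
  define R where "R k x y = - m/2 * ((H x \<bullet> k) * (Bf (u y) \<bullet> k)) + m/2 * ((Bf (u x) \<bullet> k) * (H y \<bullet> k)) +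
     (\<epsilon>/2 * (- (1/2 * Df (u x) (W k) + m * (H x \<bullet> Bf (W k))) * (H y \<bullet> k)) + \<epsilon>/2 * ((Bf (u x) \<bullet> k) * Qf (u y) (W k)))" for k x y
  have A_eq: "A x y = - 1/4 * Df (u x) (u y) + (\<Sum>k\<in>Basis. R k x y)" for x y
    unfolding A_def R_def inner_complex_Basis[of "H x" "Bf (u y)"] inner_complex_Basis[of _ "H y"] sum_Basis_complex
    by (simp add: algebra_simps)
  have "g t t \<le> exp (- 2 * c * t) * g 0 0"
  proof (rule psd_kernel_decay[where g = g and A = A and G = G and c = c, OF _ _ _ _ _ _ _ _ t])
    show "continuous_on ({0..} \<times> {0..}) (\<lambda>(x, y). g x y)"
    proof -
      have h: "continuous_on ({0..} \<times> {0..}) (\<lambda>z. H (fst z))" "continuous_on ({0..} \<times> {0..}) (\<lambda>z. H (snd z))"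
        by (rule continuous_on_compose2[OF H_cont]; auto intro!: continuous_intros)+
      have q: "continuous_on ({0..} \<times> {0..}) (\<lambda>z. Qf (u (fst z)) (W k))" "continuous_on ({0..} \<times> {0..}) (\<lambda>z. Qf (u (snd z)) (W k))" for k
        by (rule continuous_on_compose2[OF qf_u_continuous[OF WL]]; auto intro!: continuous_intros)+
      show ?thesis unfolding g_def case_prod_unfold by (intro continuous_intros h q qf_jointly_continuous)
    qed
    show "g x y = g y x" for x y
      by (simp add: g_def qf_commute[of \<xi> l "u x" "u y"] inner_commute[of "H x" "H y"] add.commute)
    show "AE t in lebesgue_on {0..}. t \<in> G"
      using u_traced AE_space by eventually_elim (simp add: G_def)
    show "G \<subseteq> {0..}" by (auto simp: G_def)
    fix a b :: real assume ab: "0 \<le> a" "a < b"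
    let ?M = "lebesgue_on {a..b}"
    have qc: "continuous_on {a..b} (\<lambda>t. Qf (u t) (W k))" for k
      by (rule continuous_on_subset[OF qf_u_continuous[OF WL]]) (use ab in auto)
    have Hc: "continuous_on {a..b} (\<lambda>t. H t \<bullet> k)" for k by (intro continuous_intros H_continuous ab)
    have Hi: "integrable ?M (\<lambda>t. H t \<bullet> k)" for k by (rule continuous_imp_integrable_real[OF Hc])
    have bi: "integrable ?M (\<lambda>t. Bf (u t) \<bullet> k)" for k using integrable_Icc[OF bf_integrable ab(1), of b] by simp
    have di: "integrable ?M (\<lambda>t. - (1/2 * Df (u t) (W k) + m * (H t \<bullet> Bf (W k))))" for k
      using has_integral_u[OF ab(1) less_imp_le[OF ab(2)] W[of k]] by (rule integrable.intros)
    show "integrable ?M (\<lambda>x. A x x)"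
    proof -
      have i: "integrable ?M (\<lambda>t. Df (u t) (u t))" "integrable ?M (\<lambda>t. (Bf (u t) \<bullet> k) * (H t \<bullet> k))"
        "integrable ?M (\<lambda>t. - (1/2 * Df (u t) (W k) + m * (H t \<bullet> Bf (W k))) * (H t \<bullet> k))"
        "integrable ?M (\<lambda>t. (Bf (u t) \<bullet> k) * Qf (u t) (W k))" for k
        by (intro integrable_Icc[OF df_diag_integrable ab(1)] integrable_mult_continuous[OF bi Hc]
            integrable_mult_continuous[OF di Hc] integrable_mult_continuous[OF bi qc]; assumption)+
      have i': "integrable ?M (\<lambda>t. (H t \<bullet> k) * (Bf (u t) \<bullet> k))" for k
        using i(2)[of k] by (simp only: mult.commute)
      show ?thesis unfolding A_eq R_def
        by (intro Bochner_Integration.integrable_add Bochner_Integration.integrable_sum integrable_mult_right i i')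
    qed
    show "\<exists>X. swappable ?M G A X"
    proof -
      obtain X where X: "swappable ?M G (\<lambda>x y. Df (u x) (u y)) X" using swappable_df[OF ab G_def] by blast
      have "\<exists>I. swappable ?M G (\<lambda>x y. \<Sum>k\<in>Basis. R k x y) I"
      proof (rule swappable_sum[OF finite_Basis])
        fix k :: complex
        note qi = continuous_imp_integrable_real[OF qc]
        note s1 = swappable_scale[OF swappable_mult[OF Hi[of k] bi[of k]], where c = "- m/2"]
        note s2 = swappable_scale[OF swappable_mult[OF bi[of k] Hi[of k]], where c = "m/2"]
        note s3 = swappable_scale[OF swappable_mult[OF di[of k] Hi[of k]], where c = "\<epsilon>/2"]
        note s4 = swappable_scale[OF swappable_mult[OF bi[of k] qi[of k]], where c = "\<epsilon>/2"]
        show "\<exists>I. swappable ?M G (R k) I" unfolding R_def[abs_def]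
          by (rule exI) (rule swappable_add[OF swappable_add[OF s1 s2] swappable_add[OF s3 s4]])
      qed
      then obtain I where I: "swappable ?M G (\<lambda>x y. \<Sum>k\<in>Basis. R k x y) I" ..
      show ?thesis using swappable_add[OF swappable_scale[OF X, of "- 1/4"] I] unfolding A_eq[abs_def] by blast
    qed
    show "(LINT x|?M. A x y) = g b y - g a y" if y: "y \<in> G" for y
    proof -
      have yt: "u y \<in> traced l" using y by (simp add: G_def)
      have "has_bochner_integral ?M (\<lambda>x. A x y) (1/2 * (Qf (u b) (u y) - Qf (u a) (u y)) + m/2 * ((H b - H a) \<bullet> H y) +
         \<epsilon>/2 * (\<Sum>k\<in>Basis. (Qf (u b) (W k) - Qf (u a) (W k)) * (H y \<bullet> k) + ((H b - H a) \<bullet> k) * Qf (u y) (W k)))"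
        unfolding A_def using ab yt W
        by (intro has_bochner_integral_add has_bochner_integral_sum has_bochner_integral_mult_right has_bochner_integral_mult_left
            has_integral_u has_integral_H) auto
      then show ?thesis unfolding g_def sum_Basis_complex by (simp add: has_bochner_integral_integral_eq algebra_simps)
    qed
  next
    fix xs assume xs: "set xs \<subseteq> G"
    then obtain U where U: "U \<in> traced l" "\<And>v. v \<in> V l \<Longrightarrow> Df U v = (\<Sum>x\<leftarrow>xs. Df (u x) v)"
      "\<And>v. v \<in> V l \<Longrightarrow> Qf U v = (\<Sum>x\<leftarrow>xs. Qf (u x) v)" "Bf U = (\<Sum>x\<leftarrow>xs. Bf (u x))"
      using sum_list_u[of xs "W 0"] W by (auto simp: G_def subset_iff)
    define z where "z = (\<Sum>x\<leftarrow>xs. H x)"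
    have UV: "U \<in> V l" by (rule traced_V[OF U(1)])
    have zS: "z \<in> S" unfolding z_def using xs by (induction xs) (auto simp: G_def intro: S)
    have lin: "(\<Sum>x\<leftarrow>xs. \<Sum>y\<leftarrow>xs. K1 x y + K2 x y) = (\<Sum>x\<leftarrow>xs. \<Sum>y\<leftarrow>xs. K1 x y) + (\<Sum>x\<leftarrow>xs. \<Sum>y\<leftarrow>xs. K2 x y)"
      "(\<Sum>x\<leftarrow>xs. \<Sum>y\<leftarrow>xs. r * K1 x y) = r * (\<Sum>x\<leftarrow>xs. \<Sum>y\<leftarrow>xs. K1 x y)" for K1 K2 :: "real \<Rightarrow> real \<Rightarrow> real" and r
      by (simp_all add: sum_list_addf sum_list_const_mult)
    have bil: "(\<Sum>x\<leftarrow>xs. \<Sum>y\<leftarrow>xs. B (u x) (u y)) = B U U"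
      if B: "\<And>v. v \<in> V l \<Longrightarrow> B U v = (\<Sum>x\<leftarrow>xs. B (u x) v)" and sym: "\<And>v w. B v w = B w v" for B :: "'n field \<Rightarrow> 'n field \<Rightarrow> real"
    proof -
      have "(\<Sum>x\<leftarrow>xs. \<Sum>y\<leftarrow>xs. B (u x) (u y)) = (\<Sum>x\<leftarrow>xs. B (u x) U)"
      proof (intro arg_cong[where f = sum_list] map_cong refl)
        fix x assume "x \<in> set xs"
        then have "u x \<in> V l" using xs by (auto simp: G_def intro: traced_V)
        then show "(\<Sum>y\<leftarrow>xs. B (u x) (u y)) = B (u x) U" using B[of "u x"] by (simp only: sym[of "u x"])
      qed
      then show ?thesis using B[OF UV] by simp
    qed
    note dd = bil[of "Df", OF U(2) df_commute] and qq = bil[of "Qf", OF U(3) qf_commute]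
    have sA: "(\<Sum>x\<leftarrow>xs. \<Sum>y\<leftarrow>xs. A x y) = - 1/4 * Df U U + (\<Sum>k\<in>Basis. - m/2 * ((z \<bullet> k) * (Bf U \<bullet> k)) + m/2 * ((Bf U \<bullet> k) * (z \<bullet> k)) +
       (\<epsilon>/2 * (- (1/2 * Df U (W k) + m * (z \<bullet> Bf (W k))) * (z \<bullet> k)) + \<epsilon>/2 * ((Bf U \<bullet> k) * Qf U (W k))))"
    proof -
      have e: "(\<Sum>x\<leftarrow>xs. - (1/2 * Df (u x) (W k) + m * (H x \<bullet> Bf (W k)))) = - (1/2 * Df U (W k) + m * (z \<bullet> Bf (W k)))" for k
      proof -
        have "(\<Sum>x\<leftarrow>xs. - (1/2 * Df (u x) (W k) + m * (H x \<bullet> Bf (W k)))) =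
          - (1/2 * (\<Sum>x\<leftarrow>xs. Df (u x) (W k)) + m * (\<Sum>x\<leftarrow>xs. H x \<bullet> Bf (W k)))"
          by (induction xs) (auto simp: algebra_simps)
        then show ?thesis by (simp only: U(2)[OF WV] z_def sum_list_inner_left)
      qed
      show ?thesis unfolding A_eq R_def sum_Basis_complex
        by (simp only: lin sum_list_product dd e sum_list_inner_left U(3)[OF WV, symmetric] U(4)[symmetric] z_def[symmetric])
    qed
    have sA': "(\<Sum>x\<leftarrow>xs. \<Sum>y\<leftarrow>xs. A y x) = (\<Sum>x\<leftarrow>xs. \<Sum>y\<leftarrow>xs. A x y)"
      by (simp add: sum_list_sum_nth) (rule sum.swap)
    have sg: "(\<Sum>x\<leftarrow>xs. \<Sum>y\<leftarrow>xs. g x y) = 1/2 * Qf U U + m/2 * (z \<bullet> z) + \<epsilon>/2 * (\<Sum>k\<in>Basis. Qf U (W k) * (z \<bullet> k) + (z \<bullet> k) * Qf U (W k))"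
    proof -
      have g_eq: "g x y = 1/2 * Qf (u x) (u y) + m/2 * ((H x \<bullet> 1) * (H y \<bullet> 1) + (H x \<bullet> \<i>) * (H y \<bullet> \<i>)) +
        \<epsilon>/2 * (Qf (u x) (W 1) * (H y \<bullet> 1) + (H x \<bullet> 1) * Qf (u y) (W 1) + (Qf (u x) (W \<i>) * (H y \<bullet> \<i>) + (H x \<bullet> \<i>) * Qf (u y) (W \<i>)))" for x y
        unfolding g_def inner_complex_Basis[of "H x" "H y"] sum_Basis_complex by (simp add: algebra_simps)
      show ?thesis unfolding g_eq inner_complex_Basis[of z z] sum_Basis_complex
        by (simp only: lin sum_list_product qq sum_list_inner_left U(3)[OF WV, symmetric] z_def[symmetric])
    qed
    have "(\<Sum>x\<leftarrow>xs. \<Sum>y\<leftarrow>xs. - (A x y + A y x) - 2 * c * g x y) =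
        - ((\<Sum>x\<leftarrow>xs. \<Sum>y\<leftarrow>xs. A x y) + (\<Sum>x\<leftarrow>xs. \<Sum>y\<leftarrow>xs. A y x)) - 2 * c * (\<Sum>x\<leftarrow>xs. \<Sum>y\<leftarrow>xs. g x y)"
      by (simp add: sum_list_subtractf sum_list_addf sum_list_const_mult uminus_sum_list_map comp_def)
    also have "\<dots> = 1/2 * Df U U + \<epsilon> * (\<Sum>k\<in>Basis. (1/2 * Df U (W k) + m * (z \<bullet> Bf (W k))) * (z \<bullet> k) - (Bf U \<bullet> k) * Qf U (W k))
        - c * (Qf U U + m * (z \<bullet> z) + 2 * \<epsilon> * (\<Sum>k\<in>Basis. Qf U (W k) * (z \<bullet> k)))"
      unfolding sA' sA sg sum_Basis_complex by (simp add: algebra_simps)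
    finally show "0 \<le> (\<Sum>x\<leftarrow>xs. \<Sum>y\<leftarrow>xs. - (A x y + A y x) - 2 * c * g x y)"
      using coercive[OF U(1) zS] by simp
  qed
  then have "2 * g t t \<le> exp (- 2 * c * t) * (2 * g 0 0)" by simp
  moreover have "2 * g x x = Qf (u x) (u x) + m * (H x \<bullet> H x) + 2 * \<epsilon> * (\<Sum>k\<in>Basis. Qf (u x) (W k) * (H x \<bullet> k))" for x
    unfolding g_def sum_Basis_complex by (simp add: algebra_simps)
  ultimately show ?thesis by (simp only:)
qed

end

text \<open>In the application \<open>D\<close> and \<open>Q\<close> are \<open>df U U\<close> and
  \<open>qf U U\<close>, \<open>Z\<close> is |z|^2, \<open>b\<close> is the squared modulus of
  \<open>bf U\<close>, \<open>Y\<close> and \<open>T\<close> pair \<open>U\<close> with the lift of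
  \<open>z\<close>, and \<open>R\<close> pairs it with the lift of \<open>bf U\<close>. The term
  \<open>1/2 * D\<close> is spent as 1/8 on \<open>Y\<close>, 1/8 on \<open>R\<close> and 1/4 on the
  decay term; of \<open>\<epsilon> * m * Z\<close> a quarter goes to \<open>Y\<close> and a half to
  the decay term. The second conclusion makes the modified energy equivalent to the energy.\<close>

lemma coercivity_estimate:
  fixes D Q Z Y R T b :: real
  assumes nn: "0 \<le> D" "0 \<le> Q" "0 \<le> Z" "0 \<le> b" and pos: "0 < m" "0 < C" "0 < p" "0 < l" "0 < M" and x: "1 \<le> x" "m \<le> M * x"
    and Y: "\<bar>Y\<bar> \<le> sqrt D * sqrt (C * x * Z)" and R: "\<bar>R\<bar> \<le> sqrt Q * sqrt (C * b)" and T: "\<bar>T\<bar> \<le> sqrt Q * sqrt (C * Z)"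
    and Q: "Q \<le> p * D" and b: "b \<le> l * D"
    and k: "0 < k" "k * C \<le> 1/2" "k * (M * sqrt (p * C * l)) \<le> 1/8" "k\<^sup>2 * (4 * M * C) \<le> 1"
    and c: "0 < c" "c \<le> k / 3" "c * (6 * p * M) \<le> 1"
    and e: "\<epsilon> = k * (m / x)"
  shows "0 \<le> 1/2 * D + \<epsilon> * (1/2 * Y + m * Z - R) - c * (m / x) * (Q + m * Z + 2 * \<epsilon> * T)"
    and "\<bar>2 * \<epsilon> * T\<bar> \<le> 1/2 * (Q + m * Z)"
proof -
  have xp: "0 < x" and mx: "0 < m / x" "m / x \<le> M" using x pos by (auto simp: field_simps)
  have ep: "0 < \<epsilon>" unfolding e by (rule mult_pos_pos[OF k(1) mx(1)])
  have amgm: "2 * (sqrt a * sqrt d) \<le> a + d" if "0 \<le> a" "0 \<le> d" for a d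
  proof -
    have "0 \<le> (sqrt a - sqrt d)^2" by simp
    then show ?thesis using that by (simp add: power2_diff)
  qed
  have "2 * \<bar>Y\<bar> \<le> D * (C * x / m) + m * Z"
  proof -
    have "sqrt D * sqrt (C * x * Z) = sqrt (D * (C * x / m)) * sqrt (m * Z)"
      unfolding real_sqrt_mult[symmetric] using pos by (simp add: field_simps)
    moreover have "2 * (sqrt (D * (C * x / m)) * sqrt (m * Z)) \<le> D * (C * x / m) + m * Z"
      by (rule amgm) (use nn pos xp in auto)
    ultimately show ?thesis using Y by linarith
  qed
  then have "\<epsilon> * (2 * \<bar>Y\<bar>) \<le> \<epsilon> * (D * (C * x / m) + m * Z)" by (rule mult_left_mono) (use ep in simp)
  also have "\<dots> = (k * C) * D + \<epsilon> * (m * Z)" using pos xp by (simp add: e field_simps)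
  also have "\<dots> \<le> 1/2 * D + \<epsilon> * (m * Z)" using mult_right_mono[OF k(2) nn(1)] by simp
  finally have Y': "\<epsilon> * \<bar>Y\<bar> \<le> 1/4 * D + 1/2 * (\<epsilon> * (m * Z))" by simp
  have "sqrt Q * sqrt (C * b) \<le> sqrt (p * D) * sqrt (C * (l * D))"
    using Q b nn pos by (intro mult_mono real_sqrt_le_mono mult_left_mono) auto
  also have "\<dots> = sqrt (p * C * l) * D"
  proof -
    have "sqrt (p * D) * sqrt (C * (l * D)) = sqrt (p * C * l * D^2)"
      unfolding real_sqrt_mult[symmetric] by (simp add: power2_eq_square mult_ac)
    also have "\<dots> = sqrt (p * C * l) * D" using nn(1) by (simp only: real_sqrt_mult real_sqrt_abs abs_of_nonneg)
    finally show ?thesis .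
  qed
  finally have R1: "\<bar>R\<bar> \<le> sqrt (p * C * l) * D" using R by linarith
  have "\<epsilon> * \<bar>R\<bar> \<le> \<epsilon> * (sqrt (p * C * l) * D)" using R1 ep by (intro mult_left_mono) auto
  also have "\<dots> \<le> (k * M) * (sqrt (p * C * l) * D)"
    using mx k(1) nn(1) pos unfolding e by (intro mult_right_mono mult_left_mono mult_nonneg_nonneg) auto
  also have "\<dots> \<le> 1/8 * D" using mult_right_mono[OF k(3) nn(1)] by (simp add: mult_ac)
  finally have R': "\<epsilon> * \<bar>R\<bar> \<le> 1/8 * D" .
  have e2: "4 * \<epsilon>^2 * C \<le> m"
  proof -
    have "4 * \<epsilon>^2 * C = (k^2 * (4 * (m / x) * C)) * (m / x)" by (simp add: e power2_eq_square)
    also have "\<dots> \<le> (k^2 * (4 * M * C)) * (m / x)"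
      using mx pos by (intro mult_right_mono mult_left_mono) auto
    also have "\<dots> \<le> 1 * (m / x)" using k(4) mx(1) by (intro mult_right_mono) auto
    also have "\<dots> \<le> m" using x(1) pos(1) by (simp add: field_simps)
    finally show ?thesis .
  qed
  have "\<bar>2 * \<epsilon> * T\<bar> \<le> 2 * \<epsilon> * (sqrt Q * sqrt (C * Z))" using T ep by (simp add: abs_mult)
  also have "\<dots> = 2 * (sqrt (1/2 * Q) * sqrt (2 * \<epsilon>^2 * C * Z))"
  proof -
    have "sqrt (1/2 * Q) * sqrt (2 * \<epsilon>^2 * C * Z) = sqrt (\<epsilon>^2 * (Q * (C * Z)))"
      unfolding real_sqrt_mult[symmetric] by (simp add: mult_ac)
    also have "\<dots> = \<epsilon> * (sqrt Q * sqrt (C * Z))" using ep by (simp only: real_sqrt_mult real_sqrt_abs abs_of_pos)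
    finally show ?thesis by simp
  qed
  also have "\<dots> \<le> 1/2 * Q + 2 * \<epsilon>^2 * C * Z" by (rule amgm) (use nn pos in auto)
  also have "\<dots> \<le> 1/2 * Q + 1/2 * (m * Z)" using mult_right_mono[OF e2 nn(3)] by simp
  finally show T': "\<bar>2 * \<epsilon> * T\<bar> \<le> 1/2 * (Q + m * Z)" by simp
  have "c * (m / x) * (Q + m * Z + 2 * \<epsilon> * T) \<le> c * (m / x) * (3/2 * (p * D + m * Z))"
  proof (rule mult_left_mono)
    show "Q + m * Z + 2 * \<epsilon> * T \<le> 3/2 * (p * D + m * Z)"
      using T' Q abs_ge_self[of "2 * \<epsilon> * T"] by (simp only: ring_distribs)
    show "0 \<le> c * (m / x)" by (rule mult_nonneg_nonneg) (use c(1) mx(1) in auto)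
  qed
  also have "\<dots> = 3/2 * (c * (m / x) * (p * D)) + 3/2 * (c * ((m / x) * (m * Z)))" by (simp only: ring_distribs mult_ac)
  also have "\<dots> \<le> 3/2 * (c * M * (p * D)) + 3/2 * (k / 3 * ((m / x) * (m * Z)))"
    using mx c nn pos xp by (intro add_mono mult_left_mono mult_right_mono) auto
  also have "\<dots> = 1/4 * ((c * (6 * p * M)) * D) + 1/2 * (\<epsilon> * (m * Z))" by (simp add: e algebra_simps)
  also have "\<dots> \<le> 1/4 * D + 1/2 * (\<epsilon> * (m * Z))"
  proof -
    have "c * (6 * p * M) * D \<le> D" using mult_right_mono[OF c(3) nn(1)] by (simp only: mult_1_left)
    then show ?thesis by (intro add_right_mono mult_left_mono) simp_all
  qed
  finally have "c * (m / x) * (Q + m * Z + 2 * \<epsilon> * T) \<le> 1/4 * D + 1/2 * (\<epsilon> * (m * Z))" .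
  moreover have "\<epsilon> * (1/2 * Y + m * Z - R) \<ge> - (1/2 * (\<epsilon> * \<bar>Y\<bar>)) + \<epsilon> * (m * Z) - \<epsilon> * \<bar>R\<bar>"
  proof -
    have "- (\<epsilon> * \<bar>Y\<bar>) \<le> \<epsilon> * Y" "\<epsilon> * R \<le> \<epsilon> * \<bar>R\<bar>" using ep by (auto simp: abs_if mult_le_cancel_left)
    then show ?thesis by (simp add: algebra_simps)
  qed
  moreover have "0 \<le> \<epsilon> * (m * Z)" using ep nn pos by simp
  ultimately show "0 \<le> 1/2 * D + \<epsilon> * (1/2 * Y + m * Z - R) - c * (m / x) * (Q + m * Z + 2 * \<epsilon> * T)"
    using Y' R' nn(1) by linarith
qed

text \<open>The point is that \<open>c\<close> depends neither on \<xi> nor on \<open>m\<close>. The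
  factor 3 is the ratio of the constants 3/2 and 1/2 in the comparison of the modified energy with
  the energy.\<close>

lemma frequency_decay:
  fixes l M :: real
  assumes l: "l > 0" and M: "M > 0"
  shows "\<exists>c>0. \<forall>(\<xi> :: int ^ 'n::finite) m u H. frequency_evolution l m \<xi> u H \<longrightarrow> 0 < m \<longrightarrow> m \<le> M * max 1 (norm (freq \<xi>)) \<longrightarrow>
    (\<xi> = 0 \<longrightarrow> (\<forall>t\<ge>0. H t = 0)) \<longrightarrow>
    (\<forall>t\<ge>0. qf \<xi> l (u t) (u t) + m * (cmod (H t))^2 \<le>
       3 * exp (- 2 * (c * (m / max 1 (norm (freq \<xi>)))) * t) * (qf \<xi> l (u 0) (u 0) + m * (cmod (H 0))^2))"
proof -
  obtain C where C: "C > 0" and lift: "\<And>\<xi> :: int ^ 'n. \<xi> \<noteq> 0 \<Longrightarrow> \<exists>w :: complex \<Rightarrow> 'n field.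
     (\<forall>z. w z \<in> V l \<and> (\<exists>k. has_trace l l (\<lambda>p. snd (w z p)) k) \<and> bf \<xi> l (w z) = z \<and>
        qf \<xi> l (w z) (w z) \<le> C * (cmod z)^2 \<and> df \<xi> l (w z) (w z) \<le> C * norm (freq \<xi>) * (cmod z)^2) \<and>
     (\<forall>a b z z'. w (of_real a * z + of_real b * z') = (\<lambda>p. a *\<^sub>R w z p + b *\<^sub>R w z' p))"
    using boundary_lift_exists[OF l, where 'n = 'n] by blast
  define p where "p = 1 + 2 * l^2"
  have p: "p > 0" by (simp add: p_def add_pos_nonneg)
  \<comment> \<open>The entries serve, in this order, to bound \<open>k\<^sup>2\<close> by
    \<open>k\<close> and to absorb the terms \<open>Y\<close>, \<open>R\<close> and \<open>T\<close>
    of \<open>coercivity_estimate\<close>.\<close>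
  define k where "k = min 1 (min (1 / (2 * C)) (min (1 / (8 * (M * sqrt (p * C * l)))) (1 / (4 * M * C))))"
  have s: "M * sqrt (p * C * l) > 0" using M p C l by simp
  have k: "0 < k" "k \<le> 1" "k \<le> 1 / (2 * C)" "k \<le> 1 / (8 * (M * sqrt (p * C * l)))" "k \<le> 1 / (4 * M * C)"
    using s C M by (auto simp: k_def)
  have k1: "k * C \<le> 1/2" using mult_right_mono[OF k(3), of C] C by simp
  have k2: "k * (M * sqrt (p * C * l)) \<le> 1/8"   proof -
    define S where "S = M * sqrt (p * C * l)"
    have "0 < 8 * S" "k \<le> 1 / (8 * S)" using s k(4) by (auto simp: S_def)
    then have "k * (8 * S) \<le> 1" by (simp only: pos_le_divide_eq)
    then show ?thesis by (simp add: S_def)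
  qed
  have k3: "k\<^sup>2 * (4 * M * C) \<le> 1"
  proof -
    have "k\<^sup>2 * (4 * M * C) = k * (k * (4 * M * C))" by (simp add: power2_eq_square)
    also have "\<dots> \<le> 1 * 1" using k(1,2) mult_right_mono[OF k(5), of "4 * M * C"] M C by (intro mult_mono) auto
    finally show ?thesis by simp
  qed
  \<comment> \<open>The first entry limits the decay term to half of
    \<open>\<epsilon> * m * Z\<close>, the second to a quarter of \<open>D\<close>; at frequency 0
    the second alone gives coercivity.\<close>
  define c where "c = min (k / 3) (1 / (6 * p * M))"
  have c: "0 < c" "c \<le> k / 3" "c \<le> 1 / (6 * p * M)" using k(1) p M by (auto simp: c_def)
  have c3: "c * (6 * p * M) \<le> 1" using mult_right_mono[OF c(3), of "6 * p * M"] p M by simp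
  show ?thesis
  proof (intro exI[of _ c] conjI c(1) allI impI)
    fix \<xi> :: "int ^ 'n" and m u H and t :: real
    assume ev: "frequency_evolution l m \<xi> u H" and m: "0 < m" "m \<le> M * max 1 (norm (freq \<xi>))"
      and H0: "\<xi> = 0 \<longrightarrow> (\<forall>t\<ge>0. H t = 0)" and t: "0 \<le> t"
    interpret frequency_evolution l m \<xi> u H by (rule ev)
    define x where "x = max 1 (norm (freq \<xi>))"
    have x: "1 \<le> x" "m \<le> M * x" using m by (auto simp: x_def)
    define E where "E t = Qf (u t) (u t) + m * (cmod (H t))^2" for t
    have E0: "0 \<le> E t" for t using m(1) by (simp add: E_def qf_nonneg)
    have "E t \<le> 3 * exp (- 2 * (c * (m / x)) * t) * E 0"
    proof (cases "\<xi> = 0")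
      case True
      have Hz: "H t = 0" if "0 \<le> t" for t using H0 True that by simp
      \<comment> \<open>Any nonzero frequency supplies a traced field. It fills the slot of the
        lift, whose weight is 0 in this case.\<close>
      have "(\<chi> i. 1) \<noteq> (0 :: int ^ 'n)" by (simp add: vec_eq_iff)
      from lift[OF this] obtain W0 :: "'n field" where W0: "W0 \<in> traced l" unfolding traced_def by blast
      have "Qf (u t) (u t) + m * (H t \<bullet> H t) + 2 * 0 * (\<Sum>k\<in>Basis. Qf (u t) W0 * (H t \<bullet> k))
        \<le> exp (- 2 * (c * (m / x)) * t) * (Qf (u 0) (u 0) + m * (H 0 \<bullet> H 0) + 2 * 0 * (\<Sum>k\<in>Basis. Qf (u 0) W0 * (H 0 \<bullet> k)))"
      proof (rule decay[where W = "\<lambda>_. W0" and S = "{0}", OF W0 _ _ _ _ t])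
        fix U :: "'n field" and z :: complex assume U: "U \<in> traced l" and z: "z \<in> {0}"
        have mx: "m / x \<le> M" using x by (simp add: field_simps)
        have "c * (m / x) * Qf U U \<le> c * M * (p * Df U U)"
          using qf_le_df[OF l traced_V[OF U], of \<xi>] mx c(1) M m(1) x(1)
          by (intro mult_mono mult_left_mono) (auto simp: p_def qf_nonneg)
        also have "\<dots> = 1/6 * ((c * (6 * p * M)) * Df U U)" by simp
        also have "\<dots> \<le> 1/6 * Df U U"
        proof (rule mult_left_mono)
          show "c * (6 * p * M) * Df U U \<le> Df U U"
            using mult_right_mono[OF c3 df_nonneg[of \<xi> l U]] by (simp only: mult_1_left)
        qed simp
        finally have "c * (m / x) * Qf U U \<le> 1/6 * Df U U" .
        then have "0 \<le> 1/2 * Df U U - c * (m / x) * Qf U U" using df_nonneg[of \<xi> l U] by linarith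
        then show "0 \<le> 1/2 * Df U U + 0 * (\<Sum>k\<in>Basis. (1/2 * Df U W0 + m * (z \<bullet> Bf W0)) * (z \<bullet> k) - (Bf U \<bullet> k) * Qf U W0)
          - (c * (m / x)) * (Qf U U + m * (z \<bullet> z) + 2 * 0 * (\<Sum>k\<in>Basis. Qf U W0 * (z \<bullet> k)))"
          using z by simp
      qed (use Hz in auto)
      then have "E t \<le> exp (- 2 * (c * (m / x)) * t) * E 0" using Hz[of t] Hz[of 0] t by (simp add: E_def)
      also have "\<dots> \<le> 3 * exp (- 2 * (c * (m / x)) * t) * E 0" using E0[of 0] by (intro mult_right_mono) auto
      finally show ?thesis .
    next
      case False
      have xn: "x = norm (freq \<xi>)" using norm_freq_ge_1[OF False] by (simp add: x_def)
      obtain w :: "complex \<Rightarrow> 'n field" where w: "\<And>z. w z \<in> V l" "\<And>z. \<exists>k. has_trace l l (\<lambda>p. snd (w z p)) k" "\<And>z. Bf (w z) = z"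
        "\<And>z. Qf (w z) (w z) \<le> C * (cmod z)^2" "\<And>z. Df (w z) (w z) \<le> C * x * (cmod z)^2"
        "\<And>a b z z'. w (of_real a * z + of_real b * z') = (\<lambda>p. a *\<^sub>R w z p + b *\<^sub>R w z' p)"
        using lift[OF False] unfolding xn[symmetric] by blast
      \<comment> \<open>Real-linearity reduces the lift to its values at 1 and the imaginary unit,
        the form in which \<open>decay\<close> takes it.\<close>
      have wz: "w z = (\<lambda>p. (z \<bullet> 1) *\<^sub>R w 1 p + (z \<bullet> \<i>) *\<^sub>R w \<i> p)" for z
      proof -
        have "of_real (z \<bullet> 1) * 1 + of_real (z \<bullet> \<i>) * \<i> = z" by (simp add: complex_eq_iff inner_complex_def)
        then show ?thesis using w(6)[of "z \<bullet> 1" 1 "z \<bullet> \<i>" \<i>] by simp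
      qed
      define e where "e = k * (m / x)"
      have df_w: "Df U (w z) = (\<Sum>k\<in>Basis. Df U (w k) * (z \<bullet> k))" if "U \<in> V l" for U z
        unfolding wz[of z] df_lincomb_right[OF l w(1) w(1) that] sum_Basis_complex by (simp add: mult.commute)
      have qf_w: "Qf U (w z) = (\<Sum>k\<in>Basis. Qf U (w k) * (z \<bullet> k))" if "U \<in> L2 (Om l)" for U z
        unfolding wz[of z] qf_lincomb_right[OF V_in_L2[OF w(1)] V_in_L2[OF w(1)] that] sum_Basis_complex by (simp add: mult.commute)
      have T: "\<bar>Qf U (w z)\<bar> \<le> sqrt (Qf U U) * sqrt (C * (cmod z)^2)" if U: "U \<in> L2 (Om l)" for U z
      proof -
        have "sqrt (Qf U U) * sqrt (Qf (w z) (w z)) \<le> sqrt (Qf U U) * sqrt (C * (cmod z)^2)"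
          using w(4)[of z] by (intro mult_left_mono real_sqrt_le_mono) (auto simp: qf_nonneg)
        then show ?thesis using qf_Cauchy_Schwarz[OF U V_in_L2[OF w(1)[of z]], of \<xi>] by linarith
      qed
      have Y: "\<bar>Df U (w z)\<bar> \<le> sqrt (Df U U) * sqrt (C * x * (cmod z)^2)" if U: "U \<in> V l" for U z
      proof -
        have "sqrt (Df U U) * sqrt (Df (w z) (w z)) \<le> sqrt (Df U U) * sqrt (C * x * (cmod z)^2)"
          using w(5)[of z] by (intro mult_left_mono real_sqrt_le_mono) (auto simp: df_nonneg)
        then show ?thesis using df_Cauchy_Schwarz[OF l U w(1)[of z], of \<xi>] by linarith
      qed
      note est = coercivity_estimate[OF _ _ _ _ m(1) C p l M x _ _ _ _ _ k(1) k1 k2 k3 c(1,2) c3 e_def]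
      have est1: "0 \<le> 1/2 * Df U U + e * (1/2 * Df U (w z) + m * (cmod z)^2 - Qf U (w (Bf U)))
          - c * (m / x) * (Qf U U + m * (cmod z)^2 + 2 * e * Qf U (w z))" if U: "U \<in> V l" for U z
        by (rule est(1)[OF df_nonneg qf_nonneg _ _ Y[OF U] T[OF V_in_L2[OF U]] T[OF V_in_L2[OF U]]])
          (use qf_le_df[OF l U, of \<xi>] bf_le_df[OF l U, of \<xi>] in \<open>auto simp: p_def\<close>)
      have dec: "Qf (u t) (u t) + m * (H t \<bullet> H t) + 2 * e * (\<Sum>k\<in>Basis. Qf (u t) (w k) * (H t \<bullet> k))
        \<le> exp (- 2 * (c * (m / x)) * t) * (Qf (u 0) (u 0) + m * (H 0 \<bullet> H 0) + 2 * e * (\<Sum>k\<in>Basis. Qf (u 0) (w k) * (H 0 \<bullet> k)))"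
      proof (rule decay[where W = w and S = UNIV, OF _ _ _ _ _ t])
        show "w k \<in> traced l" for k using w(1,2) by (simp add: traced_def)
        fix U :: "'n field" and z :: complex assume "U \<in> traced l"
        then have U: "U \<in> V l" by (rule traced_V)
        have "(\<Sum>k\<in>Basis. (1/2 * Df U (w k) + m * (z \<bullet> Bf (w k))) * (z \<bullet> k) - (Bf U \<bullet> k) * Qf U (w k)) =
            1/2 * Df U (w z) + m * (cmod z)^2 - Qf U (w (Bf U))"
          unfolding df_w[OF U, of z] qf_w[OF V_in_L2[OF U], of "Bf U"] w(3) power2_norm_eq_inner inner_complex_Basis[of z z] sum_Basis_complex
          by (simp add: algebra_simps)
        then show "0 \<le> 1/2 * Df U U + e * (\<Sum>k\<in>Basis. (1/2 * Df U (w k) + m * (z \<bullet> Bf (w k))) * (z \<bullet> k) - (Bf U \<bullet> k) * Qf U (w k))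
          - (c * (m / x)) * (Qf U U + m * (z \<bullet> z) + 2 * e * (\<Sum>k\<in>Basis. Qf U (w k) * (z \<bullet> k)))"
          using est1[OF U, of z] by (simp only: qf_w[OF V_in_L2[OF U], of z, symmetric] power2_norm_eq_inner)
      qed auto
      have cmp: "1/2 * E t \<le> Qf (u t) (u t) + m * (H t \<bullet> H t) + 2 * e * (\<Sum>k\<in>Basis. Qf (u t) (w k) * (H t \<bullet> k))"
        "Qf (u t) (u t) + m * (H t \<bullet> H t) + 2 * e * (\<Sum>k\<in>Basis. Qf (u t) (w k) * (H t \<bullet> k)) \<le> 3/2 * E t" if "0 \<le> t" for t
      proof -
        have ut: "u t \<in> L2 (Om l)" by (rule u_L2[OF that])
        \<comment> \<open>The comparison with the energy rests on the bound for \<open>T\<close>.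
          The remaining parameters are given values that satisfy their hypotheses trivially;
          \<open>Qf / p\<close> turns the one relating \<open>Q\<close> and \<open>D\<close> into an
          equality.\<close>
        have "\<bar>2 * e * Qf (u t) (w (H t))\<bar> \<le> 1/2 * (Qf (u t) (u t) + m * (cmod (H t))^2)"
          by (rule est(2)[where D = "Qf (u t) (u t) / p" and Y = 0 and R = 0 and b = 0, OF _ qf_nonneg _ _ _ _ T[OF ut]])
            (use p l C x in \<open>auto simp: qf_nonneg\<close>)
        then show "1/2 * E t \<le> Qf (u t) (u t) + m * (H t \<bullet> H t) + 2 * e * (\<Sum>k\<in>Basis. Qf (u t) (w k) * (H t \<bullet> k))"
          "Qf (u t) (u t) + m * (H t \<bullet> H t) + 2 * e * (\<Sum>k\<in>Basis. Qf (u t) (w k) * (H t \<bullet> k)) \<le> 3/2 * E t"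
          unfolding E_def qf_w[OF ut, of "H t", symmetric] power2_norm_eq_inner by (auto simp: abs_le_iff)
      qed
      have "1/2 * E t \<le> exp (- 2 * (c * (m / x)) * t) * (3/2 * E 0)"
        by (rule order_trans[OF order_trans[OF cmp(1)[OF t] dec] mult_left_mono[OF cmp(2)[OF order_refl]]]) simp
      then show ?thesis by simp
    qed
    then show "Qf (u t) (u t) + m * (cmod (H t))^2 \<le>
       3 * exp (- 2 * (c * (m / max 1 (norm (freq \<xi>)))) * t) * (Qf (u 0) (u 0) + m * (cmod (H 0))^2)"
      by (simp only: E_def x_def)
  qed
qed

section \<open>Summation over the frequencies\<close>

text \<open>Everything is compared through \<open>X\<close>: the symbol is of order X^r, and
  \<open>max 1 (norm (freq \<xi>))\<close> lies between half of X^(1/2) and X^(1/2). The third bound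
  is the growth condition of \<open>frequency_decay\<close>, the fourth the lower bound for its
  rate.\<close>

lemma power_symbol_bounds:
  fixes g \<sigma> r :: real and \<xi> :: "int ^ 'n::finite"
  assumes g: "g > 0" and \<sigma>: "\<sigma> > 0" and r: "0 \<le> r" "r < 1/2"
  defines "X \<equiv> 1 + (norm (freq \<xi>))^2"
  shows "power_symbol g \<sigma> r \<xi> \<le> (g + 2 * pi * \<sigma>) * X powr r"
    and "min g \<sigma> / 2 * X powr r \<le> power_symbol g \<sigma> r \<xi>"
    and "power_symbol g \<sigma> r \<xi> \<le> 2 * (g + 2 * pi * \<sigma>) * max 1 (norm (freq \<xi>))"
    and "min g \<sigma> / 2 * X powr (r - 1/2) \<le> power_symbol g \<sigma> r \<xi> / max 1 (norm (freq \<xi>))"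
proof -
  define n where "n = norm (freq \<xi>)"
  have n: "0 \<le> n" and X: "X = 1 + n^2" "1 \<le> X" by (auto simp: n_def X_def)
  have pi1: "1 \<le> 2 * pi" using pi_gt3 by simp
  have n2: "n powr (2 * r) = (n^2) powr r" using n by (cases "n = 0") (auto simp: powr_powr[symmetric] powr_numeral)
  have Xr: "1 \<le> X powr r" using X(2) r by (simp add: ge_one_powr_ge_zero)
  have up: "power_symbol g \<sigma> r \<xi> \<le> (g + 2 * pi * \<sigma>) * X powr r \<and> min g \<sigma> / 2 * X powr r \<le> power_symbol g \<sigma> r \<xi>"
  proof (cases "r = 0")
    case True
    have "\<sigma> * 1 \<le> \<sigma> * (2 * pi)" using pi1 \<sigma> by (intro mult_left_mono) auto
    moreover have "X powr r = 1" using True X(2) by simp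
    ultimately show ?thesis using True g \<sigma> by (simp add: power_symbol_def mult_ac)
  next
    case False
    have e: "power_symbol g \<sigma> r \<xi> = g + \<sigma> * ((2 * pi) powr (2 * r) * n powr (2 * r))"
      using False n by (simp add: power_symbol_def n_def[symmetric] powr_mult)
    have p: "1 \<le> (2 * pi) powr (2 * r)" "(2 * pi) powr (2 * r) \<le> 2 * pi"
      using pi1 r powr_mono[of "2 * r" 1 "2 * pi"] by (auto simp: ge_one_powr_ge_zero)
    have nX: "n powr (2 * r) \<le> X powr r" unfolding n2 using X r by (intro powr_mono2) auto
    have "(2 * pi) powr (2 * r) * n powr (2 * r) \<le> (2 * pi) * X powr r" using p nX by (intro mult_mono) auto
    then have "\<sigma> * ((2 * pi) powr (2 * r) * n powr (2 * r)) \<le> \<sigma> * ((2 * pi) * X powr r)" using \<sigma> by (intro mult_left_mono) auto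
    moreover have "g * 1 \<le> g * X powr r" using g Xr by (intro mult_left_mono) auto
    ultimately have 1: "power_symbol g \<sigma> r \<xi> \<le> (g + 2 * pi * \<sigma>) * X powr r" unfolding e by (simp add: algebra_simps)
    have "X powr r \<le> 2 * (1 + n powr (2 * r))"
    proof -
      have two: "2 powr r \<le> (2::real)" using powr_mono[of r 1 2] r by simp
      have m0: "X \<le> 2 * max 1 (n^2)" using X by auto
      have "X powr r \<le> (2 * max 1 (n^2)) powr r" using m0 X(2) r by (intro powr_mono2) auto
      also have "\<dots> = 2 powr r * (max 1 (n^2)) powr r" by (simp add: powr_mult)
      also have "\<dots> \<le> 2 * (max 1 (n^2)) powr r" using two by (intro mult_right_mono) auto
      also have "(max 1 (n^2)) powr r \<le> 1 + n powr (2 * r)" unfolding n2 by (auto simp: max_def)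
      finally show ?thesis by simp
    qed
    then have "min g \<sigma> / 2 * X powr r \<le> min g \<sigma> / 2 * (2 * (1 + n powr (2 * r)))" using g \<sigma> by (intro mult_left_mono) auto
    also have "\<dots> = min g \<sigma> + min g \<sigma> * n powr (2 * r)" by (simp add: algebra_simps)
    also have "\<dots> \<le> g + \<sigma> * ((2 * pi) powr (2 * r) * n powr (2 * r))"
    proof (intro add_mono mult_mono)
      show "n powr (2 * r) \<le> (2 * pi) powr (2 * r) * n powr (2 * r)" using mult_right_mono[OF p(1), of "n powr (2 * r)"] by simp
    qed (use \<sigma> in auto)
    finally show ?thesis using 1 e by simp
  qed
  then show "power_symbol g \<sigma> r \<xi> \<le> (g + 2 * pi * \<sigma>) * X powr r" and low: "min g \<sigma> / 2 * X powr r \<le> power_symbol g \<sigma> r \<xi>" by auto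
  have sX: "X powr (1/2) = sqrt X" using X(2) by (simp add: powr_half_sqrt)
  have mX: "max 1 n \<le> X powr (1/2)" unfolding sX using X n by (auto intro!: real_le_rsqrt)
  have "X powr r \<le> X powr (1/2)" using X r by (intro powr_mono) auto
  also have "\<dots> \<le> 1 + n" unfolding sX unfolding X(1) using n by (intro real_le_lsqrt) (auto simp: power2_eq_square algebra_simps)
  also have "\<dots> \<le> 2 * max 1 n" by auto
  finally have "(g + 2 * pi * \<sigma>) * X powr r \<le> (g + 2 * pi * \<sigma>) * (2 * max 1 n)" using g \<sigma> by (intro mult_left_mono) (auto simp: add_pos_pos less_imp_le)
  then show "power_symbol g \<sigma> r \<xi> \<le> 2 * (g + 2 * pi * \<sigma>) * max 1 (norm (freq \<xi>))" 
    using order_trans[OF conjunct1[OF up]] by (simp only: n_def mult_ac)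
  have "min g \<sigma> / 2 * X powr (r - 1/2) * max 1 n \<le> min g \<sigma> / 2 * X powr (r - 1/2) * X powr (1/2)"
    using mX g \<sigma> by (intro mult_left_mono) auto
  also have "\<dots> = min g \<sigma> / 2 * X powr r" using X(2) by (simp add: mult.assoc powr_add[symmetric])
  also have "\<dots> \<le> power_symbol g \<sigma> r \<xi>" by (rule low)
  finally show "min g \<sigma> / 2 * X powr (r - 1/2) \<le> power_symbol g \<sigma> r \<xi> / max 1 (norm (freq \<xi>))"
    by (simp add: n_def[symmetric] pos_le_divide_eq)
qed

text \<open>Trades decay for regularity: with y = X^(-q) t one has 1 + t \<le> X^q (1 + y), and any
  power of 1 + y is dominated by \<open>exp (b * y)\<close>. Raising to the power s / q turns X^q
  into the Sobolev weight X^s.\<close>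

lemma exp_decay_weight:
  fixes b q s :: real
  assumes b: "b > 0" and q: "q > 0" and s: "s > 0"
  shows "\<exists>K>0. \<forall>X\<ge>1. \<forall>t\<ge>0. exp (- (b * X powr (- q) * t)) \<le> K * X powr s * (1 + t) powr (- (s / q))"
proof -
  define a where "a = s / q"
  have a: "a > 0" using s q by (simp add: a_def)
  \<comment> \<open>The maximum of \<open>(1 + y) powr a * exp (- b * y)\<close> over
    \<open>1 + y > 0\<close>, attained at \<open>1 + y = a / b\<close>; the bound comes from ln v
    \<le> v - 1 at v = (1 + y) b / a.\<close>
  define K where "K = exp (b - a - a * ln (b / a))"
  show ?thesis
  proof (intro exI[of _ K] conjI allI impI)
    show "K > 0" by (simp add: K_def)
    fix X t :: real assume X: "1 \<le> X" and t: "0 \<le> t"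
    define y where "y = X powr (- q) * t"
    have y: "0 \<le> y" using t by (simp add: y_def)
    have Xq: "1 \<le> X powr q" "X powr q * X powr (- q) = 1"
      using X q by (auto simp: ge_one_powr_ge_zero powr_add[symmetric])
    have "1 + t \<le> X powr q * (1 + y)"
    proof -
      have "X powr q * y = t" using Xq(2) by (simp add: y_def mult.assoc[symmetric])
      then show ?thesis using Xq(1) by (simp add: distrib_left)
    qed
    then have "(1 + t) powr a \<le> (X powr q * (1 + y)) powr a" using t a by (intro powr_mono2) auto
    also have "\<dots> = X powr s * (1 + y) powr a" using X y q by (simp add: powr_mult powr_powr a_def)
    also have "(1 + y) powr a \<le> K * exp (b * y)"
    proof -
      have "ln ((1 + y) * (b / a)) \<le> (1 + y) * (b / a) - 1" using y b a by (intro ln_le_minus_one) auto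
      then have "ln (1 + y) + ln (b / a) \<le> (1 + y) * (b / a) - 1" using y b a by (subst (asm) ln_mult) auto
      then have "a * (ln (1 + y) + ln (b / a)) \<le> a * ((1 + y) * (b / a) - 1)" using a by (intro mult_left_mono) auto
      also have "\<dots> = b * (1 + y) - a" using a by (simp add: field_simps)
      finally have "a * ln (1 + y) \<le> (b - a - a * ln (b / a)) + b * y" by (simp add: algebra_simps)
      then show ?thesis using y by (simp add: powr_def K_def exp_add[symmetric])
    qed
    finally have "(1 + t) powr a \<le> X powr s * (K * exp (b * y))" by (simp add: mult_left_mono)
    then have "exp (- (b * y)) * (1 + t) powr a \<le> exp (- (b * y)) * (X powr s * (K * exp (b * y)))" by (intro mult_left_mono) auto
    also have "\<dots> = K * X powr s" by (simp add: exp_minus field_simps)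
    finally have "exp (- (b * y)) * (1 + t) powr a \<le> K * X powr s" .
    then have "exp (- (b * y)) \<le> K * X powr s / (1 + t) powr a" using t by (simp add: pos_le_divide_eq)
    then show "exp (- (b * X powr (- q) * t)) \<le> K * X powr s * (1 + t) powr (- (s / q))"
      by (simp add: y_def a_def powr_minus_divide mult.assoc)
  qed
qed

lemma nn_integral_qf:
  assumes u: "u \<in> L2 (Om l)"
  shows "(\<Sum>\<^sup>+ \<xi>. ennreal (qf \<xi> l u u)) = ennreal (LINT z|Om l. (norm (u z))^2)"
proof -
  have "(LINT z|Om l. (norm (u z))^2) = (\<Sum>c\<in>Basis. (L2_norm (Om l) (\<lambda>z. u z \<bullet> c))^2)"
    using L2_inner_components[OF u u] by (simp add: L2_inner_def L2_norm_sq power2_norm_eq_inner)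
  then have "ennreal (LINT z|Om l. (norm (u z))^2) = (\<Sum>c\<in>Basis. ennreal ((L2_norm (Om l) (\<lambda>z. u z \<bullet> c))^2))"
    by (simp add: sum_ennreal)
  also have "\<dots> = (\<Sum>c\<in>Basis. \<integral>\<^sup>+ \<xi>. ennreal ((fcn l \<xi> (\<lambda>z. u z \<bullet> c))^2) \<partial>count_space UNIV)"
    by (intro sum.cong refl parseval_Om[symmetric] L2_comp[OF u])
  also have "\<dots> = (\<Sum>\<^sup>+ \<xi>. (\<Sum>c\<in>Basis. ennreal ((fcn l \<xi> (\<lambda>z. u z \<bullet> c))^2)))"
    by (rule nn_integral_sum[symmetric]) simp
  finally show ?thesis by (simp add: qf_eq_norms sum_ennreal)
qed

text \<open>Both branches of \<open>M_form\<close> are bounded by the frequency sum: through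
  \<open>L2_inner_le_multiplier\<close> when \<open>M_op \<mu> h\<close> is square-integrable, and
  by definition otherwise. The factors 1/2 of the energy are estimated by 1.\<close>

lemma energy_le_frequencies:
  assumes u: "u \<in> L2 (Om l)" and h: "h \<in> L2 Sig" and \<mu>: "\<And>\<xi>. 0 \<le> \<mu> \<xi>"
  shows "energy l \<mu> u h \<le> (\<Sum>\<^sup>+ \<xi>. ennreal (qf \<xi> l u u + \<mu> \<xi> * (cmod (fourier h \<xi>))^2))"
proof -
  have M: "M_form \<mu> h \<le> (\<Sum>\<^sup>+ \<xi>. ennreal (\<mu> \<xi> * (cmod (fourier h \<xi>))^2))"
  proof (cases "h \<in> dom_M \<mu>")
    case True
    have "ennreal (L2_inner Sig (M_op \<mu> h) h) \<le> (\<Sum>\<^sup>+ \<xi>. ennreal (\<mu> \<xi> * (cmod (fourier h \<xi>))^2))"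
      by (rule L2_inner_le_multiplier[OF fourier_M_op(1)[OF True] h fourier_M_op(2)[OF True] \<mu>])
    then show ?thesis using True by (simp add: M_form_def L2_inner_def)
  qed (simp add: M_form_def)
  have half: "ennreal (1/2) * a \<le> a" for a
    using mult_right_mono[of "ennreal (1/2)" 1 a] ennreal_leI[of "1/2" 1] by simp
  have "energy l \<mu> u h \<le> ennreal (LINT z|Om l. (norm (u z))^2) + M_form \<mu> h"
    unfolding energy_def by (intro add_mono half)
  also have "\<dots> \<le> (\<Sum>\<^sup>+ \<xi>. ennreal (qf \<xi> l u u)) + (\<Sum>\<^sup>+ \<xi>. ennreal (\<mu> \<xi> * (cmod (fourier h \<xi>))^2))"
    unfolding nn_integral_qf[OF u] by (intro add_mono M order_refl)
  also have "\<dots> = (\<Sum>\<^sup>+ \<xi>. ennreal (qf \<xi> l u u) + ennreal (\<mu> \<xi> * (cmod (fourier h \<xi>))^2))"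
    by (rule nn_integral_add[symmetric]) simp_all
  also have "\<dots> = (\<Sum>\<^sup>+ \<xi>. ennreal (qf \<xi> l u u + \<mu> \<xi> * (cmod (fourier h \<xi>))^2))"
    by (intro nn_integral_cong ennreal_plus[symmetric]) (simp_all add: qf_nonneg \<mu>)
  finally show ?thesis .
qed

text \<open>Tonelli exchanges the sum with the integral over \<open>y\<close>, which turns the
  Sobolev norm of the data into a weighted sum of the one-frequency energies.\<close>

lemma Hs_L2_sq_qf:
  fixes u :: "('n::finite) field"
  assumes u: "u \<in> L2 (Om l)"
  shows "Hs_L2_sq l s u = (\<Sum>\<^sup>+ \<xi>. ennreal ((1 + (norm (freq \<xi>))^2) powr s * qf \<xi> l u u))"
proof -
  let ?f = "\<lambda>(\<xi> :: int ^ 'n) y. ennreal ((1 + (norm (freq \<xi>))^2) powr s * (\<Sum>b\<in>Basis. (cmod (fc \<xi> (\<lambda>z. u z \<bullet> b) y))^2))"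
  have f: "fc \<xi> (\<lambda>z. u z \<bullet> b) \<in> L2 (Iy l)" if "b \<in> Basis" for \<xi> b
    by (rule fc_L2[OF L2_comp[OF u that]])
  have "Hs_L2_sq l s u = (\<integral>\<^sup>+ y. (\<Sum>\<^sup>+ \<xi>. ?f \<xi> y) \<partial>Iy l)"
    unfolding Hs_L2_sq_def fc_def by (subst nn_integral_restrict_space) auto
  also have "\<dots> = (\<integral>\<^sup>+ \<xi>. (\<integral>\<^sup>+ y. ?f \<xi> y \<partial>Iy l) \<partial>count_space UNIV)"
  proof (rule nn_integral_count_space_nn_integral)
    fix \<xi> :: "int ^ 'n"
    have "(\<lambda>y. (1 + (norm (freq \<xi>))^2) powr s * (\<Sum>b\<in>Basis. (cmod (fc \<xi> (\<lambda>z. u z \<bullet> b) y))^2)) \<in> borel_measurable (Iy l)"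
      by (intro borel_measurable_times borel_measurable_const borel_measurable_sum borel_measurable_power
          borel_measurable_norm[THEN measurable_compose[rotated]] L2_measurable[OF f])
    then show "?f \<xi> \<in> borel_measurable (Iy l)" by (rule measurable_compose[OF _ measurable_ennreal])
  qed simp
  also have "\<dots> = (\<Sum>\<^sup>+ \<xi>. ennreal ((1 + (norm (freq \<xi>))^2) powr s * qf \<xi> l u u))"
  proof (rule nn_integral_cong)
    fix \<xi> :: "int ^ 'n"
    have i: "integrable (Iy l) (\<lambda>y. (cmod (fc \<xi> (\<lambda>z. u z \<bullet> b) y))^2)" if "b \<in> Basis" for b
      by (rule L2_integrable_norm_sq[OF f[OF that]])
    have "(\<integral>\<^sup>+ y. ?f \<xi> y \<partial>Iy l) = ennreal (LINT y|Iy l. (1 + (norm (freq \<xi>))^2) powr s * (\<Sum>b\<in>Basis. (cmod (fc \<xi> (\<lambda>z. u z \<bullet> b) y))^2))"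
      by (rule nn_integral_eq_integral) (auto intro!: integrable_mult_right Bochner_Integration.integrable_sum i sum_nonneg mult_nonneg_nonneg)
    also have "(LINT y|Iy l. (1 + (norm (freq \<xi>))^2) powr s * (\<Sum>b\<in>Basis. (cmod (fc \<xi> (\<lambda>z. u z \<bullet> b) y))^2)) = (1 + (norm (freq \<xi>))^2) powr s * qf \<xi> l u u"
      using i by (simp add: qf_def L2_inner_def power2_norm_eq_inner)
    finally show "(\<integral>\<^sup>+ y. ?f \<xi> y \<partial>Iy l) = ennreal ((1 + (norm (freq \<xi>))^2) powr s * qf \<xi> l u u)" .
  qed
  finally show ?thesis .
qed

lemma qf_cong_AE:
  fixes u v :: "('n::finite) field"
  assumes "u \<in> L2 (Om l)" "v \<in> L2 (Om l)" "AE z in Om l. u z = v z"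
  shows "qf \<xi> l u u = qf \<xi> l v v"
  unfolding qf_eq_norms
proof (intro sum.cong refl arg_cong[where f = "\<lambda>x. x\<^sup>2"])
  fix c :: "'n pt" assume c: "c \<in> Basis"
  have L: "(\<lambda>z. u z \<bullet> c) \<in> L2 (Om l)" "(\<lambda>z. v z \<bullet> c) \<in> L2 (Om l)" by (intro L2_comp assms c)+
  have "AE z in Om l. u z \<bullet> c = v z \<bullet> c" using assms(3) by eventually_elim simp
  then have "AE y in Iy l. fc \<xi> (\<lambda>z. u z \<bullet> c) y = fc \<xi> (\<lambda>z. v z \<bullet> c) y"
    by (rule fc_cong_AE[OF L2_measurable[OF L(1)] L2_measurable[OF L(2)]])
  then show "fcn l \<xi> (\<lambda>z. u z \<bullet> c) = fcn l \<xi> (\<lambda>z. v z \<bullet> c)"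
    by (rule L2_norm_cong_AE[OF L2_measurable[OF fc_L2[OF L(1)]] L2_measurable[OF fc_L2[OF L(2)]]])
qed

text \<open>Turns the zero mean of \<open>h t\<close> into the vanishing of \<open>H\<close> at
  frequency 0, as \<open>frequency_decay\<close> demands.\<close>

lemma fourier_0: "fourier h 0 = of_real (LINT x|Sig. h x)"
proof -
  have "freq (0 :: int ^ 'n::finite) = 0" by (simp add: freq_def vec_eq_iff)
  then show ?thesis by (simp add: fourier_def)
qed

theorem theorem4p3:
  fixes l s g \<sigma> r :: real and \<mu> :: "int ^ 'n::finite \<Rightarrow> real"
  assumes "l > 0" and "s > 0" and "g > 0" and "\<sigma> > 0" and "0 \<le> r" and "r < 1/2"
    and "\<mu> = power_symbol g \<sigma> r"
  shows "\<exists>K>0. \<forall>(u :: real \<Rightarrow> 'n field) (h :: real \<Rightarrow> real ^ 'n \<Rightarrow> real) u\<^sub>0 h\<^sub>0.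
           weak_solution l \<mu> u h u\<^sub>0 h\<^sub>0 \<longrightarrow> u\<^sub>0 \<in> Hs_L2 l s \<longrightarrow> h\<^sub>0 \<in> Hs (s + r) \<longrightarrow>
           (\<forall>t\<ge>0. energy l \<mu> (u t) (h t) \<le>
              ennreal K * (Hs_L2_sq l s u\<^sub>0 + Hs_sq (s + r) h\<^sub>0)
                * ennreal ((1 + t) powr (- (s / (1/2 - r)))))"
proof -
  define X where "X \<xi> = 1 + (norm (freq \<xi>))^2" for \<xi> :: "int ^ 'n"
  define P where "P = g + 2 * pi * \<sigma>"
  define a where "a = s / (1/2 - r)"
  have P: "P > 0" using assms by (simp add: P_def add_pos_pos)
  have X: "1 \<le> X \<xi>" for \<xi> by (simp add: X_def)
  have bounds: "\<mu> \<xi> \<le> P * X \<xi> powr r" "min g \<sigma> / 2 * X \<xi> powr r \<le> \<mu> \<xi>" "\<mu> \<xi> \<le> 2 * P * max 1 (norm (freq \<xi>))"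
    "min g \<sigma> / 2 * X \<xi> powr (r - 1/2) \<le> \<mu> \<xi> / max 1 (norm (freq \<xi>))" for \<xi>
    unfolding P_def X_def assms(7) by (rule power_symbol_bounds[OF assms(3-6)])+
  have \<mu>: "0 < \<mu> \<xi>" for \<xi>
  proof -
    have "0 < min g \<sigma> / 2 * X \<xi> powr r" using assms X[of \<xi>] by (intro mult_pos_pos) auto
    then show ?thesis using bounds(2)[of \<xi>] by linarith
  qed
  obtain c where c: "c > 0" and decay: "\<And>(\<xi> :: int ^ 'n) m u H t. frequency_evolution l m \<xi> u H \<Longrightarrow> 0 < m \<Longrightarrow> m \<le> 2 * P * max 1 (norm (freq \<xi>)) \<Longrightarrow>
    (\<xi> = 0 \<longrightarrow> (\<forall>t\<ge>0. H t = 0)) \<Longrightarrow> 0 \<le> t \<Longrightarrow> qf \<xi> l (u t) (u t) + m * (cmod (H t))^2 \<le>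
       3 * exp (- 2 * (c * (m / max 1 (norm (freq \<xi>)))) * t) * (qf \<xi> l (u 0) (u 0) + m * (cmod (H 0))^2)"
    using frequency_decay[OF assms(1), of "2 * P", where 'n = 'n] P by auto
  \<comment> \<open>The factor \<open>2 * c\<close> of the exponent in
    \<open>frequency_decay\<close> times the constant in the lower bound of \<mu> / |\<xi>|.\<close>
  define b where "b = 2 * c * (min g \<sigma> / 2)"
  have b: "b > 0" using c assms by (simp add: b_def)
  obtain K where K: "K > 0" and weight: "\<And>X t. 1 \<le> X \<Longrightarrow> 0 \<le> t \<Longrightarrow> exp (- (b * X powr (- (1/2 - r)) * t)) \<le> K * X powr s * (1 + t) powr (- a)"
    using exp_decay_weight[OF b _ assms(2), of "1/2 - r"] assms(6) unfolding a_def by auto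
  \<comment> \<open>3 comes from \<open>frequency_decay\<close> and \<open>K\<close> from the
    weight; \<open>max 1 P\<close> lets one constant serve both norms of the data.\<close>
  define K' where "K' = 3 * K * max 1 P"
  have K': "K' > 0" using K by (simp add: K'_def)
  show ?thesis
  proof (intro exI[of _ K'] conjI K' allI impI)
    fix u :: "real \<Rightarrow> 'n field" and h u\<^sub>0 h\<^sub>0 and t :: real
    assume w: "weak_solution l \<mu> u h u\<^sub>0 h\<^sub>0" and "u\<^sub>0 \<in> Hs_L2 l s" and "h\<^sub>0 \<in> Hs (s + r)" and t: "0 \<le> t"
    have uL: "u t \<in> L2 (Om l)" and hL: "h t \<in> L2 Sig" if "0 \<le> t" for t
      using w that by (auto simp: weak_solution_def cont_time_def)
    have u0: "u\<^sub>0 \<in> L2 (Om l)" "AE z in Om l. u 0 z = u\<^sub>0 z" and h0: "h\<^sub>0 \<in> L2 Sig" "AE x in Sig. h 0 x = h\<^sub>0 x"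
      and mean: "\<And>t. 0 \<le> t \<Longrightarrow> (LINT x|Sig. h t x) = 0"
      using w by (auto simp: weak_solution_def)
    define E where "E \<xi> t = qf \<xi> l (u t) (u t) + \<mu> \<xi> * (cmod (fourier (h t) \<xi>))^2" for \<xi> t
    have E0: "0 \<le> E \<xi> t" for \<xi> t using \<mu>[of \<xi>] by (simp add: E_def qf_nonneg)
    have E: "E \<xi> t \<le> 3 * K * (1 + t) powr (- a) * (X \<xi> powr s * E \<xi> 0)" for \<xi>
    proof -
      let ?x = "max 1 (norm (freq \<xi>))"
      have "E \<xi> t \<le> 3 * exp (- 2 * (c * (\<mu> \<xi> / ?x)) * t) * E \<xi> 0" unfolding E_def
        by (rule decay[OF weak_solution_frequency_evolution[OF assms(1) w] \<mu> bounds(3) _ t])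
          (auto simp: fourier_0 mean)
      also have "\<dots> \<le> 3 * (K * X \<xi> powr s * (1 + t) powr (- a)) * E \<xi> 0"
      proof (intro mult_right_mono mult_left_mono E0)
        have "b * X \<xi> powr (- (1/2 - r)) = 2 * c * (min g \<sigma> / 2 * X \<xi> powr (r - 1/2))" by (simp add: b_def)
        also have "\<dots> \<le> 2 * c * (\<mu> \<xi> / ?x)" using bounds(4)[of \<xi>] c by (intro mult_left_mono) auto
        finally have "b * X \<xi> powr (- (1/2 - r)) * t \<le> 2 * c * (\<mu> \<xi> / ?x) * t" using t by (rule mult_right_mono)
        then have "exp (- 2 * (c * (\<mu> \<xi> / ?x)) * t) \<le> exp (- (b * X \<xi> powr (- (1/2 - r)) * t))" by simp
        also have "\<dots> \<le> K * X \<xi> powr s * (1 + t) powr (- a)" by (rule weight[OF X t])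
        finally show "exp (- 2 * (c * (\<mu> \<xi> / ?x)) * t) \<le> K * X \<xi> powr s * (1 + t) powr (- a)" .
      qed simp
      finally show ?thesis by (simp add: mult_ac)
    qed
    \<comment> \<open>Here the regularity of the data enters. The decay costs the weight X^s, and
      the upper bound of order X^r for the symbol raises the exponent on the surface to s +
      r.\<close>
    have i: "ennreal (X \<xi> powr s * E \<xi> 0) \<le> ennreal (X \<xi> powr s * qf \<xi> l u\<^sub>0 u\<^sub>0) +
        ennreal P * ennreal (X \<xi> powr (s + r) * (cmod (fourier h\<^sub>0 \<xi>))^2)" for \<xi>
    proof -
      have q: "qf \<xi> l (u 0) (u 0) = qf \<xi> l u\<^sub>0 u\<^sub>0" by (rule qf_cong_AE[OF uL u0]) simp
      have f: "fourier (h 0) \<xi> = fourier h\<^sub>0 \<xi>"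
        by (rule fourier_cong_AE[OF L2_measurable[OF hL] L2_measurable[OF h0(1)] h0(2)]) simp
      have "X \<xi> powr s * (\<mu> \<xi> * (cmod (fourier h\<^sub>0 \<xi>))^2) \<le> X \<xi> powr s * ((P * X \<xi> powr r) * (cmod (fourier h\<^sub>0 \<xi>))^2)"
        using bounds(1)[of \<xi>] by (intro mult_left_mono mult_right_mono) auto
      also have "\<dots> = P * (X \<xi> powr (s + r) * (cmod (fourier h\<^sub>0 \<xi>))^2)" by (simp add: powr_add mult_ac)
      finally have "X \<xi> powr s * E \<xi> 0 \<le> X \<xi> powr s * qf \<xi> l u\<^sub>0 u\<^sub>0 + P * (X \<xi> powr (s + r) * (cmod (fourier h\<^sub>0 \<xi>))^2)"
        by (simp add: E_def q f distrib_left)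
      then have "ennreal (X \<xi> powr s * E \<xi> 0) \<le> ennreal (X \<xi> powr s * qf \<xi> l u\<^sub>0 u\<^sub>0 + P * (X \<xi> powr (s + r) * (cmod (fourier h\<^sub>0 \<xi>))^2))"
        by (rule ennreal_leI)
      also have "\<dots> = ennreal (X \<xi> powr s * qf \<xi> l u\<^sub>0 u\<^sub>0) + ennreal P * ennreal (X \<xi> powr (s + r) * (cmod (fourier h\<^sub>0 \<xi>))^2)"
        using P by (subst ennreal_plus) (auto simp: qf_nonneg ennreal_mult)
      finally show ?thesis .
    qed
    let ?c = "ennreal (3 * K * (1 + t) powr (- a))"
    have "energy l \<mu> (u t) (h t) \<le> (\<Sum>\<^sup>+ \<xi>. ennreal (E \<xi> t))"
      unfolding E_def using \<mu> by (intro energy_le_frequencies uL hL t less_imp_le)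
    also have "\<dots> \<le> (\<Sum>\<^sup>+ \<xi>. ?c * ennreal (X \<xi> powr s * E \<xi> 0))"
      using E E0 K by (intro nn_integral_mono) (auto simp: ennreal_mult[symmetric] intro!: ennreal_leI)
    also have "\<dots> = ?c * (\<Sum>\<^sup>+ \<xi>. ennreal (X \<xi> powr s * E \<xi> 0))"
      by (rule nn_integral_cmult) simp
    also have "(\<Sum>\<^sup>+ \<xi>. ennreal (X \<xi> powr s * E \<xi> 0)) \<le>
        (\<Sum>\<^sup>+ \<xi>. ennreal (X \<xi> powr s * qf \<xi> l u\<^sub>0 u\<^sub>0) + ennreal P * ennreal (X \<xi> powr (s + r) * (cmod (fourier h\<^sub>0 \<xi>))^2))"
      by (rule nn_integral_mono) (rule i)
    also have "\<dots> = Hs_L2_sq l s u\<^sub>0 + ennreal P * Hs_sq (s + r) h\<^sub>0"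
      unfolding Hs_L2_sq_qf[OF u0(1)] Hs_sq_def X_def by (subst nn_integral_add) (auto simp: nn_integral_cmult)
    also have "\<dots> \<le> ennreal (max 1 P) * (Hs_L2_sq l s u\<^sub>0 + Hs_sq (s + r) h\<^sub>0)"
    proof -
      have "1 * Hs_L2_sq l s u\<^sub>0 \<le> ennreal (max 1 P) * Hs_L2_sq l s u\<^sub>0"
        by (intro mult_right_mono) (simp_all add: ennreal_leI flip: ennreal_1)
      moreover have "ennreal P * Hs_sq (s + r) h\<^sub>0 \<le> ennreal (max 1 P) * Hs_sq (s + r) h\<^sub>0"
        by (intro mult_right_mono ennreal_leI) simp_all
      ultimately show ?thesis by (simp add: distrib_left add_mono)
    qed
    finally have "energy l \<mu> (u t) (h t) \<le> ?c * (ennreal (max 1 P) * (Hs_L2_sq l s u\<^sub>0 + Hs_sq (s + r) h\<^sub>0))"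
      by (simp add: mult_left_mono)
    also have "\<dots> = ennreal K' * (Hs_L2_sq l s u\<^sub>0 + Hs_sq (s + r) h\<^sub>0) * ennreal ((1 + t) powr (- a))"
    proof -
      have e: "?c * ennreal (max 1 P) = ennreal K' * ennreal ((1 + t) powr (- a))"
        using K by (simp add: K'_def ennreal_mult[symmetric] mult_ac)
      show ?thesis unfolding mult.assoc[symmetric] e by (simp only: mult_ac)
    qed
    finally show "energy l \<mu> (u t) (h t) \<le> ennreal K' * (Hs_L2_sq l s u\<^sub>0 + Hs_sq (s + r) h\<^sub>0) * ennreal ((1 + t) powr (- (s / (1/2 - r))))"
      by (simp only: a_def)
  qed
qed

end
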